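(* Let $n, m \ge 1$ be integers. Then the function $N^m : \mathfrak{S}_n \to \mathbb{Z}$, $N^m(\sigma) = \#\{A \in M(n,m) \mid \sigma A^{\mathsf{T}} = A\}$, is a character of the symmetric group $\mathfrak{S}_n$. Moreover, for every partition $\lambda \vdash n$, $$\langle \chi^\lambda, N^m \rangle_{\mathfrak{S}_n} = \sum_{\nu \vdash nm} a_{\lambda,m}^\nu .$$
   Context: $M(n,m)$ is the set of $n\times n$ matrices with non-negative integer entries all of whose row sums and column sums equal $m$. $A^{\mathsf{T}}$ is the transpose of $A$. $\mathfrak{S}_n$ is identified with the group of $n\times n$ permutation matrices ($\sigma$ has entry $1$ in positions $(\sigma(j),j)$ and $0$ elsewhere), so $\sigma A^{\mathsf{T}}$ is a matrix product; the condition $\sigma A^{\mathsf{T}}=A$ is equivalent to $A_{ij}=A_{\sigma(j)\,i}$ for all $i,j$. "Character" means character of a finite-dimensional complex representation. $\chi^\lambda$ is the irreducible character of $\mathfrak{S}_n$ indexed by $\lambda\vdash n$ (with $\chi^{(n)}$ trivial and $\chi^{(1^n)}=\operatorname{sgn}$). $\langle \chi,\phi\rangle_G=\frac1{|G|}\sum_{g\in G}\chi(g)\overline{\phi(g)}$ for class functions on a finite group $G$. Plethysm is the unique binary operation $(f,g)\mapsto f[g]$ on the ring $\Lambda$ of symmetric functions over $\mathbb{Q}$ such that $p_k[p_l]=p_{kl}$ for power sums ($k,l\ge1$), $g\mapsto p_k[g]$ is a $\mathbb{Q}$-algebra homomorphism for each $k\ge 1$, and $f\mapsto f[g]$ is a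 $\mathbb{Q}$-algebra homomorphism for each $g\in\Lambda$. The plethysm coefficients $a_{\lambda,m}^\nu$ are defined by $s_\lambda[s_m]=\sum_{\nu\vdash nm}a_{\lambda,m}^\nu s_\nu$, where $s_\lambda$ are Schur functions and $s_m=s_{(m)}$. Equivalently, $a_{\lambda,m}^\nu=\langle\chi^\nu,\operatorname{Ind}_{\mathfrak{S}_m\wr\mathfrak{S}_n}^{\mathfrak{S}_{nm}}\operatorname{Inf}_{\mathfrak{S}_n}^{\mathfrak{S}_m\wr\mathfrak{S}_n}\chi^\lambda\rangle$, where $\mathfrak{S}_m\wr\mathfrak{S}_n=\mathfrak{S}_m^n\rtimes\mathfrak{S}_n\le\mathfrak{S}_{nm}$ is the stabilizer of the set partition $\{\mathcal{P}_1,\dots,\mathcal{P}_n\}$ with $\mathcal{P}_i=\{(i-1)m+1,\dots,im\}$, and $\operatorname{Inf}$ is inflation along the quotient map $\mathfrak{S}_m\wr\mathfrak{S}_n\to\mathfrak{S}_n$. *)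

theory Defs
  imports
    "HOL-Algebra.Sym_Groups"
    "HOL-Library.Poly_Mapping"
    "Jordan_Normal_Form.VS_Connect"
begin

definition representation :: "('g, 'b) monoid_scheme \<Rightarrow> nat \<Rightarrow> ('g \<Rightarrow> complex mat) \<Rightarrow> bool" where
  "representation G d \<rho> \<longleftrightarrow> \<rho> \<in> hom G (units_of (ring_mat TYPE(complex) d ()))"

definition irreducible_representation ::
    "('g, 'b) monoid_scheme \<Rightarrow> nat \<Rightarrow> ('g \<Rightarrow> complex mat) \<Rightarrow> bool" where
  "irreducible_representation G d \<rho> \<longleftrightarrow>
     representation G d \<rho> \<and> d \<noteq> 0 \<and>
     (\<forall>W. VectorSpace.subspace class_ring W (module_vec TYPE(complex) d) \<longrightarrow>
          (\<forall>g\<in>carrier G. \<forall>w\<in>W. \<rho> g *\<^sub>v w \<in> W) \<longrightarrow>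
          W = {0\<^sub>v d} \<or> W = carrier_vec d)"

definition affords ::
    "('g, 'b) monoid_scheme \<Rightarrow> nat \<Rightarrow> ('g \<Rightarrow> complex mat) \<Rightarrow> ('g \<Rightarrow> complex) \<Rightarrow> bool" where
  "affords G d \<rho> \<chi> \<longleftrightarrow> (\<forall>g\<in>carrier G. \<chi> g = (\<Sum>i<d. \<rho> g $$ (i, i)))"

definition is_character :: "('g, 'b) monoid_scheme \<Rightarrow> ('g \<Rightarrow> complex) \<Rightarrow> bool" where
  "is_character G \<chi> \<longleftrightarrow> (\<exists>d \<rho>. representation G d \<rho> \<and> affords G d \<rho> \<chi>)"

definition is_irreducible_character :: "('g, 'b) monoid_scheme \<Rightarrow> ('g \<Rightarrow> complex) \<Rightarrow> bool" where
  "is_irreducible_character G \<chi> \<longleftrightarrow>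
     (\<exists>d \<rho>. irreducible_representation G d \<rho> \<and> affords G d \<rho> \<chi>)"

definition char_inner ::
    "('g, 'b) monoid_scheme \<Rightarrow> ('g \<Rightarrow> complex) \<Rightarrow> ('g \<Rightarrow> complex) \<Rightarrow> complex" where
  "char_inner G \<chi> \<phi> = (\<Sum>g\<in>carrier G. \<chi> g * cnj (\<phi> g)) / of_nat (card (carrier G))"

definition induced_char ::
    "('g, 'b) monoid_scheme \<Rightarrow> 'g set \<Rightarrow> ('g \<Rightarrow> complex) \<Rightarrow> 'g \<Rightarrow> complex" where
  "induced_char G H \<phi> g =
     (\<Sum>x | x \<in> carrier G \<and> inv\<^bsub>G\<^esub> x \<otimes>\<^bsub>G\<^esub> g \<otimes>\<^bsub>G\<^esub> x \<in> H.
        \<phi> (inv\<^bsub>G\<^esub> x \<otimes>\<^bsub>G\<^esub> g \<otimes>\<^bsub>G\<^esub> x)) / of_nat (card H)"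

definition partitions_of :: "nat \<Rightarrow> nat list set" where
  "partitions_of n = {lam. sorted_wrt (\<ge>) lam \<and> 0 \<notin> set lam \<and> sum_list lam = n}"

definition conjugate_partition :: "nat list \<Rightarrow> nat list" where
  "conjugate_partition lam =
     map (\<lambda>j. length (filter (\<lambda>k. j < k) lam)) [0..<(if lam = [] then 0 else hd lam)]"

definition young_subgroup :: "nat list \<Rightarrow> (nat \<Rightarrow> nat) set" where
  "young_subgroup lam =
     {\<sigma> \<in> carrier (sym_group (sum_list lam)).
        \<forall>i<length lam. \<sigma> ` {sum_list (take i lam)<..sum_list (take (Suc i) lam)} =
                       {sum_list (take i lam)<..sum_list (take (Suc i) lam)}}"

text \<open>The standard labelling of the irreducible characters (as in James and Kerber): the one
  labelled by \<open>\<lambda>\<close> is the unique irreducible character that is a constituent both of the trivial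
  character induced from the Young subgroup of \<open>\<lambda>\<close> and of the sign character induced from the
  Young subgroup of the conjugate partition.  Thus \<open>(n)\<close> labels the trivial character and
  \<open>(1, \<dots>, 1)\<close> the sign character.  Extensionality only fixes the values outside the group.\<close>

definition sym_irr_char :: "nat list \<Rightarrow> (nat \<Rightarrow> nat) \<Rightarrow> complex" where
  "sym_irr_char lam =
     (let G = sym_group (sum_list lam) in
      THE \<chi>. \<chi> \<in> extensional (carrier G) \<and> is_irreducible_character G \<chi> \<and>
        char_inner G \<chi> (induced_char G (young_subgroup lam) (\<lambda>_. 1)) \<noteq> 0 \<and>
        char_inner G \<chi> (induced_char G (young_subgroup (conjugate_partition lam))
                          (\<lambda>\<sigma>. of_int (sign \<sigma>))) \<noteq> 0)"

text \<open>A formal power series over \<open>\<rat>\<close> in variables \<open>x\<^sub>0, x\<^sub>1, \<dots>\<close> is represented by its coefficient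
  function on monomials, i.e. on finitely supported exponent vectors.\<close>

type_synonym monomial = "nat \<Rightarrow>\<^sub>0 nat"
type_synonym series = "monomial \<Rightarrow> rat"

definition symmetric_series :: "series \<Rightarrow> bool" where
  "symmetric_series f \<longleftrightarrow>
     (\<forall>\<pi> \<alpha> \<beta>. bij \<pi> \<longrightarrow> Poly_Mapping.lookup \<beta> = Poly_Mapping.lookup \<alpha> \<circ> \<pi> \<longrightarrow> f \<beta> = f \<alpha>)"

definition bounded_degree :: "series \<Rightarrow> bool" where
  "bounded_degree f \<longleftrightarrow> (\<exists>d. \<forall>\<alpha>. f \<alpha> \<noteq> 0 \<longrightarrow> (\<Sum>i\<in>Poly_Mapping.keys \<alpha>. Poly_Mapping.lookup \<alpha> i) \<le> d)"

definition sym_fun :: "series ring" where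
  "sym_fun =
     \<lparr> carrier = {f. symmetric_series f \<and> bounded_degree f},
       mult = (\<lambda>f g \<alpha>. \<Sum>(\<beta>, \<gamma>) | \<beta> + \<gamma> = \<alpha>. f \<beta> * g \<gamma>),
       one = (\<lambda>\<alpha>. if \<alpha> = 0 then 1 else 0),
       zero = (\<lambda>\<alpha>. 0),
       add = (\<lambda>f g \<alpha>. f \<alpha> + g \<alpha>) \<rparr>"

definition sym_fun_alg_hom :: "(series \<Rightarrow> series) set" where
  "sym_fun_alg_hom =
     {h \<in> Ring.ring_hom sym_fun sym_fun.
        \<forall>c. \<forall>f\<in>carrier sym_fun. h (\<lambda>\<alpha>. c * f \<alpha>) = (\<lambda>\<alpha>. c * h f \<alpha>)}"

definition power_sum :: "nat \<Rightarrow> series" where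
  "power_sum k \<alpha> = (if \<exists>i. \<alpha> = Poly_Mapping.single i k then 1 else 0)"

definition diagram :: "nat list \<Rightarrow> (nat \<times> nat) set" where
  "diagram lam = {(i, j). i < length lam \<and> j < lam ! i}"

definition semistandard_tableaux :: "nat list \<Rightarrow> (nat \<times> nat \<Rightarrow> nat) set" where
  "semistandard_tableaux lam =
     {T \<in> extensional (diagram lam).
        (\<forall>i j j'. (i, j) \<in> diagram lam \<longrightarrow> (i, j') \<in> diagram lam \<longrightarrow> j < j' \<longrightarrow> T (i, j) \<le> T (i, j')) \<and>
        (\<forall>i i' j. (i, j) \<in> diagram lam \<longrightarrow> (i', j) \<in> diagram lam \<longrightarrow> i < i' \<longrightarrow> T (i, j) < T (i', j))}"

definition schur :: "nat list \<Rightarrow> series" where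
  "schur lam \<alpha> =
     of_nat (card {T \<in> semistandard_tableaux lam.
                     \<forall>k. card {c \<in> diagram lam. T c = k} = Poly_Mapping.lookup \<alpha> k})"

text \<open>The last conjunct only fixes the values outside the ring of symmetric functions.\<close>

definition is_plethysm :: "(series \<Rightarrow> series \<Rightarrow> series) \<Rightarrow> bool" where
  "is_plethysm P \<longleftrightarrow>
     (\<forall>f\<in>carrier sym_fun. \<forall>g\<in>carrier sym_fun. P f g \<in> carrier sym_fun) \<and>
     (\<forall>k\<ge>1. \<forall>l\<ge>1. P (power_sum k) (power_sum l) = power_sum (k * l)) \<and>
     (\<forall>k\<ge>1. (\<lambda>g. P (power_sum k) g) \<in> sym_fun_alg_hom) \<and>
     (\<forall>g\<in>carrier sym_fun. (\<lambda>f. P f g) \<in> sym_fun_alg_hom) \<and>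
     (\<forall>f g. f \<notin> carrier sym_fun \<or> g \<notin> carrier sym_fun \<longrightarrow> P f g = undefined)"

definition plethysm :: "series \<Rightarrow> series \<Rightarrow> series" where
  "plethysm = (THE P. is_plethysm P)"

text \<open>The coefficients of the plethysm of the Schur functions \<open>s\<^sub>\<lambda>\<close> and \<open>s\<^sub>m\<close> in the basis of
  Schur functions; \<open>s\<^sub>m\<close> is the Schur function of the one-row partition \<open>(m)\<close>, with \<open>m \<ge> 1\<close>.\<close>

definition plethysm_coeff :: "nat list \<Rightarrow> nat \<Rightarrow> nat list \<Rightarrow> rat" where
  "plethysm_coeff lam m =
     (THE a. a \<in> extensional (partitions_of (sum_list lam * m)) \<and>
        plethysm (schur lam) (schur [m]) =
          (\<lambda>\<alpha>. \<Sum>\<nu>\<in>partitions_of (sum_list lam * m). a \<nu> * schur \<nu> \<alpha>))"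

definition magic_matrices :: "nat \<Rightarrow> nat \<Rightarrow> nat mat set" where
  "magic_matrices n m =
     {A \<in> carrier_mat n n. (\<forall>i<n. (\<Sum>j<n. A $$ (i, j)) = m) \<and> (\<forall>j<n. (\<Sum>i<n. A $$ (i, j)) = m)}"

text \<open>Matrix indices start at \<open>0\<close>, whereas \<^const>\<open>sym_group\<close> acts on \<open>{1..n}\<close>.\<close>

definition perm_matrix :: "nat \<Rightarrow> (nat \<Rightarrow> nat) \<Rightarrow> nat mat" where
  "perm_matrix n \<sigma> = mat n n (\<lambda>(i, j). if \<sigma> (Suc j) = Suc i then 1 else 0)"

definition twisted_symmetric_count :: "nat \<Rightarrow> nat \<Rightarrow> (nat \<Rightarrow> nat) \<Rightarrow> nat" where
  "twisted_symmetric_count n m \<sigma> =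
     card {A \<in> magic_matrices n m. perm_matrix n \<sigma> * transpose_mat A = A}"

end

theory Submission
  imports Defs "HOL-Combinatorics.Orbits" "Jordan_Normal_Form.Spectral_Radius"
begin

text \<open>Let \<open>\<theta>\<^sub>\<alpha>\<close> be the permutation character of \<open>S\<^sub>N\<close> on the colourings of \<open>{1..N}\<close> in which
  colour \<open>i\<close> occurs \<open>\<alpha>\<^sub>i\<close> times.  Inverting the Kostka matrix turns the \<open>\<theta>\<^sub>\<mu>\<close> into virtual characters
  \<open>f\<^sub>\<lambda>\<close>; the Cauchy identity makes them orthonormal, so that they are irreducible, and Kostka
  triangularity together with the pairing of \<open>\<theta>\<^sub>\<mu>\<close> with \<open>sgn \<theta>\<^sub>\<nu>\<close> identifies \<open>f\<^sub>\<lambda>\<close> with \<open>\<chi>\<^sup>\<lambda>\<close>.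
  The identity \<open>\<Sum> s\<^sub>\<lambda> = \<Prod> (1 - x\<^sub>i)\<^sup>-\<^sup>1 \<Prod> (1 - x\<^sub>i x\<^sub>j)\<^sup>-\<^sup>1\<close> shows that \<open>\<Sum>\<^sub>\<lambda> f\<^sub>\<lambda> w\<close> is the number
  of square roots of \<open>w\<close>.

  For \<open>\<sigma>\<close> in \<open>S\<^sub>n\<close> let \<open>W\<^sub>\<sigma>\<close> be the set of the \<open>(m!)\<^sup>n\<close> permutations of \<open>{1..nm}\<close> that permute the
  \<open>n\<close> blocks of size \<open>m\<close> by \<open>\<sigma>\<close>.  A permutation whose square lies in \<open>W\<^sub>\<sigma>\<close> is counted by the
  matrix recording how many elements of one block it moves into another, and the matrices that
  occur are the solutions of \<open>\<sigma> A\<^sup>T = A\<close>.  Hence \<open>N\<^sup>m \<sigma>\<close> is the average over \<open>W\<^sub>\<sigma>\<close> of the number of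
  square roots, which is the character of \<open>S\<^sub>n\<close> on the invariants of \<open>(S\<^sub>m)\<^sup>n\<close> in the sum of all
  irreducible representations of \<open>S\<^sub>n\<^sub>m\<close>.  On the other side \<open>s\<^sub>\<lambda>[s\<^sub>m]\<close> is the average over \<open>\<sigma>\<close> of
  \<open>f\<^sub>\<lambda> \<sigma>\<close> times the product of the \<open>p\<^sub>k[s\<^sub>m]\<close> over the cycle lengths \<open>k\<close> of \<open>\<sigma>\<close>, and this product
  is in turn the average over \<open>w\<close> in \<open>W\<^sub>\<sigma>\<close> of the power sum product of the cycle type of \<open>w\<close>.  The linear
  functional with \<open>s\<^sub>\<nu> \<mapsto> 1\<close> maps the latter to the number of square roots of \<open>w\<close>.\<close>

text \<open>Schur functions are given by tableaux, \<open>\<chi>\<^sup>\<lambda>\<close> by a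
  uniqueness property and plethysm by axioms. What links them is one count: the permutations of a
  set carrying one labelling to another. There are none unless all labels occur equally often, and
  otherwise their number is a product of factorials. For pairs of labels, sums over permutations
  thus become numbers of nonnegative integer matrices: with prescribed margins for
  \<open>\<theta>\<^sub>\<mu> \<theta>\<^sub>\<alpha>\<close>, symmetric or twisted symmetric ones
  for square roots. Kostka numbers are taken as chains of horizontal strips because removing the
  last row of such a matrix then corresponds to removing the last strip.

  The set \<open>W\<^sub>\<sigma>\<close> is the coset over \<open>\<sigma>\<close> of
  \<open>(S\<^sub>m)\<^sup>n\<close> in the wreath product. The inverse Kostka matrix is integral,
  which makes \<open>f\<^sub>\<lambda>\<close> a virtual character; norm 1 then leaves only a sign
  open. Existence and uniqueness of plethysm come from the power sums being free generators; that
  they generate is read off from the expansion of \<open>s\<^sub>\<lambda>\<close> with coefficients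
  given by \<open>f\<^sub>\<lambda>\<close>.\<close>

abbreviation lookup where "lookup \<equiv> Poly_Mapping.lookup"
abbreviation keys where "keys \<equiv> Poly_Mapping.keys"
abbreviation single where "single \<equiv> Poly_Mapping.single"
abbreviation map_key where "map_key \<equiv> Poly_Mapping.map_key"

section \<open>Colourings and permutations\<close>

definition matchings :: "'a set \<Rightarrow> 'b set \<Rightarrow> ('a \<Rightarrow> 'c) \<Rightarrow> ('b \<Rightarrow> 'c) \<Rightarrow> ('a \<Rightarrow> 'b) set" where
  "matchings A B v u = {x \<in> extensional A. bij_betw x A B \<and> (\<forall>a\<in>A. u (x a) = v a)}"

lemma finite_matchings: "finite A \<Longrightarrow> finite B \<Longrightarrow> finite (matchings A B v u)"
  by (rule finite_subset[OF _ finite_PiE[of A "\<lambda>_. B"]])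
     (auto simp: matchings_def PiE_iff bij_betw_def extensional_def)

lemma matchings_insert:
  assumes "a \<notin> A"
  shows "matchings (insert a A) B v u =
    (\<Union>b\<in>{b \<in> B. u b = v a}. (\<lambda>x. x(a := b)) ` matchings A (B - {b}) v u)"
proof (intro equalityI subsetI)
  fix x assume x: "x \<in> matchings (insert a A) B v u"
  have bij: "bij_betw x (insert a A) B" and ext: "x \<in> extensional (insert a A)"
    and u: "\<And>a'. a' \<in> insert a A \<Longrightarrow> u (x a') = v a'"
    using x by (auto simp: matchings_def)
  have "bij_betw x A (B - {x a})"
    using bij assms by (auto simp: bij_betw_def inj_on_def)
  then have bij': "bij_betw (restrict x A) A (B - {x a})"
    by (simp add: bij_betw_restrict_eq)
  have "restrict x A \<in> matchings A (B - {x a}) v u"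
    using bij' u by (auto simp: matchings_def)
  moreover have "x = (restrict x A)(a := x a)"
    using ext by (auto simp: fun_eq_iff extensional_def restrict_def)
  moreover have "x a \<in> {b \<in> B. u b = v a}"
    using bij u by (auto simp: bij_betw_def)
  ultimately show "x \<in> (\<Union>b\<in>{b \<in> B. u b = v a}. (\<lambda>x. x(a := b)) ` matchings A (B - {b}) v u)"
    by blast
next
  fix x assume "x \<in> (\<Union>b\<in>{b \<in> B. u b = v a}. (\<lambda>x. x(a := b)) ` matchings A (B - {b}) v u)"
  then obtain b y where b: "b \<in> B" "u b = v a" and y: "y \<in> matchings A (B - {b}) v u"
    and x: "x = y(a := b)" by auto
  have "bij_betw y A (B - {b})" using y by (auto simp: matchings_def)
  then have "bij_betw x A (B - {b})" using assms
    by (subst bij_betw_cong[of _ _ y]) (auto simp: x)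
  then have "bij_betw x (insert a A) (insert b (B - {b}))"
    using assms by (auto simp: bij_betw_def x)
  moreover have "insert b (B - {b}) = B" using b by auto
  ultimately show "x \<in> matchings (insert a A) B v u"
    using y b assms by (auto simp: matchings_def x extensional_def)
qed

text \<open>Fibres of equal size are matched independently of each other. The new point
  \<open>a\<close> may go to any point of \<open>B\<close> of its colour, and there is one more of
  these than points of that colour in the smaller set. Colours of \<open>C\<close> that do not occur
  contribute \<open>fact 0\<close>.\<close>

lemma card_matchings:
  assumes "finite A" "finite B" "finite C" "v ` A \<subseteq> C"
    and "\<And>c. card {b \<in> B. u b = c} = card {a \<in> A. v a = c}"
  shows "card (matchings A B v u) = (\<Prod>c\<in>C. fact (card {a \<in> A. v a = c}))"
  using assms
proof (induction A arbitrary: B rule: finite_induct)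
  case empty
  then have "{b \<in> B. u b = u b'} = {}" if "b' \<in> B" for b'
    by simp
  then have "B = {}" by auto
  then have "matchings {} B v u = {\<lambda>_. undefined}"
    by (auto simp: matchings_def bij_betw_def)
  then show ?case by simp
next
  case (insert a A)
  let ?Ba = "{b \<in> B. u b = v a}"
  let ?n = "\<lambda>c. card {a \<in> A. v a = c}"
  have n: "card {a' \<in> insert a A. v a' = c} = ?n c + (if c = v a then 1 else 0)" for c
  proof -
    have "{a' \<in> insert a A. v a' = c} = (if c = v a then insert a {a \<in> A. v a = c} else {a \<in> A. v a = c})"
      using insert.hyps by auto
    then show ?thesis using insert.hyps by simp
  qed
  have IH: "card (matchings A (B - {b}) v u) = (\<Prod>c\<in>C. fact (?n c))" if b: "b \<in> ?Ba" for b
  proof (rule insert.IH)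
    show "card {b' \<in> B - {b}. u b' = c} = ?n c" for c
    proof (cases "c = v a")
      case True
      have "{b' \<in> B - {b}. u b' = c} = {b' \<in> B. u b' = c} - {b}" by auto
      then show ?thesis using insert.prems(4)[of c] n[of c] True b by simp
    next
      case False
      then have "{b' \<in> B - {b}. u b' = c} = {b' \<in> B. u b' = c}" using b by auto
      then show ?thesis using insert.prems(4)[of c] n[of c] False by simp
    qed
  qed (use insert.prems in auto)
  have inj: "inj_on (\<lambda>x. x(a := b)) (matchings A D v u)" for b D
  proof (rule inj_onI)
    fix x y assume x: "x \<in> matchings A D v u" and y: "y \<in> matchings A D v u" and eq: "x(a := b) = y(a := b)"
    show "x = y"
    proof
      fix t show "x t = y t"
        using fun_cong[OF eq, of t] x y insert.hyps(2)
        by (cases "t = a") (auto simp: matchings_def extensional_def)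
    qed
  qed
  have "card (matchings (insert a A) B v u) = (\<Sum>b\<in>?Ba. card ((\<lambda>x. x(a := b)) ` matchings A (B - {b}) v u))"
    unfolding matchings_insert[OF insert.hyps(2)]
  proof (rule card_UN_disjoint)
    show "\<forall>b\<in>?Ba. finite ((\<lambda>x. x(a := b)) ` matchings A (B - {b}) v u)"
      using insert by (auto intro!: finite_matchings)
    show "\<forall>b\<in>?Ba. \<forall>b'\<in>?Ba. b \<noteq> b' \<longrightarrow>
        (\<lambda>x. x(a := b)) ` matchings A (B - {b}) v u \<inter> (\<lambda>x. x(a := b')) ` matchings A (B - {b'}) v u = {}"
      by (auto dest!: fun_cong[of _ _ a])
  qed (use insert in auto)
  also have "\<dots> = (\<Sum>b\<in>?Ba. (\<Prod>c\<in>C. fact (?n c)))"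
    by (rule sum.cong) (auto simp: card_image[OF inj] IH)
  also have "\<dots> = (?n (v a) + 1) * (\<Prod>c\<in>C. fact (?n c))"
    using insert.prems(4)[of "v a"] n[of "v a"] by simp
  also have "\<dots> = (\<Prod>c\<in>C. fact (card {a' \<in> insert a A. v a' = c}))"
  proof -
    have va: "v a \<in> C" using insert.prems by auto
    have "(\<Prod>c\<in>C - {v a}. fact (card {a' \<in> insert a A. v a' = c})) = (\<Prod>c\<in>C - {v a}. fact (?n c) :: nat)"
      by (rule prod.cong) (simp_all only: n, auto)
    then show ?thesis
      using prod.remove[OF insert.prems(2) va, of "\<lambda>c. fact (card {a' \<in> insert a A. v a' = c}) :: nat"]
        prod.remove[OF insert.prems(2) va, of "\<lambda>c. fact (?n c) :: nat"] n[of "v a"]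
      by (simp add: algebra_simps)
  qed
  finally show ?case .
qed

text \<open>The basic count behind the sums over permutations below. A permutation carrying
  \<open>v\<close> to \<open>u\<close> maps each fibre of \<open>v\<close> onto the fibre of
  \<open>u\<close> of the same colour, so unequal fibre sizes leave none at all.\<close>

lemma card_permutes_matching:
  assumes "finite A" "finite C" "v ` A \<subseteq> C"
  shows "card {x. x permutes A \<and> (\<forall>a\<in>A. u (x a) = v a)} =
    (if \<forall>c. card {a \<in> A. u a = c} = card {a \<in> A. v a = c}
     then \<Prod>c\<in>C. fact (card {a \<in> A. v a = c}) else 0)" (is "card ?X = _")
proof (cases "\<forall>c. card {a \<in> A. u a = c} = card {a \<in> A. v a = c}")
  case True
  have "bij_betw (\<lambda>x. restrict x A) ?X (matchings A A v u)"
  proof (rule bij_betwI[where g = "\<lambda>x a. if a \<in> A then x a else a"])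
    show "(\<lambda>x. restrict x A) \<in> ?X \<rightarrow> matchings A A v u"
      by (auto simp: matchings_def bij_betw_restrict_eq permutes_imp_bij)
    show "(\<lambda>x a. if a \<in> A then x a else a) \<in> matchings A A v u \<rightarrow> ?X"
    proof
      fix x assume x: "x \<in> matchings A A v u"
      have "bij_betw (\<lambda>a. if a \<in> A then x a else a) A A"
        using x by (subst bij_betw_cong[of _ _ x]) (auto simp: matchings_def)
      then show "(\<lambda>a. if a \<in> A then x a else a) \<in> ?X"
        using x by (auto simp: permutes_altdef matchings_def)
    qed
    show "\<And>x. x \<in> ?X \<Longrightarrow>
         (\<lambda>a. if a \<in> A then restrict x A a else a) = x"
      by (auto simp: fun_eq_iff permutes_not_in)
    show "\<And>y. y \<in> matchings A A v u \<Longrightarrow> (\<lambda>a\<in>A. if a \<in> A then y a else a) = y"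
      by (auto simp: matchings_def extensional_def fun_eq_iff)
  qed
  then have "card ?X = card (matchings A A v u)"
    by (rule bij_betw_same_card)
  then show ?thesis using card_matchings[OF assms(1,1,2,3), of u] True by simp
next
  case False
  have "?X = {}"
  proof (rule ccontr)
    assume "?X \<noteq> {}"
    then obtain x where x: "x permutes A" "\<And>a. a \<in> A \<Longrightarrow> u (x a) = v a" by auto
    have "card {a \<in> A. u a = c} = card {a \<in> A. v a = c}" for c
    proof -
      have "x ` {a \<in> A. v a = c} = {a \<in> A. u a = c}"
      proof (intro equalityI subsetI)
        fix a' assume a': "a' \<in> {a \<in> A. u a = c}"
        obtain a where "x a = a'" using permutes_surj[OF x(1)] by (metis surjD)
        then show "a' \<in> x ` {a \<in> A. v a = c}"
          using a' x(2)[of a] permutes_in_image[OF x(1), of a] by (intro image_eqI[of _ _ a]) auto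
      qed (use x in \<open>auto simp: permutes_in_image[OF x(1)]\<close>)
      then have "bij_betw x {a \<in> A. v a = c} {a \<in> A. u a = c}"
        using inj_on_subset[OF permutes_inj[OF x(1)]] by (auto simp: bij_betw_def)
      then show ?thesis by (simp add: bij_betw_same_card)
    qed
    then show False using False by blast
  qed
  then show ?thesis unfolding if_not_P[OF False] by (metis card.empty)
qed

section \<open>Monomials, colourings and their contents\<close>

definition mdeg :: "monomial \<Rightarrow> nat" where
  "mdeg \<alpha> = (\<Sum>i\<in>keys \<alpha>. lookup \<alpha> i)"

text \<open>The order of the stabiliser of a colouring with content \<alpha>.\<close>

definition mfact :: "monomial \<Rightarrow> nat" where
  "mfact \<alpha> = (\<Prod>i\<in>keys \<alpha>. fact (lookup \<alpha> i))"

definition content :: "'a set \<Rightarrow> ('a \<Rightarrow> nat) \<Rightarrow> monomial" where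
  "content A f = (\<Sum>a\<in>A. single (f a) 1)"

lemma mdeg_superset:
  assumes "finite S" "keys \<alpha> \<subseteq> S"
  shows "mdeg \<alpha> = (\<Sum>i\<in>S. lookup \<alpha> i)"
  unfolding mdeg_def using assms by (intro sum.mono_neutral_left) (auto simp: in_keys_iff)

lemma mdeg_add: "mdeg (\<alpha> + \<beta>) = mdeg \<alpha> + mdeg \<beta>"
proof -
  let ?S = "keys \<alpha> \<union> keys \<beta>"
  have "mdeg (\<alpha> + \<beta>) = (\<Sum>i\<in>?S. lookup (\<alpha> + \<beta>) i)"
    by (rule mdeg_superset) (auto simp: keys_add)
  also have "\<dots> = mdeg \<alpha> + mdeg \<beta>"
    by (simp add: lookup_add sum.distrib mdeg_superset[of ?S])
  finally show ?thesis .
qed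

lemma mdeg_0 [simp]: "mdeg 0 = 0" by (simp add: mdeg_def)

lemma mdeg_single [simp]: "mdeg (single i k) = k"
  by (simp add: mdeg_def)

lemma mdeg_sum: "mdeg (\<Sum>i\<in>I. f i) = (\<Sum>i\<in>I. mdeg (f i))"
  by (induction I rule: infinite_finite_induct) (auto simp: mdeg_add)

lemma mdeg_eq_0_iff: "mdeg \<alpha> = 0 \<longleftrightarrow> \<alpha> = 0"
  by (auto simp: mdeg_def in_keys_iff intro: poly_mapping_eqI)

lemma lookup_content:
  "finite A \<Longrightarrow> lookup (content A f) k = card {a \<in> A. f a = k}"
  by (simp add: content_def lookup_sum lookup_single when_def sum.If_cases Int_def)

lemma mdeg_content: "mdeg (content A f) = card A"
  by (simp add: content_def mdeg_sum)

lemma keys_content: "finite A \<Longrightarrow> keys (content A f) = f ` A"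
  by (auto simp: in_keys_iff lookup_content)

lemma content_cong: "(\<And>a. a \<in> A \<Longrightarrow> f a = g a) \<Longrightarrow> content A f = content A g"
  by (simp add: content_def)

lemma sum_content_fibres:
  assumes "finite A" "finite I" "b ` A \<subseteq> I"
  shows "(\<Sum>i\<in>I. content {a \<in> A. b a = i} f) = content A f"
  unfolding content_def using assms by (intro sum.group) auto

definition cols :: "'a set \<Rightarrow> monomial \<Rightarrow> ('a \<Rightarrow> nat) set" where
  "cols A \<alpha> = {f \<in> extensional A. content A f = \<alpha>}"

text \<open>Its cardinality is the value at \<open>w\<close> of the permutation character
  \<open>\<theta>\<^sub>\<alpha>\<close>. It is also the coefficient of
  \<open>x\<^sup>\<alpha>\<close> in the product of the power sums of the cycle lengths of
  \<open>w\<close>.\<close>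

definition fixcols :: "'a set \<Rightarrow> monomial \<Rightarrow> ('a \<Rightarrow> 'a) \<Rightarrow> ('a \<Rightarrow> nat) set" where
  "fixcols A \<alpha> w = {f \<in> cols A \<alpha>. \<forall>a\<in>A. f (w a) = f a}"

lemma finite_cols: "finite A \<Longrightarrow> finite (cols A \<alpha>)"
  by (rule finite_subset[OF _ finite_PiE[of A "\<lambda>_. keys \<alpha>"]])
     (auto simp: cols_def PiE_iff keys_content extensional_def)

lemma finite_fixcols: "finite A \<Longrightarrow> finite (fixcols A \<alpha> w)"
  by (simp add: fixcols_def finite_cols)

text \<open>The rows of the matrix that counts the points with label \<open>i\<close> under
  \<open>b\<close> and colour \<open>j\<close> under \<open>f\<close>.\<close>

definition fcontents :: "'a set \<Rightarrow> 'i set \<Rightarrow> ('a \<Rightarrow> 'i) \<Rightarrow> ('a \<Rightarrow> nat) \<Rightarrow> 'i \<Rightarrow> monomial" where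
  "fcontents A I b f = (\<lambda>i\<in>I. content {a \<in> A. b a = i} f)"

lemma mfact_superset:
  assumes "finite S" "keys \<alpha> \<subseteq> S"
  shows "mfact \<alpha> = (\<Prod>i\<in>S. fact (lookup \<alpha> i))"
  unfolding mfact_def using assms by (intro prod.mono_neutral_left) (auto simp: in_keys_iff)

lemma prod_fact_fcontents:
  assumes "finite A" "finite I" "finite J" "f ` A \<subseteq> J"
  shows "(\<Prod>p\<in>I \<times> J. fact (card {a \<in> A. (b a, f a) = p})) =
    (\<Prod>i\<in>I. mfact (fcontents A I b f i))"
proof -
  have "(\<Prod>p\<in>I \<times> J. fact (card {a \<in> A. (b a, f a) = p})) =
      (\<Prod>i\<in>I. \<Prod>j\<in>J. fact (card {a \<in> A. (b a, f a) = (i, j)}) :: nat)"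
    by (subst prod.cartesian_product) (auto intro!: prod.cong)
  also have "\<dots> = (\<Prod>i\<in>I. mfact (fcontents A I b f i))"
  proof (rule prod.cong)
    fix i assume i: "i \<in> I"
    have "mfact (fcontents A I b f i) = (\<Prod>j\<in>J. fact (lookup (fcontents A I b f i) j))"
      using assms i by (intro mfact_superset) (auto simp: fcontents_def keys_content)
    also have "\<dots> = (\<Prod>j\<in>J. fact (card {a \<in> A. (b a, f a) = (i, j)}))"
      using assms i by (simp add: fcontents_def lookup_content conj_assoc)
    finally show "(\<Prod>j\<in>J. fact (card {a \<in> A. (b a, f a) = (i, j)})) = mfact (fcontents A I b f i)" by simp
  qed simp
  finally show ?thesis .
qed

text \<open>A product of multinomial coefficients, by double counting. The model set
  \<open>B\<close> has \<open>lookup (\<beta> i) j\<close> points of colour \<open>j\<close> over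
  each label \<open>i\<close>. A label-preserving bijection from \<open>A\<close> to
  \<open>B\<close> transports the colours of \<open>B\<close> to a colouring of \<open>A\<close>
  with contents \<beta>, and every such colouring arises from the same number of bijections, the
  product of the \<open>mfact (\<beta> i)\<close>.\<close>

lemma card_fcontents:
  fixes b :: "'a \<Rightarrow> 'i"
  assumes fin: "finite A" "finite I" and b: "b ` A \<subseteq> I"
    and \<beta>: "\<beta> \<in> extensional I" "\<And>i. i \<in> I \<Longrightarrow> mdeg (\<beta> i) = card {a \<in> A. b a = i}"
  shows "card {f \<in> extensional A. fcontents A I b f = \<beta>} * (\<Prod>i\<in>I. mfact (\<beta> i)) =
    (\<Prod>i\<in>I. fact (card {a \<in> A. b a = i}))"
proof -
  define B where "B = (SIGMA i:I. SIGMA j:keys (\<beta> i). {..<lookup (\<beta> i) j})"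
  define F where "F = {f \<in> extensional A. fcontents A I b f = \<beta>}"
  define J where "J = (\<Union>i\<in>I. keys (\<beta> i))"
  have finJ: "finite J" using fin by (auto simp: J_def)
  have finB: "finite B" using fin by (auto simp: B_def)
  have F: "f ` A \<subseteq> J" if "f \<in> F" for f
  proof
    fix j assume "j \<in> f ` A"
    then obtain a where a: "a \<in> A" "j = f a" by auto
    have "b a \<in> I" using a b by auto
    moreover have "f a \<in> keys (fcontents A I b f (b a))"
      using a fin calculation by (auto simp: fcontents_def keys_content)
    ultimately show "j \<in> J" using that a by (auto simp: J_def F_def)
  qed
  have finF: "finite F"
    by (rule finite_subset[OF _ finite_PiE[of A "\<lambda>_. J"]])
      (use F fin finJ in \<open>auto simp: PiE_iff F_def extensional_def\<close>)
  have fib: "card {x \<in> B. fst x = i} = card {a \<in> A. b a = i}" for i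
  proof (cases "i \<in> I")
    case True
    have "{x \<in> B. fst x = i} = Pair i ` (SIGMA j:keys (\<beta> i). {..<lookup (\<beta> i) j})"
      using True by (auto simp: B_def)
    then have "card {x \<in> B. fst x = i} = card (SIGMA j:keys (\<beta> i). {..<lookup (\<beta> i) j})"
      by (simp add: card_image inj_on_def)
    also have "\<dots> = mdeg (\<beta> i)" by (simp add: mdeg_def)
    finally show ?thesis using \<beta>(2)[OF True] by simp
  next
    case False
    then have "{x \<in> B. fst x = i} = {}" "{a \<in> A. b a = i} = {}" using b by (auto simp: B_def)
    then show ?thesis by (metis card.empty)
  qed
  let ?X = "matchings A B b fst"
  let ?M = "\<lambda>f. matchings A B (\<lambda>a. (b a, f a)) (\<lambda>x. (fst x, fst (snd x)))"
  have fibp: "card {x \<in> B. (fst x, fst (snd x)) = p} = card {a \<in> A. (b a, f a) = p}" if f: "f \<in> F" for f p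
  proof (cases "fst p \<in> I")
    case True
    have "{x \<in> B. (fst x, fst (snd x)) = p} = (\<lambda>k. (fst p, snd p, k)) ` {..<lookup (\<beta> (fst p)) (snd p)}"
      using True by (auto simp: B_def in_keys_iff image_iff prod_eq_iff)
    then have "card {x \<in> B. (fst x, fst (snd x)) = p} = lookup (\<beta> (fst p)) (snd p)"
      by (simp add: card_image inj_on_def)
    also have "\<dots> = card {a \<in> A. (b a, f a) = p}"
      using f True fin by (auto simp: F_def fcontents_def lookup_content conj_assoc prod_eq_iff)
    finally show ?thesis .
  next
    case False
    then have "{x \<in> B. (fst x, fst (snd x)) = p} = {}" "{a \<in> A. (b a, f a) = p} = {}" using b by (auto simp: B_def)
    then show ?thesis by (metis card.empty)
  qed
  have X: "?X = (\<Union>f\<in>F. ?M f)"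
  proof (intro equalityI subsetI)
    fix x assume x: "x \<in> ?X"
    define f where "f = (\<lambda>a\<in>A. fst (snd (x a)))"
    have xM: "x \<in> ?M f" using x by (auto simp: matchings_def f_def)
    have "fcontents A I b f = \<beta>"
    proof
      fix i show "fcontents A I b f i = \<beta> i"
      proof (cases "i \<in> I")
        case True
        show ?thesis
        proof (rule poly_mapping_eqI)
          fix j
          have bij: "bij_betw x A B" using x by (simp add: matchings_def)
          have "{a \<in> A. b a = i \<and> f a = j} = {a \<in> A. fst (x a) = i \<and> fst (snd (x a)) = j}"
            using x by (auto simp: matchings_def f_def)
          moreover have "bij_betw x \<dots> {y \<in> B. fst y = i \<and> fst (snd y) = j}"
            using bij by (auto simp: bij_betw_def inj_on_def image_iff)
          ultimately have "card {a \<in> A. b a = i \<and> f a = j} = card {y \<in> B. fst y = i \<and> fst (snd y) = j}"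
            by (simp add: bij_betw_same_card)
          also have "{y \<in> B. fst y = i \<and> fst (snd y) = j} = (\<lambda>k. (i, j, k)) ` {..<lookup (\<beta> i) j}"
            using True by (auto simp: B_def in_keys_iff image_iff)
          also have "card \<dots> = lookup (\<beta> i) j"
            by (simp add: card_image inj_on_def)
          finally show "lookup (fcontents A I b f i) j = lookup (\<beta> i) j"
            using True fin by (simp add: fcontents_def lookup_content conj_assoc)
        qed
      qed (use \<beta> in \<open>auto simp: fcontents_def extensional_def\<close>)
    qed
    then have "f \<in> F" by (simp add: F_def f_def)
    then show "x \<in> (\<Union>f\<in>F. ?M f)" using xM by auto
  qed (auto simp: matchings_def)
  have "card ?X = (\<Sum>f\<in>F. card (?M f))"
    unfolding X
  proof (rule card_UN_disjoint)
    show "\<forall>f\<in>F. \<forall>g\<in>F. f \<noteq> g \<longrightarrow> ?M f \<inter> ?M g = {}"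
    proof (intro ballI impI)
      fix f g assume "f \<in> F" "g \<in> F" "f \<noteq> g"
      then obtain a where "a \<in> A" "f a \<noteq> g a"
        by (metis (no_types, lifting) F_def extensionalityI mem_Collect_eq)
      then show "?M f \<inter> ?M g = {}" by (fastforce simp: matchings_def)
    qed
  qed (use finF fin finB in \<open>auto intro!: finite_matchings\<close>)
  also have "\<dots> = (\<Sum>f\<in>F. \<Prod>i\<in>I. mfact (\<beta> i))"
  proof (rule sum.cong)
    fix f assume f: "f \<in> F"
    have "card (?M f) = (\<Prod>p\<in>I \<times> J. fact (card {a \<in> A. (b a, f a) = p}))"
      using b F[OF f] fibp[OF f] fin finB finJ by (intro card_matchings) auto
    also have "\<dots> = (\<Prod>i\<in>I. mfact (fcontents A I b f i))"
      by (rule prod_fact_fcontents) (use fin finJ F[OF f] in auto)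
    finally show "card (?M f) = (\<Prod>i\<in>I. mfact (\<beta> i))" using f by (simp add: F_def)
  qed simp
  also have "\<dots> = card F * (\<Prod>i\<in>I. mfact (\<beta> i))" by simp
  also have "card ?X = (\<Prod>i\<in>I. fact (card {a \<in> A. b a = i}))"
    using fib fin finB b by (intro card_matchings) auto
  finally show ?thesis by (simp add: F_def)
qed

text \<open>The weight of a colouring cancels the denominators of the multinomial coefficients, so
  every tuple of contents in \<Phi> contributes the same amount.\<close>

lemma sum_mfact_fcontents:
  fixes b :: "'a \<Rightarrow> 'i"
  assumes fin: "finite A" "finite I" "finite \<Phi>" and b: "b ` A \<subseteq> I"
    and \<Phi>: "\<And>\<beta>. \<beta> \<in> \<Phi> \<Longrightarrow> \<beta> \<in> extensional I"
      "\<And>\<beta> i. \<beta> \<in> \<Phi> \<Longrightarrow> i \<in> I \<Longrightarrow> mdeg (\<beta> i) = card {a \<in> A. b a = i}"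
  shows "(\<Sum>f | f \<in> extensional A \<and> fcontents A I b f \<in> \<Phi>. \<Prod>i\<in>I. mfact (fcontents A I b f i)) =
    (\<Prod>i\<in>I. fact (card {a \<in> A. b a = i})) * card \<Phi>"
proof -
  let ?S = "{f. f \<in> extensional A \<and> fcontents A I b f \<in> \<Phi>}"
  let ?J = "\<Union>\<beta>\<in>\<Phi>. \<Union>i\<in>I. keys (\<beta> i)"
  have sub: "f ` A \<subseteq> ?J" if "f \<in> ?S" for f
  proof
    fix j assume "j \<in> f ` A"
    then obtain a where a: "a \<in> A" "j = f a" by auto
    have "b a \<in> I" using a b by auto
    moreover have "f a \<in> keys (fcontents A I b f (b a))"
      using a fin calculation by (auto simp: fcontents_def keys_content)
    ultimately show "j \<in> ?J" using that a by auto
  qed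
  have finS: "finite ?S"
  proof (rule finite_subset[OF _ finite_PiE[of A "\<lambda>_. ?J"]])
    show "?S \<subseteq> A \<rightarrow>\<^sub>E ?J"
    proof
      fix f assume "f \<in> ?S"
      then show "f \<in> A \<rightarrow>\<^sub>E ?J" using sub[of f] by (simp add: PiE_iff image_subset_iff)
    qed
  qed (use fin in auto)
  have "(\<Sum>f\<in>?S. \<Prod>i\<in>I. mfact (fcontents A I b f i)) =
      (\<Sum>\<beta>\<in>\<Phi>. \<Sum>f | f \<in> ?S \<and> fcontents A I b f = \<beta>. \<Prod>i\<in>I. mfact (fcontents A I b f i))"
    using finS fin by (intro sum.group[symmetric]) auto
  also have "\<dots> = (\<Sum>\<beta>\<in>\<Phi>. \<Prod>i\<in>I. fact (card {a \<in> A. b a = i}))"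
  proof (rule sum.cong)
    fix \<beta> assume \<beta>: "\<beta> \<in> \<Phi>"
    have "{f \<in> ?S. fcontents A I b f = \<beta>} = {f \<in> extensional A. fcontents A I b f = \<beta>}"
      using \<beta> by auto
    then have "(\<Sum>f | f \<in> ?S \<and> fcontents A I b f = \<beta>. \<Prod>i\<in>I. mfact (fcontents A I b f i)) =
        card {f \<in> extensional A. fcontents A I b f = \<beta>} * (\<Prod>i\<in>I. mfact (\<beta> i))"
      by simp
    then show "(\<Sum>f | f \<in> ?S \<and> fcontents A I b f = \<beta>. \<Prod>i\<in>I. mfact (fcontents A I b f i)) =
        (\<Prod>i\<in>I. fact (card {a \<in> A. b a = i}))"
      using card_fcontents[OF fin(1,2) b \<Phi>(1)[OF \<beta>] \<Phi>(2)[OF \<beta>]] by simp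
  qed simp
  finally show ?thesis by simp
qed

text \<open>Here \<open>\<beta> j\<close> is column \<open>j\<close> of a matrix \<open>A\<close>,
  so that \<open>lookup (\<beta> j) i\<close> is \<open>A (i, j)\<close> and the last condition says
  \<open>A (\<sigma> j, i) = A (i, j)\<close>. The column sums may vary: for
  \<open>\<sigma> = id\<close> they become the exponents of a monomial.\<close>

definition twisted_tuples ::
    "nat set \<Rightarrow> (nat \<Rightarrow> nat) \<Rightarrow> (nat \<Rightarrow> nat) \<Rightarrow> (nat \<Rightarrow> monomial) set" where
  "twisted_tuples I \<sigma> s = {\<beta> \<in> extensional I.
     (\<forall>i\<in>I. mdeg (\<beta> i) = s i \<and> keys (\<beta> i) \<subseteq> I) \<and>
     (\<forall>i\<in>I. \<forall>j\<in>I. lookup (\<beta> i) (\<sigma> j) = lookup (\<beta> j) i)}"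

text \<open>For \<open>\<sigma> = id\<close> these are the matrices with row sums \<open>s\<close>
  and column sums \<alpha>. For general \<sigma> and constant \<open>s\<close> their number is a
  coefficient of the product of the \<open>p\<^sub>k[h\<^sub>s]\<close> over the cycle lengths
  \<open>k\<close>.\<close>

definition invariant_tuples ::
    "'i set \<Rightarrow> ('i \<Rightarrow> 'i) \<Rightarrow> ('i \<Rightarrow> nat) \<Rightarrow> monomial \<Rightarrow> ('i \<Rightarrow> monomial) set" where
  "invariant_tuples I \<sigma> s \<alpha> = {\<beta> \<in> extensional I.
     (\<forall>i\<in>I. mdeg (\<beta> i) = s i \<and> \<beta> (\<sigma> i) = \<beta> i) \<and> (\<Sum>i\<in>I. \<beta> i) = \<alpha>}"

lemma lookup_le_mdeg: "lookup \<alpha> i \<le> mdeg \<alpha>"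
  by (cases "i \<in> keys \<alpha>") (auto simp: mdeg_def in_keys_iff intro: member_le_sum)

lemma finite_monomials: "finite J \<Longrightarrow> finite {\<alpha>. keys \<alpha> \<subseteq> J \<and> mdeg \<alpha> \<le> d}"
proof (rule finite_imageD)
  assume J: "finite J"
  have "lookup ` {\<alpha>. keys \<alpha> \<subseteq> J \<and> mdeg \<alpha> \<le> d}
      \<subseteq> (\<lambda>f x. if x \<in> J then f x else 0) ` (J \<rightarrow>\<^sub>E {..d})"
  proof
    fix f assume "f \<in> lookup ` {\<alpha>. keys \<alpha> \<subseteq> J \<and> mdeg \<alpha> \<le> d}"
    then obtain \<alpha> where \<alpha>: "f = lookup \<alpha>" "keys \<alpha> \<subseteq> J" "mdeg \<alpha> \<le> d" by auto
    have "restrict f J \<in> J \<rightarrow>\<^sub>E {..d}" using \<alpha> lookup_le_mdeg[of \<alpha>] by (auto intro: order_trans)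
    moreover have "f = (\<lambda>x. if x \<in> J then restrict f J x else 0)"
      using \<alpha> by (auto simp: fun_eq_iff in_keys_iff)
    ultimately show "f \<in> (\<lambda>f x. if x \<in> J then f x else 0) ` (J \<rightarrow>\<^sub>E {..d})" by blast
  qed
  then show "finite (lookup ` {\<alpha>. keys \<alpha> \<subseteq> J \<and> mdeg \<alpha> \<le> d})"
    using J by (auto intro!: finite_PiE elim: finite_subset)
qed (auto simp: inj_on_def)

lemma finite_twisted_tuples: "finite I \<Longrightarrow> finite (twisted_tuples I \<sigma> s)"
  by (rule finite_subset[OF _ finite_PiE[of I "\<lambda>i. {\<alpha>. keys \<alpha> \<subseteq> I \<and> mdeg \<alpha> \<le> s i}"]])
     (auto simp: twisted_tuples_def PiE_iff extensional_def finite_monomials)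

lemma keys_sum_monomials:
  assumes "finite I" shows "keys (\<Sum>i\<in>I. \<beta> i :: monomial) = (\<Union>i\<in>I. keys (\<beta> i))"
  using assms by (auto simp: in_keys_iff lookup_sum)

lemma finite_invariant_tuples: "finite I \<Longrightarrow> finite (invariant_tuples I \<sigma> s \<alpha>)"
  by (rule finite_subset[OF _ finite_PiE[of I "\<lambda>i. {\<beta>. keys \<beta> \<subseteq> keys \<alpha> \<and> mdeg \<beta> \<le> s i}"]])
     (auto simp: invariant_tuples_def PiE_iff extensional_def finite_monomials keys_sum_monomials)

lemma finite_permutes_subset: "finite A \<Longrightarrow> finite {x. x permutes A \<and> P x}"
  by (rule finite_subset[OF _ finite_permutations[of A]]) auto

text \<open>With \<open>f = b \<circ> x\<close> the condition on \<open>x \<circ> x\<close> splits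
  into two conditions on \<open>x\<close>: it carries the labelling \<open>(f, \<sigma> b)\<close>
  to \<open>(b, f)\<close>. Such an \<open>x\<close> exists exactly if both labellings have the same
  label counts, which is the twisted symmetry of the matrix of \<open>(b, f)\<close>; their number
  is then the product of the factorials of its entries.\<close>

lemma card_square_in_fibre:
  fixes b :: "'a \<Rightarrow> nat"
  assumes fin: "finite A" "finite I" and b: "\<And>a. a \<in> A \<Longrightarrow> b a \<in> I" and \<sigma>: "\<sigma> permutes I"
  shows "card {x. x permutes A \<and> (\<forall>a\<in>A. b (x (x a)) = \<sigma> (b a))} =
    (\<Prod>i\<in>I. fact (card {a \<in> A. b a = i})) * card (twisted_tuples I \<sigma> (\<lambda>i. card {a \<in> A. b a = i}))"
proof -
  let ?X = "{x. x permutes A \<and> (\<forall>a\<in>A. b (x (x a)) = \<sigma> (b a))}"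
  let ?s = "\<lambda>i. card {a \<in> A. b a = i}"
  let ?Y = "\<lambda>f. {x. x permutes A \<and> (\<forall>a\<in>A. (b (x a), f (x a)) = (f a, \<sigma> (b a)))}"
  let ?T = "twisted_tuples I \<sigma> ?s"
  let ?E = "{f. f \<in> extensional A \<and> f ` A \<subseteq> I}"
  let ?m = "\<lambda>f. \<Prod>i\<in>I. mfact (fcontents A I b f i)"
  have finE: "finite ?E"
    by (rule finite_subset[OF _ finite_PiE[of A "\<lambda>_. I"]]) (use fin in \<open>auto simp: PiE_iff extensional_def\<close>)
  have bI: "b ` A \<subseteq> I" using b by auto
  have Y: "card (?Y f) = (if fcontents A I b f \<in> ?T then ?m f else 0)" if f: "f \<in> ?E" for f
  proof -
    have fI: "f a \<in> I" if "a \<in> A" for a using f that by auto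
    have L: "lookup (fcontents A I b f i) j = card {a \<in> A. (b a, f a) = (i, j)}" if "i \<in> I" for i j
      using that fin by (simp add: fcontents_def lookup_content conj_assoc)
    have iff: "(\<forall>p. card {a \<in> A. (b a, f a) = p} = card {a \<in> A. (f a, \<sigma> (b a)) = p}) \<longleftrightarrow>
        fcontents A I b f \<in> ?T"
    proof
      assume l: "\<forall>p. card {a \<in> A. (b a, f a) = p} = card {a \<in> A. (f a, \<sigma> (b a)) = p}"
      have "lookup (fcontents A I b f i) (\<sigma> j) = lookup (fcontents A I b f j) i"
        if "i \<in> I" "j \<in> I" for i j
      proof -
        have "{a \<in> A. (f a, \<sigma> (b a)) = (i, \<sigma> j)} = {a \<in> A. (b a, f a) = (j, i)}"
          using permutes_inj[OF \<sigma>] by (auto dest: injD)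
        then show ?thesis using l that by (simp only: L)
      qed
      then show "fcontents A I b f \<in> ?T"
        using fI fin by (auto simp: twisted_tuples_def fcontents_def mdeg_content keys_content)
    next
      assume r: "fcontents A I b f \<in> ?T"
      show "\<forall>p. card {a \<in> A. (b a, f a) = p} = card {a \<in> A. (f a, \<sigma> (b a)) = p}"
      proof
        fix p :: "nat \<times> nat"
        obtain i j where p: "p = (i, j)" by (cases p)
        show "card {a \<in> A. (b a, f a) = p} = card {a \<in> A. (f a, \<sigma> (b a)) = p}"
        proof (cases "i \<in> I \<and> j \<in> I")
          case True
          obtain j' where j': "j = \<sigma> j'" using permutes_surj[OF \<sigma>] by (metis surjD)
          then have j'I: "j' \<in> I" using True permutes_in_image[OF \<sigma>] by auto
          have "{a \<in> A. (f a, \<sigma> (b a)) = (i, \<sigma> j')} = {a \<in> A. (b a, f a) = (j', i)}"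
            using permutes_inj[OF \<sigma>] by (auto dest: injD)
          moreover have "lookup (fcontents A I b f i) (\<sigma> j') = lookup (fcontents A I b f j') i"
            using r True j'I by (auto simp: twisted_tuples_def)
          ultimately show ?thesis using True j'I by (simp only: L p j')
        next
          case False
          then have "{a \<in> A. (b a, f a) = p} = {}" "{a \<in> A. (f a, \<sigma> (b a)) = p} = {}"
            using b fI permutes_in_image[OF \<sigma>] by (auto simp: p)
          then show ?thesis by (metis)
        qed
      qed
    qed
    have "card (?Y f) = (if \<forall>p. card {a \<in> A. (b a, f a) = p} = card {a \<in> A. (f a, \<sigma> (b a)) = p}
        then \<Prod>p\<in>I \<times> I. fact (card {a \<in> A. (f a, \<sigma> (b a)) = p}) else 0)"
      by (rule card_permutes_matching) (use fin b fI permutes_in_image[OF \<sigma>] in auto)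
    also have "\<dots> = (if \<forall>p. card {a \<in> A. (b a, f a) = p} = card {a \<in> A. (f a, \<sigma> (b a)) = p}
        then \<Prod>p\<in>I \<times> I. fact (card {a \<in> A. (b a, f a) = p}) else 0)"
      by (auto intro: prod.cong)
    also have "\<dots> = (if fcontents A I b f \<in> ?T then ?m f else 0)"
      unfolding iff using fI by (subst prod_fact_fcontents[OF fin(1,2,2)]) auto
    finally show ?thesis .
  qed
  have "?X = (\<Union>f\<in>?E. ?Y f)"
  proof (intro equalityI subsetI)
    fix x assume x: "x \<in> ?X"
    define f where "f = (\<lambda>a\<in>A. b (x a))"
    have "f \<in> ?E" using x b by (auto simp: f_def permutes_in_image)
    moreover have "x \<in> ?Y f" using x by (auto simp: f_def permutes_in_image)
    ultimately show "x \<in> (\<Union>f\<in>?E. ?Y f)" by blast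
  next
    fix x assume "x \<in> (\<Union>f\<in>?E. ?Y f)"
    then obtain f where f: "x permutes A" "\<And>a. a \<in> A \<Longrightarrow> b (x a) = f a" "\<And>a. a \<in> A \<Longrightarrow> f (x a) = \<sigma> (b a)" by auto
    have "b (x (x a)) = \<sigma> (b a)" if "a \<in> A" for a
      using f(2)[of "x a"] f(3)[OF that] that by (simp add: permutes_in_image[OF f(1)])
    then show "x \<in> ?X" using f by auto
  qed
  moreover have "?Y f \<inter> ?Y g = {}" if h: "f \<in> ?E" "g \<in> ?E" "f \<noteq> g" for f g
  proof -
    obtain a where "a \<in> A" "f a \<noteq> g a"
      using h by (metis (no_types, lifting) extensionalityI mem_Collect_eq)
    then show ?thesis by auto
  qed
  ultimately have "card ?X = (\<Sum>f\<in>?E. card (?Y f))"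
    using finE fin by (simp add: card_UN_disjoint finite_permutes_subset)
  also have "\<dots> = (\<Sum>f\<in>?E. if fcontents A I b f \<in> ?T then ?m f else 0)"
    by (rule sum.cong) (simp_all only: Y)
  also have "\<dots> = (\<Sum>f | f \<in> ?E \<and> fcontents A I b f \<in> ?T. ?m f)"
    using finE by (simp only: sum.inter_filter)
  also have "{f. f \<in> ?E \<and> fcontents A I b f \<in> ?T} = {f. f \<in> extensional A \<and> fcontents A I b f \<in> ?T}"
  proof -
    have "f a \<in> I" if "fcontents A I b f \<in> ?T" "a \<in> A" for f a
    proof -
      have "f a \<in> keys (fcontents A I b f (b a))"
        using that b fin by (auto simp: fcontents_def keys_content)
      then show ?thesis using that b[of a] by (auto simp: twisted_tuples_def)
    qed
    then show ?thesis by auto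
  qed
  also have "(\<Sum>f | f \<in> extensional A \<and> fcontents A I b f \<in> ?T. ?m f) =
      (\<Prod>i\<in>I. fact (card {a \<in> A. b a = i})) * card ?T"
  proof (rule sum_mfact_fcontents)
    show "finite ?T" by (rule finite_twisted_tuples[OF fin(2)])
  qed (use fin bI in \<open>auto simp: twisted_tuples_def\<close>)
  finally show ?thesis .
qed

text \<open>Exchange the sums. For a fixed colouring \<open>f\<close> the admissible
  \<open>w\<close> carry the labelling \<open>(\<sigma> b, f)\<close> to \<open>(b, f)\<close>. They
  exist exactly if the content of \<open>f\<close> on a fibre is constant along the cycles of
  \<sigma>, and then their number is the product of the factorials of the joint fibre sizes.\<close>

lemma sum_fixcols_fibre:
  fixes b :: "'a \<Rightarrow> 'i"
  assumes fin: "finite A" "finite I" and b: "\<And>a. a \<in> A \<Longrightarrow> b a \<in> I" and \<sigma>: "\<sigma> permutes I"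
  shows "(\<Sum>w | w permutes A \<and> (\<forall>a\<in>A. b (w a) = \<sigma> (b a)). card (fixcols A \<alpha> w)) =
    (\<Prod>i\<in>I. fact (card {a \<in> A. b a = i})) * card (invariant_tuples I \<sigma> (\<lambda>i. card {a \<in> A. b a = i}) \<alpha>)"
proof -
  let ?l = "\<lambda>(f :: 'a \<Rightarrow> nat) p. {a \<in> A. (b a, f a) = p}"
  let ?c = "fcontents A I b"
  let ?W = "{w. w permutes A \<and> (\<forall>a\<in>A. b (w a) = \<sigma> (b a))}"
  let ?s = "\<lambda>i. card {a \<in> A. b a = i}"
  let ?Y = "\<lambda>f. {w. w permutes A \<and> (\<forall>a\<in>A. (b (w a), f (w a)) = (\<sigma> (b a), f a))}"
  let ?T = "invariant_tuples I \<sigma> ?s \<alpha>"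
  let ?m = "\<lambda>f. \<Prod>i\<in>I. mfact (?c f i)"
  have bI: "b ` A \<subseteq> I" using b by auto
  have Y: "card (?Y f) = (if ?c f \<in> ?T then ?m f else 0)" if f: "f \<in> cols A \<alpha>" for f
  proof -
    have L: "lookup (?c f i) j = card {a \<in> A. (b a, f a) = (i, j)}" if "i \<in> I" for i j
      using that fin by (simp add: fcontents_def lookup_content conj_assoc)
    have sh: "{a \<in> A. (\<sigma> (b a), f a) = (\<sigma> i, j)} = {a \<in> A. (b a, f a) = (i, j)}" for i j
      using permutes_inj[OF \<sigma>] by (auto dest: injD)
    have iff: "(\<forall>p. card (?l f p) = card {a \<in> A. (\<sigma> (b a), f a) = p}) \<longleftrightarrow>
        ?c f \<in> ?T"
    proof
      assume l: "\<forall>p. card (?l f p) = card {a \<in> A. (\<sigma> (b a), f a) = p}"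
      have "?c f (\<sigma> i) = ?c f i" if "i \<in> I" for i
      proof (rule poly_mapping_eqI)
        fix j show "lookup (?c f (\<sigma> i)) j = lookup (?c f i) j"
          using l sh[of i j] that permutes_in_image[OF \<sigma>] by (simp only: L)
      qed
      moreover have "(\<Sum>i\<in>I. ?c f i) = \<alpha>"
        using f sum_content_fibres[OF fin bI, of f] by (simp add: fcontents_def cols_def)
      ultimately show "?c f \<in> ?T"
        using fin by (auto simp: invariant_tuples_def fcontents_def mdeg_content)
    next
      assume r: "?c f \<in> ?T"
      show "\<forall>p. card (?l f p) = card {a \<in> A. (\<sigma> (b a), f a) = p}"
      proof
        fix p :: "'i \<times> nat"
        obtain i j where p: "p = (i, j)" by (cases p)
        show "card (?l f p) = card {a \<in> A. (\<sigma> (b a), f a) = p}"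
        proof (cases "i \<in> I")
          case True
          obtain i' where i': "i = \<sigma> i'" using permutes_surj[OF \<sigma>] by (metis surjD)
          then have i'I: "i' \<in> I" using True permutes_in_image[OF \<sigma>] by auto
          have "?c f (\<sigma> i') = ?c f i'"
            using r i'I by (auto simp: invariant_tuples_def)
          then have "card {a \<in> A. (b a, f a) = (\<sigma> i', j)} = card {a \<in> A. (b a, f a) = (i', j)}"
            using L[of "\<sigma> i'" j] L[of i' j] True i' i'I by simp
          then show ?thesis by (simp only: p i' sh)
        next
          case False
          then have "(?l f p) = {}" "{a \<in> A. (\<sigma> (b a), f a) = p} = {}"
            using b permutes_in_image[OF \<sigma>] by (auto simp: p)
          then show ?thesis by (metis)
        qed
      qed
    qed
    let ?J = "f ` A"
    have finJ: "finite ?J" using fin by simp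
    have "card (?Y f) = (if \<forall>p. card (?l f p) = card {a \<in> A. (\<sigma> (b a), f a) = p}
        then \<Prod>p\<in>I \<times> ?J. fact (card {a \<in> A. (\<sigma> (b a), f a) = p}) else 0)"
      by (rule card_permutes_matching) (use fin b permutes_in_image[OF \<sigma>] in auto)
    also have "\<dots> = (if \<forall>p. card (?l f p) = card {a \<in> A. (\<sigma> (b a), f a) = p}
        then \<Prod>p\<in>I \<times> ?J. fact (card (?l f p)) else 0)"
      by (auto intro: prod.cong)
    also have "\<dots> = (if ?c f \<in> ?T then ?m f else 0)"
      unfolding iff by (subst prod_fact_fcontents[OF fin finJ]) auto
    finally show ?thesis .
  qed
  have "(\<Sum>w\<in>?W. card (fixcols A \<alpha> w)) = (\<Sum>w\<in>?W. \<Sum>f\<in>cols A \<alpha>. if \<forall>a\<in>A. f (w a) = f a then 1 else 0)"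
    by (rule sum.cong) (simp_all add: fixcols_def sum.If_cases finite_cols fin Int_def)
  also have "\<dots> = (\<Sum>f\<in>cols A \<alpha>. \<Sum>w\<in>?W. if \<forall>a\<in>A. f (w a) = f a then 1 else 0)"
    by (rule sum.swap)
  also have "\<dots> = (\<Sum>f\<in>cols A \<alpha>. card (?Y f))"
  proof (rule sum.cong)
    fix f
    have "{w \<in> ?W. \<forall>a\<in>A. f (w a) = f a} = ?Y f" by auto
    then show "(\<Sum>w\<in>?W. if \<forall>a\<in>A. f (w a) = f a then 1 else 0) = card (?Y f)"
      using finite_permutes_subset[OF fin(1)] by (simp add: sum.If_cases Int_def)
  qed simp
  also have "\<dots> = (\<Sum>f\<in>cols A \<alpha>. if ?c f \<in> ?T then ?m f else 0)"
    by (rule sum.cong) (simp_all only: Y)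
  also have "\<dots> = (\<Sum>f | f \<in> cols A \<alpha> \<and> ?c f \<in> ?T. ?m f)"
    using finite_cols[OF fin(1)] by (simp only: sum.inter_filter)
  also have "{f. f \<in> cols A \<alpha> \<and> ?c f \<in> ?T} = {f. f \<in> extensional A \<and> ?c f \<in> ?T}"
  proof -
    have "content A f = \<alpha>" if "?c f \<in> ?T" for f
    proof -
      have "(\<Sum>i\<in>I. ?c f i) = \<alpha>" using that by (auto simp: invariant_tuples_def)
      then show ?thesis using sum_content_fibres[OF fin bI, of f] by (simp add: fcontents_def)
    qed
    then show ?thesis by (auto simp: cols_def)
  qed
  also have "(\<Sum>f | f \<in> extensional A \<and> ?c f \<in> ?T. ?m f) =
      (\<Prod>i\<in>I. fact (card {a \<in> A. b a = i})) * card ?T"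
  proof (rule sum_mfact_fcontents)
    show "finite ?T" by (rule finite_invariant_tuples[OF fin(2)])
  qed (use fin bI in \<open>auto simp: invariant_tuples_def\<close>)
  finally show ?thesis .
qed

section \<open>Shapes and horizontal strips\<close>

text \<open>Partitions with infinitely many trailing zeros, so that shapes with different numbers of
  rows are compared without padding.\<close>

definition is_shape :: "(nat \<Rightarrow> nat) \<Rightarrow> bool" where
  "is_shape u \<longleftrightarrow> (\<forall>i. u (Suc i) \<le> u i) \<and> (\<exists>L. \<forall>i\<ge>L. u i = 0)"

definition ssize :: "(nat \<Rightarrow> nat) \<Rightarrow> nat" where
  "ssize u = (\<Sum>i | u i \<noteq> 0. u i)"

text \<open>Interlacing: \<open>u\<close> arises from \<open>v\<close> by adding cells no two of
  which lie in one column.\<close>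

definition hstrip :: "(nat \<Rightarrow> nat) \<Rightarrow> (nat \<Rightarrow> nat) \<Rightarrow> bool" where
  "hstrip v u \<longleftrightarrow> (\<forall>i. v i \<le> u i \<and> u (Suc i) \<le> v i)"

definition shapes :: "nat \<Rightarrow> (nat \<Rightarrow> nat) set" where
  "shapes n = {u. is_shape u \<and> ssize u = n}"

definition lower :: "nat \<Rightarrow> (nat \<Rightarrow> nat) \<Rightarrow> (nat \<Rightarrow> nat) set" where
  "lower r u = {v. is_shape v \<and> is_shape u \<and> hstrip v u \<and> ssize v + r = ssize u}"

definition upper :: "nat \<Rightarrow> (nat \<Rightarrow> nat) \<Rightarrow> (nat \<Rightarrow> nat) set" where
  "upper r v = {u. v \<in> lower r u}"

lemma ssize_eq:
  assumes "\<And>i. i \<ge> L \<Longrightarrow> u i = 0" shows "ssize u = (\<Sum>i<L. u i)"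
proof -
  have "i < L" if "u i \<noteq> 0" for i using assms[of i] that by (cases "i < L") auto
  then show ?thesis unfolding ssize_def by (intro sum.mono_neutral_left) auto
qed

lemma is_shape_antimono: "is_shape u \<Longrightarrow> i \<le> j \<Longrightarrow> u j \<le> u i"
  unfolding is_shape_def by (metis lift_Suc_antimono_le)

lemma shape_support:
  assumes "is_shape u" shows "i \<ge> ssize u \<Longrightarrow> u i = 0"
proof (rule ccontr)
  assume i: "i \<ge> ssize u" "u i \<noteq> 0"
  obtain L where L: "\<And>i. i \<ge> L \<Longrightarrow> u i = 0" using assms by (auto simp: is_shape_def)
  have iL: "i < L" using L[of i] i(2) by (cases "i < L") auto
  have "Suc i = (\<Sum>j<Suc i. 1)" by simp
  also have "\<dots> \<le> (\<Sum>j<Suc i. u j)"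
  proof (rule sum_mono)
    fix j assume "j \<in> {..<Suc i}"
    then have "u i \<le> u j" using is_shape_antimono[OF assms, of j i] by simp
    then show "1 \<le> u j" using i(2) by linarith
  qed
  also have "\<dots> \<le> (\<Sum>j<L. u j)" by (rule sum_mono2) (use iL in auto)
  also have "\<dots> = ssize u" using ssize_eq[of L u] L by simp
  finally show False using i(1) by simp
qed

lemma shape_le_ssize: assumes "is_shape u" shows "u i \<le> ssize u"
proof (cases "i < ssize u")
  case True
  have "u i \<le> (\<Sum>j<ssize u. u j)" by (rule member_le_sum) (use True in auto)
  then show ?thesis using ssize_eq[of "ssize u" u] shape_support[OF assms] by simp
qed (use shape_support[OF assms] in simp)

lemma finite_bounded_functions:
  "finite {f :: nat \<Rightarrow> nat. \<forall>i. f i \<le> N \<and> (i \<ge> L \<longrightarrow> f i = 0)}"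
proof (rule finite_subset)
  show "{f :: nat \<Rightarrow> nat. \<forall>i. f i \<le> N \<and> (i \<ge> L \<longrightarrow> f i = 0)}
      \<subseteq> (\<lambda>g i. if i < L then g i else 0) ` ({..<L} \<rightarrow>\<^sub>E {..N})"
  proof
    fix f :: "nat \<Rightarrow> nat" assume f: "f \<in> {f. \<forall>i. f i \<le> N \<and> (i \<ge> L \<longrightarrow> f i = 0)}"
    have "f = (\<lambda>i. if i < L then restrict f {..<L} i else 0)" using f by (auto simp: fun_eq_iff)
    moreover have "restrict f {..<L} \<in> {..<L} \<rightarrow>\<^sub>E {..N}" using f by auto
    ultimately show "f \<in> (\<lambda>g i. if i < L then g i else 0) ` ({..<L} \<rightarrow>\<^sub>E {..N})" by blast
  qed
qed (auto intro: finite_PiE)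

lemma finite_shapes: "finite (shapes n)"
  by (rule finite_subset[OF _ finite_bounded_functions[of n n]])
     (auto simp: shapes_def shape_support intro: shape_le_ssize)

lemma lower_subset: "lower r u \<subseteq> shapes (ssize u - r)"
  by (auto simp: lower_def shapes_def)

lemma upper_subset: "upper r v \<subseteq> shapes (ssize v + r)"
  by (auto simp: lower_def upper_def shapes_def)

lemma finite_lower: "finite (lower r u)"
  by (rule finite_subset[OF lower_subset finite_shapes])

lemma finite_upper: "finite (upper r u)"
  by (rule finite_subset[OF upper_subset finite_shapes])

text \<open>If \<open>F\<close> stands for the sum of the \<open>F u\<close> times
  \<open>s\<^sub>u\<close>, adding strips is multiplication by \<open>h\<^sub>r\<close> according to
  the Pieri rule, and \<open>remove_strip\<close> is the adjoint operator.\<close>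

definition add_strip :: "nat \<Rightarrow> ((nat \<Rightarrow> nat) \<Rightarrow> nat) \<Rightarrow> (nat \<Rightarrow> nat) \<Rightarrow> nat" where
  "add_strip r F u = (\<Sum>v\<in>lower r u. F v)"

definition remove_strip :: "nat \<Rightarrow> ((nat \<Rightarrow> nat) \<Rightarrow> nat) \<Rightarrow> (nat \<Rightarrow> nat) \<Rightarrow> nat" where
  "remove_strip r F v = (\<Sum>u\<in>upper r v. F u)"

text \<open>In both reflections below the intermediate shapes form a product of intervals, and reversing
  every interval exchanges the two strip sizes.\<close>

lemma card_two_strips_swap_le:
  "card {\<nu> \<in> lower r u. v \<in> lower s \<nu>} \<le> card {\<nu> \<in> lower s u. v \<in> lower r \<nu>}"
proof (cases "is_shape v \<and> is_shape u")
  case False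
  then have "{\<nu> \<in> lower r u. v \<in> lower s \<nu>} = {}" by (auto simp: lower_def)
  then show ?thesis by (metis card.empty le0)
next
  case True
  define lo where "lo i = max (v i) (u (Suc i))" for i
  define hi where "hi i = (case i of 0 \<Rightarrow> u 0 | Suc j \<Rightarrow> min (u (Suc j)) (v j))" for i
  define R where "R \<nu> = (\<lambda>i. lo i + hi i - \<nu> i)" for \<nu> :: "nat \<Rightarrow> nat"
  obtain L where L: "\<And>i. i \<ge> L \<Longrightarrow> u i = 0" using True by (auto simp: is_shape_def)
  have iff: "hstrip v \<nu> \<and> hstrip \<nu> u \<longleftrightarrow> (\<forall>i. lo i \<le> \<nu> i \<and> \<nu> i \<le> hi i)" for \<nu>
  proof -
    have "(\<forall>i. \<nu> i \<le> hi i) \<longleftrightarrow> (\<forall>i. \<nu> i \<le> u i) \<and> (\<forall>i. \<nu> (Suc i) \<le> v i)"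
    proof (intro iffI conjI allI)
      fix i assume l: "\<forall>i. \<nu> i \<le> hi i"
      show "\<nu> i \<le> u i" using l[rule_format, of i] by (cases i) (auto simp: hi_def)
      show "\<nu> (Suc i) \<le> v i" using l[rule_format, of "Suc i"] by (auto simp: hi_def)
    next
      fix i assume "(\<forall>i. \<nu> i \<le> u i) \<and> (\<forall>i. \<nu> (Suc i) \<le> v i)"
      then show "\<nu> i \<le> hi i" by (cases i) (auto simp: hi_def)
    qed
    then show ?thesis by (auto simp: hstrip_def lo_def)
  qed
  \<comment> \<open>Maximum and minimum of the same two numbers. Summed over the rows this shows
    that all interval ends add up to the sizes of \<open>u\<close> and \<open>v\<close>, hence that
    the reflection exchanges the two strip sizes.\<close>
  have lohi: "lo i + hi (Suc i) = v i + u (Suc i)" for i by (simp add: lo_def hi_def)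
  { fix \<nu> assume \<nu>: "\<nu> \<in> lower r u" "v \<in> lower s \<nu>"
    have b: "lo i \<le> \<nu> i" "\<nu> i \<le> hi i" for i
      using \<nu> iff[of \<nu>] by (auto simp: lower_def)
    have b': "lo i \<le> R \<nu> i" "R \<nu> i \<le> hi i" for i
      using b[of i] by (auto simp: R_def)
    have h: "hstrip v (R \<nu>)" "hstrip (R \<nu>) u" using b' iff[of "R \<nu>"] by auto
    have v0: "v i = 0" and \<nu>0: "\<nu> i = 0" and R0: "R \<nu> i = 0" if "i \<ge> L" for i
      using b b' h L[OF that] \<nu> by (auto simp: lower_def hstrip_def) (metis le_zero_eq)+
    have sh: "is_shape (R \<nu>)" unfolding is_shape_def
    proof (intro conjI allI exI impI)
      fix i show "R \<nu> (Suc i) \<le> R \<nu> i" using h by (meson hstrip_def order_trans)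
    qed (rule R0)
    have "ssize \<nu> + ssize (R \<nu>) = (\<Sum>i<Suc L. \<nu> i + R \<nu> i)"
      using ssize_eq[of "Suc L" \<nu>] ssize_eq[of "Suc L" "R \<nu>"] \<nu>0 R0 by (simp add: sum.distrib)
    also have "\<dots> = (\<Sum>i<Suc L. lo i + hi i)"
    proof (rule sum.cong)
      fix i show "\<nu> i + R \<nu> i = lo i + hi i" using b(2)[of i] by (simp add: R_def)
    qed simp
    also have "\<dots> = (\<Sum>i<Suc L. lo i) + (\<Sum>i<Suc L. hi i)" by (rule sum.distrib)
    also have "\<dots> = (\<Sum>i<L. lo i) + lo L + (hi 0 + (\<Sum>i<L. hi (Suc i)))"
      unfolding sum.lessThan_Suc_shift[of hi] by simp
    also have "\<dots> = (\<Sum>i<L. lo i + hi (Suc i)) + u 0"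
      using v0[of L] L[of "Suc L"] by (simp add: lo_def hi_def sum.distrib)
    also have "\<dots> = (\<Sum>i<L. v i) + (\<Sum>i<Suc L. u i)"
      by (simp add: lohi sum.distrib sum.lessThan_Suc_shift del: sum.lessThan_Suc)
    also have "\<dots> = ssize v + ssize u"
      using ssize_eq[of L v] ssize_eq[of "Suc L" u] v0 L by simp
    finally have "ssize \<nu> + ssize (R \<nu>) = ssize v + ssize u" .
    then have "R \<nu> \<in> {\<nu> \<in> lower s u. v \<in> lower r \<nu>}"
      using \<nu> h sh by (auto simp: lower_def)
    moreover have "R (R \<nu>) = \<nu>" using b by (auto simp: R_def fun_eq_iff trans_le_add2)
    ultimately have "R \<nu> \<in> {\<nu> \<in> lower s u. v \<in> lower r \<nu>} \<and> R (R \<nu>) = \<nu>" by blast }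
  note * = this
  show ?thesis
  proof (rule card_inj_on_le[of R])
    show "inj_on R {\<nu> \<in> lower r u. v \<in> lower s \<nu>}"
      by (rule inj_on_inverseI[of _ R]) (use * in auto)
    show "R ` {\<nu> \<in> lower r u. v \<in> lower s \<nu>} \<subseteq> {\<nu> \<in> lower s u. v \<in> lower r \<nu>}"
      using * by blast
  qed (simp add: finite_lower)
qed

lemma card_two_strips_swap:
  "card {\<nu> \<in> lower r u. v \<in> lower s \<nu>} = card {\<nu> \<in> lower s u. v \<in> lower r \<nu>}"
  by (intro antisym card_two_strips_swap_le)

text \<open>The commutation relation between \<open>h\<^sub>r\<close> and the adjoint of
  \<open>h\<^sub>s\<close>, entry by entry. Row \<open>i + 1\<close> of a common successor is
  reflected to row \<open>i\<close> of a common predecessor. The first row of the successor has no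
  upper bound; its excess over \<open>u 0\<close> and \<open>\<mu> 0\<close> is the summation index
  \<open>k\<close>.\<close>

lemma card_common_upper:
  "card {\<nu> \<in> upper s \<mu>. u \<in> lower r \<nu>} = (\<Sum>k\<le>min r s. card {v \<in> lower (r - k) \<mu>. u \<in> upper (s - k) v})"
proof (cases "is_shape \<mu> \<and> is_shape u \<and> ssize u + r = ssize \<mu> + s")
  case False
  then have e1: "{\<nu> \<in> upper s \<mu>. u \<in> lower r \<nu>} = {}" by (auto simp: lower_def upper_def)
  have e2: "{v \<in> lower (r - k) \<mu>. u \<in> upper (s - k) v} = {}" if "k \<in> {..min r s}" for k
    using False that by (auto simp: lower_def upper_def)
  have "(\<Sum>k\<le>min r s. card {v \<in> lower (r - k) \<mu>. u \<in> upper (s - k) v}) = 0"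
    by (intro sum.neutral ballI) (simp only: e2 card.empty)
  then show ?thesis unfolding e1 by simp
next
  case True
  define lo where "lo i = max (u (Suc i)) (\<mu> (Suc i))" for i
  define hi where "hi i = min (u i) (\<mu> i)" for i
  define U where "U = {\<nu>. is_shape \<nu> \<and> hstrip u \<nu> \<and> hstrip \<mu> \<nu> \<and> ssize \<nu> = ssize \<mu> + s}"
  define T where "T = {v. is_shape v \<and> hstrip v u \<and> hstrip v \<mu> \<and> ssize u \<le> ssize v + s}"
  obtain L1 L2 where "\<And>i. i \<ge> L1 \<Longrightarrow> u i = 0" "\<And>i. i \<ge> L2 \<Longrightarrow> \<mu> i = 0" using True by (auto simp: is_shape_def)
  then obtain L where L: "\<And>i. i \<ge> L \<Longrightarrow> u i = 0 \<and> \<mu> i = 0" by (metis (no_types) le_cases order_trans)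
  have iffT: "hstrip v u \<and> hstrip v \<mu> \<longleftrightarrow> (\<forall>i. lo i \<le> v i \<and> v i \<le> hi i)" for v
    by (auto simp: hstrip_def lo_def hi_def)
  have iffU: "hstrip u \<nu> \<and> hstrip \<mu> \<nu> \<longleftrightarrow> max (u 0) (\<mu> 0) \<le> \<nu> 0 \<and> (\<forall>i. lo i \<le> \<nu> (Suc i) \<and> \<nu> (Suc i) \<le> hi i)" for \<nu>
  proof -
    have "(\<forall>i. u i \<le> \<nu> i \<and> \<mu> i \<le> \<nu> i) \<longleftrightarrow> u 0 \<le> \<nu> 0 \<and> \<mu> 0 \<le> \<nu> 0 \<and> (\<forall>i. u (Suc i) \<le> \<nu> (Suc i) \<and> \<mu> (Suc i) \<le> \<nu> (Suc i))"
      by (metis not0_implies_Suc)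
    then show ?thesis by (auto simp: hstrip_def lo_def hi_def)
  qed
  have tot: "max (u 0) (\<mu> 0) + (\<Sum>i<L. lo i + hi i) = ssize u + ssize \<mu>"
  proof -
    have "hi L = 0" using L by (simp add: hi_def)
    then have "(\<Sum>i<L. hi i) = (\<Sum>i<Suc L. hi i)" by simp
    also have "\<dots> = hi 0 + (\<Sum>i<L. hi (Suc i))" by (rule sum.lessThan_Suc_shift)
    finally have "max (u 0) (\<mu> 0) + (\<Sum>i<L. lo i + hi i) = max (u 0) (\<mu> 0) + hi 0 + (\<Sum>i<L. lo i + hi (Suc i))"
      by (simp add: sum.distrib)
    also have "\<dots> = u 0 + \<mu> 0 + (\<Sum>i<L. u (Suc i) + \<mu> (Suc i))"
    proof -
      have "max (u 0) (\<mu> 0) + hi 0 = u 0 + \<mu> 0" "lo i + hi (Suc i) = u (Suc i) + \<mu> (Suc i)" for i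
        by (simp_all add: lo_def hi_def)
      then show ?thesis by (simp only:)
    qed
    also have "\<dots> = (\<Sum>i<Suc L. u i) + (\<Sum>i<Suc L. \<mu> i)"
      by (simp add: sum.distrib sum.lessThan_Suc_shift del: sum.lessThan_Suc)
    also have "\<dots> = ssize u + ssize \<mu>"
      using ssize_eq[of "Suc L" u] ssize_eq[of "Suc L" \<mu>] L by simp
    finally show ?thesis .
  qed
  define F where "F v = (\<lambda>i. case i of 0 \<Rightarrow> max (u 0) (\<mu> 0) + (ssize v + s - ssize u) | Suc j \<Rightarrow> lo j + hi j - v j)"
    for v :: "nat \<Rightarrow> nat"
  define G where "G \<nu> = (\<lambda>i. lo i + hi i - \<nu> (Suc i))" for \<nu> :: "nat \<Rightarrow> nat"
  have GT: "G \<nu> \<in> T" and FG: "F (G \<nu>) = \<nu>" if \<nu>: "\<nu> \<in> U" for \<nu>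
  proof -
    have b: "lo i \<le> \<nu> (Suc i)" "\<nu> (Suc i) \<le> hi i" and b0: "max (u 0) (\<mu> 0) \<le> \<nu> 0" for i
      using \<nu> iffU[of \<nu>] by (auto simp: U_def)
    have b': "lo i \<le> G \<nu> i" "G \<nu> i \<le> hi i" for i
      using b[of i] by (auto simp: G_def)
    have h: "hstrip (G \<nu>) u" "hstrip (G \<nu>) \<mu>" using b' iffT[of "G \<nu>"] by auto
    have G0: "G \<nu> i = 0" and \<nu>0: "\<nu> (Suc i) = 0" if "i \<ge> L" for i
      using b[of i] b'[of i] L[OF that] by (auto simp: hi_def)
    have sh: "is_shape (G \<nu>)" unfolding is_shape_def
    proof (intro conjI allI exI impI)
      fix i show "G \<nu> (Suc i) \<le> G \<nu> i" using h by (meson hstrip_def order_trans)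
    qed (rule G0)
    have "ssize \<nu> = (\<Sum>i<Suc L. \<nu> i)"
    proof (rule ssize_eq)
      fix i assume "i \<ge> Suc L" then show "\<nu> i = 0" using \<nu>0[of "i - 1"] by (cases i) auto
    qed
    then have "ssize \<nu> + ssize (G \<nu>) = \<nu> 0 + (\<Sum>i<L. \<nu> (Suc i) + G \<nu> i)"
      using ssize_eq[of L "G \<nu>"] G0 by (simp add: sum.distrib sum.lessThan_Suc_shift del: sum.lessThan_Suc)
    also have "(\<Sum>i<L. \<nu> (Suc i) + G \<nu> i) = (\<Sum>i<L. lo i + hi i)"
      using b(2) by (simp add: G_def trans_le_add2)
    finally have sz: "ssize \<nu> + ssize (G \<nu>) + max (u 0) (\<mu> 0) = \<nu> 0 + (ssize u + ssize \<mu>)"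
      using tot by simp
    then have sz': "ssize (G \<nu>) + s + max (u 0) (\<mu> 0) = \<nu> 0 + ssize u" using \<nu> by (simp add: U_def)
    then show "G \<nu> \<in> T" using sh h b0 by (auto simp: T_def)
    show "F (G \<nu>) = \<nu>"
    proof
      fix i show "F (G \<nu>) i = \<nu> i"
      proof (cases i)
        case 0
        obtain d where d: "\<nu> 0 = max (u 0) (\<mu> 0) + d" using b0 le_Suc_ex by blast
        then have "ssize (G \<nu>) + s = d + ssize u" using sz' by linarith
        then show ?thesis using 0 d by (simp add: F_def)
      next
        case (Suc j) then show ?thesis using b[of j] by (simp add: F_def G_def trans_le_add2)
      qed
    qed
  qed
  have FU: "F v \<in> U" and GF: "G (F v) = v" if v: "v \<in> T" for v
  proof -
    have b: "lo i \<le> v i" "v i \<le> hi i" for i using v iffT[of v] by (auto simp: T_def)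
    have b': "lo i \<le> F v (Suc i)" "F v (Suc i) \<le> hi i" for i
      using b[of i] by (auto simp: F_def)
    have h: "hstrip u (F v)" "hstrip \<mu> (F v)" using b' iffU[of "F v"] by (auto simp: F_def)
    have v0: "v i = 0" and F0: "F v (Suc i) = 0" if "i \<ge> L" for i
      using b[of i] b'[of i] L[OF that] by (auto simp: hi_def)
    have F0': "F v i = 0" if "i \<ge> Suc L" for i using F0[of "i - 1"] that by (cases i) auto
    have sh: "is_shape (F v)" unfolding is_shape_def
    proof (intro conjI allI exI impI)
      fix i show "F v (Suc i) \<le> F v i" using h by (meson hstrip_def order_trans)
    qed (rule F0')
    have "ssize (F v) = (\<Sum>i<Suc L. F v i)" by (rule ssize_eq) (rule F0')
    then have "ssize (F v) + ssize v = F v 0 + (\<Sum>i<L. F v (Suc i) + v i)"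
      using ssize_eq[of L v] v0 by (simp add: sum.distrib sum.lessThan_Suc_shift del: sum.lessThan_Suc)
    also have "(\<Sum>i<L. F v (Suc i) + v i) = (\<Sum>i<L. lo i + hi i)"
      using b(2) by (simp add: F_def trans_le_add2)
    finally have "ssize (F v) + ssize v + max (u 0) (\<mu> 0) = F v 0 + (ssize u + ssize \<mu>)"
      using tot by simp
    moreover have "F v 0 = max (u 0) (\<mu> 0) + (ssize v + s - ssize u)" by (simp add: F_def)
    ultimately have "ssize (F v) = ssize \<mu> + s" using v by (simp add: T_def)
    then show "F v \<in> U" using sh h by (simp add: U_def)
    show "G (F v) = v" using b by (auto simp: F_def G_def fun_eq_iff trans_le_add2)
  qed
  have "bij_betw G U T" by (rule bij_betwI[of _ _ _ F]) (use GT FG FU GF in auto)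
  then have "card U = card T" by (rule bij_betw_same_card)
  moreover have "{\<nu> \<in> upper s \<mu>. u \<in> lower r \<nu>} = U"
    using True by (auto simp: U_def lower_def upper_def)
  moreover have "T = (\<Union>k\<le>min r s. {v \<in> lower (r - k) \<mu>. u \<in> upper (s - k) v})"
  proof (intro equalityI subsetI)
    fix v assume v: "v \<in> T"
    have le: "ssize v \<le> ssize u" "ssize v \<le> ssize \<mu>"
    proof -
      have *: "hstrip v u" "hstrip v \<mu>" using v by (auto simp: T_def)
      have v0: "v i = 0" if "i \<ge> L" for i using L[OF that] * by (metis hstrip_def le_zero_eq)
      show "ssize v \<le> ssize u" "ssize v \<le> ssize \<mu>"
        using ssize_eq[of L v] ssize_eq[of L u] ssize_eq[of L \<mu>] v0 L * by (auto simp: hstrip_def intro!: sum_mono)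
    qed
    let ?k = "ssize v + s - ssize u"
    have "?k \<le> min r s" "ssize v + (r - ?k) = ssize \<mu>" "ssize u = ssize v + (s - ?k)"
      using le v True by (auto simp: T_def)
    then have "v \<in> {v \<in> lower (r - ?k) \<mu>. u \<in> upper (s - ?k) v}"
      using v True by (auto simp: T_def lower_def upper_def)
    then show "v \<in> (\<Union>k\<le>min r s. {v \<in> lower (r - k) \<mu>. u \<in> upper (s - k) v})"
      using \<open>?k \<le> min r s\<close> by blast
  qed (use True in \<open>auto simp: T_def lower_def upper_def\<close>)
  moreover have "card (\<Union>k\<le>min r s. {v \<in> lower (r - k) \<mu>. u \<in> upper (s - k) v}) =
      (\<Sum>k\<le>min r s. card {v \<in> lower (r - k) \<mu>. u \<in> upper (s - k) v})"
  proof (rule card_UN_disjoint)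
    show "\<forall>i\<in>{..min r s}. \<forall>j\<in>{..min r s}. i \<noteq> j \<longrightarrow>
       {v \<in> lower (r - i) \<mu>. u \<in> upper (s - i) v} \<inter> {v \<in> lower (r - j) \<mu>. u \<in> upper (s - j) v} = {}"
      by (auto simp: lower_def upper_def)
  qed (auto simp: finite_lower)
  ultimately show ?thesis by simp
qed

lemma sum_over_card:
  fixes F :: "'a \<Rightarrow> nat"
  assumes "finite S" "\<And>x. x \<in> S \<Longrightarrow> finite (B x)" "finite C" "\<And>x. x \<in> S \<Longrightarrow> B x \<subseteq> C"
  shows "(\<Sum>x\<in>S. \<Sum>y\<in>B x. F y) = (\<Sum>y\<in>C. F y * card {x \<in> S. y \<in> B x})"
proof -
  have "(\<Sum>x\<in>S. \<Sum>y\<in>B x. F y) = (\<Sum>x\<in>S. \<Sum>y\<in>C. if y \<in> B x then F y else 0)"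
  proof (rule sum.cong)
    fix x assume "x \<in> S"
    then have "C \<inter> B x = B x" using assms by blast
    then show "(\<Sum>y\<in>B x. F y) = (\<Sum>y\<in>C. if y \<in> B x then F y else 0)"
      using assms by (simp add: sum.If_cases)
  qed simp
  also have "\<dots> = (\<Sum>y\<in>C. \<Sum>x\<in>S. if y \<in> B x then F y else 0)" by (rule sum.swap)
  also have "\<dots> = (\<Sum>y\<in>C. F y * card {x \<in> S. y \<in> B x})"
    using assms by (intro sum.cong) (simp_all add: sum.If_cases Int_def)
  finally show ?thesis .
qed

text \<open>This is what makes Kostka numbers independent of the order of the exponents.\<close>

lemma add_strip_commute: "add_strip r (add_strip s F) = add_strip s (add_strip r F)"
proof
  fix u
  have *: "add_strip r (add_strip s F) u = (\<Sum>v\<in>\<Union>(shapes ` {..ssize u}). F v * card {\<nu> \<in> lower r u. v \<in> lower s \<nu>})" for r s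
    unfolding add_strip_def
    by (rule sum_over_card) (auto simp: finite_lower finite_shapes, auto simp: lower_def shapes_def)
  show "add_strip r (add_strip s F) u = add_strip s (add_strip r F) u"
    unfolding * card_two_strips_swap[of r] ..
qed

lemma remove_add_strip:
  "remove_strip s (add_strip r F) \<mu> = (\<Sum>k\<le>min r s. add_strip (r - k) (remove_strip (s - k) F) \<mu>)"
proof -
  let ?C = "\<Union>(shapes ` {..ssize \<mu> + s})"
  have finC: "finite ?C" by (auto simp: finite_shapes)
  have "remove_strip s (add_strip r F) \<mu> = (\<Sum>u\<in>?C. F u * card {\<nu> \<in> upper s \<mu>. u \<in> lower r \<nu>})"
    unfolding remove_strip_def add_strip_def using finC
    by (intro sum_over_card) (auto simp: finite_lower finite_upper, auto simp: lower_def upper_def shapes_def)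
  also have "\<dots> = (\<Sum>u\<in>?C. \<Sum>k\<le>min r s. F u * card {v \<in> lower (r - k) \<mu>. u \<in> upper (s - k) v})"
    by (simp add: card_common_upper sum_distrib_left)
  also have "\<dots> = (\<Sum>k\<le>min r s. \<Sum>u\<in>?C. F u * card {v \<in> lower (r - k) \<mu>. u \<in> upper (s - k) v})"
    by (rule sum.swap)
  also have "\<dots> = (\<Sum>k\<le>min r s. add_strip (r - k) (remove_strip (s - k) F) \<mu>)"
  proof (rule sum.cong)
    fix k assume "k \<in> {..min r s}"
    then show "(\<Sum>u\<in>?C. F u * card {v \<in> lower (r - k) \<mu>. u \<in> upper (s - k) v}) =
        add_strip (r - k) (remove_strip (s - k) F) \<mu>"
      unfolding remove_strip_def add_strip_def using finC
      by (intro sum_over_card[symmetric]) (auto simp: finite_lower finite_upper, auto simp: lower_def upper_def shapes_def)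
  qed simp
  finally show ?thesis .
qed

text \<open>Adjointness of the two operators for the pairing in which the shapes are
  orthonormal.\<close>

lemma sum_add_strip:
  "(\<Sum>\<nu>\<in>shapes (n + r). add_strip r F \<nu> * H \<nu>) = (\<Sum>v\<in>shapes n. F v * remove_strip r H v)"
proof -
  have "(\<Sum>\<nu>\<in>shapes (n + r). add_strip r F \<nu> * H \<nu>) =
      (\<Sum>\<nu>\<in>shapes (n + r). \<Sum>v\<in>shapes n. if v \<in> lower r \<nu> then F v * H \<nu> else 0)"
  proof (rule sum.cong)
    fix \<nu> assume "\<nu> \<in> shapes (n + r)"
    then have "shapes n \<inter> lower r \<nu> = lower r \<nu>" by (auto simp: shapes_def lower_def)
    then show "add_strip r F \<nu> * H \<nu> = (\<Sum>v\<in>shapes n. if v \<in> lower r \<nu> then F v * H \<nu> else 0)"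
      by (simp add: sum.If_cases finite_shapes add_strip_def sum_distrib_right)
  qed simp
  also have "\<dots> = (\<Sum>v\<in>shapes n. \<Sum>\<nu>\<in>shapes (n + r). if v \<in> lower r \<nu> then F v * H \<nu> else 0)"
    by (rule sum.swap)
  also have "\<dots> = (\<Sum>v\<in>shapes n. F v * remove_strip r H v)"
  proof (rule sum.cong)
    fix v assume "v \<in> shapes n"
    then have "shapes (n + r) \<inter> {\<nu>. v \<in> lower r \<nu>} = upper r v" by (auto simp: shapes_def lower_def upper_def)
    then show "(\<Sum>\<nu>\<in>shapes (n + r). if v \<in> lower r \<nu> then F v * H \<nu> else 0) = F v * remove_strip r H v"
      by (simp add: sum.If_cases finite_shapes remove_strip_def sum_distrib_left)
  qed simp
  finally show ?thesis .
qed

section \<open>Kostka numbers\<close>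

definition empty_shape :: "(nat \<Rightarrow> nat) \<Rightarrow> nat" where
  "empty_shape u = (if \<forall>i. u i = 0 then 1 else 0)"

definition strips :: "nat \<Rightarrow> (nat \<Rightarrow> nat) \<Rightarrow> (nat \<Rightarrow> nat) \<Rightarrow> nat" where
  "strips k s = fold add_strip (map s [0..<k]) empty_shape"

text \<open>The Kostka number, as a number of chains of shapes whose successive differences are
  horizontal strips of the prescribed sizes.\<close>

definition kostka :: "monomial \<Rightarrow> (nat \<Rightarrow> nat) \<Rightarrow> nat" where
  "kostka \<alpha> = strips (Poly_Mapping.degree \<alpha>) (lookup \<alpha>)"

lemma strips_0: "strips 0 s = empty_shape" by (simp add: strips_def)

lemma strips_Suc: "strips (Suc k) s = add_strip (s k) (strips k s)"
  by (simp add: strips_def)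

lemma strips_cong: "(\<And>i. i < k \<Longrightarrow> s i = t i) \<Longrightarrow> strips k s = strips k t"
  by (induction k) (simp_all add: strips_0 strips_Suc)

lemma ssize_zero: "ssize (\<lambda>i. 0) = 0" by (simp add: ssize_def)

lemma is_shape_zero: "is_shape (\<lambda>i. 0)" by (simp add: is_shape_def)

text \<open>The vanishing from row \<open>k\<close> on holds because a horizontal strip opens at
  most one new row.\<close>

lemma strips_nonzero:
  "strips k s u \<noteq> 0 \<Longrightarrow> is_shape u \<and> ssize u = (\<Sum>i<k. s i) \<and> (\<forall>i\<ge>k. u i = 0)"
proof (induction k arbitrary: u)
  case 0
  then have "u = (\<lambda>i. 0)" by (auto simp: strips_0 empty_shape_def split: if_splits)
  then show ?case by (simp add: ssize_zero is_shape_zero)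
next
  case (Suc k)
  then have "(\<Sum>v\<in>lower (s k) u. strips k s v) \<noteq> 0" by (simp add: strips_Suc add_strip_def)
  then obtain v where v: "v \<in> lower (s k) u" "strips k s v \<noteq> 0" by (metis sum.neutral)
  have "u i = 0" if "i \<ge> Suc k" for i
    using Suc.IH[OF v(2)] v(1) that by (cases i) (auto simp: lower_def hstrip_def, metis le_zero_eq)
  then show ?case using Suc.IH[OF v(2)] v(1) by (auto simp: lower_def)
qed

lemma lower_0: "is_shape u \<Longrightarrow> lower 0 u = {u}"
proof (intro equalityI subsetI)
  fix v assume sh: "is_shape u" and "v \<in> lower 0 u"
  then have v: "is_shape v" "hstrip v u" "ssize v = ssize u" by (auto simp: lower_def)
  have le: "v i \<le> u i" for i using v(2) by (simp add: hstrip_def)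
  have z: "u i = 0" "v i = 0" if "i \<ge> ssize u" for i
    using shape_support[OF sh that] le[of i] by auto
  have "v i = u i" if "i < ssize u" for i
  proof (rule ccontr)
    assume "v i \<noteq> u i"
    then have "(\<Sum>i<ssize u. v i) < (\<Sum>i<ssize u. u i)"
      using le that by (intro sum_strict_mono_ex1) (auto intro!: bexI[of _ i] simp: le_neq_implies_less)
    then show False using v(3) ssize_eq[of "ssize u" u] ssize_eq[of "ssize u" v] z by simp
  qed
  then have "v = u" using z by (metis ext not_le)
  then show "v \<in> {u}" by simp
qed (auto simp: lower_def hstrip_def is_shape_def)

lemma strips_Suc_0: "s k = 0 \<Longrightarrow> strips (Suc k) s = strips k s"
proof
  fix u assume s: "s k = 0"
  show "strips (Suc k) s u = strips k s u"
  proof (cases "is_shape u")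
    case True then show ?thesis by (simp add: strips_Suc s add_strip_def lower_0)
  next
    case False
    then have "lower 0 u = {}" by (auto simp: lower_def)
    then show ?thesis using strips_nonzero[of k s u] False by (auto simp: strips_Suc s add_strip_def)
  qed
qed

lemma strips_extend: "k \<le> l \<Longrightarrow> (\<And>i. i \<ge> k \<Longrightarrow> s i = 0) \<Longrightarrow> strips l s = strips k s"
  by (induction l rule: dec_induct) (simp_all add: strips_Suc_0)

lemma keys_less_degree: "keys \<alpha> \<subseteq> {..<Poly_Mapping.degree \<alpha>}"
  using in_keys_less_degree by auto

text \<open>Any bound on the support may serve as the number of strips, since empty strips change
  nothing.\<close>

lemma kostka_eq:
  assumes "keys \<alpha> \<subseteq> {..<k}"
  shows "kostka \<alpha> = strips k (lookup \<alpha>)"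
proof -
  have z: "lookup \<alpha> i = 0" if "i \<ge> k" for i using assms that by (auto simp: in_keys_iff)
  have z': "lookup \<alpha> i = 0" if "i \<ge> Poly_Mapping.degree \<alpha>" for i
    using that by (rule beyond_degree_lookup_zero)
  let ?l = "max k (Poly_Mapping.degree \<alpha>)"
  have "strips ?l (lookup \<alpha>) = strips k (lookup \<alpha>)"
    by (rule strips_extend) (simp_all add: z)
  moreover have "strips ?l (lookup \<alpha>) = strips (Poly_Mapping.degree \<alpha>) (lookup \<alpha>)"
    by (rule strips_extend) (simp_all add: z')
  ultimately show ?thesis by (simp add: kostka_def)
qed

text \<open>The recursion in the last variable on which the inductions below rest.\<close>

lemma kostka_add_single:
  assumes "keys \<alpha> \<subseteq> {..<k}"
  shows "kostka (\<alpha> + single k r) = add_strip r (kostka \<alpha>)"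
proof -
  have k: "lookup \<alpha> k = 0" using assms by (auto simp: in_keys_iff)
  have "keys (\<alpha> + single k r) \<subseteq> {..<Suc k}"
    using assms keys_add[of \<alpha> "single k r"] by (auto split: if_splits)
  then have "kostka (\<alpha> + single k r) = strips (Suc k) (lookup (\<alpha> + single k r))"
    by (rule kostka_eq)
  also have "\<dots> = add_strip r (strips k (lookup (\<alpha> + single k r)))"
    by (simp add: strips_Suc lookup_add k)
  also have "strips k (lookup (\<alpha> + single k r)) = strips k (lookup \<alpha>)"
    by (rule strips_cong) (simp add: lookup_add lookup_single)
  finally show ?thesis by (simp add: kostka_eq[OF assms])
qed

lemma kostka_0: "kostka 0 = empty_shape" by (simp add: kostka_eq[of 0 0] strips_0)

lemma kostka_nonzero:
  assumes "kostka \<alpha> u \<noteq> 0" shows "is_shape u" "ssize u = mdeg \<alpha>"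
proof -
  have "strips (Poly_Mapping.degree \<alpha>) (lookup \<alpha>) u \<noteq> 0" using assms by (simp add: kostka_def)
  from strips_nonzero[OF this] show "is_shape u" "ssize u = mdeg \<alpha>"
    using mdeg_superset[OF _ keys_less_degree] by auto
qed

text \<open>Strips may be added in any order, so only the multiset of nonzero exponents
  matters.\<close>

lemma kostka_symmetric:
  assumes \<pi>: "bij \<pi>" and \<beta>: "lookup \<beta> = lookup \<alpha> \<circ> \<pi>"
  shows "kostka \<beta> = kostka \<alpha>"
proof -
  \<comment> \<open>An empty strip is neutral only on functions that vanish off the shapes, so the
    empty strips are first moved next to \<open>empty_shape\<close>.\<close>
  have cancel: "fold add_strip xs empty_shape = fold add_strip (filter (\<lambda>x. x \<noteq> 0) xs) empty_shape" for xs
  proof -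
    have "mset xs = mset (replicate (count (mset xs) 0) 0 @ filter (\<lambda>x. x \<noteq> 0) xs)"
      by (simp add: multiset_eq_iff count_replicate_mset)
    then have "fold add_strip xs = fold add_strip (replicate (count (mset xs) 0) 0 @ filter (\<lambda>x. x \<noteq> 0) xs)"
      by (intro fold_multiset_equiv) (auto simp: fun_eq_iff add_strip_commute)
    moreover have "fold add_strip (replicate j 0) empty_shape = empty_shape" for j
    proof (induction j)
      case (Suc j)
      have "add_strip 0 empty_shape = empty_shape"
        using strips_Suc_0[of "\<lambda>_. 0" 0] by (simp add: strips_Suc strips_0)
      then show ?case using Suc by simp
    qed simp
    ultimately show ?thesis by simp
  qed
  have keys: "keys \<alpha> = \<pi> ` keys \<beta>"
  proof (intro equalityI subsetI)
    fix x assume x: "x \<in> keys \<alpha>"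
    obtain y where "x = \<pi> y" using bij_is_surj[OF \<pi>] by (metis surjD)
    then show "x \<in> \<pi> ` keys \<beta>" using x by (auto simp: in_keys_iff \<beta>)
  qed (auto simp: in_keys_iff \<beta>)
  define k where "k = max (Poly_Mapping.degree \<alpha>) (Poly_Mapping.degree \<beta>)"
  have kk: "keys \<alpha> \<subseteq> {..<k}" "keys \<beta> \<subseteq> {..<k}"
    using keys_less_degree[of \<alpha>] keys_less_degree[of \<beta>] by (auto simp: k_def)
  have m: "mset (filter (\<lambda>x. x \<noteq> 0) (map (lookup \<gamma>) [0..<k])) =
      image_mset (lookup \<gamma>) (mset_set (keys \<gamma>))" if "keys \<gamma> \<subseteq> {..<k}" for \<gamma> :: monomial
  proof -
    have "mset (filter (\<lambda>x. x \<noteq> 0) (map (lookup \<gamma>) [0..<k])) =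
      image_mset (lookup \<gamma>) (filter_mset (\<lambda>i. lookup \<gamma> i \<noteq> 0) (mset_set {..<k}))"
      by (simp add: filter_map o_def mset_filter[symmetric] atLeast0LessThan del: mset_filter flip: mset_upt) (simp add: mset_upt)
    also have "filter_mset (\<lambda>i. lookup \<gamma> i \<noteq> 0) (mset_set {..<k}) = mset_set (keys \<gamma>)"
    proof -
      have "{i \<in> {..<k}. lookup \<gamma> i \<noteq> 0} = keys \<gamma>" using that by (auto simp: in_keys_iff)
      then show ?thesis by (simp add: filter_mset_mset_set)
    qed
    finally show ?thesis .
  qed
  have "image_mset (lookup \<alpha>) (mset_set (keys \<alpha>)) =
      image_mset (lookup \<alpha>) (image_mset \<pi> (mset_set (keys \<beta>)))"
  proof -
    have "inj_on \<pi> (keys \<beta>)" using \<pi> by (meson bij_is_inj inj_on_subset subset_UNIV)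
    then show ?thesis by (simp add: keys image_mset_mset_set)
  qed
  also have "\<dots> = image_mset (lookup \<beta>) (mset_set (keys \<beta>))"
    by (simp add: \<beta> multiset.map_comp)
  finally have "mset (filter (\<lambda>x. x \<noteq> 0) (map (lookup \<alpha>) [0..<k])) =
      mset (filter (\<lambda>x. x \<noteq> 0) (map (lookup \<beta>) [0..<k]))"
    by (simp only: m kk)
  then have "fold add_strip (filter (\<lambda>x. x \<noteq> 0) (map (lookup \<alpha>) [0..<k])) =
      fold add_strip (filter (\<lambda>x. x \<noteq> 0) (map (lookup \<beta>) [0..<k]))"
    by (intro fold_multiset_equiv) (auto simp: fun_eq_iff add_strip_commute)
  then show ?thesis
    unfolding kostka_eq[OF kk(1)] kostka_eq[OF kk(2)] strips_def by (subst (1 2) cancel) simp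
qed

section \<open>Factorisations of monomials, the Pieri rule and the Cauchy identity\<close>

definition splits :: "nat \<Rightarrow> monomial \<Rightarrow> (monomial \<times> monomial) set" where
  "splits s \<alpha> = {(\<gamma>, \<delta>). \<gamma> + \<delta> = \<alpha> \<and> mdeg \<gamma> = s}"

lemma finite_add_eq: "finite {(\<gamma>, \<delta>). \<gamma> + \<delta> = (\<alpha> :: monomial)}"
proof (rule finite_subset)
  let ?M = "{\<gamma>. keys \<gamma> \<subseteq> keys \<alpha> \<and> mdeg \<gamma> \<le> mdeg \<alpha>}"
  show "{(\<gamma>, \<delta>). \<gamma> + \<delta> = \<alpha>} \<subseteq> ?M \<times> ?M"
    by (auto simp: mdeg_add in_keys_iff lookup_add)
qed (intro finite_cartesian_product finite_monomials finite_keys)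

lemma finite_splits: "finite (splits s \<alpha>)"
  by (rule finite_subset[OF _ finite_add_eq[of \<alpha>]]) (auto simp: splits_def)

lemma decompose_at:
  fixes \<gamma> :: monomial
  assumes "keys \<gamma> \<subseteq> {..<Suc k}"
  obtains \<gamma>' where "\<gamma> = \<gamma>' + single k (lookup \<gamma> k)" "keys \<gamma>' \<subseteq> {..<k}"
proof -
  let ?g = "\<gamma> - single k (lookup \<gamma> k)"
  have "\<gamma> = ?g + single k (lookup \<gamma> k)"
    by (rule poly_mapping_eqI) (simp add: lookup_add lookup_minus lookup_single when_def)
  moreover have "keys ?g \<subseteq> {..<k}"
    using assms by (auto simp: in_keys_iff lookup_minus lookup_single when_def less_Suc_eq subset_iff split: if_splits)
  ultimately show ?thesis using that by blast
qed

lemma add_single_eq_iff: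
  fixes \<alpha> \<beta> :: monomial
  assumes "keys \<alpha> \<subseteq> {..<k}" "keys \<beta> \<subseteq> {..<k}"
  shows "\<alpha> + single k r = \<beta> + single k s \<longleftrightarrow> \<alpha> = \<beta> \<and> r = s"
proof
  assume eq: "\<alpha> + single k r = \<beta> + single k s"
  have "lookup \<alpha> k = 0" "lookup \<beta> k = 0" using assms by (auto simp: in_keys_iff)
  then have "r = s" using arg_cong[OF eq, of "\<lambda>x. lookup x k"] by (simp add: lookup_add)
  then show "\<alpha> = \<beta> \<and> r = s" using eq by simp
qed simp

lemma keys_add_subset: "keys (\<alpha> + \<beta> :: monomial) \<subseteq> S \<longleftrightarrow> keys \<alpha> \<subseteq> S \<and> keys \<beta> \<subseteq> S"
  by (auto simp: in_keys_iff lookup_add subset_iff)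

text \<open>The exponent \<open>r\<close> of the new variable is shared as
  \<open>j + (r - j)\<close>; what remains of the two factors is a split of \<alpha>.\<close>

lemma sum_splits_add_single:
  fixes F :: "monomial \<Rightarrow> monomial \<Rightarrow> nat"
  assumes "keys \<alpha> \<subseteq> {..<k}"
  shows "(\<Sum>(\<gamma>, \<delta>)\<in>splits s (\<alpha> + single k r). F \<gamma> \<delta>) =
    (\<Sum>j\<le>min r s. \<Sum>(\<gamma>, \<delta>)\<in>splits (s - j) \<alpha>. F (\<gamma> + single k j) (\<delta> + single k (r - j)))"
proof -
  let ?S = "SIGMA j:{..min r s}. splits (s - j) \<alpha>"
  let ?f = "\<lambda>(j, \<gamma>, \<delta>). (\<gamma> + single k j, \<delta> + single k (r - j))"
  have keys: "keys \<gamma> \<subseteq> {..<k}" "keys \<delta> \<subseteq> {..<k}" if "\<gamma> + \<delta> = \<alpha>" for \<gamma> \<delta>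
    using assms keys_add_subset[of \<gamma> \<delta> "{..<k}"] that by auto
  have inj: "inj_on ?f ?S"
  proof (rule inj_onI)
    fix p q assume p: "p \<in> ?S" and q: "q \<in> ?S" and eq: "?f p = ?f q"
    obtain j \<gamma> \<delta> j' \<gamma>' \<delta>' where pq: "p = (j, \<gamma>, \<delta>)" "q = (j', \<gamma>', \<delta>')"
      by (metis prod_cases3)
    have "\<gamma> + \<delta> = \<alpha>" "\<gamma>' + \<delta>' = \<alpha>" using p q by (auto simp: pq splits_def)
    note kk = keys[OF this(1)] keys[OF this(2)]
    show "p = q"
      using eq add_single_eq_iff[OF kk(1,3)] add_single_eq_iff[OF kk(2,4)] by (auto simp: pq)
  qed
  have img: "?f ` ?S = splits s (\<alpha> + single k r)"
  proof (intro equalityI subsetI)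
    fix p assume "p \<in> ?f ` ?S"
    then obtain j \<gamma> \<delta> where p: "p = (\<gamma> + single k j, \<delta> + single k (r - j))"
      and j: "j \<le> r" "j \<le> s" and gd: "\<gamma> + \<delta> = \<alpha>" "mdeg \<gamma> = s - j" by (auto simp: splits_def)
    have "single k j + single k (r - j) = single k r"
      using j by (simp flip: single_add)
    then have "\<gamma> + single k j + (\<delta> + single k (r - j)) = \<alpha> + single k r"
      using gd(1) by (metis (no_types, lifting) add.assoc add.left_commute)
    then show "p \<in> splits s (\<alpha> + single k r)" using p j gd by (simp add: splits_def mdeg_add)
  next
    fix p assume "p \<in> splits s (\<alpha> + single k r)"
    then obtain \<gamma> \<delta> where p: "p = (\<gamma>, \<delta>)" "\<gamma> + \<delta> = \<alpha> + single k r" "mdeg \<gamma> = s" by (auto simp: splits_def)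
    have "keys (\<gamma> + \<delta>) \<subseteq> {..<Suc k}"
      unfolding p(2) keys_add_subset using assms by (auto split: if_splits)
    then have kk: "keys \<gamma> \<subseteq> {..<Suc k}" "keys \<delta> \<subseteq> {..<Suc k}" by (auto simp: keys_add_subset)
    obtain \<gamma>' where \<gamma>': "\<gamma> = \<gamma>' + single k (lookup \<gamma> k)" "keys \<gamma>' \<subseteq> {..<k}"
      by (rule decompose_at[OF kk(1)])
    obtain \<delta>' where \<delta>': "\<delta> = \<delta>' + single k (lookup \<delta> k)" "keys \<delta>' \<subseteq> {..<k}"
      by (rule decompose_at[OF kk(2)])
    let ?j = "lookup \<gamma> k" and ?j' = "lookup \<delta> k"
    have "(\<gamma>' + \<delta>') + single k (?j + ?j') = \<alpha> + single k r"
      using p(2) \<gamma>'(1) \<delta>'(1) by (metis (no_types, lifting) add.assoc add.left_commute single_add)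
    then have eq: "\<gamma>' + \<delta>' = \<alpha>" "?j + ?j' = r"
      using add_single_eq_iff[of "\<gamma>' + \<delta>'" k \<alpha>] assms \<gamma>'(2) \<delta>'(2) by (auto simp: keys_add_subset)
    have "mdeg \<gamma>' + ?j = s" using p(3) \<gamma>'(1) by (metis mdeg_add mdeg_single)
    then have "(?j, \<gamma>', \<delta>') \<in> ?S" using eq by (auto simp: splits_def)
    moreover have "p = ?f (?j, \<gamma>', \<delta>')"
    proof -
      have "r - ?j = ?j'" using eq by simp
      then show ?thesis using p(1) \<gamma>'(1)[symmetric] \<delta>'(1)[symmetric] by simp
    qed
    ultimately show "p \<in> ?f ` ?S" by blast
  qed
  have "(\<Sum>(\<gamma>, \<delta>)\<in>splits s (\<alpha> + single k r). F \<gamma> \<delta>) =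
      (\<Sum>(j, \<gamma>, \<delta>)\<in>?S. F (\<gamma> + single k j) (\<delta> + single k (r - j)))"
    unfolding img[symmetric] by (subst sum.reindex[OF inj]) (auto intro!: sum.cong)
  also have "\<dots> = (\<Sum>j\<le>min r s. \<Sum>(\<gamma>, \<delta>)\<in>splits (s - j) \<alpha>. F (\<gamma> + single k j) (\<delta> + single k (r - j)))"
    by (subst sum.Sigma) (auto simp: finite_splits split_def)
  finally show ?thesis .
qed

text \<open>Induction on the number of variables. The hypothesis covers all monomials in the smaller
  set of variables, because the recursions pass from \<alpha> to its factors.\<close>

lemma monomial_induct [consumes 1, case_names zero add]:
  assumes "keys \<alpha> \<subseteq> {..<k}" and "P 0 0"
    and "\<And>k \<alpha> r. keys \<alpha> \<subseteq> {..<k} \<Longrightarrow> (\<And>\<beta>. keys \<beta> \<subseteq> {..<k} \<Longrightarrow> P k \<beta>) \<Longrightarrow>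
      P (Suc k) (\<alpha> + single k r)"
  shows "P k (\<alpha> :: monomial)"
  using assms(1)
proof (induction k arbitrary: \<alpha>)
  case 0 then show ?case using assms(2) by simp
next
  case (Suc k)
  obtain \<beta> where "\<alpha> = \<beta> + single k (lookup \<alpha> k)" "keys \<beta> \<subseteq> {..<k}"
    by (rule decompose_at[OF Suc.prems])
  then show ?case using assms(3)[of \<beta> k "lookup \<alpha> k"] Suc.IH by metis
qed

lemma remove_strip_empty_shape: "remove_strip s empty_shape = (if s = 0 then empty_shape else (\<lambda>_. 0))"
proof
  fix v
  have *: "upper s v \<inter> {u. \<forall>i. u i = 0} = (if s = 0 \<and> (\<forall>i. v i = 0) then {\<lambda>i. 0} else {})"
    by (auto simp: upper_def lower_def is_shape_def hstrip_def ssize_def fun_eq_iff)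
  have "remove_strip s empty_shape v = card (upper s v \<inter> {u. \<forall>i. u i = 0})"
    by (simp add: remove_strip_def empty_shape_def sum.If_cases finite_upper)
  then show "remove_strip s empty_shape v = (if s = 0 then empty_shape else (\<lambda>_. 0)) v"
    unfolding * by (auto simp: empty_shape_def)
qed

lemma splits_0: "splits s 0 = (if s = 0 then {(0, 0)} else {})"
  by (auto simp: splits_def add_eq_0_iff_both_eq_0 dest: arg_cong[of _ _ mdeg] simp: mdeg_add mdeg_eq_0_iff)

text \<open>The Pieri rule for \<open>h\<^sub>s s\<^sub>v\<close>, read at the exponent \<alpha>:
  every monomial \<gamma> of degree \<open>s\<close> has coefficient 1 in \<open>h\<^sub>s\<close>.
  The induction moves the removal past the last added strip by
  \<open>remove_add_strip\<close>.\<close>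

lemma remove_strip_kostka:
  "remove_strip s (kostka \<alpha>) v = (\<Sum>(\<gamma>, \<delta>)\<in>splits s \<alpha>. kostka \<delta> v)"
  using keys_less_degree[of \<alpha>]
proof (induction arbitrary: s v rule: monomial_induct)
  case zero
  then show ?case by (auto simp: kostka_0 remove_strip_empty_shape splits_0)
next
  case (add k \<alpha> r)
  have "remove_strip s (kostka (\<alpha> + single k r)) v =
      (\<Sum>j\<le>min r s. add_strip (r - j) (remove_strip (s - j) (kostka \<alpha>)) v)"
    by (simp add: kostka_add_single add remove_add_strip)
  also have "\<dots> = (\<Sum>j\<le>min r s. \<Sum>(\<gamma>, \<delta>)\<in>splits (s - j) \<alpha>. kostka (\<delta> + single k (r - j)) v)"
  proof (rule sum.cong)
    fix j
    have "add_strip (r - j) (remove_strip (s - j) (kostka \<alpha>)) v =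
        (\<Sum>u\<in>lower (r - j) v. \<Sum>(\<gamma>, \<delta>)\<in>splits (s - j) \<alpha>. kostka \<delta> u)"
      using add by (simp add: add_strip_def)
    also have "\<dots> = (\<Sum>p\<in>splits (s - j) \<alpha>. \<Sum>u\<in>lower (r - j) v. kostka (snd p) u)"
      by (subst sum.swap) (simp add: split_def)
    also have "\<dots> = (\<Sum>p\<in>splits (s - j) \<alpha>. kostka (snd p + single k (r - j)) v)"
    proof (rule sum.cong)
      fix p assume "p \<in> splits (s - j) \<alpha>"
      then have "fst p + snd p = \<alpha>" by (auto simp: splits_def)
      then have "keys (snd p) \<subseteq> {..<k}" using add(1) keys_add_subset by metis
      then show "(\<Sum>u\<in>lower (r - j) v. kostka (snd p) u) = kostka (snd p + single k (r - j)) v"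
        by (simp add: kostka_add_single add_strip_def)
    qed simp
    finally show "add_strip (r - j) (remove_strip (s - j) (kostka \<alpha>)) v =
        (\<Sum>(\<gamma>, \<delta>)\<in>splits (s - j) \<alpha>. kostka (\<delta> + single k (r - j)) v)"
      by (simp add: split_def)
  qed simp
  also have "\<dots> = (\<Sum>(\<gamma>, \<delta>)\<in>splits s (\<alpha> + single k r). kostka \<delta> v)"
    by (rule sum_splits_add_single[OF add(1), symmetric])
  finally show ?case .
qed

lemma card_invariant_tuples_Suc:
  "card (invariant_tuples {..<Suc k} id s \<alpha>) =
    (\<Sum>(\<gamma>, \<delta>)\<in>splits (s k) \<alpha>. card (invariant_tuples {..<k} id s \<delta>))"
proof -
  let ?S = "SIGMA p:splits (s k) \<alpha>. invariant_tuples {..<k} id s (snd p)"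
  have "bij_betw (\<lambda>\<beta>. ((\<beta> k, \<Sum>i<k. \<beta> i), restrict \<beta> {..<k})) (invariant_tuples {..<Suc k} id s \<alpha>) ?S"
  proof (rule bij_betwI[where g = "\<lambda>(p, \<beta>). \<beta>(k := fst p)"])
    show "(\<lambda>\<beta>. ((\<beta> k, \<Sum>i<k. \<beta> i), restrict \<beta> {..<k})) \<in> invariant_tuples {..<Suc k} id s \<alpha> \<rightarrow> ?S"
      by (auto simp: invariant_tuples_def splits_def add.commute)
    show "(\<lambda>(p, \<beta>). \<beta>(k := fst p)) \<in> ?S \<rightarrow> invariant_tuples {..<Suc k} id s \<alpha>"
      by (auto simp: invariant_tuples_def splits_def extensional_def less_Suc_eq add.commute)
    show "(\<lambda>(p, \<beta>). \<beta>(k := fst p)) ((\<beta> k, \<Sum>i<k. \<beta> i), restrict \<beta> {..<k}) = \<beta>"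
      if "\<beta> \<in> invariant_tuples {..<Suc k} id s \<alpha>" for \<beta>
      using that by (auto simp: invariant_tuples_def extensional_def fun_eq_iff less_Suc_eq)
    show "(\<lambda>\<beta>. ((\<beta> k, \<Sum>i<k. \<beta> i), restrict \<beta> {..<k})) ((\<lambda>(p, \<beta>). \<beta>(k := fst p)) q) = q" if "q \<in> ?S" for q
      using that by (auto simp: invariant_tuples_def splits_def extensional_def fun_eq_iff)
  qed
  then have "card (invariant_tuples {..<Suc k} id s \<alpha>) = card ?S" by (rule bij_betw_same_card)
  also have "\<dots> = (\<Sum>p\<in>splits (s k) \<alpha>. card (invariant_tuples {..<k} id s (snd p)))"
    by (simp add: finite_splits finite_invariant_tuples)
  finally show ?thesis by (simp add: split_def)
qed

text \<open>The Cauchy identity, coefficientwise.\<close>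

lemma sum_kostka_kostka:
  assumes "keys \<mu> \<subseteq> {..<k}" and "mdeg \<alpha> = n"
  shows "(\<Sum>\<nu>\<in>shapes n. kostka \<mu> \<nu> * kostka \<alpha> \<nu>) =
    card (invariant_tuples {..<k} id (lookup \<mu>) \<alpha>)"
  using assms
proof (induction arbitrary: n \<alpha> rule: monomial_induct)
  case zero
  \<comment> \<open>Over the empty index set there is exactly one extensional tuple.\<close>
  have inv: "invariant_tuples {..<0} id (lookup (0 :: monomial)) \<alpha> = (if \<alpha> = 0 then {\<lambda>_. undefined} else {})"
    by (auto simp: invariant_tuples_def)
  show ?case
  proof (cases "\<alpha> = 0")
    case True
    have "(\<Sum>\<nu>\<in>shapes n. kostka 0 \<nu> * kostka \<alpha> \<nu>) = (\<Sum>\<nu>\<in>shapes n. if \<nu> = (\<lambda>i. 0) then 1 else 0)"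
      by (rule sum.cong) (auto simp: True kostka_0 empty_shape_def fun_eq_iff)
    also have "\<dots> = 1"
    proof -
      have "(\<lambda>i. 0) \<in> shapes n" using True zero by (simp add: shapes_def ssize_zero is_shape_zero)
      then show ?thesis by (simp add: finite_shapes)
    qed
    finally show ?thesis unfolding inv using True by simp
  next
    case False
    then have "n \<noteq> 0" using zero mdeg_eq_0_iff[of \<alpha>] by simp
    then have "kostka 0 \<nu> = 0" if "\<nu> \<in> shapes n" for \<nu>
      using that kostka_nonzero[of 0 \<nu>] by (auto simp: shapes_def)
    then show ?thesis unfolding inv using False by simp
  qed
next
  case (add k \<mu> r)
  have lk: "lookup (\<mu> + single k r) k = r"
    using add(1) by (auto simp: lookup_add in_keys_iff)
  have tup: "invariant_tuples {..<k} id (lookup (\<mu> + single k r)) \<delta> =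
      invariant_tuples {..<k} id (lookup \<mu>) \<delta>" for \<delta>
    by (auto simp: invariant_tuples_def lookup_add lookup_single)
  show ?case
  proof (cases "r \<le> n")
    case True
    then obtain n' where n: "n = n' + r" by (metis le_add_diff_inverse2)
    \<comment> \<open>Adjointness moves the last strip of \<mu> to the other factor, where removing
      it splits off the last row of the matrix.\<close>
    have "(\<Sum>\<nu>\<in>shapes n. kostka (\<mu> + single k r) \<nu> * kostka \<alpha> \<nu>) =
        (\<Sum>v\<in>shapes n'. kostka \<mu> v * remove_strip r (kostka \<alpha>) v)"
      by (simp add: n kostka_add_single add sum_add_strip)
    also have "\<dots> = (\<Sum>v\<in>shapes n'. \<Sum>p\<in>splits r \<alpha>. kostka \<mu> v * kostka (snd p) v)"
      by (simp add: remove_strip_kostka sum_distrib_left split_def)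
    also have "\<dots> = (\<Sum>p\<in>splits r \<alpha>. \<Sum>v\<in>shapes n'. kostka \<mu> v * kostka (snd p) v)" by (rule sum.swap)
    also have "\<dots> = (\<Sum>p\<in>splits r \<alpha>. card (invariant_tuples {..<k} id (lookup \<mu>) (snd p)))"
    proof (rule sum.cong)
      fix p assume "p \<in> splits r \<alpha>"
      then have "mdeg (snd p) = n'" using add.prems n by (auto simp: splits_def mdeg_add)
      then show "(\<Sum>v\<in>shapes n'. kostka \<mu> v * kostka (snd p) v) =
          card (invariant_tuples {..<k} id (lookup \<mu>) (snd p))"
        by (rule add.IH[OF add(1)])
    qed simp
    also have "\<dots> = card (invariant_tuples {..<Suc k} id (lookup (\<mu> + single k r)) \<alpha>)"
      unfolding card_invariant_tuples_Suc lk tup by (simp add: split_def)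
    finally show ?thesis .
  next
    case False
    have "splits r \<alpha> = {}" using False add.prems by (auto simp: splits_def mdeg_add)
    then have rhs: "card (invariant_tuples {..<Suc k} id (lookup (\<mu> + single k r)) \<alpha>) = 0"
      unfolding card_invariant_tuples_Suc lk by simp
    have "kostka (\<mu> + single k r) \<nu> = 0" if "\<nu> \<in> shapes n" for \<nu>
      using that kostka_nonzero[of "\<mu> + single k r" \<nu>] False by (auto simp: shapes_def mdeg_add)
    then have "(\<Sum>\<nu>\<in>shapes n. kostka (\<mu> + single k r) \<nu> * kostka \<alpha> \<nu>) = 0" by simp
    then show ?thesis unfolding rhs .
  qed
qed

section \<open>Symmetric matrices and the sum of all Kostka numbers of given content\<close>

definition cut :: "nat \<Rightarrow> monomial \<Rightarrow> monomial" where
  "cut k \<alpha> = \<alpha> - single k (lookup \<alpha> k)"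

lemma lookup_cut: "lookup (cut k \<alpha>) i = (if i = k then 0 else lookup \<alpha> i)"
  by (simp add: cut_def lookup_minus lookup_single)

lemma cut_add: "cut k \<alpha> + single k (lookup \<alpha> k) = \<alpha>"
  by (rule poly_mapping_eqI) (simp add: lookup_add lookup_cut lookup_single)

lemma keys_cut: "keys (cut k \<alpha>) = keys \<alpha> - {k}"
  by (auto simp: in_keys_iff lookup_cut split: if_splits)

lemma mdeg_cut: "mdeg (cut k \<alpha>) + lookup \<alpha> k = mdeg \<alpha>"
  using arg_cong[OF cut_add[of k \<alpha>], of mdeg] by (simp add: mdeg_add)

text \<open>Twisted tuples for \<open>id\<close> are symmetric matrices. Delete the last row and
  column: \<open>j\<close> is the diagonal entry, \<gamma> the rest of the last row and \<delta> the
  row sums that are left.\<close>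

lemma card_twisted_tuples_Suc:
  assumes \<mu>: "keys \<mu> \<subseteq> {..<k}"
  shows "card (twisted_tuples {..<Suc k} id (lookup (\<mu> + single k r))) =
    (\<Sum>j\<le>r. \<Sum>(\<gamma>, \<delta>)\<in>splits (r - j) \<mu>. card (twisted_tuples {..<k} id (lookup \<delta>)))"
proof -
  let ?L = "twisted_tuples {..<Suc k} id (lookup (\<mu> + single k r))"
  let ?S = "SIGMA j:{..r}. SIGMA p:splits (r - j) \<mu>. twisted_tuples {..<k} id (lookup (snd p))"
  let ?f = "\<lambda>\<beta>. (lookup (\<beta> k) k, (cut k (\<beta> k), \<mu> - cut k (\<beta> k)), \<lambda>i\<in>{..<k}. cut k (\<beta> i))"
  let ?g = "\<lambda>(j, p, \<beta>') i. if i = k then fst p + single k j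
    else if i < k then \<beta>' i + single k (lookup (fst p) i) else undefined"
  have \<mu>0: "lookup \<mu> i = 0" if "i \<ge> k" for i using \<mu> that by (auto simp: in_keys_iff)
  have "bij_betw ?f ?L ?S"
  proof (rule bij_betwI[where g = ?g])
    show "?f \<in> ?L \<rightarrow> ?S"
    proof
      fix \<beta> assume \<beta>: "\<beta> \<in> ?L"
      let ?\<gamma> = "cut k (\<beta> k)"
      have d: "mdeg (\<beta> k) = r" "mdeg (\<beta> i) = lookup \<mu> i" if "i < k" for i
        using \<beta> that \<mu>0[of k] by (auto simp: twisted_tuples_def lookup_add lookup_single)
      have dk: "mdeg (\<beta> k) = r" using \<beta> \<mu>0[of k] by (auto simp: twisted_tuples_def lookup_add lookup_single)
      have K: "keys (\<beta> i) \<subseteq> {..<Suc k}" if "i \<le> k" for i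
        using \<beta> that by (auto simp: twisted_tuples_def)
      have sym: "lookup (\<beta> i) j = lookup (\<beta> j) i" if "i \<le> k" "j \<le> k" for i j
        using \<beta> that by (auto simp: twisted_tuples_def)
      have kg: "keys ?\<gamma> \<subseteq> {..<k}" using K[of k] by (auto simp: keys_cut less_Suc_eq)
      have le: "lookup ?\<gamma> i \<le> lookup \<mu> i" for i
      proof (cases "i < k")
        case True
        then show ?thesis using sym[of k i] lookup_le_mdeg[of "\<beta> i" k] d(2)[of i] by (simp add: lookup_cut)
      next
        case False
        then have "i \<notin> keys ?\<gamma>" using kg by auto
        then show ?thesis by (simp add: in_keys_iff)
      qed
      have "?\<gamma> + (\<mu> - ?\<gamma>) = \<mu>" by (rule poly_mapping_eqI) (simp add: lookup_add lookup_minus le)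
      moreover have "mdeg ?\<gamma> = r - lookup (\<beta> k) k" using mdeg_cut[of k "\<beta> k"] dk by simp
      moreover have "lookup (\<beta> k) k \<le> r" using lookup_le_mdeg[of "\<beta> k" k] dk by simp
      moreover have "(\<lambda>i\<in>{..<k}. cut k (\<beta> i)) \<in> twisted_tuples {..<k} id (lookup (\<mu> - ?\<gamma>))"
      proof -
        have "mdeg (cut k (\<beta> i)) = lookup (\<mu> - ?\<gamma>) i" if "i < k" for i
          using mdeg_cut[of k "\<beta> i"] d(2)[OF that] sym[of i k] that by (simp add: lookup_minus lookup_cut)
        moreover have "keys (cut k (\<beta> i)) \<subseteq> {..<k}" if "i < k" for i
          using K[of i] that by (auto simp: keys_cut less_Suc_eq)
        ultimately show ?thesis using sym by (simp add: twisted_tuples_def lookup_cut)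
      qed
      ultimately show "?f \<beta> \<in> ?S" by (auto simp: splits_def)
    qed
    show "?g \<in> ?S \<rightarrow> ?L"
    proof
      fix q assume "q \<in> ?S"
      then obtain j \<gamma> \<delta> \<beta>' where q: "q = (j, (\<gamma>, \<delta>), \<beta>')" and j: "j \<le> r" and gd: "\<gamma> + \<delta> = \<mu>" "mdeg \<gamma> = r - j"
        and \<beta>': "\<beta>' \<in> twisted_tuples {..<k} id (lookup \<delta>)" by (auto simp: splits_def)
      have kg: "keys \<gamma> \<subseteq> {..<k}" using \<mu> gd(1) keys_add_subset[of \<gamma> \<delta>] by auto
      have g0: "lookup \<gamma> k = 0" using kg by (auto simp: in_keys_iff)
      have d: "mdeg (\<beta>' i) = lookup \<delta> i" and K: "keys (\<beta>' i) \<subseteq> {..<k}" if "i < k" for i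
        using \<beta>' that by (auto simp: twisted_tuples_def)
      have b0: "lookup (\<beta>' i) k = 0" if "i < k" for i using K[OF that] by (auto simp: in_keys_iff)
      have sym: "lookup (\<beta>' i) j = lookup (\<beta>' j) i" if "i < k" "j < k" for i j
        using \<beta>' that by (auto simp: twisted_tuples_def)
      have gd': "lookup \<mu> i = lookup \<gamma> i + lookup \<delta> i" for i
        by (simp add: gd(1)[symmetric] lookup_add)
      have "?g q \<in> extensional {..<Suc k}" by (auto simp: q extensional_def)
      moreover have "mdeg (?g q i) = lookup (\<mu> + single k r) i" if "i < Suc k" for i
        using that j gd(2) d \<mu>0[of k] gd' by (auto simp: q mdeg_add lookup_add lookup_single less_Suc_eq)
      moreover have "keys (?g q i) \<subseteq> {..<Suc k}" if "i < Suc k" for i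
      proof -
        have "keys (\<beta>' i) \<subseteq> {..<Suc k}" if "i < k" using K[OF that] by auto
        moreover have "keys \<gamma> \<subseteq> {..<Suc k}" using kg by auto
        ultimately show ?thesis using that
          by (cases "i = k") (auto simp: q keys_add_subset less_Suc_eq split: if_splits)
      qed
      moreover have "lookup (?g q i) i' = lookup (?g q i') i" if "i < Suc k" "i' < Suc k" for i i'
        using that sym b0 g0 by (auto simp: q lookup_add lookup_single less_Suc_eq)
      ultimately show "?g q \<in> ?L" by (auto simp: twisted_tuples_def)
    qed
    show "?g (?f \<beta>) = \<beta>" if \<beta>: "\<beta> \<in> ?L" for \<beta>
    proof
      fix i
      have sym: "lookup (\<beta> k) i = lookup (\<beta> i) k" if "i < k" for i
        using \<beta> that by (auto simp: twisted_tuples_def)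
      show "?g (?f \<beta>) i = \<beta> i"
      proof (cases "i = k")
        case True then show ?thesis by (simp add: cut_add)
      next
        case False
        then show ?thesis using sym[of i] \<beta>
          by (auto simp: lookup_cut cut_add twisted_tuples_def extensional_def)
      qed
    qed
    show "?f (?g q) = q" if "q \<in> ?S" for q
    proof -
      obtain j \<gamma> \<delta> \<beta>' where q: "q = (j, (\<gamma>, \<delta>), \<beta>')" and j: "j \<le> r" and gd: "\<gamma> + \<delta> = \<mu>"
        and \<beta>': "\<beta>' \<in> twisted_tuples {..<k} id (lookup \<delta>)" using \<open>q \<in> ?S\<close> by (auto simp: splits_def)
      have kg: "keys \<gamma> \<subseteq> {..<k}" using \<mu> gd(1) keys_add_subset[of \<gamma> \<delta>] by auto
      have g0: "lookup \<gamma> k = 0" using kg by (auto simp: in_keys_iff)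
      have b0: "lookup (\<beta>' i) k = 0" if "i < k" for i
      proof -
        have "keys (\<beta>' i) \<subseteq> {..<k}" using \<beta>' that by (auto simp: twisted_tuples_def)
        then show ?thesis by (auto simp: in_keys_iff)
      qed
      have c: "cut k (\<alpha> + single k t) = \<alpha>" if "lookup \<alpha> k = 0" for \<alpha> t
        by (rule poly_mapping_eqI) (use that in \<open>auto simp: lookup_cut lookup_add lookup_single\<close>)
      have m1: "\<mu> - \<gamma> = \<delta>" using gd by auto
      have m2: "(\<lambda>i\<in>{..<k}. cut k (?g q i)) = \<beta>'"
        using \<beta>' b0 by (auto simp: q fun_eq_iff c twisted_tuples_def extensional_def)
      have g1: "?g q k = \<gamma> + single k j" by (simp add: q)
      have "lookup (\<gamma> + single k j) k = j" by (simp add: lookup_add g0)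
      then show ?thesis unfolding g1 m2 c[OF g0] m1 by (simp add: q)
    qed
  qed
  then have "card ?L = card ?S" by (rule bij_betw_same_card)
  also have "\<dots> = (\<Sum>j\<le>r. \<Sum>(\<gamma>, \<delta>)\<in>splits (r - j) \<mu>. card (twisted_tuples {..<k} id (lookup \<delta>)))"
    by (simp add: finite_splits finite_twisted_tuples split_def)
  finally show ?thesis .
qed

text \<open>The common successors of a shape with itself. It trades additions for removals when all
  shapes have weight 1.\<close>

lemma card_upper: "card (upper r v) = (\<Sum>j\<le>r. card (lower (r - j) v))"
proof -
  have "{\<nu> \<in> upper r v. v \<in> lower r \<nu>} = upper r v" by (auto simp: upper_def)
  moreover have "{v' \<in> lower (r - j) v. v \<in> upper (r - j) v'} = lower (r - j) v" for j by (auto simp: upper_def)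
  ultimately show ?thesis using card_common_upper[of r v v r] by (simp only: min.idem)
qed

text \<open>The coefficient of \<open>x\<^sup>\<mu>\<close> in the product formula for the sum of
  all Schur functions: the diagonal of a symmetric matrix gives the factors in one variable, the
  entries above it those in two. The last strip is summed away by turning its additions into
  removals (\<open>card_upper\<close>), and these split the exponents
  (\<open>remove_strip_kostka\<close>).\<close>

lemma sum_kostka:
  assumes "keys \<mu> \<subseteq> {..<k}"
  shows "(\<Sum>\<nu>\<in>shapes (mdeg \<mu>). kostka \<mu> \<nu>) = card (twisted_tuples {..<k} id (lookup \<mu>))"
  using assms
proof (induction rule: monomial_induct)
  case zero
  have "(\<lambda>i. 0) \<in> shapes 0" by (simp add: shapes_def ssize_zero is_shape_zero)
  moreover have "(\<Sum>\<nu>\<in>shapes (mdeg 0). kostka 0 \<nu>) = (\<Sum>\<nu>\<in>shapes 0. if \<nu> = (\<lambda>i. 0) then 1 else 0)"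
    by (rule sum.cong) (auto simp: kostka_0 empty_shape_def fun_eq_iff)
  moreover have tw: "twisted_tuples {..<0} id (lookup (0 :: monomial)) = {\<lambda>_. undefined}"
    by (auto simp: twisted_tuples_def)
  ultimately show ?case unfolding tw by (simp add: finite_shapes)
next
  case (add k \<mu> r)
  let ?n = "mdeg \<mu>"
  have "(\<Sum>\<nu>\<in>shapes (mdeg (\<mu> + single k r)). kostka (\<mu> + single k r) \<nu>) =
      (\<Sum>\<nu>\<in>shapes (?n + r). add_strip r (kostka \<mu>) \<nu> * 1)"
    by (simp add: mdeg_add kostka_add_single add)
  also have "\<dots> = (\<Sum>v\<in>shapes ?n. kostka \<mu> v * remove_strip r (\<lambda>_. 1) v)"
    by (rule sum_add_strip)
  also have "\<dots> = (\<Sum>v\<in>shapes ?n. \<Sum>j\<le>r. kostka \<mu> v * card (lower (r - j) v))"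
    by (simp add: remove_strip_def card_upper sum_distrib_left)
  also have "\<dots> = (\<Sum>j\<le>r. \<Sum>v\<in>shapes ?n. kostka \<mu> v * card (lower (r - j) v))" by (rule sum.swap)
  also have "\<dots> = (\<Sum>j\<le>r. \<Sum>(\<gamma>, \<delta>)\<in>splits (r - j) \<mu>. card (twisted_tuples {..<k} id (lookup \<delta>)))"
  proof (rule sum.cong)
    fix j
    let ?t = "r - j"
    show "(\<Sum>v\<in>shapes ?n. kostka \<mu> v * card (lower ?t v)) =
        (\<Sum>(\<gamma>, \<delta>)\<in>splits ?t \<mu>. card (twisted_tuples {..<k} id (lookup \<delta>)))"
    proof (cases "?t \<le> ?n")
      case True
      then obtain n' where n': "?n = n' + ?t" by (metis le_add_diff_inverse2)
      have "(\<Sum>v\<in>shapes ?n. kostka \<mu> v * card (lower ?t v)) =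
          (\<Sum>v\<in>shapes (n' + ?t). add_strip ?t (\<lambda>_. 1) v * kostka \<mu> v)"
        by (simp add: n' add_strip_def mult.commute)
      also have "\<dots> = (\<Sum>u\<in>shapes n'. 1 * remove_strip ?t (kostka \<mu>) u)" by (rule sum_add_strip)
      also have "\<dots> = (\<Sum>u\<in>shapes n'. \<Sum>p\<in>splits ?t \<mu>. kostka (snd p) u)"
        by (simp add: remove_strip_kostka split_def)
      also have "\<dots> = (\<Sum>p\<in>splits ?t \<mu>. \<Sum>u\<in>shapes n'. kostka (snd p) u)" by (rule sum.swap)
      also have "\<dots> = (\<Sum>p\<in>splits ?t \<mu>. card (twisted_tuples {..<k} id (lookup (snd p))))"
      proof (rule sum.cong)
        fix p assume p: "p \<in> splits ?t \<mu>"
        have 1: "fst p + snd p = \<mu>" using p by (auto simp: splits_def)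
        have 2: "keys (snd p) \<subseteq> {..<k}" using add(1) 1 keys_add_subset by metis
        have "mdeg (fst p) = ?t" using p by (auto simp: splits_def)
        then have "mdeg (snd p) = n'" using arg_cong[OF 1, of mdeg] n' by (simp add: mdeg_add)
        then show "(\<Sum>u\<in>shapes n'. kostka (snd p) u) = card (twisted_tuples {..<k} id (lookup (snd p)))"
          using add.IH[OF 2] by (simp only:)
      qed simp
      finally show ?thesis by (simp add: split_def)
    next
      case False
      have "splits ?t \<mu> = {}" using False by (auto simp: splits_def mdeg_add)
      moreover have "lower ?t v = {}" if "v \<in> shapes ?n" for v
        using False that by (auto simp: lower_def shapes_def)
      ultimately show ?thesis by simp
    qed
  qed simp
  also have "\<dots> = card (twisted_tuples {..<Suc k} id (lookup (\<mu> + single k r)))"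
    by (rule card_twisted_tuples_Suc[OF add(1), symmetric])
  finally show ?case .
qed

text \<open>The first \<open>j\<close> strips lie within the first \<open>j\<close> rows, and later
  strips can only lengthen these rows.\<close>

lemma strips_dominance:
  "strips k s u \<noteq> 0 \<Longrightarrow> j \<le> k \<Longrightarrow> (\<Sum>i<j. s i) \<le> (\<Sum>i<j. u i)"
proof (induction k arbitrary: u)
  case (Suc k)
  show ?case
  proof (cases "j = Suc k")
    case True
    have "ssize u = (\<Sum>i<Suc k. s i)" "\<forall>i\<ge>Suc k. u i = 0" using strips_nonzero[OF Suc.prems(1)] by auto
    then show ?thesis using ssize_eq[of "Suc k" u] True by simp
  next
    case False
    have "(\<Sum>v\<in>lower (s k) u. strips k s v) \<noteq> 0" using Suc.prems(1) by (simp add: strips_Suc add_strip_def)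
    then obtain v where v: "v \<in> lower (s k) u" "strips k s v \<noteq> 0" by (metis sum.neutral)
    have "(\<Sum>i<j. s i) \<le> (\<Sum>i<j. v i)" using Suc.IH[OF v(2)] False Suc.prems(2) by simp
    also have "\<dots> \<le> (\<Sum>i<j. u i)" using v(1) by (intro sum_mono) (auto simp: lower_def hstrip_def)
    finally show ?thesis .
  qed
qed simp

lemma kostka_dominance:
  assumes "kostka \<alpha> u \<noteq> 0" shows "(\<Sum>i<j. lookup \<alpha> i) \<le> (\<Sum>i<j. u i)"
proof -
  let ?k = "max j (Poly_Mapping.degree \<alpha>)"
  have "kostka \<alpha> = strips ?k (lookup \<alpha>)"
    by (rule kostka_eq) (use keys_less_degree[of \<alpha>] in auto)
  then show ?thesis using strips_dominance[of ?k "lookup \<alpha>" u j] assms by simp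
qed

text \<open>The only chain is that of the truncations of \<open>u\<close>: after \<open>k\<close>
  strips at most \<open>k\<close> rows are nonempty, and the size forces them to be the full rows of
  \<open>u\<close>.\<close>

lemma strips_self:
  assumes "is_shape u"
  shows "strips k u (\<lambda>i. if i < k then u i else 0) = 1"
proof (induction k)
  case 0 then show ?case by (simp add: strips_0 empty_shape_def)
next
  case (Suc k)
  let ?t = "\<lambda>k i. if i < k then u i else 0"
  have le: "u j \<le> u i" if "i \<le> j" for i j using is_shape_antimono[OF assms that] .
  have sh: "is_shape (?t k)" for k
    unfolding is_shape_def using le by (auto intro!: exI[of _ k])
  have sz: "ssize (?t k) = (\<Sum>i<k. u i)" for k
    using ssize_eq[of k "?t k"] by simp
  have "lower (u k) (?t (Suc k)) \<inter> {v. strips k u v \<noteq> 0} = {?t k}"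
  proof (intro equalityI subsetI)
    fix v assume "v \<in> lower (u k) (?t (Suc k)) \<inter> {v. strips k u v \<noteq> 0}"
    then have v: "v \<in> lower (u k) (?t (Suc k))" "strips k u v \<noteq> 0" by auto
    have z: "v i = 0" if "i \<ge> k" for i using strips_nonzero[OF v(2)] that by auto
    have "v \<in> lower 0 (?t k)"
    proof -
      have h: "v i \<le> ?t (Suc k) i" "?t (Suc k) (Suc i) \<le> v i" for i
        using v(1) unfolding lower_def hstrip_def by blast+
      have "v i \<le> ?t k i" "?t k (Suc i) \<le> v i" for i
        using h[of i] z[of i] by (auto split: if_splits)
      moreover have "ssize v = ssize (?t k)" using strips_nonzero[OF v(2)] sz by simp
      ultimately show ?thesis using v(1) sh[of k] by (simp add: lower_def hstrip_def)
    qed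
    then show "v \<in> {?t k}" using lower_0[OF sh] by auto
  next
    fix v assume "v \<in> {?t k}"
    then have v: "v = ?t k" by simp
    have "hstrip (?t k) (?t (Suc k))" using le by (auto simp: hstrip_def)
    then have "?t k \<in> lower (u k) (?t (Suc k))" using sh[of k] sh[of "Suc k"] sz[of k] sz[of "Suc k"] by (simp add: lower_def)
    then show "v \<in> lower (u k) (?t (Suc k)) \<inter> {v. strips k u v \<noteq> 0}" using Suc v by simp
  qed
  moreover have "(\<Sum>v\<in>lower (u k) (?t (Suc k)). strips k u v) =
      (\<Sum>v\<in>lower (u k) (?t (Suc k)) \<inter> {v. strips k u v \<noteq> 0}. strips k u v)"
    by (rule sum.mono_neutral_right) (auto simp: finite_lower)
  ultimately show ?case using Suc by (simp only: strips_Suc add_strip_def) simp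
qed

lemma kostka_self:
  assumes "is_shape (lookup \<alpha>)" shows "kostka \<alpha> (lookup \<alpha>) = 1"
proof -
  have "lookup \<alpha> = (\<lambda>i. if i < Poly_Mapping.degree \<alpha> then lookup \<alpha> i else 0)"
    using beyond_degree_lookup_zero[of \<alpha>] by (auto simp: fun_eq_iff)
  then show ?thesis using strips_self[OF assms, of "Poly_Mapping.degree \<alpha>"] by (simp add: kostka_def)
qed

section \<open>Semistandard tableaux\<close>

definition cells :: "(nat \<Rightarrow> nat) \<Rightarrow> (nat \<times> nat) set" where
  "cells u = {(i, j). j < u i}"

definition tableaux :: "(nat \<Rightarrow> nat) \<Rightarrow> (nat \<Rightarrow> nat) \<Rightarrow> (nat \<times> nat \<Rightarrow> nat) set" where
  "tableaux u s = {T \<in> extensional (cells u).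
     (\<forall>i j j'. (i, j) \<in> cells u \<longrightarrow> (i, j') \<in> cells u \<longrightarrow> j < j' \<longrightarrow> T (i, j) \<le> T (i, j')) \<and>
     (\<forall>i i' j. (i, j) \<in> cells u \<longrightarrow> (i', j) \<in> cells u \<longrightarrow> i < i' \<longrightarrow> T (i, j) < T (i', j)) \<and>
     (\<forall>k. card {c \<in> cells u. T c = k} = s k)}"

lemma cells_Sigma: "is_shape u \<Longrightarrow> cells u = (SIGMA i:{..<ssize u}. {..<u i})"
  using shape_support[of u] by (auto simp: cells_def) (metis not_le not_less_zero)

lemma finite_cells: "is_shape u \<Longrightarrow> finite (cells u)"
  by (simp add: cells_Sigma)

lemma card_cells: "is_shape u \<Longrightarrow> card (cells u) = ssize u"
  using ssize_eq[of "ssize u" u] shape_support[of u] by (simp add: cells_Sigma)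

text \<open>The cells with entries below \<open>k\<close> form a shape, and the remaining cells, all
  with entry \<open>k\<close>, form a horizontal strip because columns are strict.\<close>

lemma tableaux_Suc:
  assumes u: "is_shape u" and s: "\<And>i. i \<ge> Suc k \<Longrightarrow> s i = 0"
  shows "\<exists>f. bij_betw f (tableaux u s) (SIGMA v:lower (s k) u. tableaux v (s(k := 0)))"
proof -
  let ?L = "tableaux u s" and ?S = "SIGMA v:lower (s k) u. tableaux v (s(k := 0))"
  define sh where "sh T = (\<lambda>i. card {j. j < u i \<and> T (i, j) < k})" for T :: "nat \<times> nat \<Rightarrow> nat"
  let ?f = "\<lambda>T. (sh T, restrict T (cells (sh T)))"
  let ?g = "\<lambda>(v, T') c. if c \<in> cells v then T' c else if c \<in> cells u then k else undefined"
  have sh_iff: "j < sh T i \<longleftrightarrow> j < u i \<and> T (i, j) < k" if T: "T \<in> ?L" for T i j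
  proof -
    let ?J = "{j. j < u i \<and> T (i, j) < k}"
    have fin: "finite ?J" by simp
    have down: "j' \<in> ?J" if "j \<in> ?J" "j' \<le> j" for j j'
    proof (cases "j' = j")
      case False
      then have "T (i, j') \<le> T (i, j)" using that T by (auto simp: tableaux_def cells_def)
      then show ?thesis using that by auto
    qed (use that in simp)
    have "?J = {..<card ?J}"
    proof (cases "?J = {}")
      case False
      have "?J = {..Max ?J}"
      proof (intro equalityI subsetI)
        fix x assume "x \<in> ?J" then show "x \<in> {..Max ?J}" using Max_ge[OF fin] by blast
      next
        fix x assume "x \<in> {..Max ?J}" then show "x \<in> ?J" using down[OF Max_in[OF fin False]] by (simp only: atMost_iff)
      qed
      then obtain M where J: "?J = {..M}" by blast
      show ?thesis by (simp only: J card_atMost lessThan_Suc_atMost)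
    qed (metis card.empty lessThan_0)
    then show ?thesis by (auto simp: sh_def)
  qed
  have fT: "?f T \<in> ?S" and gf: "?g (?f T) = T" if T: "T \<in> ?L" for T
  proof -
    have le: "T c \<le> k" if c: "c \<in> cells u" for c
    proof (rule ccontr)
      assume "\<not> T c \<le> k"
      then have "card {c' \<in> cells u. T c' = T c} = 0" using T s[of "T c"] by (simp add: tableaux_def)
      then show False using c finite_cells[OF u] by (cases c) auto
    qed
    have sub: "cells (sh T) \<subseteq> cells u" using sh_iff[OF T] by (auto simp: cells_def)
    have cell_iff: "c \<in> cells (sh T) \<longleftrightarrow> c \<in> cells u \<and> T c < k" for c
      using sh_iff[OF T] by (cases c) (auto simp: cells_def)
    have h1: "sh T i \<le> u i" for i using sh_iff[OF T, of "u i" i] by (meson less_irrefl not_le)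
    \<comment> \<open>Otherwise a cell with entry at least \<open>k\<close> would have a cell below
      it, whose entry exceeds \<open>k\<close>.\<close>
    have h2: "u (Suc i) \<le> sh T i" for i
    proof (rule ccontr)
      assume "\<not> u (Suc i) \<le> sh T i"
      then have j: "sh T i < u (Suc i)" by simp
      then have j': "sh T i < u i" using is_shape_antimono[OF u, of i "Suc i"] by simp
      have "T (i, sh T i) < T (Suc i, sh T i)" using T j j' by (auto simp: tableaux_def cells_def)
      also have "\<dots> \<le> k" by (rule le) (simp add: cells_def j)
      finally show False using sh_iff[OF T, of "sh T i" i] j' by simp
    qed
    have hs: "hstrip (sh T) u" using h1 h2 by (simp add: hstrip_def)
    have shs: "is_shape (sh T)" unfolding is_shape_def
    proof (intro conjI allI exI impI)
      fix i show "sh T (Suc i) \<le> sh T i" using h1[of "Suc i"] h2[of i] by simp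
      show "sh T i = 0" if "i \<ge> ssize u" for i using h1[of i] shape_support[OF u that] by simp
    qed
    have "cells u = cells (sh T) \<union> {c \<in> cells u. T c = k}" using le cell_iff by (auto simp: le_less)
    moreover have "card (cells (sh T) \<union> {c \<in> cells u. T c = k}) = card (cells (sh T)) + card {c \<in> cells u. T c = k}"
      using finite_cells[OF u] finite_cells[OF shs] by (intro card_Un_disjoint) (auto simp: cell_iff)
    moreover have "card {c \<in> cells u. T c = k} = s k" using T by (simp add: tableaux_def)
    ultimately have "ssize u = ssize (sh T) + s k" using card_cells[OF u] card_cells[OF shs] by simp
    then have low: "sh T \<in> lower (s k) u" using hs shs u by (simp add: lower_def)
    have "restrict T (cells (sh T)) \<in> tableaux (sh T) (s(k := 0))"
    proof -
      have "card {c \<in> cells (sh T). restrict T (cells (sh T)) c = m} = (s(k := 0)) m" for m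
      proof (cases "m < k")
        case True
        then have "{c \<in> cells (sh T). restrict T (cells (sh T)) c = m} = {c \<in> cells u. T c = m}"
          using cell_iff by auto
        then show ?thesis using True T by (simp add: tableaux_def)
      next
        case False
        then have "{c \<in> cells (sh T). restrict T (cells (sh T)) c = m} = {}" using cell_iff by auto
        moreover have "(s(k := 0)) m = 0" using False s[of m] by (cases "m = k") auto
        ultimately show ?thesis by (simp only: card.empty)
      qed
      moreover have "T (i, j) \<le> T (i, j')" if "(i, j) \<in> cells (sh T)" "(i, j') \<in> cells (sh T)" "j < j'" for i j j'
        using T subsetD[OF sub that(1)] subsetD[OF sub that(2)] that(3) unfolding tableaux_def by blast
      moreover have "T (i, j) < T (i', j)" if "(i, j) \<in> cells (sh T)" "(i', j) \<in> cells (sh T)" "i < i'" for i i' j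
        using T subsetD[OF sub that(1)] subsetD[OF sub that(2)] that(3) unfolding tableaux_def by blast
      ultimately show ?thesis unfolding tableaux_def by simp
    qed
    then show "?f T \<in> ?S" using low by simp
    show "?g (?f T) = T"
    proof
      fix c
      have "T \<in> extensional (cells u)" using T by (simp add: tableaux_def)
      then have "T c = undefined" if "c \<notin> cells u" using that by (rule extensional_arb)
      then show "?g (?f T) c = T c" using cell_iff[of c] le[of c] by (auto simp: le_less)
    qed
  qed
  have gS: "?g q \<in> ?L" and fg: "?f (?g q) = q" if q: "q \<in> ?S" for q
  proof -
    obtain v T' where q': "q = (v, T')" and v: "v \<in> lower (s k) u" and T': "T' \<in> tableaux v (s(k := 0))"
      using q by auto
    have shk: "is_shape v" and h: "v i \<le> u i" "u (Suc i) \<le> v i" for i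
      using v by (auto simp: lower_def hstrip_def)
    have sub: "cells v \<subseteq> cells u" using h(1) by (auto simp: cells_def intro: less_le_trans)
    have lt: "T' c < k" if c: "c \<in> cells v" for c
    proof (rule ccontr)
      assume "\<not> T' c < k"
      then have "(s(k := 0)) (T' c) = 0" using s[of "T' c"] by (cases "T' c = k") auto
      then have "card {c' \<in> cells v. T' c' = T' c} = 0" using T' by (simp add: tableaux_def)
      then show False using c finite_cells[OF shk] by (cases c) auto
    qed
    let ?T = "?g q"
    have Tin: "?T c = T' c" if "c \<in> cells v" for c using that by (simp add: q')
    have Tout: "?T c = k" if "c \<in> cells u" "c \<notin> cells v" for c using that by (simp add: q')
    have "?T (i, j) \<le> ?T (i, j')" if "(i, j) \<in> cells u" "(i, j') \<in> cells u" "j < j'" for i j j'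
    proof (cases "(i, j') \<in> cells v")
      case True
      then have "(i, j) \<in> cells v" using that by (auto simp: cells_def)
      then show ?thesis using True that T' by (simp add: Tin) (simp add: tableaux_def)
    next
      case False
      then show ?thesis using that Tout[of "(i, j')"] Tout[of "(i, j)"] Tin[of "(i, j)"] lt[of "(i, j)"]
        by (cases "(i, j) \<in> cells v") auto
    qed
    moreover have "?T (i, j) < ?T (i', j)" if "(i, j) \<in> cells u" "(i', j) \<in> cells u" "i < i'" for i i' j
    proof -
      have "u i' \<le> u (Suc i)" using is_shape_antimono[of u "Suc i" i'] that v by (auto simp: lower_def)
      then have ij: "(i, j) \<in> cells v" using that h(2)[of i] by (auto simp: cells_def)
      show ?thesis
      proof (cases "(i', j) \<in> cells v")
        case True
        then show ?thesis using ij that T' by (simp add: Tin) (simp add: tableaux_def)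
      next
        case False
        then show ?thesis using Tin[OF ij] lt[OF ij] Tout[OF that(2)] by simp
      qed
    qed
    moreover have "card {c \<in> cells u. ?T c = m} = s m" for m
    proof (cases "m = k")
      case True
      have e: "{c \<in> cells u. ?T c = m} = cells u - cells v"
      proof (intro equalityI subsetI)
        fix x assume "x \<in> {c \<in> cells u. ?T c = m}"
        then show "x \<in> cells u - cells v" using Tin[of x] lt[of x] True by (cases "x \<in> cells v") auto
      next
        fix x assume "x \<in> cells u - cells v"
        then show "x \<in> {c \<in> cells u. ?T c = m}" using Tout[of x] True by blast
      qed
      have "ssize v + s k = ssize u" using v by (simp add: lower_def)
      then show ?thesis unfolding e unfolding card_Diff_subset[OF finite_cells[OF shk] sub] card_cells[OF shk] card_cells[OF u] True
        by simp
    next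
      case False
      have e: "{c \<in> cells u. ?T c = m} = {c \<in> cells v. T' c = m}"
      proof (intro equalityI subsetI)
        fix x assume "x \<in> {c \<in> cells u. ?T c = m}"
        then show "x \<in> {c \<in> cells v. T' c = m}" using Tin[of x] Tout[of x] False by (cases "x \<in> cells v") auto
      next
        fix x assume "x \<in> {c \<in> cells v. T' c = m}"
        then show "x \<in> {c \<in> cells u. ?T c = m}" using Tin[of x] sub by blast
      qed
      have "card {c \<in> cells v. T' c = m} = (s(k := 0)) m" using T' by (simp add: tableaux_def)
      then show ?thesis unfolding e using False by simp
    qed
    moreover have "?T \<in> extensional (cells u)" using sub by (auto simp: q' extensional_def)
    ultimately show L: "?T \<in> ?L" unfolding tableaux_def by blast
    have "sh ?T = v"
    proof
      fix i
      have "{j. j < u i \<and> ?T (i, j) < k} = {..<v i}"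
      proof (intro equalityI subsetI)
        fix j assume "j \<in> {j. j < u i \<and> ?T (i, j) < k}"
        then show "j \<in> {..<v i}" using Tout[of "(i, j)"] by (auto simp: cells_def)
      next
        fix j assume "j \<in> {..<v i}"
        then have c: "(i, j) \<in> cells v" by (simp add: cells_def)
        then show "j \<in> {j. j < u i \<and> ?T (i, j) < k}" using Tin[OF c] lt[OF c] sub by (auto simp: cells_def)
      qed
      then show "sh ?T i = v i" by (simp add: sh_def)
    qed
    moreover have "restrict ?T (cells v) = T'"
      using T' by (auto simp: q' fun_eq_iff tableaux_def extensional_def)
    ultimately show "?f ?T = q" by (simp only: q')
  qed
  have "bij_betw ?f ?L ?S"
    by (rule bij_betwI[of _ _ _ ?g]) (use fT gf gS fg in blast)+
  then show ?thesis by blast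
qed

text \<open>Finiteness belongs to the claim because counting the pairs in the induction step depends
  on it.\<close>

lemma card_tableaux:
  "is_shape u \<Longrightarrow> (\<And>i. i \<ge> k \<Longrightarrow> s i = 0) \<Longrightarrow> finite (tableaux u s) \<and> card (tableaux u s) = strips k s u"
proof (induction k arbitrary: u s)
  case 0
  show ?case
  proof (cases "\<forall>i. u i = 0")
    case True
    then have "cells u = {}" by (simp add: cells_def)
    then have e: "tableaux u s = {\<lambda>_. undefined}" using 0 by (auto simp: tableaux_def)
    show ?thesis unfolding e using True by (simp add: strips_0 empty_shape_def)
  next
    case False
    then obtain i where i: "u i \<noteq> 0" by auto
    have "T \<notin> tableaux u s" for T
    proof
      assume "T \<in> tableaux u s"
      then have "card {c \<in> cells u. T c = T (i, 0)} = 0" using 0 by (simp add: tableaux_def)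
      moreover have "(i, 0) \<in> {c \<in> cells u. T c = T (i, 0)}" using i by (simp add: cells_def)
      ultimately show False using finite_cells[OF 0(1)] by auto
    qed
    then have "tableaux u s = {}" by auto
    then show ?thesis using i by (auto simp: strips_0 empty_shape_def)
  qed
next
  case (Suc k)
  obtain f where f: "bij_betw f (tableaux u s) (SIGMA v:lower (s k) u. tableaux v (s(k := 0)))"
    using tableaux_Suc[of u k s] Suc.prems by blast
  have IH: "finite (tableaux v (s(k := 0))) \<and> card (tableaux v (s(k := 0))) = strips k s v"
    if "v \<in> lower (s k) u" for v
  proof -
    have "is_shape v" using that by (simp add: lower_def)
    moreover have "(s(k := 0)) i = 0" if "i \<ge> k" for i using that Suc.prems(2)[of i] by (cases "i = k") auto
    moreover have "strips k (s(k := 0)) = strips k s" by (rule strips_cong) simp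
    ultimately show ?thesis using Suc.IH by metis
  qed
  have "finite (SIGMA v:lower (s k) u. tableaux v (s(k := 0)))"
    using IH finite_lower by (intro finite_SigmaI) auto
  moreover have "card (SIGMA v:lower (s k) u. tableaux v (s(k := 0))) = strips (Suc k) s u"
    using IH by (simp add: finite_lower strips_Suc add_strip_def)
  ultimately show ?case using bij_betw_finite[OF f] bij_betw_same_card[OF f] by simp
qed

section \<open>Partitions as lists and as shapes\<close>

definition shape_of :: "nat list \<Rightarrow> nat \<Rightarrow> nat" where
  "shape_of lam = (\<lambda>i. if i < length lam then lam ! i else 0)"

lemma diagram_cells: "diagram lam = cells (shape_of lam)"
  by (auto simp: diagram_def cells_def shape_of_def split: if_splits)

lemma is_shape_shape_of: "sorted_wrt (\<ge>) lam \<Longrightarrow> is_shape (shape_of lam)"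
  by (auto simp: is_shape_def shape_of_def sorted_wrt_iff_nth_less intro!: exI[of _ "length lam"])

lemma ssize_shape_of: "ssize (shape_of lam) = sum_list lam"
proof -
  have "ssize (shape_of lam) = (\<Sum>i<length lam. shape_of lam i)" by (rule ssize_eq) (simp add: shape_of_def)
  then show ?thesis by (simp add: shape_of_def sum_list_sum_nth atLeast0LessThan)
qed

lemma bij_shape_of: "bij_betw shape_of (partitions_of n) (shapes n)"
proof (rule bij_betwI')
  fix x y assume x: "x \<in> partitions_of n" and y: "y \<in> partitions_of n"
  show "shape_of x = shape_of y \<longleftrightarrow> x = y"
  proof
    assume eq: "shape_of x = shape_of y"
    have len: "length z = card {i. shape_of z i \<noteq> 0}" if "z \<in> partitions_of n" for z
    proof -
      have "{i. shape_of z i \<noteq> 0} = {..<length z}"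
        using that by (auto simp: shape_of_def partitions_of_def in_set_conv_nth split: if_splits)
      then show ?thesis by simp
    qed
    have "length x = length y" using len[OF x] len[OF y] eq by simp
    then show "x = y" using eq by (intro nth_equalityI) (auto simp: shape_of_def fun_eq_iff split: if_splits)
  qed simp
next
  fix x assume "x \<in> partitions_of n"
  then show "shape_of x \<in> shapes n"
    by (auto simp: shapes_def partitions_of_def ssize_shape_of is_shape_shape_of)
next
  fix u assume u: "u \<in> shapes n"
  then have sh: "is_shape u" by (simp add: shapes_def)
  define l where "l = (LEAST i. u i = 0)"
  have l0: "u l = 0" unfolding l_def by (rule LeastI[of _ "ssize u"]) (simp add: shape_support[OF sh])
  have nz: "u i \<noteq> 0" if "i < l" for i using that not_less_Least unfolding l_def by blast
  have z: "u i = 0" if "i \<ge> l" for i using is_shape_antimono[OF sh that] l0 by simp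
  let ?x = "map u [0..<l]"
  have "shape_of ?x = u" using z by (auto simp: shape_of_def fun_eq_iff)
  moreover have "?x \<in> partitions_of n"
  proof -
    have "sum_list ?x = n" using ssize_shape_of[of ?x] calculation u by (simp add: shapes_def)
    moreover have "sorted_wrt (\<ge>) ?x"
      using is_shape_antimono[OF sh] by (auto simp: sorted_wrt_iff_nth_less)
    moreover have "0 \<notin> set ?x"
    proof
      assume "0 \<in> set ?x"
      then obtain i where "i < l" "u i = 0" by auto
      then show False using nz by blast
    qed
    ultimately show ?thesis by (simp add: partitions_of_def)
  qed
  ultimately show "\<exists>x\<in>partitions_of n. u = shape_of x" by metis
qed

lemma finite_partitions_of: "finite (partitions_of n)"
  using bij_betw_finite[OF bij_shape_of] finite_shapes by blast

text \<open>From here on Schur functions are handled through chains of strips instead of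
  tableaux.\<close>

lemma schur_kostka:
  assumes "lam \<in> partitions_of n"
  shows "schur lam \<alpha> = of_nat (kostka \<alpha> (shape_of lam))"
proof -
  have "{T \<in> semistandard_tableaux lam. \<forall>k. card {c \<in> diagram lam. T c = k} = lookup \<alpha> k} =
      tableaux (shape_of lam) (lookup \<alpha>)"
    by (auto simp: semistandard_tableaux_def tableaux_def diagram_cells)
  moreover have "card (tableaux (shape_of lam) (lookup \<alpha>)) = kostka \<alpha> (shape_of lam)"
    unfolding kostka_def using assms
    by (intro conjunct2[OF card_tableaux]) (auto simp: partitions_of_def is_shape_shape_of beyond_degree_lookup_zero)
  ultimately show ?thesis by (simp add: schur_def)
qed

section \<open>Class functions\<close>

text \<open>Which powers of \<open>w\<close> agree at \<open>x\<close> depends only on the size of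
  the orbit, so two permutations with the same orbits can be compared power by power.\<close>

lemma funpow_eq_iff_mod_card_orbit:
  assumes "permutation w"
  shows "(w ^^ i) x = (w ^^ j) x \<longleftrightarrow> i mod card (Orbits.orbit w x) = j mod card (Orbits.orbit w x)"
proof -
  let ?c = "funpow_dist1 w x x"
  have self: "x \<in> Orbits.orbit w x" by (rule permutation_self_in_orbit[OF assms])
  have c: "card (Orbits.orbit w x) = ?c"
    using inj_on_funpow_dist1[OF self] by (simp add: orbit_conv_funpow_dist1[OF self] card_image del: funpow.simps)
  have per: "(w ^^ ?c) x = x" using funpow_dist1_prop[OF self] .
  have red: "(w ^^ i) x = (w ^^ (i mod ?c)) x" for i
    using funpow_mod_eq[OF per, of i] by simp
  have "(w ^^ (i mod ?c)) x = (w ^^ (j mod ?c)) x \<longleftrightarrow> i mod ?c = j mod ?c"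
    using inj_onD[OF inj_on_funpow_dist1[OF self], of "i mod ?c" "j mod ?c"] by auto
  then show ?thesis unfolding c using red[of i] red[of j] by argo
qed

text \<open>Choose a representative \<open>r\<close> in each orbit and send
  \<open>(w ^^ i) r\<close> to \<open>(\<tau> ^^ i) r\<close>. This is well defined and injective
  because the orbits of \<open>r\<close> under both permutations have the same size.\<close>

lemma same_orbits_imp_conjugate:
  assumes fin: "finite A" and w: "w permutes A" and \<tau>: "\<tau> permutes A"
    and orb: "\<And>a. a \<in> A \<Longrightarrow> Orbits.orbit \<tau> a = Orbits.orbit w a"
  shows "\<exists>g. g permutes A \<and> (\<forall>a\<in>A. g (w a) = \<tau> (g a))"
proof -
  have pw: "permutation w" by (rule permutes_imp_permutation[OF fin w])
  have p\<tau>: "permutation \<tau>" by (rule permutes_imp_permutation[OF fin \<tau>])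
  \<comment> \<open>The choice depends on the orbit alone, hence is constant along orbits.\<close>
  define r where "r a = (SOME b. b \<in> Orbits.orbit w a)" for a
  have r: "r a \<in> Orbits.orbit w a" for a
    unfolding r_def using orbit_nonempty[of w a] by (simp add: some_in_eq)
  have orb_r: "Orbits.orbit w (r a) = Orbits.orbit w a" for a
    by (rule orbit_cyclic_eq3[OF cyclic_on_orbit'[OF pw] r])
  have rw: "r (w a) = r a" for a
    unfolding r_def permutation_orbit_step[OF pw] ..
  have orbA: "Orbits.orbit w a \<subseteq> A" if "a \<in> A" for a
    using permutes_orbit_subset[OF w that] .
  have rA: "r a \<in> A" if "a \<in> A" for a using orbA[OF that] r by auto
  have pow: "(w ^^ i) (r a) = (w ^^ j) (r a) \<longleftrightarrow> (\<tau> ^^ i) (r a) = (\<tau> ^^ j) (r a)" if "a \<in> A" for i j a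
    by (simp add: funpow_eq_iff_mod_card_orbit pw p\<tau> orb[OF rA[OF that]])
  define k where "k a = funpow_dist w (r a) a" for a
  have a_in: "a \<in> Orbits.orbit w (r a)" for a
    unfolding orb_r by (rule permutation_self_in_orbit[OF pw])
  have k: "(w ^^ k a) (r a) = a" for a
    unfolding k_def by (rule funpow_dist_prop[OF a_in])
  define g where "g a = (if a \<in> A then (\<tau> ^^ k a) (r a) else a)" for a
  have g_orb: "g a \<in> Orbits.orbit w a" if "a \<in> A" for a
  proof -
    have "g a \<in> Orbits.orbit \<tau> (r a)"
      using that funpow_in_orbit[OF permutation_self_in_orbit[OF p\<tau>]] by (simp add: g_def)
    then show ?thesis using orb[OF rA[OF that]] orb_r by simp
  qed
  have inj: "inj_on g A"
  proof (rule inj_onI)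
    fix a b assume ab: "a \<in> A" "b \<in> A" "g a = g b"
    have "Orbits.orbit w a = Orbits.orbit w (g a)" "Orbits.orbit w b = Orbits.orbit w (g b)"
      using g_orb ab orbit_cyclic_eq3[OF cyclic_on_orbit'[OF pw]] by metis+
    then have "r a = r b" using ab by (simp add: r_def)
    moreover have "(\<tau> ^^ k a) (r a) = (\<tau> ^^ k b) (r b)" using ab by (simp add: g_def)
    ultimately have "(w ^^ k a) (r a) = (w ^^ k b) (r b)" using pow[OF ab(1)] by simp
    then show "a = b" by (simp add: k)
  qed
  have "g ` A \<subseteq> A" using g_orb orbA by blast
  then have "bij_betw g A A" using inj fin by (simp add: bij_betw_def endo_inj_surj)
  then have "g permutes A" by (auto simp: permutes_altdef g_def)
  moreover have "g (w a) = \<tau> (g a)" if a: "a \<in> A" for a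
  proof -
    have wa: "w a \<in> A" using a by (simp add: permutes_in_image[OF w])
    have "(w ^^ k (w a)) (r a) = (w ^^ Suc (k a)) (r a)"
      using k[of "w a"] k[of a] by (simp add: rw)
    then have "(\<tau> ^^ k (w a)) (r a) = (\<tau> ^^ Suc (k a)) (r a)"
      using pow[OF a] by blast
    then show ?thesis using a wa by (simp add: g_def rw)
  qed
  ultimately show ?thesis by blast
qed

text \<open>Colourings of equal content form a single orbit.\<close>

lemma cols_conjugate:
  assumes fin: "finite A" and f: "f \<in> cols A \<alpha>" "f' \<in> cols A \<alpha>"
  obtains g where "g permutes A" "\<And>a. a \<in> A \<Longrightarrow> f' (g a) = f a"
proof -
  have "card {a \<in> A. f' a = c} = card {a \<in> A. f a = c}" for c
    using f by (simp add: cols_def flip: lookup_content[OF fin])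
  then have "card {x. x permutes A \<and> (\<forall>a\<in>A. f' (x a) = f a)} > 0"
    using card_permutes_matching[of A "f ` A" f f'] fin by (simp add: prod_pos)
  then have "{x. x permutes A \<and> (\<forall>a\<in>A. f' (x a) = f a)} \<noteq> {}" by (metis card.empty less_irrefl)
  then show ?thesis using that by blast
qed

lemma sum_conjugate_stabilizer:
  fixes \<phi> :: "('a \<Rightarrow> 'a) \<Rightarrow> int"
  assumes fin: "finite A" and g: "g permutes A" "\<And>a. a \<in> A \<Longrightarrow> f' (g a) = f a"
    and cls: "\<And>w \<tau> g. w permutes A \<Longrightarrow> \<tau> permutes A \<Longrightarrow> g permutes A \<Longrightarrow>
      (\<And>a. a \<in> A \<Longrightarrow> g (w a) = \<tau> (g a)) \<Longrightarrow> \<phi> w = \<phi> \<tau>"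
  shows "(\<Sum>w | w permutes A \<and> (\<forall>a\<in>A. f' (w a) = f' a). \<phi> w) =
    (\<Sum>w | w permutes A \<and> (\<forall>a\<in>A. f (w a) = f a). \<phi> w)"
proof (rule sum.reindex_bij_witness[where i = "\<lambda>w. g \<circ> w \<circ> inv' g" and j = "\<lambda>w. inv' g \<circ> w \<circ> g"])
  have ig: "inv' g permutes A" by (rule permutes_inv[OF g(1)])
  have gi: "g (inv' g x) = x" "inv' g (g x) = x" for x using permutes_inverses[OF g(1)] by auto
  fix w
  show "g \<circ> (inv' g \<circ> w \<circ> g) \<circ> inv' g = w" by (auto simp: gi)
  show "inv' g \<circ> (g \<circ> w \<circ> inv' g) \<circ> g = w" by (auto simp: gi)
  { assume w: "w \<in> {w. w permutes A \<and> (\<forall>a\<in>A. f' (w a) = f' a)}"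
    then have "inv' g \<circ> w \<circ> g permutes A" using g ig by (auto intro: permutes_compose)
    moreover have "f ((inv' g \<circ> w \<circ> g) a) = f a" if "a \<in> A" for a
      using w that g(2)[of "inv' g (w (g a))"] g(2)[OF that] permutes_in_image[OF ig] permutes_in_image[OF g(1)]
      by (auto simp: gi permutes_in_image)
    ultimately show "inv' g \<circ> w \<circ> g \<in> {w. w permutes A \<and> (\<forall>a\<in>A. f (w a) = f a)}" by blast
    then show "\<phi> (inv' g \<circ> w \<circ> g) = \<phi> w"
      using w g(1) by (intro cls[where g = g]) (auto simp: gi) }
  { assume w: "w \<in> {w. w permutes A \<and> (\<forall>a\<in>A. f (w a) = f a)}"
    then have "g \<circ> w \<circ> inv' g permutes A" using g ig by (auto intro: permutes_compose)
    moreover have "f' ((g \<circ> w \<circ> inv' g) a) = f' a" if "a \<in> A" for a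
    proof -
      have ia: "inv' g a \<in> A" using that permutes_in_image[OF ig] by simp
      then have "w (inv' g a) \<in> A" using w by (auto simp: permutes_in_image)
      then show ?thesis using w ia g(2)[of "w (inv' g a)"] g(2)[OF ia] by (auto simp: gi)
    qed
    ultimately show "g \<circ> w \<circ> inv' g \<in> {w. w permutes A \<and> (\<forall>a\<in>A. f' (w a) = f' a)}" by blast }
qed

text \<open>Colour the points by the cycles of \<open>w\<close>: a permutation preserving this colouring has orbits
  contained in those of \<open>w\<close>, and if all orbits agree it is conjugate to \<open>w\<close>.\<close>

lemma class_function_eq_0:
  fixes \<phi> :: "('a \<Rightarrow> 'a) \<Rightarrow> int"
  assumes fin: "finite A"
    and cls: "\<And>w \<tau> g. w permutes A \<Longrightarrow> \<tau> permutes A \<Longrightarrow> g permutes A \<Longrightarrow>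
      (\<And>a. a \<in> A \<Longrightarrow> g (w a) = \<tau> (g a)) \<Longrightarrow> \<phi> w = \<phi> \<tau>"
    and zero: "\<And>\<alpha>. (\<Sum>w | w permutes A. \<phi> w * int (card (fixcols A \<alpha> w))) = 0"
    and w: "w permutes A"
  shows "\<phi> w = 0"
  using w
\<comment> \<open>The measure counts the pairs of points in a common orbit; it drops strictly when
  orbits are refined.\<close>
proof (induction "card (SIGMA a:A. Orbits.orbit w a)" arbitrary: w rule: less_induct)
  case less
  have perm: "permutation v" if "v permutes A" for v
    using permutes_imp_permutation[OF fin that] .
  have fin_orb: "finite (SIGMA a:A. Orbits.orbit v a)" if "v permutes A" for v
    using fin finite_subset[OF permutes_orbit_subset[OF that]] by auto
  obtain e :: "'a set \<Rightarrow> nat" where e: "inj_on e (Orbits.orbit w ` A)"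
    using finite_imp_inj_to_nat_seg[of "Orbits.orbit w ` A"] fin by auto
  define f where "f = (\<lambda>a\<in>A. e (Orbits.orbit w a))"
  define S where "S = {\<tau>. \<tau> permutes A \<and> (\<forall>a\<in>A. f (\<tau> a) = f a)}"
  have finS: "finite S" unfolding S_def by (rule finite_permutes_subset[OF fin])
  let ?\<alpha> = "content A f"
  have f: "f \<in> cols A ?\<alpha>" by (simp add: cols_def f_def)
  have "0 = (\<Sum>\<tau> | \<tau> permutes A. \<phi> \<tau> * int (card (fixcols A ?\<alpha> \<tau>)))" using zero by simp
  also have "\<dots> = (\<Sum>\<tau> | \<tau> permutes A. \<Sum>f'\<in>cols A ?\<alpha>. if \<forall>a\<in>A. f' (\<tau> a) = f' a then \<phi> \<tau> else 0)"
    by (rule sum.cong) (simp_all add: fixcols_def sum.If_cases finite_cols fin Int_def)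
  also have "\<dots> = (\<Sum>f'\<in>cols A ?\<alpha>. \<Sum>\<tau> | \<tau> permutes A. if \<forall>a\<in>A. f' (\<tau> a) = f' a then \<phi> \<tau> else 0)"
    by (rule sum.swap)
  also have "\<dots> = (\<Sum>f'\<in>cols A ?\<alpha>. \<Sum>\<tau> | \<tau> permutes A \<and> (\<forall>a\<in>A. f' (\<tau> a) = f' a). \<phi> \<tau>)"
    by (rule sum.cong[OF refl]) (simp add: sum.If_cases finite_permutations[OF fin] Int_def)
  also have "\<dots> = (\<Sum>f'\<in>cols A ?\<alpha>. \<Sum>\<tau>\<in>S. \<phi> \<tau>)"
  proof (rule sum.cong)
    fix f' assume "f' \<in> cols A ?\<alpha>"
    then obtain g where "g permutes A" "\<And>a. a \<in> A \<Longrightarrow> f' (g a) = f a"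
      using cols_conjugate[OF fin f] by metis
    then show "(\<Sum>\<tau> | \<tau> permutes A \<and> (\<forall>a\<in>A. f' (\<tau> a) = f' a). \<phi> \<tau>) = (\<Sum>\<tau>\<in>S. \<phi> \<tau>)"
      unfolding S_def by (rule sum_conjugate_stabilizer[OF fin _ _ cls])
  qed simp
  also have "\<dots> = int (card (cols A ?\<alpha>)) * (\<Sum>\<tau>\<in>S. \<phi> \<tau>)" by simp
  \<comment> \<open>The stabilisers of all colourings with this content are conjugate, so the
    vanishing total is a positive multiple of the sum over one of them.\<close>
  finally have S0: "(\<Sum>\<tau>\<in>S. \<phi> \<tau>) = 0"
    using f finite_cols[OF fin, of ?\<alpha>] by (auto simp: card_eq_0_iff)
  have sub: "Orbits.orbit \<tau> a \<subseteq> Orbits.orbit w a" if \<tau>: "\<tau> \<in> S" and a: "a \<in> A" for \<tau> a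
  proof
    fix b assume b: "b \<in> Orbits.orbit \<tau> a"
    have \<tau>p: "\<tau> permutes A" using \<tau> by (simp add: S_def)
    from b have "b \<in> A \<and> f b = f a"
    proof induction
      case base then show ?case using \<tau> a by (auto simp: S_def permutes_in_image)
    next
      case (step b) then show ?case using \<tau> by (auto simp: S_def permutes_in_image)
    qed
    then have "Orbits.orbit w b = Orbits.orbit w a" using a inj_onD[OF e, of "Orbits.orbit w b" "Orbits.orbit w a"] by (auto simp: f_def)
    then show "b \<in> Orbits.orbit w a" using permutation_self_in_orbit[OF perm[OF less.prems]] by auto
  qed
  have val: "\<phi> \<tau> = (if \<forall>a\<in>A. Orbits.orbit \<tau> a = Orbits.orbit w a then \<phi> w else 0)" if \<tau>: "\<tau> \<in> S" for \<tau>
  proof (cases "\<forall>a\<in>A. Orbits.orbit \<tau> a = Orbits.orbit w a")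
    case True
    have \<tau>p: "\<tau> permutes A" using \<tau> by (simp add: S_def)
    obtain g where "g permutes A" "\<forall>a\<in>A. g (w a) = \<tau> (g a)"
      using same_orbits_imp_conjugate[OF fin less.prems \<tau>p] True by auto
    then have "\<phi> w = \<phi> \<tau>" using cls[OF less.prems \<tau>p, of g] by auto
    then show ?thesis using True by simp
  next
    case False
    have \<tau>p: "\<tau> permutes A" using \<tau> by (simp add: S_def)
    have "(SIGMA a:A. Orbits.orbit \<tau> a) \<subset> (SIGMA a:A. Orbits.orbit w a)"
      using False sub[OF \<tau>] by blast
    then have "card (SIGMA a:A. Orbits.orbit \<tau> a) < card (SIGMA a:A. Orbits.orbit w a)"
      by (rule psubset_card_mono[OF fin_orb[OF less.prems]])
    then have "\<phi> \<tau> = 0" by (rule less.hyps[OF _ \<tau>p])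
    then show ?thesis using False by auto
  qed
  have "(\<Sum>\<tau>\<in>S. \<phi> \<tau>) = (\<Sum>\<tau>\<in>S. if \<forall>a\<in>A. Orbits.orbit \<tau> a = Orbits.orbit w a then \<phi> w else 0)"
    by (rule sum.cong) (simp_all only: val)
  also have "\<dots> = \<phi> w * int (card {\<tau> \<in> S. \<forall>a\<in>A. Orbits.orbit \<tau> a = Orbits.orbit w a})"
    using finS by (simp add: sum.If_cases Int_def)
  finally have prod0: "\<phi> w * int (card {\<tau> \<in> S. \<forall>a\<in>A. Orbits.orbit \<tau> a = Orbits.orbit w a}) = 0" using S0 by simp
  have "w \<in> S"
    using less.prems permutation_orbit_step[OF perm[OF less.prems]]
    by (auto simp: S_def f_def permutes_in_image)
  then have "card {\<tau> \<in> S. \<forall>a\<in>A. Orbits.orbit \<tau> a = Orbits.orbit w a} \<noteq> 0"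
    using finS by (auto simp: card_eq_0_iff)
  then show ?case using prod0 by auto
qed

section \<open>Orthonormal class functions\<close>

text \<open>The row of an element \<open>p0\<close> of least rank vanishes off the diagonal. Hence
  the unknown \<open>x p0\<close> occurs only in the equation at \<open>p0\<close>, and that
  equation can be solved last.\<close>

lemma triangular_solve:
  fixes K :: "'p \<Rightarrow> 'p \<Rightarrow> int" and r :: "'p \<Rightarrow> nat"
  assumes "finite P" and "\<And>p. p \<in> P \<Longrightarrow> K p p = 1"
    and "\<And>p q. p \<in> P \<Longrightarrow> q \<in> P \<Longrightarrow> p \<noteq> q \<Longrightarrow> K p q \<noteq> 0 \<Longrightarrow> r q < r p"
  shows "\<exists>x. \<forall>q\<in>P. (\<Sum>p\<in>P. x p * K p q) = b q"
  using assms
proof (induction "card P" arbitrary: P)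
  case 0 then show ?case by simp
next
  case (Suc n)
  then have "P \<noteq> {}" by auto
  then obtain p0 where p0: "p0 \<in> P" "\<And>p. p \<in> P \<Longrightarrow> r p0 \<le> r p"
    using ex_min_if_finite[of "r ` P"] Suc.prems(1) by (metis (no_types, lifting) arg_min_if_finite(1,2) not_le)
  let ?P = "P - {p0}"
  have K0: "K p0 q = 0" if "q \<in> ?P" for q using Suc.prems(3)[of p0 q] p0(1) p0(2)[of q] that by force
  obtain x where x: "\<And>q. q \<in> ?P \<Longrightarrow> (\<Sum>p\<in>?P. x p * K p q) = b q"
  proof -
    have "\<exists>x. \<forall>q\<in>?P. (\<Sum>p\<in>?P. x p * K p q) = b q"
      by (rule Suc.hyps(1)) (use Suc.hyps(2) Suc.prems p0 in auto)
    then show ?thesis using that by blast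
  qed
  let ?x = "x(p0 := b p0 - (\<Sum>p\<in>?P. x p * K p p0))"
  have "(\<Sum>p\<in>P. ?x p * K p q) = b q" if q: "q \<in> P" for q
  proof -
    have "(\<Sum>p\<in>P. ?x p * K p q) = ?x p0 * K p0 q + (\<Sum>p\<in>?P. ?x p * K p q)"
      by (rule sum.remove[OF Suc.prems(1) p0(1)])
    also have "(\<Sum>p\<in>?P. ?x p * K p q) = (\<Sum>p\<in>?P. x p * K p q)" by (rule sum.cong) auto
    finally show ?thesis using x[of q] K0[of q] q Suc.prems(2)[OF p0(1)] by (cases "q = p0") auto
  qed
  then show ?case by blast
qed

lemma sum_mult_delta:
  fixes F :: "'p \<Rightarrow> 'b :: semiring_1"
  assumes "finite P" "q \<in> P"
  shows "(\<Sum>t\<in>P. F t * (if t = q then 1 else 0)) = F q" "(\<Sum>t\<in>P. F t * (if q = t then 1 else 0)) = F q"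
proof -
  have "(\<Sum>t\<in>P. F t * (if t = q then 1 else 0)) = (\<Sum>t\<in>P. if t = q then F t else 0)"
    by (rule sum.cong) auto
  then show "(\<Sum>t\<in>P. F t * (if t = q then 1 else 0)) = F q" using assms by simp
  then show "(\<Sum>t\<in>P. F t * (if q = t then 1 else 0)) = F q" by (simp only: eq_commute[of q])
qed

text \<open>Left and right inverse are found separately, the latter from the transposed matrix with
  reversed rank, and they coincide by associativity.\<close>

lemma triangular_inverse:
  fixes K :: "'p \<Rightarrow> 'p \<Rightarrow> int" and r :: "'p \<Rightarrow> nat"
  assumes fin: "finite P" and diag: "\<And>p. p \<in> P \<Longrightarrow> K p p = 1"
    and tri: "\<And>p q. p \<in> P \<Longrightarrow> q \<in> P \<Longrightarrow> p \<noteq> q \<Longrightarrow> K p q \<noteq> 0 \<Longrightarrow> r q < r p"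
  shows "\<exists>J. \<forall>p\<in>P. \<forall>q\<in>P. (\<Sum>t\<in>P. J p t * K t q) = (if p = q then 1 else 0) \<and>
    (\<Sum>t\<in>P. K p t * J t q) = (if p = q then 1 else 0)"
proof -
  have "\<exists>x. \<forall>q\<in>P. (\<Sum>t\<in>P. x t * K t q) = (if p = q then 1 else 0)" for p
    by (rule triangular_solve[of P K r]) (use assms in auto)
  then obtain J where J: "\<And>p q. q \<in> P \<Longrightarrow> (\<Sum>t\<in>P. J p t * K t q) = (if p = q then 1 else 0)" by metis
  have "\<exists>x. \<forall>p\<in>P. (\<Sum>t\<in>P. x t * K p t) = (if p = q then 1 else 0)" for q
  proof -
    have Max: "r p \<le> Max (r ` P)" if "p \<in> P" for p using fin that by simp
    show ?thesis
    proof (rule triangular_solve[of P "\<lambda>p q. K q p" "\<lambda>p. Max (r ` P) - r p"])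
      fix p q assume "p \<in> P" "q \<in> P" "p \<noteq> q" "K q p \<noteq> 0"
      then have "r p < r q" "r q \<le> Max (r ` P)" using tri[of q p] Max by auto
      then show "Max (r ` P) - r q < Max (r ` P) - r p" by linarith
    qed (use fin diag in auto)
  qed
  then obtain J' where J': "\<And>p q. p \<in> P \<Longrightarrow> (\<Sum>t\<in>P. J' q t * K p t) = (if p = q then 1 else 0)" by metis
  have "J p q = J' q p" if "p \<in> P" "q \<in> P" for p q
  proof -
    have "J p q = (\<Sum>t\<in>P. J p t * (if t = q then 1 else 0))" using sum_mult_delta[OF fin that(2), of "J p"] by simp
    also have "\<dots> = (\<Sum>t\<in>P. J p t * (\<Sum>u\<in>P. J' q u * K t u))"
      by (rule sum.cong) (simp_all add: J')
    also have "\<dots> = (\<Sum>t\<in>P. \<Sum>u\<in>P. J p t * (J' q u * K t u))" by (simp add: sum_distrib_left)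
    also have "\<dots> = (\<Sum>u\<in>P. \<Sum>t\<in>P. J p t * (J' q u * K t u))" by (rule sum.swap)
    also have "\<dots> = (\<Sum>u\<in>P. J' q u * (\<Sum>t\<in>P. J p t * K t u))" by (simp add: sum_distrib_left mult_ac)
    also have "\<dots> = (\<Sum>u\<in>P. J' q u * (if p = u then 1 else 0))"
      by (rule sum.cong) (simp_all add: J)
    also have "\<dots> = J' q p" by (rule sum_mult_delta[OF fin that(1)])
    finally show ?thesis .
  qed
  then have "(\<Sum>t\<in>P. K p t * J t q) = (if p = q then 1 else 0)" if "p \<in> P" "q \<in> P" for p q
    using that J'[of p q] by (simp add: mult.commute)
  then show ?thesis using J by blast
qed

section \<open>The Kostka matrix and the dominance order\<close>

lemma shape_of_pos: "0 < shape_of lam i \<Longrightarrow> i < length lam"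
  by (cases "i < length lam") (simp_all add: shape_of_def)

definition part_mono :: "nat list \<Rightarrow> monomial" where
  "part_mono lam = Abs_poly_mapping (shape_of lam)"

lemma lookup_part_mono: "lookup (part_mono lam) = shape_of lam"
proof -
  have "{i. shape_of lam i \<noteq> 0} \<subseteq> {..<length lam}" by (auto dest: shape_of_pos)
  then have "finite {i. shape_of lam i \<noteq> 0}" by (rule finite_subset) simp
  then show ?thesis by (simp add: part_mono_def)
qed

lemma mdeg_part_mono: "mdeg (part_mono lam) = sum_list lam"
proof -
  have "mdeg (part_mono lam) = (\<Sum>i<length lam. shape_of lam i)"
    by (subst mdeg_superset[of "{..<length lam}"]) (auto simp: lookup_part_mono in_keys_iff dest: shape_of_pos)
  then show ?thesis by (simp add: shape_of_def sum_list_sum_nth atLeast0LessThan)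
qed

definition kostka_number :: "nat list \<Rightarrow> nat list \<Rightarrow> int" where
  "kostka_number lam mu = int (kostka (part_mono mu) (shape_of lam))"

definition dominates :: "nat list \<Rightarrow> nat list \<Rightarrow> bool" where
  "dominates lam mu \<longleftrightarrow> (\<forall>j. (\<Sum>i<j. shape_of mu i) \<le> (\<Sum>i<j. shape_of lam i))"

lemma kostka_number_dominates: "kostka_number lam mu \<noteq> 0 \<Longrightarrow> dominates lam mu"
  using kostka_dominance[of "part_mono mu" "shape_of lam"]
  by (simp add: kostka_number_def dominates_def lookup_part_mono)

lemma kostka_number_self: "lam \<in> partitions_of n \<Longrightarrow> kostka_number lam lam = 1"
  using kostka_self[of "part_mono lam"]
  by (simp add: kostka_number_def lookup_part_mono is_shape_shape_of partitions_of_def)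

lemma shape_of_inject:
  "lam \<in> partitions_of n \<Longrightarrow> mu \<in> partitions_of n \<Longrightarrow> shape_of lam = shape_of mu \<longleftrightarrow> lam = mu"
  using bij_shape_of[of n] by (auto simp: bij_betw_def inj_on_def)

lemma partial_sums_determine:
  fixes f g :: "nat \<Rightarrow> nat"
  assumes "\<And>j. (\<Sum>i<j. f i) = (\<Sum>i<j. g i)" shows "f = g"
proof
  fix i show "f i = g i" using assms[of i] assms[of "Suc i"] by simp
qed

lemma dominates_antisym:
  "lam \<in> partitions_of n \<Longrightarrow> mu \<in> partitions_of n \<Longrightarrow> dominates lam mu \<Longrightarrow> dominates mu lam \<Longrightarrow> lam = mu"
  by (metis dominates_def shape_of_inject partial_sums_determine antisym)

text \<open>The sum of all partial sums is strictly monotone for dominance and thus provides the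
  rank needed for the inversion. Partial sums up to \<open>n\<close> are enough, since a shape of
  size \<open>n\<close> has at most \<open>n\<close> rows.\<close>

lemma kostka_number_triangular:
  assumes lam: "lam \<in> partitions_of n" and mu: "mu \<in> partitions_of n"
    and "lam \<noteq> mu" "kostka_number lam mu \<noteq> 0"
  shows "(\<Sum>j\<le>n. \<Sum>i<j. shape_of mu i) < (\<Sum>j\<le>n. \<Sum>i<j. shape_of lam i)"
proof (rule ccontr)
  assume not_less: "\<not> ?thesis"
  have dom: "(\<Sum>i<j. shape_of mu i) \<le> (\<Sum>i<j. shape_of lam i)" for j
    using kostka_number_dominates[OF assms(4)] by (simp add: dominates_def)
  have eq: "(\<Sum>i<j. shape_of mu i) = (\<Sum>i<j. shape_of lam i)" if "j \<le> n" for j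
  proof (rule ccontr)
    assume "(\<Sum>i<j. shape_of mu i) \<noteq> (\<Sum>i<j. shape_of lam i)"
    then have "(\<Sum>j\<le>n. \<Sum>i<j. shape_of mu i) < (\<Sum>j\<le>n. \<Sum>i<j. shape_of lam i)"
      using dom that by (intro sum_strict_mono_ex1) (auto intro!: bexI[of _ j] le_neq_implies_less)
    then show False using not_less by simp
  qed
  have supp: "shape_of x i = 0" if "x \<in> partitions_of n" "i \<ge> n" for x i
    using shape_support[of "shape_of x" i] that by (simp add: is_shape_shape_of ssize_shape_of partitions_of_def)
  have "shape_of mu i = shape_of lam i" for i
  proof (cases "i < n")
    case True
    then show ?thesis using eq[of i] eq[of "Suc i"] by simp
  next
    case False
    then show ?thesis using supp[OF lam, of i] supp[OF mu, of i] by simp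
  qed
  then have "shape_of mu = shape_of lam" by blast
  then show False using shape_of_inject[OF lam mu] assms(3) by simp
qed

text \<open>The entries are integers, so that \<open>frob_char\<close> becomes an integer
  combination of permutation characters.\<close>

definition inverse_kostka :: "nat \<Rightarrow> nat list \<Rightarrow> nat list \<Rightarrow> int" where
  "inverse_kostka n = (SOME J. \<forall>p\<in>partitions_of n. \<forall>q\<in>partitions_of n.
    (\<Sum>t\<in>partitions_of n. J p t * kostka_number t q) = (if p = q then 1 else 0) \<and>
    (\<Sum>t\<in>partitions_of n. kostka_number p t * J t q) = (if p = q then 1 else 0))"

lemma inverse_kostka:
  assumes "p \<in> partitions_of n" "q \<in> partitions_of n"
  shows "(\<Sum>t\<in>partitions_of n. inverse_kostka n p t * kostka_number t q) = (if p = q then 1 else 0)"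
    "(\<Sum>t\<in>partitions_of n. kostka_number p t * inverse_kostka n t q) = (if p = q then 1 else 0)"
proof -
  have "\<exists>J. \<forall>p\<in>partitions_of n. \<forall>q\<in>partitions_of n.
    (\<Sum>t\<in>partitions_of n. J p t * kostka_number t q) = (if p = q then 1 else 0) \<and>
    (\<Sum>t\<in>partitions_of n. kostka_number p t * J t q) = (if p = q then 1 else 0)"
    by (rule triangular_inverse[of _ _ "\<lambda>lam. \<Sum>j\<le>n. \<Sum>i<j. shape_of lam i"])
      (use finite_partitions_of kostka_number_self kostka_number_triangular in blast)+
  from someI_ex[OF this] show "(\<Sum>t\<in>partitions_of n. inverse_kostka n p t * kostka_number t q) = (if p = q then 1 else 0)"
    "(\<Sum>t\<in>partitions_of n. kostka_number p t * inverse_kostka n t q) = (if p = q then 1 else 0)"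
    using assms unfolding inverse_kostka_def by blast+
qed

text \<open>Every exponent vector is a rearrangement of a partition, so symmetric data are
  determined at the monomials \<open>part_mono lam\<close>.\<close>

lemma sort_monomial:
  assumes "mdeg \<alpha> = n"
  obtains lam \<pi> where "lam \<in> partitions_of n" "bij \<pi>" "shape_of lam = lookup \<alpha> \<circ> \<pi>"
proof -
  define L where "L = Poly_Mapping.degree \<alpha>"
  define xs where "xs = rev (sort (map (lookup \<alpha>) [0..<L]))"
  define \<rho> where "\<rho> i = (if i < L then xs ! i else 0)" for i
  have len: "length xs = L" by (simp add: xs_def)
  have z: "lookup \<alpha> i = 0" if "i \<ge> L" for i
    using that unfolding L_def by (rule beyond_degree_lookup_zero)
  have "sorted_wrt (\<ge>) xs" by (simp add: xs_def sorted_wrt_rev)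
  then have desc: "xs ! j \<le> xs ! i" if "i < j" "j < L" for i j
    using that len by (simp add: sorted_wrt_iff_nth_less)
  then have sh: "is_shape \<rho>" by (auto simp: is_shape_def \<rho>_def intro!: exI[of _ L])
  have "image_mset \<rho> (mset_set {..<L}) = mset (map \<rho> [0..<L])"
    by (simp add: mset_upt atLeast0LessThan)
  also have "map \<rho> [0..<L] = xs" by (rule nth_equalityI) (simp_all add: len \<rho>_def)
  also have "mset xs = mset (map (lookup \<alpha>) [0..<L])" by (simp add: xs_def)
  also have "\<dots> = image_mset (lookup \<alpha>) (mset_set {..<L})"
    by (simp add: mset_upt atLeast0LessThan)
  finally obtain \<pi> where \<pi>: "\<pi> permutes {..<L}" "\<forall>i\<in>{..<L}. \<rho> i = lookup \<alpha> (\<pi> i)"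
    by (rule image_mset_eq_implies_permutes[OF finite_lessThan])
  have eq: "\<rho> = lookup \<alpha> \<circ> \<pi>"
  proof
    fix i show "\<rho> i = (lookup \<alpha> \<circ> \<pi>) i"
      using \<pi> z[of i] permutes_not_in[OF \<pi>(1), of i] by (cases "i < L") (auto simp: \<rho>_def)
  qed
  have "ssize \<rho> = (\<Sum>i<L. \<rho> i)" by (rule ssize_eq) (simp add: \<rho>_def)
  also have "\<dots> = (\<Sum>i<L. lookup \<alpha> (\<pi> i))" by (simp add: eq)
  also have "\<dots> = (\<Sum>i<L. lookup \<alpha> i)"
    using sum.permute[OF \<pi>(1), of "lookup \<alpha>"] by simp
  also have "\<dots> = n" using mdeg_superset[OF _ keys_less_degree, of \<alpha>] assms by (simp add: L_def)
  finally have "\<rho> \<in> shapes n" using sh by (simp add: shapes_def)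
  then have "\<rho> \<in> shape_of ` partitions_of n" using bij_shape_of[of n] by (simp add: bij_betw_def)
  then obtain lam where "lam \<in> partitions_of n" "shape_of lam = \<rho>" by blast
  then show ?thesis using that[of lam \<pi>] eq permutes_bij[OF \<pi>(1)] by simp
qed

section \<open>Permutation characters on colourings and their Kostka inversion\<close>

lemma content_permute:
  assumes "finite A" "g permutes A"
  shows "content A (f \<circ> g) = content A f"
  unfolding content_def using sum.permute[OF assms(2), of "\<lambda>a. single (f a) 1", symmetric] by (simp only: o_def)

lemma card_fixcols_symmetric_le:
  assumes fin: "finite A" and w: "w permutes A"
    and \<pi>: "bij \<pi>" and \<beta>: "lookup \<beta> = lookup \<alpha> \<circ> \<pi>"
  shows "card (fixcols A \<beta> w) \<le> card (fixcols A \<alpha> w)"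
proof (rule card_inj_on_le[of "\<lambda>f. \<lambda>a. if a \<in> A then \<pi> (f a) else undefined"])
  show "inj_on (\<lambda>f a. if a \<in> A then \<pi> (f a) else undefined) (fixcols A \<beta> w)"
  proof (rule inj_onI)
    fix f g assume f: "f \<in> fixcols A \<beta> w" and g: "g \<in> fixcols A \<beta> w"
      and eq: "(\<lambda>a. if a \<in> A then \<pi> (f a) else undefined) = (\<lambda>a. if a \<in> A then \<pi> (g a) else undefined)"
    show "f = g"
    proof
      fix a
      have "\<pi> (f a) = \<pi> (g a)" if "a \<in> A" using fun_cong[OF eq, of a] that by simp
      then show "f a = g a" using f g bij_is_inj[OF \<pi>]
        by (cases "a \<in> A") (auto simp: fixcols_def cols_def extensional_def dest: injD)
    qed
  qed
  show "(\<lambda>f a. if a \<in> A then \<pi> (f a) else undefined) ` fixcols A \<beta> w \<subseteq> fixcols A \<alpha> w"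
  proof (intro image_subsetI)
    fix f assume f: "f \<in> fixcols A \<beta> w"
    let ?f = "\<lambda>a. if a \<in> A then \<pi> (f a) else undefined"
    have cf: "content A f = \<beta>" using f by (simp add: fixcols_def cols_def)
    have "content A ?f = \<alpha>"
    proof (rule poly_mapping_eqI)
      fix k
      obtain k' where k': "k = \<pi> k'" using bij_is_surj[OF \<pi>] by (metis surjD)
      have "{a \<in> A. ?f a = k} = {a \<in> A. f a = k'}" using bij_is_inj[OF \<pi>] by (auto simp: k' dest: injD)
      then have "lookup (content A ?f) k = lookup \<beta> k'"
        using cf fin by (simp only: lookup_content) (simp add: lookup_content flip: cf)
      then show "lookup (content A ?f) k = lookup \<alpha> k" by (simp add: \<beta> k')
    qed
    moreover have "?f (w a) = ?f a" if "a \<in> A" for a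
      using f that permutes_in_image[OF w] by (simp add: fixcols_def)
    ultimately show "?f \<in> fixcols A \<alpha> w" by (simp add: fixcols_def cols_def extensional_def)
  qed
qed (rule finite_fixcols[OF fin])

lemma card_fixcols_symmetric:
  assumes fin: "finite A" and w: "w permutes A"
    and \<pi>: "bij \<pi>" and \<beta>: "lookup \<beta> = lookup \<alpha> \<circ> \<pi>"
  shows "card (fixcols A \<beta> w) = card (fixcols A \<alpha> w)"
proof (rule antisym)
  have "lookup \<alpha> = lookup \<beta> \<circ> inv' \<pi>"
    using surj_f_inv_f[OF bij_is_surj[OF \<pi>]] by (simp add: \<beta> fun_eq_iff)
  then show "card (fixcols A \<alpha> w) \<le> card (fixcols A \<beta> w)"
    by (rule card_fixcols_symmetric_le[OF fin w bij_imp_bij_inv[OF \<pi>]])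
qed (rule card_fixcols_symmetric_le[OF assms])

lemma card_fixcols_conjugate_le:
  assumes fin: "finite A" and g: "g permutes A" and w: "w permutes A" and eq: "\<And>a. a \<in> A \<Longrightarrow> g (w a) = \<tau> (g a)"
  shows "card (fixcols A \<alpha> \<tau>) \<le> card (fixcols A \<alpha> w)"
proof (rule card_inj_on_le[of "\<lambda>f. restrict (f \<circ> g) A"])
  have gA: "g a \<in> A \<longleftrightarrow> a \<in> A" for a by (rule permutes_in_image[OF g])
  show "inj_on (\<lambda>f. restrict (f \<circ> g) A) (fixcols A \<alpha> \<tau>)"
  proof (rule inj_onI)
    fix f f' assume f: "f \<in> fixcols A \<alpha> \<tau>" "f' \<in> fixcols A \<alpha> \<tau>" and eq: "restrict (f \<circ> g) A = restrict (f' \<circ> g) A"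
    show "f = f'"
    proof
      fix b
      obtain a where a: "b = g a" using permutes_surj[OF g] by (metis surjD)
      show "f b = f' b" using fun_cong[OF eq, of a] f gA[of a]
        by (cases "a \<in> A") (auto simp: a fixcols_def cols_def extensional_def)
    qed
  qed
  show "(\<lambda>f. restrict (f \<circ> g) A) ` fixcols A \<alpha> \<tau> \<subseteq> fixcols A \<alpha> w"
  proof (intro image_subsetI)
    fix f assume f: "f \<in> fixcols A \<alpha> \<tau>"
    have "content A (restrict (f \<circ> g) A) = content A (f \<circ> g)" by (rule content_cong) simp
    also have "\<dots> = \<alpha>" using f content_permute[OF fin g] by (simp add: fixcols_def cols_def)
    finally show "restrict (f \<circ> g) A \<in> fixcols A \<alpha> w"
      using f gA permutes_in_image[OF w] by (simp add: fixcols_def cols_def eq)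
  qed
qed (rule finite_fixcols[OF fin])

lemma card_fixcols_conjugate:
  assumes fin: "finite A" and w: "w permutes A" and \<tau>: "\<tau> permutes A" and g: "g permutes A"
    and eq: "\<And>a. a \<in> A \<Longrightarrow> g (w a) = \<tau> (g a)"
  shows "card (fixcols A \<alpha> w) = card (fixcols A \<alpha> \<tau>)"
proof (rule antisym)
  show "card (fixcols A \<alpha> \<tau>) \<le> card (fixcols A \<alpha> w)" by (rule card_fixcols_conjugate_le[OF fin g w eq])
  have ig: "inv' g permutes A" by (rule permutes_inv[OF g])
  have "inv' g (\<tau> a) = w (inv' g a)" if "a \<in> A" for a
  proof -
    have "inv' g a \<in> A" using that permutes_in_image[OF ig] by simp
    then have "g (w (inv' g a)) = \<tau> a" using eq[of "inv' g a"] permutes_inverses[OF g] by simp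
    then show ?thesis using permutes_inverses[OF g] by metis
  qed
  then show "card (fixcols A \<alpha> w) \<le> card (fixcols A \<alpha> \<tau>)"
    by (rule card_fixcols_conjugate_le[OF fin ig \<tau>])
qed

lemma card_fixcols_0: "mdeg \<alpha> \<noteq> card A \<Longrightarrow> card (fixcols A \<alpha> w) = 0"
proof -
  assume "mdeg \<alpha> \<noteq> card A"
  then have "fixcols A \<alpha> w = {}" using mdeg_content[of A] by (auto simp: fixcols_def cols_def)
  then show ?thesis by simp
qed

text \<open>It turns out to be the irreducible character labelled by \<open>lam\<close>.\<close>

definition frob_char :: "'a set \<Rightarrow> nat list \<Rightarrow> ('a \<Rightarrow> 'a) \<Rightarrow> int" where
  "frob_char A lam w = (\<Sum>mu\<in>partitions_of (card A).
     inverse_kostka (card A) mu lam * int (card (fixcols A (part_mono mu) w)))"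

lemma sum_shapes_partitions: "(\<Sum>\<nu>\<in>shapes n. F \<nu>) = (\<Sum>lam\<in>partitions_of n. F (shape_of lam))"
  by (rule sum.reindex_bij_betw[OF bij_shape_of, symmetric])

lemma kostka_part_mono:
  assumes "lam \<in> partitions_of n" "bij \<pi>" "shape_of lam = lookup \<alpha> \<circ> \<pi>"
  shows "kostka (part_mono lam) = kostka \<alpha>"
  by (rule kostka_symmetric[OF assms(2)]) (simp add: lookup_part_mono assms)

text \<open>Young's rule. For partitions it holds by the construction of \<open>frob_char\<close>,
  for other monomials by symmetry.\<close>

lemma card_fixcols_expand:
  assumes fin: "finite A" and w: "w permutes A" and \<alpha>: "mdeg \<alpha> = card A"
  shows "int (card (fixcols A \<alpha> w)) =
    (\<Sum>lam\<in>partitions_of (card A). int (kostka \<alpha> (shape_of lam)) * frob_char A lam w)"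
proof -
  let ?P = "partitions_of (card A)" and ?J = "inverse_kostka (card A)"
  obtain mu \<pi> where mu: "mu \<in> ?P" "bij \<pi>" "shape_of mu = lookup \<alpha> \<circ> \<pi>"
    by (rule sort_monomial[OF \<alpha>])
  let ?\<theta> = "\<lambda>t. int (card (fixcols A (part_mono t) w))"
  have "(\<Sum>lam\<in>?P. int (kostka \<alpha> (shape_of lam)) * frob_char A lam w) =
      (\<Sum>lam\<in>?P. \<Sum>t\<in>?P. kostka_number lam mu * (?J t lam * ?\<theta> t))"
    using kostka_part_mono[OF mu] by (simp add: frob_char_def sum_distrib_left kostka_number_def)
  also have "\<dots> = (\<Sum>t\<in>?P. \<Sum>lam\<in>?P. kostka_number lam mu * (?J t lam * ?\<theta> t))" by (rule sum.swap)
  also have "\<dots> = (\<Sum>t\<in>?P. (\<Sum>lam\<in>?P. ?J t lam * kostka_number lam mu) * ?\<theta> t)"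
    by (simp add: sum_distrib_left sum_distrib_right mult_ac)
  also have "\<dots> = (\<Sum>t\<in>?P. (if t = mu then 1 else 0) * ?\<theta> t)"
    by (rule sum.cong) (simp_all add: inverse_kostka mu)
  also have "\<dots> = ?\<theta> mu" using mu(1) finite_partitions_of by (simp add: if_distrib[of "\<lambda>x. x * _"] cong: if_cong)
  also have "\<dots> = int (card (fixcols A \<alpha> w))"
    using card_fixcols_symmetric[OF fin w mu(2), of "part_mono mu" \<alpha>] mu(3)
    by (simp add: lookup_part_mono)
  finally show ?thesis ..
qed

text \<open>Orbit times stabiliser for a colouring: the case of \<open>card_fcontents\<close> with a
  single fibre.\<close>

lemma card_cols_mfact:
  assumes fin: "finite A" and \<alpha>: "mdeg \<alpha> = card A"
  shows "card (cols A \<alpha>) * mfact \<alpha> = fact (card A)"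
proof -
  have "card {f \<in> extensional A. fcontents A {()} (\<lambda>_. ()) f = (\<lambda>i\<in>{()}. \<alpha>)} * (\<Prod>i\<in>{()}. mfact ((\<lambda>i\<in>{()}. \<alpha>) i)) =
      (\<Prod>i\<in>{()}. fact (card {a \<in> A. () = i}))"
    using fin \<alpha> by (intro card_fcontents) auto
  moreover have "{f \<in> extensional A. fcontents A {()} (\<lambda>_. ()) f = (\<lambda>i\<in>{()}. \<alpha>)} = cols A \<alpha>"
    by (auto simp: cols_def fcontents_def fun_eq_iff restrict_def)
  ultimately show ?thesis by simp
qed

text \<open>The map \<open>h\<close> will be the identity for inner products and squaring for square
  roots.\<close>

lemma sum_over_fixcols:
  fixes F :: "('a \<Rightarrow> 'a) \<Rightarrow> 'b :: comm_semiring_1"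
  assumes fin: "finite A" "finite W"
  shows "(\<Sum>w\<in>W. of_nat (card (fixcols A \<alpha> (h w))) * F w) =
    (\<Sum>f\<in>cols A \<alpha>. \<Sum>w | w \<in> W \<and> (\<forall>a\<in>A. f (h w a) = f a). F w)"
proof -
  have "(\<Sum>w\<in>W. of_nat (card (fixcols A \<alpha> (h w))) * F w) =
      (\<Sum>w\<in>W. \<Sum>f\<in>cols A \<alpha>. if \<forall>a\<in>A. f (h w a) = f a then F w else 0)"
    by (rule sum.cong[OF refl]) (simp add: fixcols_def sum.If_cases finite_cols[OF fin(1)] Int_def)
  also have "\<dots> = (\<Sum>f\<in>cols A \<alpha>. \<Sum>w\<in>W. if \<forall>a\<in>A. f (h w a) = f a then F w else 0)" by (rule sum.swap)
  also have "\<dots> = (\<Sum>f\<in>cols A \<alpha>. \<Sum>w | w \<in> W \<and> (\<forall>a\<in>A. f (h w a) = f a). F w)"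
    by (rule sum.cong[OF refl]) (simp add: sum.If_cases fin(2) Int_def)
  finally show ?thesis .
qed

lemma prod_fact_content:
  assumes fin: "finite A" and f: "f \<in> cols A \<alpha>" and k: "keys \<alpha> \<subseteq> {..<k}"
  shows "(\<Prod>i\<in>{..<k}. fact (card {a \<in> A. f a = i})) = mfact \<alpha>"
    "(\<lambda>i. card {a \<in> A. f a = i}) = lookup \<alpha>" "a \<in> A \<Longrightarrow> f a \<in> {..<k}"
proof -
  have c: "content A f = \<alpha>" using f by (simp add: cols_def)
  show l: "(\<lambda>i. card {a \<in> A. f a = i}) = lookup \<alpha>"
    using lookup_content[OF fin, of f] c by (simp add: fun_eq_iff)
  show "(\<Prod>i\<in>{..<k}. fact (card {a \<in> A. f a = i})) = mfact \<alpha>"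
    using mfact_superset[OF _ k] fun_cong[OF l] by simp
  show "f a \<in> {..<k}" if "a \<in> A" using that k keys_content[OF fin, of f] c by auto
qed

text \<open>A fixed colouring of content \<mu> is taken as the labelling in
  \<open>sum_fixcols_fibre\<close> with \<open>\<sigma> = id\<close>. The inner sum then counts
  matrices with row sums \<mu> and column sums \<alpha>, and the Cauchy identity rewrites their
  number.\<close>

lemma sum_fixcols_fixcols:
  assumes fin: "finite A" and \<mu>: "mdeg \<mu> = card A" and \<alpha>: "mdeg \<alpha> = card A"
  shows "(\<Sum>w | w permutes A. card (fixcols A \<mu> w) * card (fixcols A \<alpha> w)) =
    fact (card A) * (\<Sum>lam\<in>partitions_of (card A). kostka \<mu> (shape_of lam) * kostka \<alpha> (shape_of lam))"
proof -
  let ?k = "Poly_Mapping.degree \<mu>" and ?W = "{w. w permutes A}"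
  note k = keys_less_degree[of \<mu>]
  let ?m = "card (invariant_tuples {..<?k} id (lookup \<mu>) \<alpha>)"
  have "(\<Sum>w\<in>?W. card (fixcols A \<mu> w) * card (fixcols A \<alpha> w)) =
      (\<Sum>f\<in>cols A \<mu>. \<Sum>w | w \<in> ?W \<and> (\<forall>a\<in>A. f (w a) = f a). card (fixcols A \<alpha> w))"
    using sum_over_fixcols[OF fin finite_permutations[OF fin], of \<mu> "\<lambda>w. w" "\<lambda>w. card (fixcols A \<alpha> w)"] by simp
  also have "\<dots> = (\<Sum>f\<in>cols A \<mu>. mfact \<mu> * ?m)"
  proof (rule sum.cong[OF refl])
    fix f assume f: "f \<in> cols A \<mu>"
    have fk: "f a \<in> {..<?k}" if "a \<in> A" for a using prod_fact_content(3)[OF fin f k that] .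
    show "(\<Sum>w | w \<in> ?W \<and> (\<forall>a\<in>A. f (w a) = f a). card (fixcols A \<alpha> w)) = mfact \<mu> * ?m"
      using sum_fixcols_fibre[where b = f and \<alpha> = \<alpha>, OF fin finite_lessThan fk permutes_id]
        prod_fact_content(1)[OF fin f k]
      by (simp only: prod_fact_content(2)[OF fin f k] mem_Collect_eq id_apply)
  qed
  also have "\<dots> = fact (card A) * ?m" using card_cols_mfact[OF fin \<mu>] by (simp flip: mult.assoc)
  also have "?m = (\<Sum>lam\<in>partitions_of (card A). kostka \<mu> (shape_of lam) * kostka \<alpha> (shape_of lam))"
    using sum_kostka_kostka[OF k \<alpha>] by (simp only: sum_shapes_partitions)
  finally show ?thesis .
qed

text \<open>Kostka inversion in one argument of the Cauchy identity leaves a single Kostka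
  number.\<close>

lemma sum_frob_char_fixcols:
  assumes fin: "finite A" and lam: "lam \<in> partitions_of (card A)" and \<alpha>: "mdeg \<alpha> = card A"
  shows "(\<Sum>w | w permutes A. frob_char A lam w * int (card (fixcols A \<alpha> w))) =
    fact (card A) * int (kostka \<alpha> (shape_of lam))"
proof -
  let ?P = "partitions_of (card A)" and ?J = "inverse_kostka (card A)" and ?W = "{w. w permutes A}"
  let ?\<theta> = "\<lambda>t w. int (card (fixcols A (part_mono t) w))"
  have deg: "mdeg (part_mono t) = card A" if "t \<in> ?P" for t
    using that by (simp add: mdeg_part_mono partitions_of_def)
  have "(\<Sum>w\<in>?W. frob_char A lam w * int (card (fixcols A \<alpha> w))) =
      (\<Sum>w\<in>?W. \<Sum>t\<in>?P. ?J t lam * (?\<theta> t w * int (card (fixcols A \<alpha> w))))"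
    by (simp add: frob_char_def sum_distrib_right mult.assoc)
  also have "\<dots> = (\<Sum>t\<in>?P. ?J t lam * (\<Sum>w\<in>?W. ?\<theta> t w * int (card (fixcols A \<alpha> w))))"
    by (subst sum.swap) (simp add: sum_distrib_left)
  also have "\<dots> = (\<Sum>t\<in>?P. ?J t lam * (fact (card A) * (\<Sum>nu\<in>?P. kostka_number nu t * int (kostka \<alpha> (shape_of nu)))))"
  proof (rule sum.cong[OF refl])
    fix t assume t: "t \<in> ?P"
    have "(\<Sum>w\<in>?W. ?\<theta> t w * int (card (fixcols A \<alpha> w))) =
        int (\<Sum>w\<in>?W. card (fixcols A (part_mono t) w) * card (fixcols A \<alpha> w))" by simp
    also have "\<dots> = fact (card A) * (\<Sum>nu\<in>?P. kostka_number nu t * int (kostka \<alpha> (shape_of nu)))"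
      unfolding sum_fixcols_fixcols[OF fin deg[OF t] \<alpha>] by (simp add: kostka_number_def)
    finally show "?J t lam * (\<Sum>w\<in>?W. ?\<theta> t w * int (card (fixcols A \<alpha> w))) =
        ?J t lam * (fact (card A) * (\<Sum>nu\<in>?P. kostka_number nu t * int (kostka \<alpha> (shape_of nu))))" by simp
  qed
  also have "\<dots> = (\<Sum>t\<in>?P. \<Sum>nu\<in>?P. fact (card A) * int (kostka \<alpha> (shape_of nu)) * (kostka_number nu t * ?J t lam))"
    by (simp add: sum_distrib_left mult_ac)
  also have "\<dots> = (\<Sum>nu\<in>?P. fact (card A) * int (kostka \<alpha> (shape_of nu)) * (\<Sum>t\<in>?P. kostka_number nu t * ?J t lam))"
    by (subst sum.swap) (simp add: sum_distrib_left)
  also have "\<dots> = (\<Sum>nu\<in>?P. fact (card A) * int (kostka \<alpha> (shape_of nu)) * (if nu = lam then 1 else 0))"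
    by (rule sum.cong) (simp_all add: inverse_kostka lam)
  also have "\<dots> = fact (card A) * int (kostka \<alpha> (shape_of lam))"
    by (rule sum_mult_delta[OF finite_partitions_of lam])
  finally show ?thesis .
qed

text \<open>Orthonormality, by Kostka inversion in the other argument as well.\<close>

lemma sum_frob_char_frob_char:
  assumes fin: "finite A" and lam: "lam \<in> partitions_of (card A)" and mu: "mu \<in> partitions_of (card A)"
  shows "(\<Sum>w | w permutes A. frob_char A lam w * frob_char A mu w) = (if lam = mu then fact (card A) else 0)"
proof -
  let ?P = "partitions_of (card A)" and ?J = "inverse_kostka (card A)" and ?W = "{w. w permutes A}"
  have deg: "mdeg (part_mono t) = card A" if "t \<in> ?P" for t
    using that by (simp add: mdeg_part_mono partitions_of_def)
  have "(\<Sum>w\<in>?W. frob_char A lam w * frob_char A mu w) =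
      (\<Sum>w\<in>?W. \<Sum>t\<in>?P. ?J t mu * (frob_char A lam w * int (card (fixcols A (part_mono t) w))))"
    by (simp add: frob_char_def[of A mu] sum_distrib_left mult_ac)
  also have "\<dots> = (\<Sum>t\<in>?P. ?J t mu * (\<Sum>w\<in>?W. frob_char A lam w * int (card (fixcols A (part_mono t) w))))"
    by (subst sum.swap) (simp add: sum_distrib_left)
  also have "\<dots> = (\<Sum>t\<in>?P. fact (card A) * (kostka_number lam t * ?J t mu))"
    by (rule sum.cong) (simp_all add: sum_frob_char_fixcols[OF fin lam] deg kostka_number_def)
  also have "\<dots> = fact (card A) * (if lam = mu then 1 else 0)"
    by (simp add: inverse_kostka lam mu flip: sum_distrib_left)
  finally show ?thesis by simp
qed

lemma frob_char_conjugate: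
  assumes "finite A" "w permutes A" "\<tau> permutes A" "g permutes A" "\<And>a. a \<in> A \<Longrightarrow> g (w a) = \<tau> (g a)"
  shows "frob_char A lam w = frob_char A lam \<tau>"
  unfolding frob_char_def using card_fixcols_conjugate[OF assms] by simp

lemma fixcols_inv:
  assumes "w permutes A" shows "fixcols A \<alpha> (inv' w) = fixcols A \<alpha> w"
proof -
  have "(\<forall>a\<in>A. f (inv' w a) = f a) \<longleftrightarrow> (\<forall>a\<in>A. f (w a) = f a)" for f :: "'a \<Rightarrow> nat"
    using permutes_in_image[OF assms] permutes_in_image[OF permutes_inv[OF assms]] permutes_inverses[OF assms] by metis
  then show ?thesis by (simp add: fixcols_def)
qed

lemma frob_char_inv: "w permutes A \<Longrightarrow> frob_char A lam (inv' w) = frob_char A lam w"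
  by (simp add: frob_char_def fixcols_inv)

section \<open>Square roots of permutations\<close>

definition sqrts :: "'a set \<Rightarrow> ('a \<Rightarrow> 'a) \<Rightarrow> ('a \<Rightarrow> 'a) set" where
  "sqrts A w = {x. x permutes A \<and> (\<forall>a\<in>A. x (x a) = w a)}"

lemma card_sqrts_conjugate_le:
  assumes fin: "finite A" and g: "g permutes A" and w: "w permutes A" and \<tau>: "\<tau> permutes A"
    and eq: "\<And>a. a \<in> A \<Longrightarrow> g (w a) = \<tau> (g a)"
  shows "card (sqrts A w) \<le> card (sqrts A \<tau>)"
proof (rule card_inj_on_le[of "\<lambda>x. g \<circ> x \<circ> inv' g"])
  have ig: "inv' g permutes A" by (rule permutes_inv[OF g])
  have gi: "g (inv' g x) = x" "inv' g (g x) = x" for x using permutes_inverses[OF g] by auto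
  show "inj_on (\<lambda>x. g \<circ> x \<circ> inv' g) (sqrts A w)"
  proof (rule inj_on_inverseI[of _ "\<lambda>y. inv' g \<circ> y \<circ> g"])
    show "inv' g \<circ> (g \<circ> x \<circ> inv' g) \<circ> g = x" for x by (simp add: fun_eq_iff gi)
  qed
  show "(\<lambda>x. g \<circ> x \<circ> inv' g) ` sqrts A w \<subseteq> sqrts A \<tau>"
  proof (intro image_subsetI)
    fix x assume x: "x \<in> sqrts A w"
    have "g (x (x (inv' g a))) = \<tau> a" if "a \<in> A" for a
    proof -
      have ia: "inv' g a \<in> A" using that permutes_in_image[OF ig] by simp
      then have "g (x (x (inv' g a))) = g (w (inv' g a))" using x by (simp add: sqrts_def)
      also have "\<dots> = \<tau> a" using eq[OF ia] by (simp add: gi)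
      finally show ?thesis .
    qed
    moreover have "g \<circ> x \<circ> inv' g permutes A" using x g ig by (auto simp: sqrts_def intro: permutes_compose)
    ultimately show "g \<circ> x \<circ> inv' g \<in> sqrts A \<tau>" by (simp add: sqrts_def gi)
  qed
  show "finite (sqrts A \<tau>)" unfolding sqrts_def by (rule finite_permutes_subset[OF fin])
qed

lemma card_sqrts_conjugate:
  assumes fin: "finite A" and w: "w permutes A" and \<tau>: "\<tau> permutes A" and g: "g permutes A"
    and eq: "\<And>a. a \<in> A \<Longrightarrow> g (w a) = \<tau> (g a)"
  shows "card (sqrts A w) = card (sqrts A \<tau>)"
proof (rule antisym)
  show "card (sqrts A w) \<le> card (sqrts A \<tau>)" by (rule card_sqrts_conjugate_le[OF fin g w \<tau> eq])
  have ig: "inv' g permutes A" by (rule permutes_inv[OF g])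
  have "inv' g (\<tau> a) = w (inv' g a)" if "a \<in> A" for a
  proof -
    have "inv' g a \<in> A" using that permutes_in_image[OF ig] by simp
    then have "g (w (inv' g a)) = \<tau> a" using eq[of "inv' g a"] permutes_inverses[OF g] by simp
    then show ?thesis using permutes_inverses[OF g] by metis
  qed
  then show "card (sqrts A \<tau>) \<le> card (sqrts A w)" by (rule card_sqrts_conjugate_le[OF fin ig \<tau> w])
qed

text \<open>Summing over the roots \<open>x\<close> themselves, one counts pairs of \<open>x\<close>
  and a colouring preserved by \<open>x \<circ> x\<close>. By \<open>card_square_in_fibre\<close>
  with \<open>\<sigma> = id\<close> these correspond to symmetric matrices, which
  \<open>sum_kostka\<close> counts.\<close>

lemma sum_sqrts_fixcols:
  assumes fin: "finite A" and \<alpha>: "mdeg \<alpha> = card A"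
  shows "(\<Sum>w | w permutes A. card (sqrts A w) * card (fixcols A \<alpha> w)) =
    fact (card A) * (\<Sum>lam\<in>partitions_of (card A). kostka \<alpha> (shape_of lam))"
proof -
  let ?k = "Poly_Mapping.degree \<alpha>" and ?W = "{w. w permutes A}"
  note k = keys_less_degree[of \<alpha>]
  let ?m = "card (twisted_tuples {..<?k} id (lookup \<alpha>))"
  have finW: "finite ?W" by (rule finite_permutations[OF fin])
  have sq: "sqrts A w = {x \<in> ?W. x \<circ> x = w}" if "w \<in> ?W" for w
  proof -
    have "(\<forall>a\<in>A. x (x a) = w a) \<longleftrightarrow> x \<circ> x = w" if x: "x permutes A" for x
    proof
      assume "\<forall>a\<in>A. x (x a) = w a"
      then have "x (x a) = w a" for a
        using permutes_not_in[OF x, of a] permutes_not_in[of w A a] \<open>w \<in> ?W\<close> by (cases "a \<in> A") auto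
      then show "x \<circ> x = w" by (simp add: fun_eq_iff)
    qed auto
    then show ?thesis by (auto simp: sqrts_def)
  qed
  have "(\<Sum>w\<in>?W. card (sqrts A w) * card (fixcols A \<alpha> w)) =
      (\<Sum>w\<in>?W. \<Sum>x | x \<in> ?W \<and> x \<circ> x = w. card (fixcols A \<alpha> (x \<circ> x)))"
    by (rule sum.cong[OF refl]) (simp add: sq)
  also have "\<dots> = (\<Sum>x\<in>?W. card (fixcols A \<alpha> (x \<circ> x)))"
    by (rule sum.group[OF finW finW]) (auto intro: permutes_compose)
  also have "\<dots> = (\<Sum>f\<in>cols A \<alpha>. \<Sum>x | x \<in> ?W \<and> (\<forall>a\<in>A. f ((x \<circ> x) a) = f a). 1)"
    using sum_over_fixcols[OF fin finW, of \<alpha> "\<lambda>x. x \<circ> x" "\<lambda>_. 1 :: nat"] by simp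
  also have "\<dots> = (\<Sum>f\<in>cols A \<alpha>. mfact \<alpha> * ?m)"
  proof (rule sum.cong[OF refl])
    fix f assume f: "f \<in> cols A \<alpha>"
    have fk: "f a \<in> {..<?k}" if "a \<in> A" for a using prod_fact_content(3)[OF fin f k that] .
    have "card {x. x permutes A \<and> (\<forall>a\<in>A. f (x (x a)) = f a)} = mfact \<alpha> * ?m"
      using card_square_in_fibre[where b = f, OF fin finite_lessThan fk permutes_id] prod_fact_content(1)[OF fin f k]
      by (simp only: prod_fact_content(2)[OF fin f k] id_apply)
    then show "(\<Sum>x | x \<in> ?W \<and> (\<forall>a\<in>A. f ((x \<circ> x) a) = f a). 1) = mfact \<alpha> * ?m" by simp
  qed
  also have "\<dots> = fact (card A) * ?m" using card_cols_mfact[OF fin \<alpha>] by (simp flip: mult.assoc)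
  also have "?m = (\<Sum>lam\<in>partitions_of (card A). kostka \<alpha> (shape_of lam))"
    using sum_kostka[OF k] by (simp only: sum_shapes_partitions \<alpha>)
  finally show ?thesis .
qed

text \<open>Both sides are class functions with the same inner products with all permutation characters
  on colourings.\<close>

lemma sum_frob_char_eq_card_sqrts:
  assumes fin: "finite A" and w: "w permutes A"
  shows "(\<Sum>lam\<in>partitions_of (card A). frob_char A lam w) = int (card (sqrts A w))"
proof -
  let ?P = "partitions_of (card A)" and ?W = "{w. w permutes A}"
  define \<phi> where "\<phi> w = (\<Sum>lam\<in>?P. frob_char A lam w) - int (card (sqrts A w))" for w
  have "\<phi> w = 0"
  proof (rule class_function_eq_0[OF fin _ _ w])
    fix w \<tau> g assume "w permutes A" "\<tau> permutes A" "g permutes A" "\<And>a. a \<in> A \<Longrightarrow> g (w a) = \<tau> (g a)"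
    note * = this
    show "\<phi> w = \<phi> \<tau>"
      unfolding \<phi>_def using card_sqrts_conjugate[OF fin *] frob_char_conjugate[OF fin *] by simp
  next
    fix \<alpha>
    show "(\<Sum>w\<in>?W. \<phi> w * int (card (fixcols A \<alpha> w))) = 0"
    proof (cases "mdeg \<alpha> = card A")
      case False then show ?thesis by (simp add: card_fixcols_0)
    next
      case True
      have "(\<Sum>w\<in>?W. \<phi> w * int (card (fixcols A \<alpha> w))) =
          (\<Sum>w\<in>?W. \<Sum>lam\<in>?P. frob_char A lam w * int (card (fixcols A \<alpha> w))) -
          int (\<Sum>w\<in>?W. card (sqrts A w) * card (fixcols A \<alpha> w))"
        by (simp add: \<phi>_def left_diff_distrib sum_subtractf sum_distrib_right)
      also have "(\<Sum>w\<in>?W. \<Sum>lam\<in>?P. frob_char A lam w * int (card (fixcols A \<alpha> w))) =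
          (\<Sum>lam\<in>?P. \<Sum>w\<in>?W. frob_char A lam w * int (card (fixcols A \<alpha> w)))" by (rule sum.swap)
      also have "\<dots> = (\<Sum>lam\<in>?P. fact (card A) * int (kostka \<alpha> (shape_of lam)))"
        by (rule sum.cong[OF refl]) (rule sum_frob_char_fixcols[OF fin _ True])
      also have "\<dots> = int (\<Sum>w\<in>?W. card (sqrts A w) * card (fixcols A \<alpha> w))"
        unfolding sum_sqrts_fixcols[OF fin True] by (simp add: sum_distrib_left)
      finally show ?thesis by simp
    qed
  qed
  then show ?thesis by (simp add: \<phi>_def)
qed

section \<open>Representations\<close>

definition tr :: "nat \<Rightarrow> complex mat \<Rightarrow> complex" where
  "tr d A = (\<Sum>i<d. A $$ (i, i))"

lemma mat_mult_index:
  "A \<in> carrier_mat n m \<Longrightarrow> B \<in> carrier_mat m k \<Longrightarrow> i < n \<Longrightarrow> j < k \<Longrightarrow>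
    (A * B) $$ (i, j) = (\<Sum>t<m. A $$ (i, t) * B $$ (t, j))"
  by (simp add: scalar_prod_def atLeast0LessThan)

lemma mat_vec_index:
  "A \<in> carrier_mat n m \<Longrightarrow> v \<in> carrier_vec m \<Longrightarrow> i < n \<Longrightarrow>
    (A *\<^sub>v v) $ i = (\<Sum>t<m. A $$ (i, t) * v $ t)"
  by (simp add: scalar_prod_def atLeast0LessThan)

lemma tr_comm:
  assumes "A \<in> carrier_mat n m" "B \<in> carrier_mat m n"
  shows "tr n (A * B) = tr m (B * A)"
proof -
  have "tr n (A * B) = (\<Sum>i<n. \<Sum>t<m. A $$ (i, t) * B $$ (t, i))"
    using assms by (simp add: tr_def mat_mult_index del: index_mult_mat(1))
  also have "\<dots> = (\<Sum>t<m. \<Sum>i<n. B $$ (t, i) * A $$ (i, t))"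
    by (subst sum.swap) (simp add: mult.commute)
  also have "\<dots> = tr m (B * A)" using assms by (simp add: tr_def mat_mult_index del: index_mult_mat(1))
  finally show ?thesis .
qed

lemma tr_one: "tr d (1\<^sub>m d) = of_nat d" by (simp add: tr_def)

lemma tr_minus: "A \<in> carrier_mat d d \<Longrightarrow> B \<in> carrier_mat d d \<Longrightarrow> tr d (A - B) = tr d A - tr d B"
  by (simp add: tr_def sum_subtractf)

lemma affords_iff: "affords G d R \<chi> \<longleftrightarrow> (\<forall>g\<in>carrier G. \<chi> g = tr d (R g))"
  by (simp add: affords_def tr_def)

lemma mat_eqI_vec:
  fixes A B :: "complex mat"
  assumes A: "A \<in> carrier_mat n m" and B: "B \<in> carrier_mat n m"
    and eq: "\<And>v. v \<in> carrier_vec m \<Longrightarrow> A *\<^sub>v v = B *\<^sub>v v"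
  shows "A = B"
proof (rule eq_matI)
  fix i j assume ij: "i < dim_row B" "j < dim_col B"
  then have ij': "i < n" "j < m" using B by auto
  have u: "(C *\<^sub>v unit_vec m j) $ i = C $$ (i, j)" if "C \<in> carrier_mat n m" for C :: "complex mat"
  proof -
    have "(C *\<^sub>v unit_vec m j) $ i = (\<Sum>t<m. C $$ (i, t) * (if t = j then 1 else 0))"
      using that ij' by (subst mat_vec_index[of _ n m]) (auto simp: unit_vec_def intro!: sum.cong)
    then show ?thesis using sum_mult_delta(1)[of "{..<m}" j "\<lambda>t. C $$ (i, t)"] ij' by simp
  qed
  show "A $$ (i, j) = B $$ (i, j)" using u[OF A] u[OF B] eq[of "unit_vec m j"] by simp
qed (use A B in auto)

lemma mat_vec_zero: "(A :: complex mat) \<in> carrier_mat n m \<Longrightarrow> A *\<^sub>v 0\<^sub>v m = 0\<^sub>v n"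
  by (intro eq_vecI) auto

text \<open>If \<open>d < r\<close>, pad both factors with zeros to size \<open>r\<close>. For
  square matrices the left inverse is also a right inverse, but row \<open>d\<close> of the padded
  \<open>X\<close> is zero.\<close>

lemma left_inverse_dim:
  fixes X Y :: "complex mat"
  assumes Y: "Y \<in> carrier_mat r d" and X: "X \<in> carrier_mat d r" and YX: "Y * X = 1\<^sub>m r"
  shows "r \<le> d"
proof (rule ccontr)
  assume "\<not> r \<le> d"
  then have dr: "d < r" by simp
  let ?X = "mat r r (\<lambda>(i, j). if i < d then X $$ (i, j) else 0)"
  let ?Y = "mat r r (\<lambda>(i, j). if j < d then Y $$ (i, j) else 0)"
  have "?Y * ?X = 1\<^sub>m r"
  proof (rule eq_matI)
    fix i j assume "i < dim_row (1\<^sub>m r :: complex mat)" "j < dim_col (1\<^sub>m r :: complex mat)"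
    then have ij: "i < r" "j < r" by auto
    have "(?Y * ?X) $$ (i, j) = (\<Sum>t<r. ?Y $$ (i, t) * ?X $$ (t, j))"
      by (rule mat_mult_index[of _ r r]) (use ij in auto)
    also have "\<dots> = (\<Sum>t<d. Y $$ (i, t) * X $$ (t, j))"
      using dr ij by (intro sum.mono_neutral_cong_right) auto
    also have "\<dots> = (Y * X) $$ (i, j)" by (rule mat_mult_index[OF Y X, symmetric]) (use ij in auto)
    finally show "(?Y * ?X) $$ (i, j) = 1\<^sub>m r $$ (i, j)" by (simp add: YX)
  qed auto
  then have "?X * ?Y = 1\<^sub>m r" by (intro mat_mult_left_right_inverse[of ?Y r ?X]) auto
  then have "(?X * ?Y) $$ (d, d) = 1" using dr by simp
  moreover have "(?X * ?Y) $$ (d, d) = (\<Sum>t<r. ?X $$ (d, t) * ?Y $$ (t, d))"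
    by (rule mat_mult_index[of _ r r]) (use dr in auto)
  ultimately show False using dr by simp
qed

section \<open>Subspaces as images of matrices\<close>

definition is_subspace :: "nat \<Rightarrow> complex vec set \<Rightarrow> bool" where
  "is_subspace d W \<longleftrightarrow> W \<subseteq> carrier_vec d \<and> 0\<^sub>v d \<in> W \<and> (\<forall>v\<in>W. \<forall>w\<in>W. v + w \<in> W) \<and> (\<forall>c. \<forall>v\<in>W. c \<cdot>\<^sub>v v \<in> W)"

lemma subspace_iff: "VectorSpace.subspace class_ring W (module_vec TYPE(complex) d) \<longleftrightarrow> is_subspace d W"
  unfolding VectorSpace.subspace_def LinearCombinations.submodule_def is_subspace_def
  using vec_vs[of d, where 'a = complex] vec_module[of d, where 'a = complex]
  by (auto simp: module_vec_simps)

text \<open>The columns of \<open>X\<close> form a basis of \<open>W\<close>, and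
  \<open>X * Y\<close> is a projection onto \<open>W\<close>. The rank \<open>r\<close> is taken
  maximal; a vector of \<open>W\<close> that \<open>X * Y\<close> does not reproduce would yield a
  further column.\<close>

lemma subspace_retraction:
  assumes W: "is_subspace d W"
  obtains r X Y where "X \<in> carrier_mat d r" "Y \<in> carrier_mat r d" "Y * X = 1\<^sub>m r"
    "\<forall>v\<in>carrier_vec r. X *\<^sub>v v \<in> W" "\<forall>w\<in>W. X *\<^sub>v (Y *\<^sub>v w) = w"
proof -
  define P where "P r \<longleftrightarrow> (\<exists>X Y. X \<in> carrier_mat d r \<and> Y \<in> carrier_mat r d \<and> Y * X = (1\<^sub>m r :: complex mat) \<and>
    (\<forall>v\<in>carrier_vec r. X *\<^sub>v v \<in> W))" for r
  have Wc: "W \<subseteq> carrier_vec d" and W0: "0\<^sub>v d \<in> W" and Wadd: "\<And>v w. v \<in> W \<Longrightarrow> w \<in> W \<Longrightarrow> v + w \<in> W"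
    and Wsm: "\<And>c v. v \<in> W \<Longrightarrow> c \<cdot>\<^sub>v v \<in> W"
    using W by (auto simp: is_subspace_def)
  have "P 0"
  proof -
    have "0\<^sub>m d 0 *\<^sub>v v \<in> W" if "v \<in> carrier_vec 0" for v
    proof -
      have "0\<^sub>m d 0 *\<^sub>v v = 0\<^sub>v d" using that by (intro eq_vecI) (auto simp: scalar_prod_def)
      then show ?thesis using W0 by simp
    qed
    then show ?thesis unfolding P_def by (intro exI[of _ "0\<^sub>m d 0"] exI[of _ "0\<^sub>m 0 d"]) auto
  qed
  moreover have "P r \<Longrightarrow> r \<le> d" for r unfolding P_def using left_inverse_dim by blast
  ultimately obtain r where r: "P r" "\<And>s. P s \<Longrightarrow> s \<le> r"
    using GreatestI_nat[of P 0 d] Greatest_le_nat[of P _ d] by metis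
  then obtain X Y where X: "X \<in> carrier_mat d r" and Y: "Y \<in> carrier_mat r d" and YX: "Y * X = 1\<^sub>m r"
    and XW: "\<And>v. v \<in> carrier_vec r \<Longrightarrow> X *\<^sub>v v \<in> W" unfolding P_def by blast
  have "X *\<^sub>v (Y *\<^sub>v w) = w" if w: "w \<in> W" for w
  proof (rule ccontr)
    assume neq: "X *\<^sub>v (Y *\<^sub>v w) \<noteq> w"
    have wc: "w \<in> carrier_vec d" using w Wc by auto
    have Yw: "Y *\<^sub>v w \<in> carrier_vec r" using Y wc by auto
    \<comment> \<open>The part of \<open>w\<close> missed by the projection; it lies in
      \<open>W\<close> and is killed by \<open>Y\<close>.\<close>
    define w' where "w' = w - X *\<^sub>v (Y *\<^sub>v w)"
    have w'c: "w' \<in> carrier_vec d" using wc X Y by (auto simp: w'_def)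
    have "w' = w + (-1) \<cdot>\<^sub>v (X *\<^sub>v (Y *\<^sub>v w))"
      using wc X Y by (intro eq_vecI) (auto simp: w'_def)
    then have w'W: "w' \<in> W" using Wadd[OF w Wsm[OF XW[OF Yw]]] by simp
    have Yw': "Y *\<^sub>v w' = 0\<^sub>v r"
    proof -
      have "Y *\<^sub>v w' = Y *\<^sub>v w - Y *\<^sub>v (X *\<^sub>v (Y *\<^sub>v w))"
        unfolding w'_def by (rule mult_minus_distrib_mat_vec[OF Y wc]) (use X Y wc in auto)
      also have "Y *\<^sub>v (X *\<^sub>v (Y *\<^sub>v w)) = (Y * X) *\<^sub>v (Y *\<^sub>v w)" using X Y wc Yw by simp
      also have "\<dots> = Y *\<^sub>v w" using Yw by (simp add: YX)
      finally show ?thesis using Yw by simp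
    qed
    obtain i0 where i0: "i0 < d" "w' $ i0 \<noteq> 0"
    proof (rule ccontr)
      assume "\<not> thesis"
      then have z: "w' $ i = 0" if "i < d" for i using that \<open>\<And>i0. i0 < d \<Longrightarrow> w' $ i0 \<noteq> 0 \<Longrightarrow> thesis\<close> by blast
      have "X *\<^sub>v (Y *\<^sub>v w) = w"
      proof (rule eq_vecI)
        fix i assume "i < dim_vec w"
        then have i: "i < d" using wc by auto
        have "w' $ i = w $ i - (X *\<^sub>v (Y *\<^sub>v w)) $ i" using i wc X by (simp add: w'_def)
        then show "(X *\<^sub>v (Y *\<^sub>v w)) $ i = w $ i" using z[OF i] by simp
      qed (use X wc in auto)
      then show False using neq by simp
    qed
    let ?c = "1 / w' $ i0"
    let ?X = "mat d (Suc r) (\<lambda>(i, j). if j < r then X $$ (i, j) else w' $ i)"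
    \<comment> \<open>The new row reads coordinate \<open>i0\<close> of
      \<open>v - X * Y * v\<close>. It therefore kills the columns of \<open>X\<close>, and the
      factor \<open>?c\<close> makes its value at \<open>w'\<close> equal to 1.\<close>
    let ?Y = "mat (Suc r) d (\<lambda>(i, j). if i < r then Y $$ (i, j) else (if j = i0 then ?c else 0) - ?c * (X * Y) $$ (i0, j))"
    have XYX: "(X * Y) * X = X" using X Y YX by (simp add: assoc_mult_mat[of X d r Y d X r])
    have XYw': "(X * Y) *\<^sub>v w' = 0\<^sub>v d" using X Y w'c Yw' by (auto intro!: eq_vecI)
    have u: "(\<Sum>t<d. ((if t = i0 then ?c else 0) - ?c * (X * Y) $$ (i0, t)) * z t) =
        ?c * z i0 - ?c * (\<Sum>t<d. (X * Y) $$ (i0, t) * z t)" for z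
    proof -
      have "(\<Sum>t<d. ((if t = i0 then ?c else 0) - ?c * (X * Y) $$ (i0, t)) * z t) =
          (\<Sum>t<d. (?c * z t) * (if t = i0 then 1 else 0)) - (\<Sum>t<d. ?c * ((X * Y) $$ (i0, t) * z t))"
        by (subst sum_subtractf[symmetric], rule sum.cong) (auto simp: algebra_simps)
      also have "(\<Sum>t<d. (?c * z t) * (if t = i0 then 1 else 0)) = ?c * z i0"
        by (rule sum_mult_delta) (use i0 in auto)
      finally show ?thesis by (simp add: sum_distrib_left)
    qed
    have "?Y * ?X = 1\<^sub>m (Suc r)"
    proof (rule eq_matI)
      fix i j assume "i < dim_row (1\<^sub>m (Suc r) :: complex mat)" "j < dim_col (1\<^sub>m (Suc r) :: complex mat)"
      then have ij: "i < Suc r" "j < Suc r" by auto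
      have e: "(?Y * ?X) $$ (i, j) = (\<Sum>t<d. ?Y $$ (i, t) * ?X $$ (t, j))"
        by (rule mat_mult_index[of _ "Suc r" d]) (use ij in auto)
      consider "i < r" "j < r" | "i < r" "j = r" | "i = r" "j < r" | "i = r" "j = r" using ij by linarith
      then show "(?Y * ?X) $$ (i, j) = 1\<^sub>m (Suc r) $$ (i, j)"
      proof cases
        case 1
        then have "(?Y * ?X) $$ (i, j) = (\<Sum>t<d. Y $$ (i, t) * X $$ (t, j))" unfolding e by simp
        also have "\<dots> = (Y * X) $$ (i, j)" by (rule mat_mult_index[OF Y X, symmetric]) (use 1 in auto)
        finally show ?thesis using 1 ij by (simp add: YX)
      next
        case 2
        then have "(?Y * ?X) $$ (i, j) = (\<Sum>t<d. Y $$ (i, t) * w' $ t)" unfolding e by simp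
        also have "\<dots> = (Y *\<^sub>v w') $ i" by (rule mat_vec_index[OF Y w'c, symmetric]) (use 2 in auto)
        finally show ?thesis using 2 ij by (simp add: Yw')
      next
        case 3
        then have "(?Y * ?X) $$ (i, j) =
            (\<Sum>t<d. ((if t = i0 then ?c else 0) - ?c * (X * Y) $$ (i0, t)) * X $$ (t, j))" unfolding e by simp
        also have "\<dots> = ?c * X $$ (i0, j) - ?c * (\<Sum>t<d. (X * Y) $$ (i0, t) * X $$ (t, j))" by (rule u)
        also have "(\<Sum>t<d. (X * Y) $$ (i0, t) * X $$ (t, j)) = ((X * Y) * X) $$ (i0, j)"
          by (rule mat_mult_index[symmetric, of _ d d _ r]) (use 3 X Y i0 in auto)
        finally show ?thesis using 3 ij by (simp only: XYX) simp
      next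
        case 4
        then have "(?Y * ?X) $$ (i, j) =
            (\<Sum>t<d. ((if t = i0 then ?c else 0) - ?c * (X * Y) $$ (i0, t)) * w' $ t)" unfolding e by simp
        also have "\<dots> = ?c * w' $ i0 - ?c * (\<Sum>t<d. (X * Y) $$ (i0, t) * w' $ t)" by (rule u)
        also have "(\<Sum>t<d. (X * Y) $$ (i0, t) * w' $ t) = ((X * Y) *\<^sub>v w') $ i0"
          by (rule mat_vec_index[symmetric]) (use X Y i0 w'c in auto)
        finally show ?thesis using 4 i0 by (simp only: XYw') simp
      qed
    qed auto
    moreover have "?X *\<^sub>v v \<in> W" if v: "v \<in> carrier_vec (Suc r)" for v
    proof -
      have "?X *\<^sub>v v = X *\<^sub>v vec r (\<lambda>i. v $ i) + v $ r \<cdot>\<^sub>v w'"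
      proof (rule eq_vecI)
        fix i assume "i < dim_vec (X *\<^sub>v vec r (\<lambda>i. v $ i) + v $ r \<cdot>\<^sub>v w')"
        then have i: "i < d" using w'c by auto
        have "(?X *\<^sub>v v) $ i = (\<Sum>t<Suc r. ?X $$ (i, t) * v $ t)"
          by (rule mat_vec_index) (use i v in auto)
        also have "\<dots> = (\<Sum>t<r. X $$ (i, t) * v $ t) + w' $ i * v $ r" using i by simp
        also have "(\<Sum>t<r. X $$ (i, t) * v $ t) = (X *\<^sub>v vec r (\<lambda>i. v $ i)) $ i"
          using mat_vec_index[OF X _ i, of "vec r (\<lambda>i. v $ i)"] by simp
        finally show "(?X *\<^sub>v v) $ i = (X *\<^sub>v vec r (\<lambda>i. v $ i) + v $ r \<cdot>\<^sub>v w') $ i"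
          using i X w'c by (simp add: mult.commute)
      qed (use w'c in auto)
      then show ?thesis using Wadd[OF XW Wsm[OF w'W]] by simp
    qed
    ultimately have "P (Suc r)" unfolding P_def by (intro exI[of _ ?X] exI[of _ ?Y]) auto
    then show False using r(2) by fastforce
  qed
  then show ?thesis using that X Y YX XW by blast
qed

text \<open>Invertibility of the matrices follows from multiplicativity and the value at the unit
  element.\<close>

lemma representation_iff:
  assumes "group G"
  shows "representation G d R \<longleftrightarrow> (\<forall>g\<in>carrier G. R g \<in> carrier_mat d d) \<and>
    (\<forall>g\<in>carrier G. \<forall>h\<in>carrier G. R (g \<otimes>\<^bsub>G\<^esub> h) = R g * R h) \<and> R \<one>\<^bsub>G\<^esub> = 1\<^sub>m d"
proof -
  interpret G: group G by fact
  let ?R = "ring_mat TYPE(complex) d ()"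
  interpret R: ring ?R by (rule ring_mat)
  have U: "group (units_of ?R)" by (rule R.units_group)
  have simps: "carrier (units_of ?R) = Units ?R" "mult (units_of ?R) = (*)" "one (units_of ?R) = 1\<^sub>m d"
    by (simp_all add: units_of_def ring_mat_def)
  have Uc: "A \<in> carrier_mat d d" if "A \<in> Units ?R" for A
    using that by (simp add: Units_def ring_mat_def)
  show ?thesis
  proof
    assume "representation G d R"
    then have h: "R \<in> hom G (units_of ?R)" by (simp add: representation_def)
    have "R \<one>\<^bsub>G\<^esub> = 1\<^sub>m d" using hom_one[OF h assms U] by (simp add: simps)
    moreover have "R g \<in> carrier_mat d d" if "g \<in> carrier G" for g
      using hom_in_carrier[OF h that] Uc by (simp add: simps)
    moreover have "R (g \<otimes>\<^bsub>G\<^esub> h) = R g * R h" if "g \<in> carrier G" "h \<in> carrier G" for g h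
      using hom_mult[OF h that] by (simp add: simps)
    ultimately show "(\<forall>g\<in>carrier G. R g \<in> carrier_mat d d) \<and>
      (\<forall>g\<in>carrier G. \<forall>h\<in>carrier G. R (g \<otimes>\<^bsub>G\<^esub> h) = R g * R h) \<and> R \<one>\<^bsub>G\<^esub> = 1\<^sub>m d" by blast
  next
    assume r: "(\<forall>g\<in>carrier G. R g \<in> carrier_mat d d) \<and>
      (\<forall>g\<in>carrier G. \<forall>h\<in>carrier G. R (g \<otimes>\<^bsub>G\<^esub> h) = R g * R h) \<and> R \<one>\<^bsub>G\<^esub> = 1\<^sub>m d"
    have "R g \<in> Units ?R" if g: "g \<in> carrier G" for g
    proof -
      have "R g * R (inv\<^bsub>G\<^esub> g) = 1\<^sub>m d" "R (inv\<^bsub>G\<^esub> g) * R g = 1\<^sub>m d"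
        using r g G.r_inv[OF g] G.l_inv[OF g] by (metis G.inv_closed)+
      then show ?thesis using r g by (auto simp: Units_def ring_mat_def)
    qed
    then show "representation G d R" using r by (auto simp: representation_def hom_def simps)
  qed
qed

text \<open>A multiplicative but possibly non-unital family of matrices acts as a representation on the
  image of the idempotent \<open>E \<one>\<close>, and vanishes on its kernel.\<close>

lemma nonunital_representation:
  assumes G: "group G" and Ec: "\<And>g. g \<in> carrier G \<Longrightarrow> E g \<in> carrier_mat d d"
    and Em: "\<And>g h. g \<in> carrier G \<Longrightarrow> h \<in> carrier G \<Longrightarrow> E (g \<otimes>\<^bsub>G\<^esub> h) = E g * E h"
  shows "\<exists>r A. representation G r A \<and> (\<forall>g\<in>carrier G. tr r (A g) = tr d (E g))"
proof -
  interpret G: group G by fact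
  let ?e = "E \<one>\<^bsub>G\<^esub>"
  let ?W = "(\<lambda>v. ?e *\<^sub>v v) ` carrier_vec d"
  note ec = Ec[OF G.one_closed]
  have "is_subspace d ?W" unfolding is_subspace_def
  proof (intro conjI ballI allI)
    show "?W \<subseteq> carrier_vec d" using ec by auto
    show "0\<^sub>v d \<in> ?W" by (rule image_eqI[of _ _ "0\<^sub>v d"]) (use ec in auto)
    show "v + w \<in> ?W" if "v \<in> ?W" "w \<in> ?W" for v w
      using that ec by (auto simp: mult_add_distrib_mat_vec[symmetric] intro!: imageI)
    show "c \<cdot>\<^sub>v v \<in> ?W" if "v \<in> ?W" for c v
      using that ec by (auto simp: mult_mat_vec[symmetric] intro!: imageI)
  qed
  from subspace_retraction[OF this]
  obtain r X Y where X: "X \<in> carrier_mat d r" and Y: "Y \<in> carrier_mat r d" and YX: "Y * X = 1\<^sub>m r"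
    and XW': "\<forall>v\<in>carrier_vec r. X *\<^sub>v v \<in> ?W" and XY': "\<forall>w\<in>?W. X *\<^sub>v (Y *\<^sub>v w) = w"
    by metis
  note XW = bspec[OF XW'] and XY = bspec[OF XY']
  have XYE: "X * (Y * E g) = E g" if g: "g \<in> carrier G" for g
  proof (rule mat_eqI_vec[of _ d d])
    fix v :: "complex vec" assume v: "v \<in> carrier_vec d"
    have "E g *\<^sub>v v = (?e * E g) *\<^sub>v v" using Em[OF G.one_closed g] g by simp
    also have "\<dots> = ?e *\<^sub>v (E g *\<^sub>v v)" using ec Ec[OF g] v by simp
    finally have "E g *\<^sub>v v \<in> ?W" using Ec[OF g] v by auto
    then show "(X * (Y * E g)) *\<^sub>v v = E g *\<^sub>v v"
      using XY X Y Ec[OF g] v by (subst assoc_mult_mat_vec[of _ d r _ d]) auto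
  qed (use X Y Ec[OF g] in auto)
  have eX: "?e * X = X"
  proof (rule mat_eqI_vec[of _ d r])
    fix v :: "complex vec" assume v: "v \<in> carrier_vec r"
    obtain z where z: "z \<in> carrier_vec d" "X *\<^sub>v v = ?e *\<^sub>v z" using XW[OF v] by auto
    have "(?e * X) *\<^sub>v v = ?e *\<^sub>v (?e *\<^sub>v z)" using ec X v z by simp
    also have "\<dots> = (?e * ?e) *\<^sub>v z" using ec z by simp
    also have "?e * ?e = ?e" using Em[OF G.one_closed G.one_closed] by simp
    finally show "(?e * X) *\<^sub>v v = X *\<^sub>v v" using z by simp
  qed (use X ec in auto)
  \<comment> \<open>The matrices \<open>X\<close> and \<open>Y\<close> identify the image of the
    idempotent with vectors of length \<open>r\<close>.\<close>
  define A where "A g = Y * E g * X" for g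
  have "representation G r A" unfolding representation_iff[OF G]
  proof (intro conjI ballI)
    show "A g \<in> carrier_mat r r" if "g \<in> carrier G" for g using X Y Ec[OF that] by (simp add: A_def)
    show "A \<one>\<^bsub>G\<^esub> = 1\<^sub>m r"
      using assoc_mult_mat[OF Y ec X] by (simp add: A_def eX YX)
    fix g h assume g: "g \<in> carrier G" and h: "h \<in> carrier G"
    have "A g * A h = (Y * E g) * (X * (Y * E h * X))"
      unfolding A_def by (rule assoc_mult_mat) (use X Y Ec[OF g] Ec[OF h] in auto)
    also have "X * (Y * E h * X) = X * (Y * E h) * X"
      by (rule assoc_mult_mat[symmetric]) (use X Y Ec[OF h] in auto)
    also have "\<dots> = E h * X" by (simp add: XYE[OF h])
    also have "(Y * E g) * (E h * X) = Y * (E g * (E h * X))"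
      by (rule assoc_mult_mat) (use X Y Ec[OF g] Ec[OF h] in auto)
    also have "E g * (E h * X) = (E g * E h) * X"
      by (rule assoc_mult_mat[symmetric]) (use X Ec[OF g] Ec[OF h] in auto)
    also have "Y * ((E g * E h) * X) = Y * (E g * E h) * X"
      by (rule assoc_mult_mat[symmetric]) (use X Y Ec[OF g] Ec[OF h] in auto)
    finally show "A (g \<otimes>\<^bsub>G\<^esub> h) = A g * A h" by (simp add: A_def Em g h)
  qed
  moreover have "tr r (A g) = tr d (E g)" if g: "g \<in> carrier G" for g
  proof -
    have "tr r (A g) = tr d (X * (Y * E g))"
      unfolding A_def by (rule tr_comm) (use X Y Ec[OF g] in auto)
    then show ?thesis by (simp add: XYE[OF g])
  qed
  ultimately show ?thesis by blast
qed

text \<open>Only traces have to be decomposed. Let \<open>p\<close> be a projection onto an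
  invariant subspace, in general not equivariant. Then \<open>R g * p\<close> and
  \<open>R g - p * R g\<close> are multiplicative families carrying the action on the subspace and
  on the quotient, and their traces add up to that of \<open>R g\<close>.\<close>

lemma character_decomposition:
  assumes G: "group G"
  shows "representation G d R \<Longrightarrow>
    \<exists>xs. (\<forall>\<chi>\<in>set xs. is_irreducible_character G \<chi>) \<and> (\<forall>g\<in>carrier G. tr d (R g) = (\<Sum>\<chi>\<leftarrow>xs. \<chi> g))"
proof (induction d arbitrary: R rule: less_induct)
  case (less d)
  interpret G: group G by fact
  note rep = less.prems[unfolded representation_iff[OF G]]
  have Rc: "R g \<in> carrier_mat d d" if "g \<in> carrier G" for g using rep that by blast
  have Rm: "R (g \<otimes>\<^bsub>G\<^esub> h) = R g * R h" if "g \<in> carrier G" "h \<in> carrier G" for g h using rep that by blast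
  show ?case
  proof (cases "d = 0 \<or> irreducible_representation G d R")
    case True
    then consider "d = 0" | "irreducible_representation G d R" by blast
    then show ?thesis
    proof cases
      case 1 then show ?thesis by (intro exI[of _ "[]"]) (simp add: tr_def)
    next
      case 2
      then have "is_irreducible_character G (\<lambda>g. tr d (R g))"
        unfolding is_irreducible_character_def affords_iff by blast
      then show ?thesis by (intro exI[of _ "[\<lambda>g. tr d (R g)]"]) simp
    qed
  next
    case False
    then obtain W where W: "is_subspace d W" and inv: "\<And>g w. g \<in> carrier G \<Longrightarrow> w \<in> W \<Longrightarrow> R g *\<^sub>v w \<in> W"
      and W0: "W \<noteq> {0\<^sub>v d}" and W1: "W \<noteq> carrier_vec d"
      using less.prems unfolding irreducible_representation_def subspace_iff by blast
    from subspace_retraction[OF W]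
    obtain r X Y where X: "X \<in> carrier_mat d r" and Y: "Y \<in> carrier_mat r d" and YX: "Y * X = 1\<^sub>m r"
      and XW': "\<forall>v\<in>carrier_vec r. X *\<^sub>v v \<in> W" and XY': "\<forall>w\<in>W. X *\<^sub>v (Y *\<^sub>v w) = w"
      by metis
    note XW = bspec[OF XW'] and XY = bspec[OF XY']
    define p where "p = X * Y"
    have p: "p \<in> carrier_mat d d" using X Y by (simp add: p_def)
    have pRX: "p * (R g * X) = R g * X" if g: "g \<in> carrier G" for g
    proof (rule mat_eqI_vec[of _ d r])
      fix v :: "complex vec" assume v: "v \<in> carrier_vec r"
      have "R g *\<^sub>v (X *\<^sub>v v) \<in> W" using inv[OF g XW[OF v]] .
      then have "X *\<^sub>v (Y *\<^sub>v (R g *\<^sub>v (X *\<^sub>v v))) = R g *\<^sub>v (X *\<^sub>v v)" by (rule XY)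
      moreover have "(p * (R g * X)) *\<^sub>v v = p *\<^sub>v ((R g * X) *\<^sub>v v)"
        by (rule assoc_mult_mat_vec) (use p Rc[OF g] X v in auto)
      moreover have "(R g * X) *\<^sub>v v = R g *\<^sub>v (X *\<^sub>v v)"
        by (rule assoc_mult_mat_vec) (use Rc[OF g] X v in auto)
      moreover have "p *\<^sub>v z = X *\<^sub>v (Y *\<^sub>v z)" if "z \<in> carrier_vec d" for z
        unfolding p_def by (rule assoc_mult_mat_vec) (use that X Y in auto)
      moreover have "R g *\<^sub>v (X *\<^sub>v v) \<in> carrier_vec d" using Rc[OF g] X v by auto
      ultimately show "(p * (R g * X)) *\<^sub>v v = (R g * X) *\<^sub>v v" by simp
    qed (use p Rc[OF g] X in auto)
    have pRp: "p * (R g * p) = R g * p" if g: "g \<in> carrier G" for g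
    proof -
      have "R g * p = (R g * X) * Y" unfolding p_def by (rule assoc_mult_mat[symmetric]) (use Rc[OF g] X Y in auto)
      moreover have "p * ((R g * X) * Y) = (p * (R g * X)) * Y"
        by (rule assoc_mult_mat[symmetric]) (use p Rc[OF g] X Y in auto)
      ultimately show ?thesis by (simp add: pRX[OF g])
    qed
    let ?E = "\<lambda>g. R g * p" and ?F = "\<lambda>g. R g - p * R g"
    have "\<exists>r A. representation G r A \<and> (\<forall>g\<in>carrier G. tr r (A g) = tr d (?E g))"
    proof (rule nonunital_representation[OF G, of ?E d])
      show "?E g \<in> carrier_mat d d" if "g \<in> carrier G" for g using Rc[OF that] p by simp
      fix g h assume g: "g \<in> carrier G" and h: "h \<in> carrier G"
      have "?E g * ?E h = R g * (p * (R h * p))"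
        by (rule assoc_mult_mat) (use Rc[OF g] Rc[OF h] p in auto)
      also have "\<dots> = R g * (R h * p)" by (simp only: pRp[OF h])
      also have "\<dots> = R g * R h * p"
        by (rule assoc_mult_mat[symmetric]) (use Rc[OF g] Rc[OF h] p in auto)
      finally show "?E (g \<otimes>\<^bsub>G\<^esub> h) = ?E g * ?E h" using Rm[OF g h] by simp
    qed
    then obtain r1 A where A: "representation G r1 A" "\<And>g. g \<in> carrier G \<Longrightarrow> tr r1 (A g) = tr d (?E g)" by blast
    have "\<exists>r A. representation G r A \<and> (\<forall>g\<in>carrier G. tr r (A g) = tr d (?F g))"
    proof (rule nonunital_representation[OF G, of ?F d])
      show "?F g \<in> carrier_mat d d" if "g \<in> carrier G" for g
        by (intro minus_carrier_mat mult_carrier_mat[OF p Rc[OF that]])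
      fix g h assume g: "g \<in> carrier G" and h: "h \<in> carrier G"
      note cg = Rc[OF g] and ch = Rc[OF h]
      have pc: "p * R h \<in> carrier_mat d d" using p ch by simp
      have pp: "p * R g \<in> carrier_mat d d" using p cg by simp
      have 1: "p * R g * (p * R h) = R g * (p * R h)"
      proof -
        have "p * R g * (p * R h) = p * R g * p * R h"
          by (rule assoc_mult_mat[symmetric]) (use p cg ch in auto)
        also have "p * R g * p = p * (R g * p)" by (rule assoc_mult_mat) (use p cg in auto)
        also have "\<dots> = R g * p" by (rule pRp[OF g])
        also have "R g * p * R h = R g * (p * R h)" by (rule assoc_mult_mat) (use p cg ch in auto)
        finally show ?thesis .
      qed
      have "?F g * ?F h = R g * ?F h - p * R g * ?F h"
        by (rule minus_mult_distrib_mat[OF cg pp minus_carrier_mat[OF pc]])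
      also have "R g * ?F h = R g * R h - R g * (p * R h)"
        by (rule mult_minus_distrib_mat) (use cg ch pc in auto)
      also have "p * R g * ?F h = p * R g * R h - p * R g * (p * R h)"
        by (rule mult_minus_distrib_mat) (use pp ch pc in auto)
      also have "\<dots> = p * (R g * R h) - R g * (p * R h)"
        unfolding 1 using assoc_mult_mat[OF p cg ch] by simp
      also have "R g * R h - R g * (p * R h) - (p * (R g * R h) - R g * (p * R h)) =
          R g * R h - p * (R g * R h)"
      proof (rule eq_matI)
        fix i j assume ij: "i < dim_row (R g * R h - p * (R g * R h))" "j < dim_col (R g * R h - p * (R g * R h))"
        then have "i < d" "j < d" using p cg ch by auto
        then show "(R g * R h - R g * (p * R h) - (p * (R g * R h) - R g * (p * R h))) $$ (i, j) =
            (R g * R h - p * (R g * R h)) $$ (i, j)"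
          using p cg ch by (simp del: index_mult_mat(1))
      qed (use p cg ch in auto)
      finally show "?F (g \<otimes>\<^bsub>G\<^esub> h) = ?F g * ?F h" using Rm[OF g h] by simp
    qed
    then obtain r2 B where B: "representation G r2 B" "\<And>g. g \<in> carrier G \<Longrightarrow> tr r2 (B g) = tr d (?F g)" by blast
    have trs: "tr d (R g) = tr r1 (A g) + tr r2 (B g)" if g: "g \<in> carrier G" for g
      using A(2)[OF g] B(2)[OF g] tr_comm[OF Rc[OF g] p] tr_minus[OF Rc[OF g], of "p * R g"] p Rc[OF g] by simp
    have R1: "R \<one>\<^bsub>G\<^esub> = 1\<^sub>m d" using rep by blast
    have A1: "A \<one>\<^bsub>G\<^esub> = 1\<^sub>m r1" and B1: "B \<one>\<^bsub>G\<^esub> = 1\<^sub>m r2"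
      using A(1) B(1) unfolding representation_iff[OF G] by blast+
    \<comment> \<open>Traces at the unit element are dimensions, which shows that both parts are
      smaller than \<open>d\<close>.\<close>
    have "(of_nat r1 :: complex) = of_nat r"
      using A(2)[OF G.one_closed] p tr_comm[OF X Y] by (simp add: A1 R1 YX tr_one flip: p_def)
    then have r1: "r1 = r" using of_nat_eq_iff by blast
    have "(of_nat d :: complex) = of_nat r1 + of_nat r2"
      using trs[OF G.one_closed] by (simp add: A1 B1 R1 tr_one)
    then have dsum: "d = r1 + r2" by (metis of_nat_add of_nat_eq_iff)
    have "r \<noteq> 0"
    proof
      assume r0: "r = 0"
      have "w = 0\<^sub>v d" if "w \<in> W" for w
      proof -
        have "X *\<^sub>v (Y *\<^sub>v w) = 0\<^sub>v d" using X Y r0 by (intro eq_vecI) (auto simp: scalar_prod_def)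
        then show ?thesis using XY[OF that] by simp
      qed
      then have "W = {0\<^sub>v d}" using W by (auto simp: is_subspace_def)
      then show False using W0 by simp
    qed
    moreover have "r \<noteq> d"
    proof
      assume rd: "r = d"
      have XYone: "X * Y = 1\<^sub>m d" by (rule mat_mult_left_right_inverse[of Y d X]) (use X Y YX rd in auto)
      have "v \<in> W" if v: "v \<in> carrier_vec d" for v
      proof -
        have "v = (X * Y) *\<^sub>v v" using v by (simp add: XYone)
        also have "\<dots> = X *\<^sub>v (Y *\<^sub>v v)" using X Y v by simp
        finally show ?thesis using XW[of "Y *\<^sub>v v"] Y v by simp
      qed
      then show False using W W1 by (auto simp: is_subspace_def)
    qed
    ultimately have lt: "r1 < d" "r2 < d" using r1 dsum by auto
    obtain xs ys where
      xs: "\<forall>\<chi>\<in>set xs. is_irreducible_character G \<chi>" "\<forall>g\<in>carrier G. tr r1 (A g) = (\<Sum>\<chi>\<leftarrow>xs. \<chi> g)" and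
      ys: "\<forall>\<chi>\<in>set ys. is_irreducible_character G \<chi>" "\<forall>g\<in>carrier G. tr r2 (B g) = (\<Sum>\<chi>\<leftarrow>ys. \<chi> g)"
      using less.IH[OF lt(1) A(1)] less.IH[OF lt(2) B(1)] by blast
    then show ?thesis using trs by (intro exI[of _ "xs @ ys"]) auto
  qed
qed

text \<open>Kernel and image of \<open>T\<close> are invariant, so a nonzero intertwiner is
  bijective. The inverse is given as a matrix, ready for trace computations.\<close>

lemma schur_lemma:
  assumes G: "group G" and irr: "irreducible_representation G d R" "irreducible_representation G d' R'"
    and T: "T \<in> carrier_mat d d'" and int: "\<And>g. g \<in> carrier G \<Longrightarrow> R g * T = T * R' g"
  shows "T = 0\<^sub>m d d' \<or> d = d' \<and> (\<exists>S\<in>carrier_mat d d. T * S = 1\<^sub>m d \<and> S * T = 1\<^sub>m d)"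
proof (rule disjCI)
  assume "\<not> (d = d' \<and> (\<exists>S\<in>carrier_mat d d. T * S = 1\<^sub>m d \<and> S * T = 1\<^sub>m d))"
  note not_iso = this
  have Rc: "R g \<in> carrier_mat d d" "R' g \<in> carrier_mat d' d'" if "g \<in> carrier G" for g
    using irr that by (simp_all add: irreducible_representation_def representation_iff[OF G])
  have intv: "R g *\<^sub>v (T *\<^sub>v v) = T *\<^sub>v (R' g *\<^sub>v v)" if "g \<in> carrier G" "v \<in> carrier_vec d'" for g v
  proof -
    have "R g *\<^sub>v (T *\<^sub>v v) = (R g * T) *\<^sub>v v"
      by (rule assoc_mult_mat_vec[symmetric]) (use T Rc[OF that(1)] that(2) in auto)
    also have "\<dots> = T *\<^sub>v (R' g *\<^sub>v v)"
      unfolding int[OF that(1)] by (rule assoc_mult_mat_vec) (use T Rc[OF that(1)] that(2) in auto)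
    finally show ?thesis .
  qed
  show "T = 0\<^sub>m d d'"
  proof (rule ccontr)
    assume T0: "T \<noteq> 0\<^sub>m d d'"
    let ?K = "{v \<in> carrier_vec d'. T *\<^sub>v v = 0\<^sub>v d}" and ?I = "(\<lambda>v. T *\<^sub>v v) ` carrier_vec d'"
    have "is_subspace d' ?K" unfolding is_subspace_def
      using T by (auto simp: mult_add_distrib_mat_vec[of _ d d'] mult_mat_vec[of _ d d'])
    moreover have "R' g *\<^sub>v v \<in> ?K" if "g \<in> carrier G" "v \<in> ?K" for g v
      using intv[of g v] that Rc[OF that(1)] mat_vec_zero[OF Rc(1)[OF that(1)]] by auto
    ultimately have "?K = {0\<^sub>v d'} \<or> ?K = carrier_vec d'"
      using irr(2) unfolding irreducible_representation_def subspace_iff by blast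
    moreover have "?K \<noteq> carrier_vec d'"
    proof
      assume "?K = carrier_vec d'"
      then have "T *\<^sub>v v = 0\<^sub>v d" if "v \<in> carrier_vec d'" for v using that by blast
      moreover have "0\<^sub>m d d' *\<^sub>v v = 0\<^sub>v d" if "v \<in> carrier_vec d'" for v :: "complex vec"
        using that by (intro eq_vecI) (auto simp: scalar_prod_def)
      ultimately have "T *\<^sub>v v = 0\<^sub>m d d' *\<^sub>v v" if "v \<in> carrier_vec d'" for v using that by simp
      then have "T = 0\<^sub>m d d'" by (intro mat_eqI_vec[OF T]) auto
      then show False using T0 by simp
    qed
    ultimately have K: "?K = {0\<^sub>v d'}" by blast
    have "is_subspace d ?I" unfolding is_subspace_def
    proof (intro conjI ballI allI)
      show "?I \<subseteq> carrier_vec d" using T by auto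
      show "0\<^sub>v d \<in> ?I" by (rule image_eqI[of _ _ "0\<^sub>v d'"]) (use T in auto)
      show "v + w \<in> ?I" if "v \<in> ?I" "w \<in> ?I" for v w
        using that T by (auto simp: mult_add_distrib_mat_vec[symmetric] intro!: imageI)
      show "c \<cdot>\<^sub>v v \<in> ?I" if "v \<in> ?I" for c v
        using that T by (auto simp: mult_mat_vec[symmetric] intro!: imageI)
    qed
    moreover have "R g *\<^sub>v v \<in> ?I" if "g \<in> carrier G" "v \<in> ?I" for g v
      using intv that Rc[OF that(1)] by auto
    ultimately have "?I = {0\<^sub>v d} \<or> ?I = carrier_vec d"
      using irr(1) unfolding irreducible_representation_def subspace_iff by blast
    moreover have "?I \<noteq> {0\<^sub>v d}" using \<open>?K \<noteq> carrier_vec d'\<close> by auto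
    ultimately have I: "?I = carrier_vec d" by blast
    have "\<exists>v\<in>carrier_vec d'. T *\<^sub>v v = unit_vec d j" if "j < d" for j
    proof -
      have "unit_vec d j \<in> ?I" unfolding I by simp
      then show ?thesis by force
    qed
    then obtain s where s: "\<And>j. j < d \<Longrightarrow> s j \<in> carrier_vec d'" "\<And>j. j < d \<Longrightarrow> T *\<^sub>v s j = unit_vec d j" by metis
    \<comment> \<open>Column \<open>j\<close> is a preimage of the unit vector \<open>j\<close>
      under \<open>T\<close>.\<close>
    let ?S = "mat d' d (\<lambda>(i, j). s j $ i)"
    have TS: "T * ?S = 1\<^sub>m d"
    proof (rule eq_matI)
      fix i j assume "i < dim_row (1\<^sub>m d :: complex mat)" "j < dim_col (1\<^sub>m d :: complex mat)"
      then have ij: "i < d" "j < d" by auto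
      have "(T * ?S) $$ (i, j) = (\<Sum>t<d'. T $$ (i, t) * ?S $$ (t, j))"
        by (rule mat_mult_index[OF T]) (use ij in auto)
      also have "\<dots> = (T *\<^sub>v s j) $ i" using mat_vec_index[OF T s(1)[OF ij(2)] ij(1)] ij by simp
      also have "\<dots> = 1\<^sub>m d $$ (i, j)" using s(2)[OF ij(2)] ij by (auto simp: unit_vec_def)
      finally show "(T * ?S) $$ (i, j) = 1\<^sub>m d $$ (i, j)" .
    qed (use T in auto)
    have ST: "?S * T = 1\<^sub>m d'"
    proof (rule mat_eqI_vec[of _ d' d'])
      fix v :: "complex vec" assume v: "v \<in> carrier_vec d'"
      let ?z = "(?S * T) *\<^sub>v v - v"
      have Sv: "(?S * T) *\<^sub>v v = ?S *\<^sub>v (T *\<^sub>v v)" by (rule assoc_mult_mat_vec) (use T v in auto)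
      have Svc: "(?S * T) *\<^sub>v v \<in> carrier_vec d'" using T v by (intro mult_mat_vec_carrier[of _ _ d']) auto
      have "T *\<^sub>v ?z = T *\<^sub>v ((?S * T) *\<^sub>v v) - T *\<^sub>v v"
        by (rule mult_minus_distrib_mat_vec[OF T Svc v])
      also have "T *\<^sub>v ((?S * T) *\<^sub>v v) = (T * ?S) *\<^sub>v (T *\<^sub>v v)"
        unfolding Sv by (rule assoc_mult_mat_vec[symmetric]) (use T v in auto)
      also have "\<dots> = T *\<^sub>v v" using T v by (simp add: TS)
      finally have "T *\<^sub>v ?z = 0\<^sub>v d" using T v by simp
      then have "?z \<in> ?K" using Svc v by auto
      then have z: "?z = 0\<^sub>v d'" using K by auto
      show "(?S * T) *\<^sub>v v = 1\<^sub>m d' *\<^sub>v v"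
      proof (rule eq_vecI)
        fix i assume "i < dim_vec (1\<^sub>m d' *\<^sub>v v)"
        then have i: "i < d'" by auto
        have "?z $ i = ((?S * T) *\<^sub>v v) $ i - v $ i" using Svc v i by (simp del: index_mult_mat_vec)
        then show "((?S * T) *\<^sub>v v) $ i = (1\<^sub>m d' *\<^sub>v v) $ i" using z i v by simp
      qed auto
    qed (use T in auto)
    have "d \<le> d'" by (rule left_inverse_dim[OF T _ TS]) auto
    moreover have "d' \<le> d" by (rule left_inverse_dim[OF _ T ST]) auto
    ultimately have dd: "d = d'" by simp
    have "?S \<in> carrier_mat d d" using dd by auto
    then show False using not_iso TS ST dd by metis
  qed
qed

section \<open>Orthogonality of characters\<close>

text \<open>Over the complex numbers \<open>T\<close> has an eigenvalue \<open>c\<close>; then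
  \<open>T - c\<close> still commutes with the representation but has a nontrivial kernel, so it
  vanishes by \<open>schur_lemma\<close>.\<close>

lemma irreducible_commuting_scalar:
  assumes G: "group G" and irr: "irreducible_representation G d R" and T: "T \<in> carrier_mat d d"
    and int: "\<And>g. g \<in> carrier G \<Longrightarrow> R g * T = T * R g"
  shows "\<exists>c. T = c \<cdot>\<^sub>m 1\<^sub>m d"
proof -
  have d: "d > 0" using irr by (simp add: irreducible_representation_def)
  have Rc: "R g \<in> carrier_mat d d" if "g \<in> carrier G" for g
    using irr that by (simp add: irreducible_representation_def representation_iff[OF G])
  obtain c v where v: "v \<in> carrier_vec d" "v \<noteq> 0\<^sub>v d" "T *\<^sub>v v = c \<cdot>\<^sub>v v"
    using spectrum_non_empty[OF T d] T by (auto simp: spectrum_def eigenvalue_def eigenvector_def)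
  let ?T = "T - c \<cdot>\<^sub>m 1\<^sub>m d"
  have Tc: "?T \<in> carrier_mat d d" by (rule minus_carrier_mat) auto
  have "R g * ?T = ?T * R g" if g: "g \<in> carrier G" for g
  proof -
    have "R g * ?T = R g * T - R g * (c \<cdot>\<^sub>m 1\<^sub>m d)"
      by (rule mult_minus_distrib_mat[OF Rc[OF g] T]) auto
    also have "R g * (c \<cdot>\<^sub>m 1\<^sub>m d) = c \<cdot>\<^sub>m R g"
      using mult_smult_distrib[OF Rc[OF g] one_carrier_mat[of d]] Rc[OF g] by simp
    also have "c \<cdot>\<^sub>m R g = (c \<cdot>\<^sub>m 1\<^sub>m d) * R g"
      using mult_smult_assoc_mat[OF one_carrier_mat[of d] Rc[OF g]] Rc[OF g] by simp
    also have "R g * T - (c \<cdot>\<^sub>m 1\<^sub>m d) * R g = ?T * R g"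
      unfolding int[OF g] by (rule minus_mult_distrib_mat[OF T _ Rc[OF g], symmetric]) auto
    finally show ?thesis .
  qed
  from schur_lemma[OF G irr irr Tc this]
  consider "?T = 0\<^sub>m d d" | S where "S \<in> carrier_mat d d" "S * ?T = 1\<^sub>m d" by blast
  then show ?thesis
  proof cases
    case 1
    have "T = c \<cdot>\<^sub>m 1\<^sub>m d"
    proof (rule eq_matI)
      fix i j assume "i < dim_row (c \<cdot>\<^sub>m 1\<^sub>m d :: complex mat)" "j < dim_col (c \<cdot>\<^sub>m 1\<^sub>m d :: complex mat)"
      then have ij: "i < d" "j < d" by auto
      have "?T $$ (i, j) = 0" using 1 ij by simp
      then show "T $$ (i, j) = (c \<cdot>\<^sub>m 1\<^sub>m d) $$ (i, j)" using T ij by simp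
    qed (use T in auto)
    then show ?thesis by blast
  next
    case (2 S)
    have "?T *\<^sub>v v = 0\<^sub>v d"
    proof (rule eq_vecI)
      fix i assume "i < dim_vec (0\<^sub>v d :: complex vec)"
      then have i: "i < d" by simp
      have "?T *\<^sub>v v = T *\<^sub>v v - (c \<cdot>\<^sub>m 1\<^sub>m d) *\<^sub>v v"
        by (rule minus_mult_distrib_mat_vec[OF T _ v(1)]) auto
      also have "(c \<cdot>\<^sub>m 1\<^sub>m d) *\<^sub>v v = c \<cdot>\<^sub>v v"
        using v(1) by (intro eq_vecI) (auto simp: scalar_prod_def if_distrib[of "\<lambda>x. x * _"] if_distrib[of "\<lambda>x. _ * x"] cong: if_cong)
      finally show "(?T *\<^sub>v v) $ i = 0\<^sub>v d $ i" using v i by simp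
    qed (use T in auto)
    then have "S *\<^sub>v (?T *\<^sub>v v) = 0\<^sub>v d" using mat_vec_zero[OF 2(1)] by simp
    moreover have "S *\<^sub>v (?T *\<^sub>v v) = (S * ?T) *\<^sub>v v"
      by (rule assoc_mult_mat_vec[OF 2(1) Tc v(1), symmetric])
    ultimately have "v = 0\<^sub>v d" using v(1) by (simp only: 2(2)) simp
    then show ?thesis using v(2) by simp
  qed
qed

text \<open>The second factor is evaluated at the inverse, where the usual formula has a complex
  conjugate. For a matrix unit \<open>E\<close> in position \<open>(i, j)\<close> the sum of
  \<open>R g * E * R' (inv g)\<close> over the group is an intertwiner, written \<open>M\<close>
  below, and Schur's lemma applies to it.\<close>

lemma irreducible_character_orthogonality:
  assumes G: "group G" and fin: "finite (carrier G)"
    and \<chi>: "is_irreducible_character G \<chi>" and \<chi>': "is_irreducible_character G \<chi>'"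
  shows "(\<Sum>g\<in>carrier G. \<chi> g * \<chi>' (inv\<^bsub>G\<^esub> g)) =
    (if \<forall>g\<in>carrier G. \<chi> g = \<chi>' g then of_nat (card (carrier G)) else 0)"
proof -
  interpret G: group G by fact
  define M where "M d d' R R' i j = mat d d' (\<lambda>(a, b). \<Sum>g\<in>carrier G. R g $$ (a, i) * R' (inv\<^bsub>G\<^esub> g) $$ (j, b))"
    for d d' i j and R R' :: "'a \<Rightarrow> complex mat"
  have Mc: "M d d' R R' i j \<in> carrier_mat d d'" for d d' R R' i j by (simp add: M_def)
  have M_int: "R h * M d d' R R' i j = M d d' R R' i j * R' h"
    if h: "h \<in> carrier G" and rep: "representation G d R" "representation G d' R'" and ij: "i < d" "j < d'"
    for h d d' R R' i j
  proof (rule eq_matI)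
    have Rc: "R g \<in> carrier_mat d d" "R' g \<in> carrier_mat d' d'" if "g \<in> carrier G" for g
      using rep that by (simp_all add: representation_iff[OF G])
    have Rm: "R (x \<otimes>\<^bsub>G\<^esub> y) = R x * R y" "R' (x \<otimes>\<^bsub>G\<^esub> y) = R' x * R' y"
      if "x \<in> carrier G" "y \<in> carrier G" for x y
      using rep that by (simp_all add: representation_iff[OF G])
    fix a b assume "a < dim_row (M d d' R R' i j * R' h)" "b < dim_col (M d d' R R' i j * R' h)"
    then have ab: "a < d" "b < d'" using Rc[OF h] by (auto simp: M_def)
    have "(R h * M d d' R R' i j) $$ (a, b) = (\<Sum>c<d. R h $$ (a, c) * M d d' R R' i j $$ (c, b))"
      by (rule mat_mult_index[OF Rc(1)[OF h] Mc ab])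
    also have "\<dots> = (\<Sum>c<d. \<Sum>g\<in>carrier G. R h $$ (a, c) * R g $$ (c, i) * R' (inv\<^bsub>G\<^esub> g) $$ (j, b))"
      using ab by (simp add: M_def sum_distrib_left mult.assoc)
    also have "\<dots> = (\<Sum>g\<in>carrier G. (\<Sum>c<d. R h $$ (a, c) * R g $$ (c, i)) * R' (inv\<^bsub>G\<^esub> g) $$ (j, b))"
      by (subst sum.swap) (simp add: sum_distrib_right)
    also have "\<dots> = (\<Sum>g\<in>carrier G. R (h \<otimes>\<^bsub>G\<^esub> g) $$ (a, i) * R' (inv\<^bsub>G\<^esub> g) $$ (j, b))"
      by (rule sum.cong[OF refl]) (simp add: Rm h mat_mult_index[OF Rc(1) Rc(1) ab(1) ij(1)] del: index_mult_mat(1))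
    also have "\<dots> = (\<Sum>g\<in>carrier G. R g $$ (a, i) * R' (inv\<^bsub>G\<^esub> g \<otimes>\<^bsub>G\<^esub> h) $$ (j, b))"
      by (rule sum.reindex_bij_witness[of _ "\<lambda>g. inv\<^bsub>G\<^esub> h \<otimes>\<^bsub>G\<^esub> g" "\<lambda>g. h \<otimes>\<^bsub>G\<^esub> g"])
        (use h in \<open>auto simp: G.m_assoc[symmetric] G.inv_mult_group\<close>, auto simp: G.m_assoc)
    also have "\<dots> = (\<Sum>g\<in>carrier G. R g $$ (a, i) * (\<Sum>c<d'. R' (inv\<^bsub>G\<^esub> g) $$ (j, c) * R' h $$ (c, b)))"
      by (rule sum.cong[OF refl]) (simp add: Rm h mat_mult_index[OF Rc(2) Rc(2) ij(2) ab(2)] del: index_mult_mat(1))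
    also have "\<dots> = (\<Sum>c<d'. M d d' R R' i j $$ (a, c) * R' h $$ (c, b))"
      using ab by (simp add: M_def sum_distrib_left sum_distrib_right mult.assoc) (subst sum.swap, simp)
    also have "\<dots> = (M d d' R R' i j * R' h) $$ (a, b)"
      by (rule mat_mult_index[OF Mc Rc(2)[OF h] ab, symmetric])
    finally show "(R h * M d d' R R' i j) $$ (a, b) = (M d d' R R' i j * R' h) $$ (a, b)" .
  qed (use h rep in \<open>auto simp: M_def representation_iff[OF G]\<close>)
  have M_sum: "(\<Sum>g\<in>carrier G. tr d (R g) * tr d' (R' (inv\<^bsub>G\<^esub> g))) = (\<Sum>a<d. \<Sum>b<d'. M d d' R R' a b $$ (a, b))"
    for d d' R R'
  proof -
    have "(\<Sum>g\<in>carrier G. tr d (R g) * tr d' (R' (inv\<^bsub>G\<^esub> g))) =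
        (\<Sum>g\<in>carrier G. \<Sum>a<d. \<Sum>b<d'. R g $$ (a, a) * R' (inv\<^bsub>G\<^esub> g) $$ (b, b))"
      by (simp add: tr_def sum_product)
    also have "\<dots> = (\<Sum>a<d. \<Sum>g\<in>carrier G. \<Sum>b<d'. R g $$ (a, a) * R' (inv\<^bsub>G\<^esub> g) $$ (b, b))"
      by (rule sum.swap)
    also have "\<dots> = (\<Sum>a<d. \<Sum>b<d'. M d d' R R' a b $$ (a, b))"
      by (rule sum.cong[OF refl], subst sum.swap) (simp add: M_def)
    finally show ?thesis .
  qed
  obtain d R where R: "irreducible_representation G d R" "\<And>g. g \<in> carrier G \<Longrightarrow> \<chi> g = tr d (R g)"
    using \<chi> unfolding is_irreducible_character_def affords_iff by blast
  obtain d' R' where R': "irreducible_representation G d' R'" "\<And>g. g \<in> carrier G \<Longrightarrow> \<chi>' g = tr d' (R' g)"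
    using \<chi>' unfolding is_irreducible_character_def affords_iff by blast
  have rep: "representation G d R" "representation G d' R'"
    using R R' by (simp_all add: irreducible_representation_def)
  have Rc: "R g \<in> carrier_mat d d" "R' g \<in> carrier_mat d' d'" if "g \<in> carrier G" for g
    using rep that by (simp_all add: representation_iff[OF G])
  show ?thesis
  proof (cases "\<forall>g\<in>carrier G. \<chi> g = \<chi>' g")
    case False
    have "M d d' R R' i j = 0\<^sub>m d d'" if ij: "i < d" "j < d'" for i j
    proof (rule ccontr)
      assume nz: "M d d' R R' i j \<noteq> 0\<^sub>m d d'"
      let ?T = "M d d' R R' i j"
      from schur_lemma[OF G R(1) R'(1) Mc M_int[OF _ rep ij]] nz
      obtain S where dd: "d = d'" and S: "S \<in> carrier_mat d d" "?T * S = 1\<^sub>m d" "S * ?T = 1\<^sub>m d" by blast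
      have Tc: "?T \<in> carrier_mat d d" using Mc[of d d'] dd by metis
      have "\<chi> g = \<chi>' g" if g: "g \<in> carrier G" for g
      proof -
        have c: "R g \<in> carrier_mat d d" "R' g \<in> carrier_mat d d" using Rc[OF g] dd by auto
        have "R g = R g * (?T * S)" using c S(2) by simp
        also have "\<dots> = R g * ?T * S" by (rule assoc_mult_mat[OF c(1) Tc S(1), symmetric])
        also have "\<dots> = ?T * R' g * S" by (simp only: M_int[OF g rep ij])
        also have "\<dots> = ?T * (R' g * S)" by (rule assoc_mult_mat[OF Tc c(2) S(1)])
        finally have "tr d (R g) = tr d (?T * (R' g * S))" by simp
        also have "\<dots> = tr d (R' g * S * ?T)" by (rule tr_comm[OF Tc mult_carrier_mat[OF c(2) S(1)]])
        also have "R' g * S * ?T = R' g" using assoc_mult_mat[OF c(2) S(1) Tc] S(3) c(2) by simp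
        finally show ?thesis using R(2)[OF g] R'(2)[OF g] dd by simp
      qed
      then show False using False by blast
    qed
    then have "(\<Sum>g\<in>carrier G. tr d (R g) * tr d' (R' (inv\<^bsub>G\<^esub> g))) = 0" unfolding M_sum by simp
    moreover have "(\<Sum>g\<in>carrier G. \<chi> g * \<chi>' (inv\<^bsub>G\<^esub> g)) = (\<Sum>g\<in>carrier G. tr d (R g) * tr d' (R' (inv\<^bsub>G\<^esub> g)))"
      by (rule sum.cong[OF refl]) (simp only: R(2) R'(2) G.inv_closed)
    ultimately show ?thesis by (simp only: if_not_P[OF False])
  next
    case True
    have "\<exists>c. M d d R R i j = c \<cdot>\<^sub>m 1\<^sub>m d" if "i < d" "j < d" for i j
      by (rule irreducible_commuting_scalar[OF G R(1) Mc M_int[OF _ rep(1,1) that]])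
    then obtain c where c: "\<And>i j. i < d \<Longrightarrow> j < d \<Longrightarrow> M d d R R i j = c i j \<cdot>\<^sub>m 1\<^sub>m d" by metis
    \<comment> \<open>The trace of the scalar matrix: summing over \<open>a\<close> produces the
      diagonal entry \<open>(i, i)\<close> of \<open>R (inv g) * R g\<close>, which is 1 for every
      \<open>g\<close>.\<close>
    have c_diag: "of_nat d * c i i = of_nat (card (carrier G))" if i: "i < d" for i
    proof -
      have "of_nat d * c i i = (\<Sum>a<d. M d d R R i i $$ (a, a))" using c[OF i i] by simp
      also have "\<dots> = (\<Sum>a<d. \<Sum>g\<in>carrier G. R (inv\<^bsub>G\<^esub> g) $$ (i, a) * R g $$ (a, i))"
        by (simp add: M_def mult.commute)
      also have "\<dots> = (\<Sum>g\<in>carrier G. \<Sum>a<d. R (inv\<^bsub>G\<^esub> g) $$ (i, a) * R g $$ (a, i))"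
        by (rule sum.swap)
      also have "\<dots> = (\<Sum>g\<in>carrier G. 1)"
      proof (rule sum.cong[OF refl])
        fix g assume g: "g \<in> carrier G"
        have "(\<Sum>a<d. R (inv\<^bsub>G\<^esub> g) $$ (i, a) * R g $$ (a, i)) = (R (inv\<^bsub>G\<^esub> g) * R g) $$ (i, i)"
          by (rule mat_mult_index[OF Rc(1) Rc(1), symmetric]) (use g i in auto)
        also have "R (inv\<^bsub>G\<^esub> g) * R g = 1\<^sub>m d"
        proof -
          have "R (inv\<^bsub>G\<^esub> g \<otimes>\<^bsub>G\<^esub> g) = R (inv\<^bsub>G\<^esub> g) * R g"
            using rep(1) g G.inv_closed[OF g] unfolding representation_iff[OF G] by blast
          moreover have "R \<one>\<^bsub>G\<^esub> = 1\<^sub>m d" using rep(1) unfolding representation_iff[OF G] by blast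
          ultimately show ?thesis by (simp only: G.l_inv[OF g])
        qed
        finally show "(\<Sum>a<d. R (inv\<^bsub>G\<^esub> g) $$ (i, a) * R g $$ (a, i)) = 1" using i by simp
      qed
      finally show ?thesis by simp
    qed
    have d0: "d > 0" using R(1) by (simp add: irreducible_representation_def)
    \<comment> \<open>Equal characters may be computed from the same representation \<open>R\<close>
      on both sides.\<close>
    have "(\<Sum>g\<in>carrier G. \<chi> g * \<chi>' (inv\<^bsub>G\<^esub> g)) = (\<Sum>g\<in>carrier G. tr d (R g) * tr d (R (inv\<^bsub>G\<^esub> g)))"
      using True R(2) by (intro sum.cong) auto
    also have "\<dots> = (\<Sum>a<d. \<Sum>b<d. c a b * (if a = b then 1 else 0))"
      unfolding M_sum using c by (intro sum.cong refl) auto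
    also have "\<dots> = (\<Sum>a<d. c a a)"
      by (intro sum.cong refl sum_mult_delta(2)) auto
    finally have "of_nat d * (\<Sum>g\<in>carrier G. \<chi> g * \<chi>' (inv\<^bsub>G\<^esub> g)) = (\<Sum>a<d. of_nat d * c a a)"
      by (simp add: sum_distrib_left)
    also have "\<dots> = of_nat d * of_nat (card (carrier G))" using c_diag by simp
    finally have "(\<Sum>g\<in>carrier G. \<chi> g * \<chi>' (inv\<^bsub>G\<^esub> g)) = of_nat (card (carrier G))" using d0 by simp
    then show ?thesis using True by simp
  qed
qed

text \<open>Extensionality turns equality on the group into equality of functions, in accordance
  with \<open>sym_irr_char\<close>.\<close>

definition irr_chars :: "('g, 'b) monoid_scheme \<Rightarrow> ('g \<Rightarrow> complex) set" where
  "irr_chars G = {\<chi> \<in> extensional (carrier G). is_irreducible_character G \<chi>}"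

lemma restrict_irreducible:
  "is_irreducible_character G \<chi> \<Longrightarrow> restrict \<chi> (carrier G) \<in> irr_chars G"
  by (auto simp: irr_chars_def is_irreducible_character_def affords_def)

lemma irr_chars_orthogonal:
  assumes "group G" "finite (carrier G)" "\<chi> \<in> irr_chars G" "\<chi>' \<in> irr_chars G"
  shows "(\<Sum>g\<in>carrier G. \<chi> g * \<chi>' (inv\<^bsub>G\<^esub> g)) = (if \<chi> = \<chi>' then of_nat (card (carrier G)) else 0)"
proof -
  have "(\<forall>g\<in>carrier G. \<chi> g = \<chi>' g) \<longleftrightarrow> \<chi> = \<chi>'"
    using assms(3,4) by (auto simp: irr_chars_def intro: extensionalityI)
  then show ?thesis
    using irreducible_character_orthogonality[OF assms(1,2), of \<chi> \<chi>'] assms(3,4)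
    by (simp add: irr_chars_def)
qed

lemma character_sum_irreducible:
  assumes G: "group G" and \<psi>: "is_character G \<psi>"
  obtains S n where "finite S" "S \<subseteq> irr_chars G"
    "\<forall>g\<in>carrier G. \<psi> g = (\<Sum>\<chi>\<in>S. of_nat (n \<chi>) * \<chi> g)"
proof -
  obtain d R where "representation G d R" and R: "\<And>g. g \<in> carrier G \<Longrightarrow> \<psi> g = tr d (R g)"
    using \<psi> unfolding is_character_def affords_iff by blast
  from character_decomposition[OF G this(1)]
  obtain xs where xs: "\<forall>\<chi>\<in>set xs. is_irreducible_character G \<chi>" "\<forall>g\<in>carrier G. tr d (R g) = (\<Sum>\<chi>\<leftarrow>xs. \<chi> g)"
    by blast
  let ?ys = "map (\<lambda>\<chi>. restrict \<chi> (carrier G)) xs"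
  have cnt: "(\<Sum>y\<leftarrow>ys. f y) = (\<Sum>y\<in>set ys. of_nat (count_list ys y) * f y)" for ys and f :: "('a \<Rightarrow> complex) \<Rightarrow> complex"
  proof -
    have "(\<Sum>y\<in>T. of_nat (count_list ys y) * f y) = (\<Sum>y\<leftarrow>ys. f y)" if "finite T" "set ys \<subseteq> T" for T
      using that
    proof (induction ys)
      case (Cons a ys)
      have "(\<Sum>y\<in>T. of_nat (count_list (a # ys) y) * f y) =
          (\<Sum>y\<in>T. of_nat (count_list ys y) * f y + f y * (if y = a then 1 else 0))"
        by (rule sum.cong) (auto simp: algebra_simps)
      then show ?case using Cons sum_mult_delta(1)[of T a f] by (simp add: sum.distrib)
    qed simp
    then show ?thesis by (metis List.finite_set order_refl)
  qed
  have "\<psi> g = (\<Sum>\<chi>\<in>set ?ys. of_nat (count_list ?ys \<chi>) * \<chi> g)" if g: "g \<in> carrier G" for g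
  proof -
    have "\<psi> g = (\<Sum>y\<leftarrow>?ys. y g)" using R[OF g] xs(2) g by (simp add: o_def)
    then show ?thesis using cnt[of "\<lambda>y. y g" ?ys] by simp
  qed
  moreover have "set ?ys \<subseteq> irr_chars G" using xs(1) restrict_irreducible by auto
  ultimately show ?thesis using that[of "set ?ys" "count_list ?ys"] by blast
qed

lemma inner_irreducible:
  assumes G: "group G" and fin: "finite (carrier G)" and S: "finite S" "S \<subseteq> irr_chars G"
    and f: "\<forall>g\<in>carrier G. f g = (\<Sum>\<chi>\<in>S. n \<chi> * \<chi> g)" and \<chi>: "\<chi> \<in> irr_chars G"
  shows "(\<Sum>g\<in>carrier G. f g * \<chi> (inv\<^bsub>G\<^esub> g)) = (if \<chi> \<in> S then n \<chi> * of_nat (card (carrier G)) else 0)"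
proof -
  have "(\<Sum>g\<in>carrier G. f g * \<chi> (inv\<^bsub>G\<^esub> g)) = (\<Sum>g\<in>carrier G. \<Sum>\<chi>'\<in>S. n \<chi>' * (\<chi>' g * \<chi> (inv\<^bsub>G\<^esub> g)))"
    using f by (intro sum.cong refl) (simp add: sum_distrib_right mult.assoc)
  also have "\<dots> = (\<Sum>\<chi>'\<in>S. n \<chi>' * (\<Sum>g\<in>carrier G. \<chi>' g * \<chi> (inv\<^bsub>G\<^esub> g)))"
    by (subst sum.swap) (simp add: sum_distrib_left)
  also have "\<dots> = (\<Sum>\<chi>'\<in>S. if \<chi>' = \<chi> then n \<chi> * of_nat (card (carrier G)) else 0)"
    using S by (intro sum.cong refl) (simp add: irr_chars_orthogonal[OF G fin _ \<chi>] subset_iff)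
  finally show ?thesis using S(1) by simp
qed

text \<open>The number \<open>k\<close> is a multiplicity. That it is not negative decides the signs
  later on.\<close>

lemma inner_character_irreducible:
  assumes G: "group G" and fin: "finite (carrier G)" and "is_character G \<psi>" and \<chi>: "\<chi> \<in> irr_chars G"
  obtains k :: nat where "(\<Sum>g\<in>carrier G. \<psi> g * \<chi> (inv\<^bsub>G\<^esub> g)) = of_nat (k * card (carrier G))"
proof -
  obtain S n where S: "finite S" "S \<subseteq> irr_chars G"
    "\<forall>g\<in>carrier G. \<psi> g = (\<Sum>\<chi>\<in>S. of_nat (n \<chi>) * \<chi> g)"
    by (rule character_sum_irreducible[OF G assms(3)])
  show ?thesis
    using inner_irreducible[OF G fin S \<chi>] that[of "if \<chi> \<in> S then n \<chi> else 0"] by (auto split: if_splits)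
qed

section \<open>Virtual characters\<close>

definition virtual_character :: "('g, 'b) monoid_scheme \<Rightarrow> ('g \<Rightarrow> complex) \<Rightarrow> bool" where
  "virtual_character G f \<longleftrightarrow> (\<exists>S n. finite S \<and> S \<subseteq> irr_chars G \<and>
    (\<forall>g\<in>carrier G. f g = (\<Sum>\<chi>\<in>S. of_int (n \<chi>) * \<chi> g)))"

lemma virtual_character_character:
  assumes "group G" "is_character G \<psi>" shows "virtual_character G \<psi>"
proof -
  obtain S n where "finite S" "S \<subseteq> irr_chars G"
    "\<forall>g\<in>carrier G. \<psi> g = (\<Sum>\<chi>\<in>S. of_nat (n \<chi>) * \<chi> g)"
    by (rule character_sum_irreducible[OF assms])
  then show ?thesis unfolding virtual_character_def
    by (intro exI[of _ S] exI[of _ "\<lambda>\<chi>. int (n \<chi>)"]) simp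
qed

lemma virtual_character_add:
  assumes "virtual_character G f" "virtual_character G f'"
  shows "virtual_character G (\<lambda>g. f g + f' g)"
proof -
  obtain S n where S: "finite S" "S \<subseteq> irr_chars G" "\<forall>g\<in>carrier G. f g = (\<Sum>\<chi>\<in>S. of_int (n \<chi>) * \<chi> g)"
    using assms(1) unfolding virtual_character_def by blast
  obtain S' n' where S': "finite S'" "S' \<subseteq> irr_chars G" "\<forall>g\<in>carrier G. f' g = (\<Sum>\<chi>\<in>S'. of_int (n' \<chi>) * \<chi> g)"
    using assms(2) unfolding virtual_character_def by blast
  let ?n = "\<lambda>\<chi>. (if \<chi> \<in> S then n \<chi> else 0) + (if \<chi> \<in> S' then n' \<chi> else 0)"
  have "f g + f' g = (\<Sum>\<chi>\<in>S \<union> S'. of_int (?n \<chi>) * \<chi> g)" if "g \<in> carrier G" for g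
  proof -
    have "(\<Sum>\<chi>\<in>S \<union> S'. of_int (?n \<chi>) * \<chi> g) =
        (\<Sum>\<chi>\<in>S \<union> S'. of_int (if \<chi> \<in> S then n \<chi> else 0) * \<chi> g) + (\<Sum>\<chi>\<in>S \<union> S'. of_int (if \<chi> \<in> S' then n' \<chi> else 0) * \<chi> g)"
      by (simp add: distrib_right sum.distrib)
    moreover have "(\<Sum>\<chi>\<in>S \<union> S'. of_int (if \<chi> \<in> S then n \<chi> else 0) * \<chi> g) = (\<Sum>\<chi>\<in>S. of_int (n \<chi>) * \<chi> g)"
      using S(1) S'(1) by (intro sum.mono_neutral_cong_right) auto
    moreover have "(\<Sum>\<chi>\<in>S \<union> S'. of_int (if \<chi> \<in> S' then n' \<chi> else 0) * \<chi> g) = (\<Sum>\<chi>\<in>S'. of_int (n' \<chi>) * \<chi> g)"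
      using S(1) S'(1) by (intro sum.mono_neutral_cong_right) auto
    ultimately show ?thesis using S(3) S'(3) that by simp
  qed
  then show ?thesis unfolding virtual_character_def using S S'
    by (intro exI[of _ "S \<union> S'"] exI[of _ ?n]) auto
qed

lemma virtual_character_smult:
  assumes "virtual_character G f" shows "virtual_character G (\<lambda>g. of_int c * f g)"
proof -
  obtain S n where "finite S" "S \<subseteq> irr_chars G" "\<forall>g\<in>carrier G. f g = (\<Sum>\<chi>\<in>S. of_int (n \<chi>) * \<chi> g)"
    using assms unfolding virtual_character_def by blast
  then show ?thesis unfolding virtual_character_def
    by (intro exI[of _ S] exI[of _ "\<lambda>\<chi>. c * n \<chi>"]) (simp add: sum_distrib_left mult.assoc)
qed

lemma virtual_character_sum:
  assumes "finite I" "\<And>i. i \<in> I \<Longrightarrow> virtual_character G (f i)"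
  shows "virtual_character G (\<lambda>g. \<Sum>i\<in>I. f i g)"
  using assms
proof (induction I rule: finite_induct)
  case empty
  show ?case unfolding virtual_character_def by (intro exI[of _ "{}"]) simp
next
  case (insert i I)
  then show ?case using virtual_character_add[of G "f i" "\<lambda>g. \<Sum>i\<in>I. f i g"] by simp
qed

text \<open>The norm is the sum of the squares of the integer multiplicities, so exactly one of them
  is nonzero, and it is 1 or -1.\<close>

lemma virtual_character_unit_norm:
  assumes G: "group G" and fin: "finite (carrier G)" and f: "virtual_character G f"
    and norm: "(\<Sum>g\<in>carrier G. f g * f (inv\<^bsub>G\<^esub> g)) = of_nat (card (carrier G))"
  obtains \<chi> where "\<chi> \<in> irr_chars G"
    "(\<forall>g\<in>carrier G. f g = \<chi> g) \<or> (\<forall>g\<in>carrier G. f g = - \<chi> g)"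
proof -
  interpret G: group G by fact
  obtain S n where S: "finite S" "S \<subseteq> irr_chars G" "\<forall>g\<in>carrier G. f g = (\<Sum>\<chi>\<in>S. of_int (n \<chi>) * \<chi> g)"
    using f unfolding virtual_character_def by blast
  have "of_nat (card (carrier G)) = (\<Sum>g\<in>carrier G. \<Sum>\<chi>\<in>S. of_int (n \<chi>) * (f g * \<chi> (inv\<^bsub>G\<^esub> g)))"
    unfolding norm[symmetric]
    by (intro sum.cong refl) (use S(3) in \<open>simp add: sum_distrib_left mult_ac\<close>)
  also have "\<dots> = (\<Sum>\<chi>\<in>S. of_int (n \<chi>) * (\<Sum>g\<in>carrier G. f g * \<chi> (inv\<^bsub>G\<^esub> g)))"
    by (subst sum.swap) (simp add: sum_distrib_left)
  also have "\<dots> = (\<Sum>\<chi>\<in>S. of_int (n \<chi>) * (of_int (n \<chi>) * of_nat (card (carrier G))))"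
    using S(2) by (intro sum.cong refl) (simp add: inner_irreducible[OF G fin S] subset_iff)
  finally have "(of_nat (card (carrier G)) :: complex) = of_int (\<Sum>\<chi>\<in>S. n \<chi> * n \<chi>) * of_nat (card (carrier G))"
    by (simp add: sum_distrib_right mult.assoc)
  moreover have "(of_nat (card (carrier G)) :: complex) \<noteq> 0" using fin G.one_closed by auto
  ultimately have "(of_int (\<Sum>\<chi>\<in>S. n \<chi> * n \<chi>) :: complex) = 1" by simp
  then have one: "(\<Sum>\<chi>\<in>S. n \<chi> * n \<chi>) = 1" using of_int_eq_1_iff by blast
  then obtain \<chi> where \<chi>: "\<chi> \<in> S" "n \<chi> \<noteq> 0" by (metis (no_types, lifting) mult_eq_0_iff sum.neutral zero_neq_one)
  have "(\<Sum>\<chi>\<in>S. n \<chi> * n \<chi>) = n \<chi> * n \<chi> + (\<Sum>\<chi>\<in>S - {\<chi>}. n \<chi> * n \<chi>)" by (rule sum.remove[OF S(1) \<chi>(1)])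
  moreover have "n \<chi> * n \<chi> \<ge> 1" using \<chi>(2) by (metis int_one_le_iff_zero_less not_square_less_zero not_less_iff_gr_or_eq mult_eq_0_iff)
  moreover have "(\<Sum>\<chi>\<in>S - {\<chi>}. n \<chi> * n \<chi>) \<ge> 0" by (intro sum_nonneg) simp
  ultimately have sq: "n \<chi> * n \<chi> = 1" and rest: "(\<Sum>\<chi>\<in>S - {\<chi>}. n \<chi> * n \<chi>) = 0" using one by auto
  have "n \<chi>' = 0" if "\<chi>' \<in> S - {\<chi>}" for \<chi>'
    using rest that S(1) sum_nonneg_eq_0_iff[of "S - {\<chi>}" "\<lambda>\<chi>. n \<chi> * n \<chi>"] by auto
  then have "f g = of_int (n \<chi>) * \<chi> g" if "g \<in> carrier G" for g
    using S(3) that sum.remove[OF S(1) \<chi>(1), of "\<lambda>\<chi>. of_int (n \<chi>) * \<chi> g"] by simp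
  moreover have "n \<chi> = 1 \<or> n \<chi> = -1" using sq by (simp add: zmult_eq_1_iff)
  ultimately show ?thesis using that[of \<chi>] \<chi>(1) S(2) by auto
qed

text \<open>The factor \<epsilon> is carried along so that one construction gives permutation
  characters and their twists by the sign.\<close>

lemma signed_permutation_character:
  assumes G: "group G" and fin: "finite X"
    and act: "\<And>g x. g \<in> carrier G \<Longrightarrow> x \<in> X \<Longrightarrow> act g x \<in> X"
    and act_mult: "\<And>g h x. g \<in> carrier G \<Longrightarrow> h \<in> carrier G \<Longrightarrow> x \<in> X \<Longrightarrow> act (g \<otimes>\<^bsub>G\<^esub> h) x = act g (act h x)"
    and act_one: "\<And>x. x \<in> X \<Longrightarrow> act \<one>\<^bsub>G\<^esub> x = x"
    and \<epsilon>_mult: "\<And>g h. g \<in> carrier G \<Longrightarrow> h \<in> carrier G \<Longrightarrow> \<epsilon> (g \<otimes>\<^bsub>G\<^esub> h) = \<epsilon> g * \<epsilon> h"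
    and \<epsilon>_one: "\<epsilon> \<one>\<^bsub>G\<^esub> = 1"
  shows "is_character G (\<lambda>g. \<epsilon> g * of_nat (card {x \<in> X. act g x = x}))"
proof -
  interpret G: group G by fact
  let ?d = "card X"
  obtain e where "bij_betw e {0..<?d} X" using ex_bij_betw_nat_finite[OF fin] by blast
  then have e: "bij_betw e {..<?d} X" by (simp add: atLeast0LessThan)
  have eX: "e i \<in> X" if "i < ?d" for i using e that by (auto simp: bij_betw_def)
  have einj: "e i = e j \<longleftrightarrow> i = j" if "i < ?d" "j < ?d" for i j
    using e that by (auto simp: bij_betw_def inj_on_def)
  define R where "R g = mat ?d ?d (\<lambda>(i, j). if act g (e j) = e i then \<epsilon> g else 0)" for g
  have "representation G ?d R" unfolding representation_iff[OF G]
  proof (intro conjI ballI)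
    show "R g \<in> carrier_mat ?d ?d" for g by (simp add: R_def)
    show "R \<one>\<^bsub>G\<^esub> = 1\<^sub>m ?d"
      by (rule eq_matI) (auto simp: R_def act_one eX einj \<epsilon>_one)
    fix g h assume g: "g \<in> carrier G" and h: "h \<in> carrier G"
    show "R (g \<otimes>\<^bsub>G\<^esub> h) = R g * R h"
    proof (rule eq_matI)
      fix i j assume "i < dim_row (R g * R h)" "j < dim_col (R g * R h)"
      then have ij: "i < ?d" "j < ?d" by (auto simp: R_def)
      obtain k where k: "k < ?d" "e k = act h (e j)"
      proof -
        have "act h (e j) \<in> e ` {..<?d}" using act[OF h eX[OF ij(2)]] e by (simp add: bij_betw_def)
        then show ?thesis using that by (metis imageE lessThan_iff)
      qed
      have "(R g * R h) $$ (i, j) = (\<Sum>t<?d. R g $$ (i, t) * R h $$ (t, j))"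
        by (rule mat_mult_index[of _ ?d ?d]) (use ij in \<open>auto simp: R_def\<close>)
      also have "\<dots> = (\<Sum>t<?d. (R g $$ (i, t) * \<epsilon> h) * (if t = k then 1 else 0))"
        using ij k by (intro sum.cong refl) (auto simp: R_def einj)
      also have "\<dots> = R g $$ (i, k) * \<epsilon> h" by (rule sum_mult_delta) (use k in auto)
      also have "\<dots> = R (g \<otimes>\<^bsub>G\<^esub> h) $$ (i, j)"
        using ij k by (simp add: R_def act_mult g h eX \<epsilon>_mult)
      finally show "R (g \<otimes>\<^bsub>G\<^esub> h) $$ (i, j) = (R g * R h) $$ (i, j)" ..
    qed (auto simp: R_def)
  qed
  moreover have "tr ?d (R g) = \<epsilon> g * of_nat (card {x \<in> X. act g x = x})" for g
  proof -
    have "bij_betw e ({..<?d} \<inter> {i. act g (e i) = e i}) {x \<in> X. act g x = x}"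
      using e by (auto simp: bij_betw_def inj_on_def)
    then have c: "card ({..<?d} \<inter> {i. act g (e i) = e i}) = card {x \<in> X. act g x = x}" by (rule bij_betw_same_card)
    have "tr ?d (R g) = (\<Sum>i<?d. if act g (e i) = e i then \<epsilon> g else 0)" by (simp add: tr_def R_def)
    also have "\<dots> = \<epsilon> g * of_nat (card ({..<?d} \<inter> {i. act g (e i) = e i}))" by (simp add: sum.If_cases)
    finally show ?thesis by (simp only: c)
  qed
  ultimately show ?thesis unfolding is_character_def affords_iff by (intro exI[of _ ?d] exI[of _ R]) simp
qed

lemma is_character_add:
  assumes G: "group G" and "is_character G \<chi>" "is_character G \<psi>"
  shows "is_character G (\<lambda>g. \<chi> g + \<psi> g)"
proof -
  obtain d R where R: "representation G d R" "\<And>g. g \<in> carrier G \<Longrightarrow> \<chi> g = tr d (R g)"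
    using assms(2) unfolding is_character_def affords_iff by blast
  obtain d' R' where R': "representation G d' R'" "\<And>g. g \<in> carrier G \<Longrightarrow> \<psi> g = tr d' (R' g)"
    using assms(3) unfolding is_character_def affords_iff by blast
  let ?R = "\<lambda>g. four_block_mat (R g) (0\<^sub>m d d') (0\<^sub>m d' d) (R' g)"
  have Rc: "R g \<in> carrier_mat d d" "R' g \<in> carrier_mat d' d'" if "g \<in> carrier G" for g
    using R(1) R'(1) that by (simp_all add: representation_iff[OF G])
  have "representation G (d + d') ?R" unfolding representation_iff[OF G]
  proof (intro conjI ballI)
    show "?R g \<in> carrier_mat (d + d') (d + d')" if "g \<in> carrier G" for g using Rc[OF that] by simp
    show "?R \<one>\<^bsub>G\<^esub> = 1\<^sub>m (d + d')"
      using R(1) R'(1) by (simp add: representation_iff[OF G] four_block_one_mat)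
    fix g h assume g: "g \<in> carrier G" and h: "h \<in> carrier G"
    note c = Rc(1)[OF g] Rc(2)[OF g] Rc(1)[OF h] Rc(2)[OF h]
    have E: "0\<^sub>m d d' * 0\<^sub>m d' d = (0\<^sub>m d d :: complex mat)" "0\<^sub>m d' d * 0\<^sub>m d d' = (0\<^sub>m d' d' :: complex mat)"
      "R g * 0\<^sub>m d d' = 0\<^sub>m d d'" "0\<^sub>m d d' * R' h = 0\<^sub>m d d'"
      "0\<^sub>m d' d * R h = 0\<^sub>m d' d" "R' g * 0\<^sub>m d' d = 0\<^sub>m d' d"
      "R g * R h + 0\<^sub>m d d = R g * R h" "0\<^sub>m d' d' + R' g * R' h = R' g * R' h"
      "0\<^sub>m d d' + 0\<^sub>m d d' = (0\<^sub>m d d' :: complex mat)" "0\<^sub>m d' d + 0\<^sub>m d' d = (0\<^sub>m d' d :: complex mat)"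
      using c by (auto intro!: eq_matI)
    have "?R g * ?R h = four_block_mat (R g * R h) (0\<^sub>m d d') (0\<^sub>m d' d) (R' g * R' h)"
      unfolding mult_four_block_mat[OF c(1) zero_carrier_mat zero_carrier_mat c(2,3) zero_carrier_mat zero_carrier_mat c(4)] E ..
    then show "?R (g \<otimes>\<^bsub>G\<^esub> h) = ?R g * ?R h"
      using R(1) R'(1) g h by (simp add: representation_iff[OF G])
  qed
  moreover have "tr (d + d') (?R g) = \<chi> g + \<psi> g" if g: "g \<in> carrier G" for g
  proof -
    have "tr (d + d') (?R g) = (\<Sum>i<d. ?R g $$ (i, i)) + (\<Sum>i<d'. ?R g $$ (d + i, d + i))"
    proof -
      have "(\<Sum>i<d + k. f i) = (\<Sum>i<d. f i) + (\<Sum>i<k. f (d + i))" for k and f :: "nat \<Rightarrow> complex"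
        by (induction k) (simp_all add: add.assoc)
      then show ?thesis unfolding tr_def by blast
    qed
    also have "\<dots> = tr d (R g) + tr d' (R' g)" using Rc[OF g] by (simp add: tr_def)
    finally show ?thesis using R(2)[OF g] R'(2)[OF g] by simp
  qed
  ultimately show ?thesis unfolding is_character_def affords_iff by (intro exI[of _ "d + d'"] exI[of _ ?R]) simp
qed

lemma is_character_zero: "group G \<Longrightarrow> is_character G (\<lambda>g. 0)"
  unfolding is_character_def affords_iff
  by (intro exI[of _ 0] exI[of _ "\<lambda>g. 1\<^sub>m 0"]) (simp add: representation_iff tr_def)

lemma is_character_sum:
  assumes G: "group G" and "finite I" "\<And>i. i \<in> I \<Longrightarrow> is_character G (\<chi> i)"
  shows "is_character G (\<lambda>g. \<Sum>i\<in>I. \<chi> i g)"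
  using assms(2,3)
  by (induction I rule: finite_induct) (auto simp: is_character_zero[OF G] intro!: is_character_add[OF G])

text \<open>The sets \<open>F g\<close> behave like the cosets of a normal subgroup of \<Gamma> with
  quotient \<open>G\<close>. The averages \<open>E g\<close> of \<open>R\<close> over them are
  multiplicative, and at the unit element this is the projection to the invariants of the
  subgroup.\<close>

lemma is_character_average:
  assumes G: "group G" and \<Gamma>: "group \<Gamma>" and \<psi>: "is_character \<Gamma> \<psi>"
    and F: "\<And>g. g \<in> carrier G \<Longrightarrow> F g \<subseteq> carrier \<Gamma>" "\<And>g. g \<in> carrier G \<Longrightarrow> finite (F g)"
      "\<And>g. g \<in> carrier G \<Longrightarrow> card (F g) = k" and k: "k > 0"
    and mult: "\<And>g h w. g \<in> carrier G \<Longrightarrow> h \<in> carrier G \<Longrightarrow> w \<in> F g \<Longrightarrow>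
      bij_betw (\<lambda>v. w \<otimes>\<^bsub>\<Gamma>\<^esub> v) (F h) (F (g \<otimes>\<^bsub>G\<^esub> h))"
  shows "is_character G (\<lambda>g. (\<Sum>w\<in>F g. \<psi> w) / of_nat k)"
proof -
  interpret G: group G by fact
  obtain d R where R: "representation \<Gamma> d R" "\<And>g. g \<in> carrier \<Gamma> \<Longrightarrow> \<psi> g = tr d (R g)"
    using \<psi> unfolding is_character_def affords_iff by blast
  have Rc: "R w \<in> carrier_mat d d" if "w \<in> carrier \<Gamma>" for w
    using R(1) that by (simp add: representation_iff[OF \<Gamma>])
  have Rm: "R (x \<otimes>\<^bsub>\<Gamma>\<^esub> y) = R x * R y" if "x \<in> carrier \<Gamma>" "y \<in> carrier \<Gamma>" for x y
    using R(1) that by (simp add: representation_iff[OF \<Gamma>])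
  define E where "E g = mat d d (\<lambda>(i, j). (\<Sum>w\<in>F g. R w $$ (i, j)) / of_nat k)" for g
  have Ec: "E g \<in> carrier_mat d d" for g by (simp add: E_def)
  have Em: "E (g \<otimes>\<^bsub>G\<^esub> h) = E g * E h" if g: "g \<in> carrier G" and h: "h \<in> carrier G" for g h
  proof (rule eq_matI)
    fix i j assume "i < dim_row (E g * E h)" "j < dim_col (E g * E h)"
    then have ij: "i < d" "j < d" by (auto simp: E_def)
    have "(E g * E h) $$ (i, j) = (\<Sum>t<d. E g $$ (i, t) * E h $$ (t, j))"
      by (rule mat_mult_index[OF Ec Ec ij])
    also have "\<dots> = (\<Sum>t<d. \<Sum>w\<in>F g. \<Sum>v\<in>F h. R w $$ (i, t) * R v $$ (t, j) / (of_nat k * of_nat k))"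
      using ij by (simp add: E_def sum_product sum_divide_distrib)
    also have "\<dots> = (\<Sum>w\<in>F g. \<Sum>v\<in>F h. \<Sum>t<d. R w $$ (i, t) * R v $$ (t, j) / (of_nat k * of_nat k))"
      by (subst sum.swap, rule sum.cong[OF refl], rule sum.swap)
    also have "\<dots> = (\<Sum>w\<in>F g. \<Sum>v\<in>F h. R (w \<otimes>\<^bsub>\<Gamma>\<^esub> v) $$ (i, j) / (of_nat k * of_nat k))"
    proof (intro sum.cong refl)
      fix w v assume "w \<in> F g" "v \<in> F h"
      then have wv: "w \<in> carrier \<Gamma>" "v \<in> carrier \<Gamma>" using F(1)[OF g] F(1)[OF h] by auto
      show "(\<Sum>t<d. R w $$ (i, t) * R v $$ (t, j) / (of_nat k * of_nat k)) =
          R (w \<otimes>\<^bsub>\<Gamma>\<^esub> v) $$ (i, j) / (of_nat k * of_nat k)"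
        unfolding Rm[OF wv] mat_mult_index[OF Rc[OF wv(1)] Rc[OF wv(2)] ij] sum_divide_distrib ..
    qed
    \<comment> \<open>Left multiplication by \<open>w\<close> maps \<open>F h\<close> bijectively
      onto the fibre of the product, so every \<open>w\<close> contributes the same sum.\<close>
    also have "\<dots> = (\<Sum>w\<in>F g. \<Sum>u\<in>F (g \<otimes>\<^bsub>G\<^esub> h). R u $$ (i, j) / (of_nat k * of_nat k))"
      by (intro sum.cong refl sum.reindex_bij_betw[OF mult[OF g h], where g = "\<lambda>u. R u $$ (i, j) / (of_nat k * of_nat k)"])
    also have "\<dots> = E (g \<otimes>\<^bsub>G\<^esub> h) $$ (i, j)"
      using ij k F(3)[OF g] by (simp add: E_def sum_divide_distrib sum_distrib_left)
    finally show "E (g \<otimes>\<^bsub>G\<^esub> h) $$ (i, j) = (E g * E h) $$ (i, j)" ..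
  qed (auto simp: E_def)
  obtain r A where A: "representation G r A" "\<forall>g\<in>carrier G. tr r (A g) = tr d (E g)"
    using nonunital_representation[OF G Ec Em] by blast
  have "tr d (E g) = (\<Sum>w\<in>F g. \<psi> w) / of_nat k" if g: "g \<in> carrier G" for g
  proof -
    have "tr d (E g) = (\<Sum>i<d. \<Sum>w\<in>F g. R w $$ (i, i)) / of_nat k"
      by (simp add: tr_def E_def sum_divide_distrib)
    also have "(\<Sum>i<d. \<Sum>w\<in>F g. R w $$ (i, i)) = (\<Sum>w\<in>F g. \<psi> w)"
      using F(1)[OF g] by (subst sum.swap) (auto simp: R(2) tr_def intro!: sum.cong)
    finally show ?thesis .
  qed
  then show ?thesis using A unfolding is_character_def affords_iff by metis
qed

section \<open>Irreducible characters of the symmetric group\<close>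

lemma carrier_sym_group: "carrier (sym_group n) = {w. w permutes {1..n}}"
  by (simp add: sym_group_def)

lemma finite_sym_group: "finite (carrier (sym_group n))"
  by (simp add: carrier_sym_group finite_permutations)

lemma card_sym_group: "card (carrier (sym_group n)) = fact n"
  by (simp add: carrier_sym_group card_permutations)

lemma cols_compose:
  assumes fin: "finite A" and w: "w permutes A" and f: "f \<in> cols A \<alpha>"
  shows "restrict (f \<circ> w) A \<in> cols A \<alpha>"
proof -
  have "content A (restrict (f \<circ> w) A) = content A (f \<circ> w)" by (rule content_cong) simp
  then show ?thesis using f content_permute[OF fin w, of f] by (simp add: cols_def)
qed

lemma signed_colouring_character:
  fixes \<epsilon> :: "(nat \<Rightarrow> nat) \<Rightarrow> complex"
  assumes \<epsilon>: "\<And>g h. g \<in> carrier (sym_group n) \<Longrightarrow> h \<in> carrier (sym_group n) \<Longrightarrow> \<epsilon> (g \<circ> h) = \<epsilon> g * \<epsilon> h" "\<epsilon> id = 1"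
  shows "is_character (sym_group n) (\<lambda>g. \<epsilon> g * of_nat (card (fixcols {1..n} \<alpha> g)))"
proof -
  let ?A = "{1..n}" and ?G = "sym_group n"
  \<comment> \<open>The inverse makes this a left action; the fixed colourings of a permutation and
    of its inverse agree.\<close>
  define act where "act g f = restrict (f \<circ> inv' g) ?A" for g and f :: "nat \<Rightarrow> nat"
  have "is_character ?G (\<lambda>g. \<epsilon> g * of_nat (card {f \<in> cols ?A \<alpha>. act g f = f}))"
  proof (rule signed_permutation_character[OF sym_group_is_group])
    show "finite (cols ?A \<alpha>)" by (simp add: finite_cols)
    show "act g f \<in> cols ?A \<alpha>" if "g \<in> carrier ?G" "f \<in> cols ?A \<alpha>" for g f
      unfolding act_def using that by (intro cols_compose) (auto simp: sym_group_carrier permutes_inv)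
    show "act (g \<otimes>\<^bsub>?G\<^esub> h) f = act g (act h f)" if "g \<in> carrier ?G" "h \<in> carrier ?G" for g h f
    proof -
      have gh: "g permutes ?A" "h permutes ?A" using that by (simp_all add: sym_group_carrier)
      have "inv' (g \<circ> h) = inv' h \<circ> inv' g" using gh by (simp add: o_inv_distrib permutes_bij)
      then show ?thesis using permutes_in_image[OF permutes_inv[OF gh(1)]]
        by (auto simp: act_def sym_group_mult fun_eq_iff)
    qed
    show "act \<one>\<^bsub>?G\<^esub> f = f" if "f \<in> cols ?A \<alpha>" for f
    proof
      fix a show "act \<one>\<^bsub>?G\<^esub> f a = f a"
        using that by (cases "a \<in> ?A") (auto simp: act_def sym_group_one cols_def extensional_def simp del: atLeastAtMost_iff)
    qed
    show "\<epsilon> (g \<otimes>\<^bsub>?G\<^esub> h) = \<epsilon> g * \<epsilon> h" if "g \<in> carrier ?G" "h \<in> carrier ?G" for g h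
      using \<epsilon>(1)[OF that] by (simp only: sym_group_mult)
    show "\<epsilon> \<one>\<^bsub>?G\<^esub> = 1" using \<epsilon>(2) by (simp only: sym_group_one)
  qed
  moreover have "{f \<in> cols ?A \<alpha>. act g f = f} = fixcols ?A \<alpha> g" if g: "g \<in> carrier ?G" for g
  proof -
    have gp: "g permutes ?A" using g by (simp add: sym_group_carrier)
    have "act g f = f \<longleftrightarrow> (\<forall>a\<in>?A. f (inv' g a) = f a)" if "f \<in> cols ?A \<alpha>" for f
    proof
      assume eq: "act g f = f"
      have "f (inv' g a) = f a" if "a \<in> ?A" for a
        using fun_cong[OF eq, of a] that by (simp add: act_def restrict_def)
      then show "\<forall>a\<in>?A. f (inv' g a) = f a" by blast
    next
      assume "\<forall>a\<in>?A. f (inv' g a) = f a"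
      then show "act g f = f" using that
        by (intro extensionalityI[of _ ?A]) (auto simp: act_def cols_def)
    qed
    then have "{f \<in> cols ?A \<alpha>. act g f = f} = fixcols ?A \<alpha> (inv' g)" by (auto simp: fixcols_def)
    then show ?thesis by (simp only: fixcols_inv[OF gp])
  qed
  ultimately show ?thesis by (simp add: is_character_def affords_def)
qed

lemma colouring_character: "is_character (sym_group n) (\<lambda>g. of_nat (card (fixcols {1..n} \<alpha> g)))"
  using signed_colouring_character[of n "\<lambda>_. 1" \<alpha>] by simp

lemma sign_colouring_character:
  "is_character (sym_group n) (\<lambda>g. of_int (sign g) * of_nat (card (fixcols {1..n} \<alpha> g)))"
  by (rule signed_colouring_character) (simp_all add: sign_compose sym_group_carrier')

abbreviation frob_restrict :: "nat \<Rightarrow> nat list \<Rightarrow> (nat \<Rightarrow> nat) \<Rightarrow> complex" where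
  "frob_restrict n lam \<equiv> restrict (\<lambda>w. of_int (frob_char {1..n} lam w)) (carrier (sym_group n))"

text \<open>Norm 1 makes \<open>f\<^sub>\<lambda>\<close> an irreducible character up to sign. Its
  inner product with the character \<open>\<theta>\<^sub>\<lambda>\<close> is the Kostka number 1,
  which excludes the negative sign.\<close>

lemma frob_restrict_irreducible:
  assumes lam: "lam \<in> partitions_of n"
  shows "frob_restrict n lam \<in> irr_chars (sym_group n)"
proof -
  let ?G = "sym_group n" and ?A = "{1..n}"
  let ?f = "\<lambda>w. of_int (frob_char ?A lam w) :: complex"
  have card: "card ?A = n" by simp
  have inv_eq: "?f (inv\<^bsub>?G\<^esub> g) = ?f g" if "g \<in> carrier ?G" for g
    using that by (simp add: frob_char_inv sym_group_carrier)
  have virt: "virtual_character ?G ?f"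
  proof -
    have "virtual_character ?G (\<lambda>w. \<Sum>mu\<in>partitions_of n. of_int (inverse_kostka n mu lam) *
        of_nat (card (fixcols ?A (part_mono mu) w)))"
      by (intro virtual_character_sum virtual_character_smult virtual_character_character
          sym_group_is_group colouring_character finite_partitions_of)
    then show ?thesis by (simp add: frob_char_def)
  qed
  have "(\<Sum>g\<in>carrier ?G. ?f g * ?f (inv\<^bsub>?G\<^esub> g)) = of_int (\<Sum>w | w permutes ?A. frob_char ?A lam w * frob_char ?A lam w)"
    using inv_eq by (simp add: carrier_sym_group)
  also have "\<dots> = of_nat (card (carrier ?G))"
    using sum_frob_char_frob_char[of ?A lam lam] lam by (simp add: card_sym_group)
  finally obtain \<chi> where \<chi>: "\<chi> \<in> irr_chars ?G"
      "(\<forall>g\<in>carrier ?G. ?f g = \<chi> g) \<or> (\<forall>g\<in>carrier ?G. ?f g = - \<chi> g)"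
    by (rule virtual_character_unit_norm[OF sym_group_is_group finite_sym_group virt])
  interpret G: group ?G by (rule sym_group_is_group)
  have "\<not> (\<forall>g\<in>carrier ?G. ?f g = - \<chi> g)"
  proof
    assume neg: "\<forall>g\<in>carrier ?G. ?f g = - \<chi> g"
    let ?\<theta> = "\<lambda>g. of_nat (card (fixcols ?A (part_mono lam) g)) :: complex"
    obtain k where k: "(\<Sum>g\<in>carrier ?G. ?\<theta> g * \<chi> (inv\<^bsub>?G\<^esub> g)) = of_nat (k * card (carrier ?G))"
      by (rule inner_character_irreducible[OF sym_group_is_group finite_sym_group colouring_character \<chi>(1)])
    have "\<chi> (inv\<^bsub>?G\<^esub> g) = - ?f g" if g: "g \<in> carrier ?G" for g
    proof -
      have "?f (inv\<^bsub>?G\<^esub> g) = - \<chi> (inv\<^bsub>?G\<^esub> g)" using neg G.inv_closed[OF g] by blast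
      then show ?thesis using inv_eq[OF g] by (metis minus_minus)
    qed
    then have "(\<Sum>g\<in>carrier ?G. ?\<theta> g * \<chi> (inv\<^bsub>?G\<^esub> g)) = - (\<Sum>g\<in>carrier ?G. ?f g * ?\<theta> g)"
      by (simp add: sum_negf[symmetric] mult.commute)
    also have "(\<Sum>g\<in>carrier ?G. ?f g * ?\<theta> g) =
        of_int (\<Sum>w | w permutes ?A. frob_char ?A lam w * int (card (fixcols ?A (part_mono lam) w)))"
      by (simp add: carrier_sym_group)
    also have "(\<Sum>w | w permutes ?A. frob_char ?A lam w * int (card (fixcols ?A (part_mono lam) w))) = fact n"
    proof -
      have "mdeg (part_mono lam) = n" using lam by (simp add: mdeg_part_mono partitions_of_def)
      then show ?thesis using sum_frob_char_fixcols[of ?A lam "part_mono lam"] lam kostka_number_self[OF lam]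
        by (simp add: kostka_number_def)
    qed
    finally have "(of_int (int (k * fact n)) :: complex) = of_int (- fact n)" using k by (simp add: card_sym_group)
    then have "int (k * fact n) = - fact n" by (simp only: of_int_eq_iff)
    moreover have "int (k * fact n) \<ge> 0" "(fact n :: int) > 0" by simp_all
    ultimately show False by linarith
  qed
  then have "\<forall>g\<in>carrier ?G. ?f g = \<chi> g" using \<chi>(2) by blast
  then have "frob_restrict n lam = \<chi>"
    using \<chi>(1) by (intro extensionalityI[of _ "carrier ?G"]) (auto simp: irr_chars_def)
  then show ?thesis using \<chi>(1) by simp
qed

text \<open>For a pair of colourings the signs are summed over the permutations fixing both. If two
  points have the same pair of colours, their transposition makes the sum vanish; otherwise only the
  identity is left.\<close>

lemma sum_sign_fixcols_fixcols:
  assumes fin: "finite A"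
  shows "(\<Sum>w | w permutes A. int (card (fixcols A \<alpha> w)) * sign w * int (card (fixcols A \<beta> w))) =
    int (card {(f, h). f \<in> cols A \<alpha> \<and> h \<in> cols A \<beta> \<and> inj_on (\<lambda>a. (f a, h a)) A})"
proof -
  let ?s = "\<lambda>(f :: 'a \<Rightarrow> nat) (h :: 'a \<Rightarrow> nat) w. (\<forall>a\<in>A. f (w a) = f a) \<and> (\<forall>a\<in>A. h (w a) = h a)"
  let ?W = "{w. w permutes A}"
  have finW: "finite ?W" by (rule finite_permutations[OF fin])
  have stab: "(\<Sum>w | w \<in> ?W \<and> ?s f h w. sign w) =
      (if inj_on (\<lambda>a. (f a, h a)) A then 1 else 0 :: int)" (is "sum sign ?S = _") for f h :: "'a \<Rightarrow> nat"
  proof (cases "inj_on (\<lambda>a. (f a, h a)) A")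
    case True
    have "?S = {id}"
    proof (intro equalityI subsetI)
      fix w assume w: "w \<in> ?S"
      have "w a = a" for a
      proof (cases "a \<in> A")
        case a: True
        then have "w a \<in> A" using w by (simp add: permutes_in_image)
        then show ?thesis using True w a by (auto simp: inj_on_def)
      qed (use w in \<open>auto simp: permutes_not_in\<close>)
      then show "w \<in> {id}" by auto
    qed (auto simp: permutes_id)
    then show ?thesis using True by (simp only: sum.insert sum.empty) simp
  next
    case False
    then obtain a b where ab: "a \<in> A" "b \<in> A" "a \<noteq> b" "f a = f b" "h a = h b" by (auto simp: inj_on_def)
    \<comment> \<open>Right multiplication by it is a sign reversing involution of the
      stabiliser.\<close>
    let ?t = "transpose a b"
    have t: "?t permutes A" by (rule permutes_swap_id) (use ab in auto)
    have ft: "f (?t x) = f x" "h (?t x) = h x" for x using ab by (auto simp: transpose_def)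
    have closed: "w \<circ> ?t \<in> ?S" if "w \<in> ?S" for w
    proof -
      have "f (w (?t x)) = f x" "h (w (?t x)) = h x" if "x \<in> A" for x
        using \<open>w \<in> ?S\<close> permutes_in_image[OF t, of x] that ft by auto
      then show ?thesis using that permutes_compose[OF t] by auto
    qed
    have "sum sign ?S = (\<Sum>w\<in>?S. sign (w \<circ> ?t))"
      by (rule sum.reindex_bij_witness[of _ "\<lambda>w. w \<circ> ?t" "\<lambda>w. w \<circ> ?t"])
        (use closed in \<open>auto simp: comp_assoc simp del: o_apply\<close>)
    also have "\<dots> = (\<Sum>w\<in>?S. - sign w)"
    proof (rule sum.cong[OF refl])
      fix w assume "w \<in> ?S"
      then have "permutation w" "permutation ?t" using fin t by (auto simp: permutation_permutes)
      then show "sign (w \<circ> ?t) = - sign w" using ab(3) by (simp add: sign_compose sign_swap_id)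
    qed
    also have "\<dots> = - sum sign ?S" by (rule sum_negf)
    finally have "sum sign ?S = - sum sign ?S" .
    then have "sum sign ?S = 0" by linarith
    then show ?thesis by (simp only: if_not_P[OF False])
  qed
  have "(\<Sum>w\<in>?W. int (card (fixcols A \<alpha> w)) * sign w * int (card (fixcols A \<beta> w))) =
      (\<Sum>w\<in>?W. \<Sum>f\<in>cols A \<alpha>. \<Sum>h\<in>cols A \<beta>. if ?s f h w then sign w else 0)"
  proof (rule sum.cong[OF refl])
    fix w
    have c: "int (card (fixcols A \<gamma> w)) = (\<Sum>f\<in>cols A \<gamma>. if \<forall>a\<in>A. f (w a) = f a then 1 else 0)" for \<gamma>
      by (simp add: fixcols_def sum.If_cases finite_cols[OF fin] Int_def)
    show "int (card (fixcols A \<alpha> w)) * sign w * int (card (fixcols A \<beta> w)) =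
        (\<Sum>f\<in>cols A \<alpha>. \<Sum>h\<in>cols A \<beta>. if ?s f h w then sign w else 0)"
      unfolding c sum_distrib_right sum_distrib_left by (subst sum.swap, intro sum.cong refl) auto
  qed
  also have "\<dots> = (\<Sum>f\<in>cols A \<alpha>. \<Sum>h\<in>cols A \<beta>. \<Sum>w\<in>?W. if ?s f h w then sign w else 0)"
    by (subst sum.swap, rule sum.cong[OF refl], rule sum.swap)
  also have "\<dots> = (\<Sum>f\<in>cols A \<alpha>. \<Sum>h\<in>cols A \<beta>. if inj_on (\<lambda>a. (f a, h a)) A then 1 else 0)"
  proof (intro sum.cong refl)
    fix f h :: "'a \<Rightarrow> nat"
    have "(\<Sum>w\<in>?W. if ?s f h w then sign w else 0) =
        (\<Sum>w | w \<in> ?W \<and> ?s f h w. sign w)"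
      by (rule sum.inter_filter[OF finW, symmetric])
    then show "(\<Sum>w\<in>?W. if ?s f h w then sign w else 0) =
        (if inj_on (\<lambda>a. (f a, h a)) A then 1 else 0)" by (simp only: stab)
  qed
  also have "\<dots> = (\<Sum>(f, h)\<in>cols A \<alpha> \<times> cols A \<beta>. if inj_on (\<lambda>a. (f a, h a)) A then 1 else 0)"
    by (rule sum.cartesian_product)
  also have "\<dots> = (\<Sum>p\<in>cols A \<alpha> \<times> cols A \<beta>. if inj_on (\<lambda>a. (fst p a, snd p a)) A then 1 else 0)"
    by (simp add: case_prod_unfold)
  also have "\<dots> = int (card ((cols A \<alpha> \<times> cols A \<beta>) \<inter> {p. inj_on (\<lambda>a. (fst p a, snd p a)) A}))"
    by (simp add: sum.If_cases finite_cols[OF fin])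
  also have "(cols A \<alpha> \<times> cols A \<beta>) \<inter> {p. inj_on (\<lambda>a. (fst p a, snd p a)) A} =
      {(f, h). f \<in> cols A \<alpha> \<and> h \<in> cols A \<beta> \<and> inj_on (\<lambda>a. (f a, h a)) A}" by auto
  finally show ?thesis .
qed

section \<open>Conjugate partitions and pairs of colourings separating the points\<close>

lemma shape_of_antimono: "lam \<in> partitions_of n \<Longrightarrow> i \<le> j \<Longrightarrow> shape_of lam j \<le> shape_of lam i"
  by (rule is_shape_antimono) (auto simp: partitions_of_def is_shape_shape_of)

lemma shape_of_conjugate:
  assumes lam: "lam \<in> partitions_of n"
  shows "shape_of (conjugate_partition lam) c = card {i. c < shape_of lam i}"
    and "{i. c < shape_of lam i} = {..<shape_of (conjugate_partition lam) c}"
proof -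
  let ?S = "{i. c < shape_of lam i}"
  have fin: "finite ?S"
    by (rule finite_subset[of _ "{..<length lam}"]) (use shape_of_pos in fastforce)+
  have "shape_of lam i \<le> shape_of lam 0" for i using shape_of_antimono[OF lam, of 0 i] by simp
  then have hd: "c < (if lam = [] then 0 else hd lam)" if "c < shape_of lam i" for i
  proof -
    have "c < shape_of lam 0" using that \<open>shape_of lam i \<le> shape_of lam 0\<close> by simp
    then show ?thesis by (cases lam) (auto simp: shape_of_def)
  qed
  have len: "length (filter (\<lambda>k. c < k) lam) = card ?S"
    unfolding length_filter_conv_card by (rule arg_cong[of _ _ card]) (auto simp: shape_of_def split: if_splits)
  show 1: "shape_of (conjugate_partition lam) c = card ?S"
  proof (cases "c < (if lam = [] then 0 else hd lam)")
    case True
    then have "lam \<noteq> []" "c < hd lam" by (auto split: if_splits)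
    then have "shape_of (conjugate_partition lam) c = length (filter (\<lambda>k. c < k) lam)"
      by (simp add: shape_of_def conjugate_partition_def)
    then show ?thesis using len by simp
  next
    case False
    then have "?S = {}" using hd by blast
    moreover have "length (conjugate_partition lam) = (if lam = [] then 0 else hd lam)"
      by (simp add: conjugate_partition_def)
    then have "shape_of (conjugate_partition lam) c = 0" using False by (simp add: shape_of_def)
    ultimately show ?thesis by simp
  qed
  have down: "j \<in> ?S" if "i \<in> ?S" "j \<le> i" for i j
    using that shape_of_antimono[OF lam that(2)] by simp
  have "?S \<subseteq> {..<card ?S}"
  proof
    fix i assume i: "i \<in> ?S"
    have "{..i} \<subseteq> ?S" using down[OF i] by blast
    then have "card {..i} \<le> card ?S" by (rule card_mono[OF fin])
    then show "i \<in> {..<card ?S}" by simp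
  qed
  then show "?S = {..<shape_of (conjugate_partition lam) c}"
    unfolding 1 by (rule card_subset_eq[rotated]) simp_all
qed

lemma mem_diagram: "(i, j) \<in> diagram lam \<longleftrightarrow> j < shape_of lam i"
  by (auto simp: diagram_def shape_of_def)

lemma finite_diagram: "lam \<in> partitions_of n \<Longrightarrow> finite (diagram lam)" and
  card_diagram: "lam \<in> partitions_of n \<Longrightarrow> card (diagram lam) = n"
  by (auto simp: partitions_of_def diagram_cells finite_cells card_cells is_shape_shape_of ssize_shape_of)

lemma sum_list_conjugate:
  assumes lam: "lam \<in> partitions_of n" shows "sum_list (conjugate_partition lam) = n"
proof -
  let ?c = "conjugate_partition lam"
  have "diagram lam = (\<lambda>(j, i). (i, j)) ` (SIGMA j:{..<length ?c}. {..<shape_of ?c j})"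
  proof (intro equalityI subsetI)
    fix p assume "p \<in> diagram lam"
    then obtain i j where p: "p = (i, j)" "j < shape_of lam i" by (cases p) (auto simp: mem_diagram)
    then have "i < shape_of ?c j" using shape_of_conjugate(2)[OF lam, of j] by auto
    then show "p \<in> (\<lambda>(j, i). (i, j)) ` (SIGMA j:{..<length ?c}. {..<shape_of ?c j})"
      using p(1) shape_of_pos[of ?c j] by force
  next
    fix p assume "p \<in> (\<lambda>(j, i). (i, j)) ` (SIGMA j:{..<length ?c}. {..<shape_of ?c j})"
    then obtain i j where p: "p = (i, j)" "i \<in> {..<shape_of ?c j}" by auto
    then show "p \<in> diagram lam" using p(2)[folded shape_of_conjugate(2)[OF lam, of j]] by (simp add: mem_diagram)
  qed
  then have "card (diagram lam) = card (SIGMA j:{..<length ?c}. {..<shape_of ?c j})"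
    by (simp add: card_image inj_on_def)
  also have "\<dots> = sum_list ?c" by (simp add: shape_of_def sum_list_sum_nth atLeast0LessThan)
  finally show ?thesis by (simp add: card_diagram[OF lam])
qed

text \<open>Identify \<open>A\<close> with the diagram: the row and the column of a cell are two
  colourings that together determine the cell.\<close>

lemma separated_pair_exists:
  assumes lam: "lam \<in> partitions_of n" and A: "finite A" "card A = n"
  shows "\<exists>f h. f \<in> cols A (part_mono lam) \<and> h \<in> cols A (part_mono (conjugate_partition lam)) \<and>
    inj_on (\<lambda>a. (f a, h a)) A"
proof -
  obtain e where e: "bij_betw e A (diagram lam)"
    using finite_same_card_bij[OF A(1) finite_diagram[OF lam]] A(2) card_diagram[OF lam] by auto
  have cardeq: "card {a \<in> A. P (e a)} = card {p \<in> diagram lam. P p}" for P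
  proof (rule bij_betw_same_card)
    show "bij_betw e {a \<in> A. P (e a)} {p \<in> diagram lam. P p}"
      unfolding bij_betw_def
    proof
      show "inj_on e {a \<in> A. P (e a)}" using e by (auto simp: bij_betw_def inj_on_def)
      have "e ` {a \<in> A. P (e a)} = {p \<in> e ` A. P p}" by auto
      then show "e ` {a \<in> A. P (e a)} = {p \<in> diagram lam. P p}" using e by (simp only: bij_betw_def)
    qed
  qed
  have "{p \<in> diagram lam. fst p = i} = Pair i ` {..<shape_of lam i}" for i by (auto simp: mem_diagram)
  then have row: "card {p \<in> diagram lam. fst p = i} = shape_of lam i" for i by (simp add: card_image inj_on_def)
  have "{p \<in> diagram lam. snd p = j} = (\<lambda>i. (i, j)) ` {i. j < shape_of lam i}" for j by (auto simp: mem_diagram)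
  then have col: "card {p \<in> diagram lam. snd p = j} = shape_of (conjugate_partition lam) j" for j
    by (simp add: card_image inj_on_def shape_of_conjugate(1)[OF lam])
  let ?f = "\<lambda>a\<in>A. fst (e a)" and ?h = "\<lambda>a\<in>A. snd (e a)"
  have "?f \<in> cols A (part_mono lam)"
    using cardeq[of "\<lambda>p. fst p = _"] row
    by (auto simp: cols_def lookup_content[OF A(1)] lookup_part_mono intro!: poly_mapping_eqI cong: conj_cong)
  moreover have "?h \<in> cols A (part_mono (conjugate_partition lam))"
    using cardeq[of "\<lambda>p. snd p = _"] col
    by (auto simp: cols_def lookup_content[OF A(1)] lookup_part_mono intro!: poly_mapping_eqI cong: conj_cong)
  moreover have "inj_on (\<lambda>a. (?f a, ?h a)) A" using e by (auto simp: inj_on_def bij_betw_def prod_eq_iff)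
  ultimately show ?thesis by blast
qed

lemma card_partition_fibres:
  assumes "finite B" "finite I" "f ` B \<subseteq> I"
  shows "(\<Sum>i\<in>I. card {a \<in> B. f a = i}) = card B"
  using sum.group[OF assms, of "\<lambda>_. 1 :: nat"] by simp

text \<open>The necessary half of the Gale-Ryser theorem. Among the points with
  \<open>f a < k\<close>, the class of \<open>h\<close> with colour \<open>c\<close> has at most
  \<open>k\<close> elements by injectivity and at most as many as column \<open>c\<close> of the
  diagram has cells. The smaller of these bounds is the number of cells of that column in the first
  \<open>k\<close> rows.\<close>

lemma separated_pair_dominates:
  assumes lam: "lam \<in> partitions_of n" and A: "finite A"
    and f: "f \<in> cols A (part_mono mu)" and h: "h \<in> cols A (part_mono (conjugate_partition lam))"
    and inj: "inj_on (\<lambda>a. (f a, h a)) A"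
  shows "dominates lam mu"
  unfolding dominates_def
proof
  fix k
  let ?c = "shape_of (conjugate_partition lam)" and ?B = "{a \<in> A. f a < k}"
  have fc: "card {a \<in> A. f a = i} = shape_of mu i" for i
    using f lookup_content[OF A, of f i] by (simp add: cols_def lookup_part_mono)
  have hc: "card {a \<in> A. h a = j} = ?c j" for j
    using h lookup_content[OF A, of h j] by (simp add: cols_def lookup_part_mono)
  obtain M where M: "\<And>a. a \<in> A \<Longrightarrow> h a < M" "\<And>i. i < k \<Longrightarrow> shape_of lam i \<le> M"
  proof -
    have "finite (h ` A \<union> shape_of lam ` {..<k})" using A by simp
    then obtain M where M: "h ` A \<union> shape_of lam ` {..<k} \<subseteq> {..<M}"
      by (meson finite_nat_iff_bounded)
    show ?thesis
    proof (rule that[of M])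
      show "h a < M" if "a \<in> A" for a using M that by auto
      show "shape_of lam i \<le> M" if "i < k" for i using M that by fastforce
    qed
  qed
  have "(\<Sum>i<k. shape_of mu i) = (\<Sum>i<k. card {a \<in> ?B. f a = i})"
  proof (rule sum.cong[OF refl])
    fix i assume "i \<in> {..<k}"
    then have "{a \<in> ?B. f a = i} = {a \<in> A. f a = i}" by auto
    then show "shape_of mu i = card {a \<in> ?B. f a = i}" by (simp only: fc)
  qed
  also have "\<dots> = card ?B"
    using card_partition_fibres[of ?B "{..<k}" f] A by auto
  also have "\<dots> = (\<Sum>c<M. card {a \<in> ?B. h a = c})"
    by (rule card_partition_fibres[symmetric]) (use A M(1) in auto)
  also have "\<dots> \<le> (\<Sum>c<M. card {i \<in> {..<k}. c < shape_of lam i})"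
  proof (rule sum_mono)
    fix c
    have "card {a \<in> ?B. h a = c} \<le> card {a \<in> A. h a = c}" by (rule card_mono) (use A in auto)
    moreover have "card {a \<in> ?B. h a = c} \<le> card {..<k}"
    proof (rule card_inj_on_le[of f])
      show "inj_on f {a \<in> ?B. h a = c}" using inj by (auto simp: inj_on_def)
    qed auto
    moreover have "card {i \<in> {..<k}. c < shape_of lam i} = min k (?c c)"
    proof -
      have "{i \<in> {..<k}. c < shape_of lam i} = {..<k} \<inter> {i. c < shape_of lam i}" by auto
      also have "\<dots> = {..<min k (?c c)}" unfolding shape_of_conjugate(2)[OF lam] by auto
      finally have "{i \<in> {..<k}. c < shape_of lam i} = {..<min k (?c c)}" .
      then show ?thesis by (simp only: card_lessThan)
    qed
    ultimately show "card {a \<in> ?B. h a = c} \<le> card {i \<in> {..<k}. c < shape_of lam i}" unfolding hc card_lessThan by linarith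
  qed
  also have "\<dots> = (\<Sum>c<M. \<Sum>i<k. if c < shape_of lam i then 1 else 0)"
    by (simp add: sum.If_cases Int_def)
  also have "\<dots> = (\<Sum>i<k. \<Sum>c<M. if c < shape_of lam i then 1 else 0)" by (rule sum.swap)
  also have "\<dots> = (\<Sum>i<k. shape_of lam i)"
  proof (rule sum.cong[OF refl])
    fix i assume "i \<in> {..<k}"
    then have "{..<M} \<inter> {c. c < shape_of lam i} = {..<shape_of lam i}" using M(2)[of i] by auto
    then show "(\<Sum>c<M. if c < shape_of lam i then 1 else 0) = shape_of lam i" by (simp add: sum.If_cases)
  qed
  finally show "(\<Sum>i<k. shape_of mu i) \<le> (\<Sum>i<k. shape_of lam i)" .
qed

text \<open>A Young subgroup is the stabiliser of the colouring of the points by the number of their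
  interval. Stated for lists with given sum, it applies to a partition and to its conjugate.\<close>

lemma block_colouring:
  assumes n: "sum_list lam = n"
  obtains b where "b \<in> cols {1..n} (part_mono lam)"
    "young_subgroup lam = {\<sigma>. \<sigma> permutes {1..n} \<and> (\<forall>a\<in>{1..n}. b (\<sigma> a) = b a)}"
proof -
  let ?A = "{1..n}" and ?s = "\<lambda>i. sum_list (take i lam)"
  let ?B = "\<lambda>i. {?s i<..?s (Suc i)}"
  have s_Suc: "?s (Suc i) = ?s i + shape_of lam i" for i
    by (cases "i < length lam") (simp_all add: take_Suc_conv_app_nth shape_of_def)
  have s_mono: "?s i \<le> ?s j" if "i \<le> j" for i j
    by (rule lift_Suc_mono_le[OF _ that]) (simp only: s_Suc le_add1)
  have s_last: "?s (length lam) = n" by (simp add: n)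
  have s_le: "?s i \<le> n" for i
    using s_mono[of i "max i (length lam)"] by (simp add: n)
  \<comment> \<open>The first interval whose upper end reaches \<open>a\<close>.\<close>
  define b where "b = (\<lambda>a\<in>?A. LEAST i. a \<le> ?s (Suc i))"
  have b_iff: "b a = i \<longleftrightarrow> a \<in> ?B i" if a: "a \<in> ?A" for a i
  proof -
    have "a \<le> ?s (Suc (length lam))" using a s_last by (simp add: n)
    then have L: "a \<le> ?s (Suc (b a))" using LeastI[of "\<lambda>i. a \<le> ?s (Suc i)" "length lam"] a by (simp add: b_def)
    have below: "?s (Suc j) < a" if "j < b a" for j
      using not_less_Least[of j "\<lambda>i. a \<le> ?s (Suc i)"] that a by (simp add: b_def)
    have low: "?s (b a) < a"
    proof (cases "b a")
      case 0 then show ?thesis using a by simp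
    next
      case (Suc j) then show ?thesis using below[of j] by simp
    qed
    show ?thesis
    proof
      assume "b a = i" then show "a \<in> ?B i" using L low by auto
    next
      assume "a \<in> ?B i"
      then have i: "?s i < a" "a \<le> ?s (Suc i)" by auto
      show "b a = i"
      proof (rule antisym)
        show "b a \<le> i" using s_mono[of "Suc i" "b a"] i low by (metis leI le_less_trans not_less not_less_eq_eq)
        show "i \<le> b a" using s_mono[of "Suc (b a)" i] i L by (metis leI le_less_trans not_less not_less_eq_eq)
      qed
    qed
  qed
  have BA: "?B i \<subseteq> ?A" for i using s_le[of "Suc i"] by auto
  have "{a \<in> ?A. b a = i} = ?B i" for i using b_iff BA by blast
  then have "card {a \<in> ?A. b a = i} = shape_of lam i" for i by (simp add: s_Suc)
  then have bc: "b \<in> cols ?A (part_mono lam)"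
    by (auto simp: cols_def b_def lookup_content lookup_part_mono intro!: poly_mapping_eqI)
  have "young_subgroup lam = {\<sigma>. \<sigma> permutes ?A \<and> (\<forall>a\<in>?A. b (\<sigma> a) = b a)}"
  proof (intro equalityI subsetI)
    fix \<sigma> assume "\<sigma> \<in> young_subgroup lam"
    then have \<sigma>: "\<sigma> permutes ?A" "\<And>i. i < length lam \<Longrightarrow> \<sigma> ` ?B i = ?B i"
      by (simp_all add: young_subgroup_def sym_group_carrier n)
    have "b (\<sigma> a) = b a" if a: "a \<in> ?A" for a
    proof -
      have aB: "a \<in> ?B (b a)" using b_iff[OF a] by blast
      \<comment> \<open>The intervals past the end of \<open>lam\<close> are empty.\<close>
      then have "b a < length lam" by (metis (no_types, lifting) BA greaterThanAtMost_empty_iff add.right_neutral empty_iff le_refl not_less s_Suc shape_of_def)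
      then have "\<sigma> a \<in> ?B (b a)" using \<sigma>(2) aB by blast
      moreover have "\<sigma> a \<in> ?A" using permutes_in_image[OF \<sigma>(1)] a by blast
      ultimately show ?thesis using b_iff by blast
    qed
    then show "\<sigma> \<in> {\<sigma>. \<sigma> permutes ?A \<and> (\<forall>a\<in>?A. b (\<sigma> a) = b a)}" using \<sigma>(1) by blast
  next
    fix \<sigma> assume "\<sigma> \<in> {\<sigma>. \<sigma> permutes ?A \<and> (\<forall>a\<in>?A. b (\<sigma> a) = b a)}"
    then have \<sigma>: "\<sigma> permutes ?A" "\<And>a. a \<in> ?A \<Longrightarrow> b (\<sigma> a) = b a" by blast+
    have "\<sigma> ` ?B i = ?B i" for i
    proof -
      have "\<sigma> ` ?B i \<subseteq> ?B i"
      proof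
        fix y assume "y \<in> \<sigma> ` ?B i"
        then obtain a where a: "a \<in> ?B i" "y = \<sigma> a" by blast
        have aA: "a \<in> ?A" using a(1) BA by blast
        have "b a = i" using b_iff[OF aA] a(1) by blast
        then have "b y = i" using \<sigma>(2)[OF aA] a(2) by simp
        moreover have "y \<in> ?A" using permutes_in_image[OF \<sigma>(1)] aA a(2) by blast
        ultimately show "y \<in> ?B i" using b_iff by blast
      qed
      then show ?thesis
        by (rule card_subset_eq[rotated]) (auto simp: card_image inj_on_subset[OF permutes_inj[OF \<sigma>(1)]])
    qed
    then show "\<sigma> \<in> young_subgroup lam" using \<sigma>(1) by (simp add: young_subgroup_def sym_group_carrier n)
  qed
  then show ?thesis using that[OF bc] by blast
qed

text \<open>The map from \<open>x\<close> to \<open>b \<circ> inv' x\<close> has the left cosets of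
  the Young subgroup as fibres, and \<open>inv' x \<circ> g \<circ> x\<close> lies in the subgroup
  iff \<open>g\<close> fixes this colouring. Hence the trivial character induced from the subgroup
  is \<open>\<theta>\<^sub>\<lambda>\<close>.\<close>

lemma card_conjugating_into_young_subgroup:
  assumes n: "sum_list lam = n" and g: "g permutes {1..n}"
  shows "card {x. x permutes {1..n} \<and> inv' x \<circ> g \<circ> x \<in> young_subgroup lam} =
    card (fixcols {1..n} (part_mono lam) g) * card (young_subgroup lam)"
    and "card (young_subgroup lam) > 0"
proof -
  let ?A = "{1..n}" and ?\<alpha> = "part_mono lam"
  obtain b where b: "b \<in> cols ?A ?\<alpha>"
    "young_subgroup lam = {\<sigma>. \<sigma> permutes ?A \<and> (\<forall>a\<in>?A. b (\<sigma> a) = b a)}"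
    by (rule block_colouring[OF n])
  have lk: "card {a \<in> ?A. f a = c} = lookup ?\<alpha> c" if "f \<in> cols ?A ?\<alpha>" for f c
    using that lookup_content[of ?A f c] by (simp add: cols_def)
  have fibre: "card {x. x permutes ?A \<and> (\<forall>a\<in>?A. f (x a) = b a)} = (\<Prod>c\<in>b ` ?A. fact (lookup ?\<alpha> c))"
    if f: "f \<in> cols ?A ?\<alpha>" for f
    by (subst card_permutes_matching[of ?A "b ` ?A"]) (simp_all only: lk[OF f] lk[OF b(1)] if_True finite_imageI finite_atLeastAtMost subset_refl simp_thms)
  have H: "card (young_subgroup lam) = (\<Prod>c\<in>b ` ?A. fact (lookup ?\<alpha> c))"
    unfolding b(2) by (rule fibre[OF b(1)])
  then show "card (young_subgroup lam) > 0" by simp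
  let ?X = "{x. x permutes ?A \<and> inv' x \<circ> g \<circ> x \<in> young_subgroup lam}"
  let ?F = "\<lambda>x. restrict (b \<circ> inv' x) ?A"
  have F: "?F x \<in> cols ?A ?\<alpha>" if "x permutes ?A" for x
    by (rule cols_compose[OF _ permutes_inv[OF that] b(1)]) simp
  have F_iff: "?F x = f \<longleftrightarrow> (\<forall>a\<in>?A. f (x a) = b a)" if x: "x permutes ?A" and f: "f \<in> cols ?A ?\<alpha>" for x f
  proof
    assume eq: "?F x = f"
    have "f (x a) = b a" if "a \<in> ?A" for a
      using that permutes_in_image[OF x, of a] permutes_inverses[OF x] unfolding eq[symmetric] by simp
    then show "\<forall>a\<in>?A. f (x a) = b a" by blast
  next
    assume eq: "\<forall>a\<in>?A. f (x a) = b a"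
    show "?F x = f"
    proof (rule extensionalityI[of _ ?A])
      fix a assume a: "a \<in> ?A"
      have "inv' x a \<in> ?A" using permutes_in_image[OF permutes_inv[OF x]] a by blast
      then have "f (x (inv' x a)) = b (inv' x a)" using eq by blast
      then show "?F x a = f a" using a permutes_inverses[OF x] by simp
    qed (use f in \<open>auto simp: cols_def\<close>)
  qed
  have mem: "x \<in> ?X \<longleftrightarrow> x permutes ?A \<and> ?F x \<in> fixcols ?A ?\<alpha> g" for x
  proof (cases "x permutes ?A")
    case x: True
    have ix: "inv' x permutes ?A" by (rule permutes_inv[OF x])
    have perm: "inv' x \<circ> g \<circ> x permutes ?A" by (intro permutes_compose x g ix)
    have "x \<in> ?X \<longleftrightarrow> (\<forall>a\<in>?A. b (inv' x (g (x a))) = b a)" unfolding b(2) using x perm by simp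
    also have "\<dots> \<longleftrightarrow> (\<forall>a\<in>?A. b (inv' x (g a)) = b (inv' x a))"
      using permutes_in_image[OF x] permutes_in_image[OF ix] permutes_inverses[OF x] by metis
    also have "\<dots> \<longleftrightarrow> (\<forall>a\<in>?A. ?F x (g a) = ?F x a)"
      using permutes_in_image[OF g] by (intro ball_cong refl) (simp add: restrict_def del: atLeastAtMost_iff)
    finally show ?thesis using x F[OF x] by (simp add: fixcols_def)
  qed auto
  have "?X = (\<Union>f\<in>fixcols ?A ?\<alpha> g. {x. x permutes ?A \<and> ?F x = f})" using mem by blast
  then have "card ?X = (\<Sum>f\<in>fixcols ?A ?\<alpha> g. card {x. x permutes ?A \<and> ?F x = f})"
    by (simp only:) (rule card_UN_disjoint, auto simp: finite_fixcols intro: finite_permutes_subset)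
  also have "\<dots> = (\<Sum>f\<in>fixcols ?A ?\<alpha> g. card (young_subgroup lam))"
  proof (rule sum.cong[OF refl])
    fix f assume "f \<in> fixcols ?A ?\<alpha> g"
    then have f: "f \<in> cols ?A ?\<alpha>" by (simp add: fixcols_def)
    have "{x. x permutes ?A \<and> ?F x = f} = {x. x permutes ?A \<and> (\<forall>a\<in>?A. f (x a) = b a)}"
      using F_iff[OF _ f] by blast
    then show "card {x. x permutes ?A \<and> ?F x = f} = card (young_subgroup lam)" by (simp only: fibre[OF f] H)
  qed
  finally show "card ?X = card (fixcols ?A ?\<alpha> g) * card (young_subgroup lam)" by simp
qed

text \<open>Invariance under conjugation lets \<phi> leave the sum; this covers the trivial
  character and the sign.\<close>

lemma induced_char_young_subgroup:
  assumes n: "sum_list lam = n" and g: "g \<in> carrier (sym_group n)"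
    and \<phi>: "\<And>x. x \<in> carrier (sym_group n) \<Longrightarrow> \<phi> (inv' x \<circ> g \<circ> x) = \<phi> g"
  shows "induced_char (sym_group n) (young_subgroup lam) \<phi> g = \<phi> g * of_nat (card (fixcols {1..n} (part_mono lam) g))"
proof -
  let ?G = "sym_group n"
  have gp: "g permutes {1..n}" using g by (simp add: sym_group_carrier)
  let ?X = "{x. x permutes {1..n} \<and> inv' x \<circ> g \<circ> x \<in> young_subgroup lam}"
  have X: "{x. x \<in> carrier ?G \<and> inv\<^bsub>?G\<^esub> x \<otimes>\<^bsub>?G\<^esub> g \<otimes>\<^bsub>?G\<^esub> x \<in> young_subgroup lam} = ?X"
    by (auto simp: sym_group_mult sym_group_carrier)
  have "(\<Sum>x\<in>?X. \<phi> (inv\<^bsub>?G\<^esub> x \<otimes>\<^bsub>?G\<^esub> g \<otimes>\<^bsub>?G\<^esub> x)) = (\<Sum>x\<in>?X. \<phi> g)"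
    using \<phi> by (intro sum.cong refl) (simp add: sym_group_mult sym_group_carrier)
  then show ?thesis
    using card_conjugating_into_young_subgroup[OF n gp] unfolding induced_char_def X by simp
qed

lemma char_inner_real:
  "char_inner G \<chi> (\<lambda>g. of_int (f g)) = (\<Sum>g\<in>carrier G. \<chi> g * of_int (f g)) / of_nat (card (carrier G))"
  by (simp add: char_inner_def)

lemma char_inner_cong:
  "(\<And>g. g \<in> carrier G \<Longrightarrow> \<phi> g = \<phi>' g) \<Longrightarrow> char_inner G \<chi> \<phi> = char_inner G \<chi> \<phi>'"
  by (simp add: char_inner_def)

text \<open>Up to the factor \<open>n!\<close> this is the multiplicity of an irreducible character
  in a character.\<close>

lemma sum_frob_sign_fixcols_nonneg:
  assumes lam: "lam \<in> partitions_of n"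
  shows "(\<Sum>w | w permutes {1..n}. frob_char {1..n} lam w * (sign w * int (card (fixcols {1..n} \<beta> w)))) \<ge> 0"
proof -
  let ?G = "sym_group n"
  interpret G: group ?G by (rule sym_group_is_group)
  obtain k where k: "(\<Sum>g\<in>carrier ?G. (of_int (sign g) * of_nat (card (fixcols {1..n} \<beta> g))) * frob_restrict n lam (inv\<^bsub>?G\<^esub> g)) =
      of_nat (k * card (carrier ?G))"
    by (rule inner_character_irreducible[OF sym_group_is_group finite_sym_group sign_colouring_character frob_restrict_irreducible[OF lam]])
  have "frob_restrict n lam (inv\<^bsub>?G\<^esub> g) = of_int (frob_char {1..n} lam g)" if "g \<in> carrier ?G" for g
    using that G.inv_closed[OF that] by (simp add: frob_char_inv sym_group_carrier)
  then have "(of_int (\<Sum>w | w permutes {1..n}. frob_char {1..n} lam w * (sign w * int (card (fixcols {1..n} \<beta> w)))) :: complex) =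
      of_int (int (k * card (carrier ?G)))"
    using k by (simp add: carrier_sym_group mult_ac)
  then show ?thesis by (simp only: of_int_eq_iff)
qed

text \<open>The pairing of \<open>\<theta>\<^sub>\<nu>\<close> with the sign twisted character
  counts separated pairs, and by Young's rule it is the sum of the \<open>t \<kappa>\<close>
  weighted by Kostka numbers, without negative terms. So \<open>t \<nu> \<noteq> 0\<close> produces
  a separated pair and hence dominance. Conversely, the pair existing for \<open>lam\<close> forces
  \<open>t \<kappa> \<noteq> 0\<close> for some \<kappa> with nonzero Kostka number, and the two
  opposite dominance relations leave only \<open>\<kappa> = lam\<close>.\<close>

lemma frob_sign_pairing:
  assumes lam: "lam \<in> partitions_of n" and mu: "mu \<in> partitions_of n"
  defines "t \<equiv> \<lambda>\<kappa>. (\<Sum>w | w permutes {1..n}. frob_char {1..n} \<kappa> w *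
    (sign w * int (card (fixcols {1..n} (part_mono (conjugate_partition lam)) w))))"
  shows "t mu \<noteq> 0 \<Longrightarrow> dominates lam mu" and "t lam \<noteq> 0"
proof -
  let ?A = "{1..n}" and ?\<beta> = "part_mono (conjugate_partition lam)"
  let ?S = "\<lambda>\<nu>. (\<Sum>w | w permutes ?A. int (card (fixcols ?A (part_mono \<nu>) w)) * sign w * int (card (fixcols ?A ?\<beta> w)))"
  have S_t: "?S \<nu> = (\<Sum>\<kappa>\<in>partitions_of n. kostka_number \<kappa> \<nu> * t \<kappa>)" if \<nu>: "\<nu> \<in> partitions_of n" for \<nu>
  proof -
    have "mdeg (part_mono \<nu>) = card ?A" using \<nu> by (simp add: mdeg_part_mono partitions_of_def)
    from card_fixcols_expand[OF _ _ this]
    have "int (card (fixcols ?A (part_mono \<nu>) w)) = (\<Sum>\<kappa>\<in>partitions_of n. kostka_number \<kappa> \<nu> * frob_char ?A \<kappa> w)"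
      if "w permutes ?A" for w
      using that by (simp add: kostka_number_def)
    then have "?S \<nu> = (\<Sum>w | w permutes ?A. \<Sum>\<kappa>\<in>partitions_of n. kostka_number \<kappa> \<nu> *
        (frob_char ?A \<kappa> w * (sign w * int (card (fixcols ?A ?\<beta> w)))))"
      by (intro sum.cong refl) (simp only: mem_Collect_eq sum_distrib_right mult.assoc)
    also have "\<dots> = (\<Sum>\<kappa>\<in>partitions_of n. kostka_number \<kappa> \<nu> * t \<kappa>)"
      unfolding t_def sum_distrib_left by (rule sum.swap)
    finally show ?thesis .
  qed
  have t0: "t \<kappa> \<ge> 0" if "\<kappa> \<in> partitions_of n" for \<kappa>
    unfolding t_def by (rule sum_frob_sign_fixcols_nonneg[OF that])
  have K0: "kostka_number \<kappa> \<nu> \<ge> 0" for \<kappa> \<nu> by (simp add: kostka_number_def)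
  have dom: "dominates lam \<nu>" if \<nu>: "\<nu> \<in> partitions_of n" and "t \<nu> \<noteq> 0" for \<nu>
  proof -
    have "(\<Sum>\<kappa>\<in>partitions_of n. kostka_number \<kappa> \<nu> * t \<kappa>) \<ge> kostka_number \<nu> \<nu> * t \<nu>"
      by (rule member_le_sum[OF \<nu>]) (use t0 K0 finite_partitions_of in \<open>auto intro: mult_nonneg_nonneg\<close>)
    then have "?S \<nu> > 0" unfolding S_t[OF \<nu>] using t0[OF \<nu>] \<open>t \<nu> \<noteq> 0\<close> kostka_number_self[OF \<nu>] by simp
    then have "{(f, h). f \<in> cols ?A (part_mono \<nu>) \<and> h \<in> cols ?A ?\<beta> \<and> inj_on (\<lambda>a. (f a, h a)) ?A} \<noteq> {}"
      unfolding sum_sign_fixcols_fixcols[OF finite_atLeastAtMost] by (metis card.empty less_irrefl of_nat_0)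
    then show ?thesis using separated_pair_dominates[OF lam finite_atLeastAtMost] by blast
  qed
  then show "t mu \<noteq> 0 \<Longrightarrow> dominates lam mu" using mu by blast
  have "finite {(f, h). f \<in> cols ?A (part_mono lam) \<and> h \<in> cols ?A ?\<beta> \<and> inj_on (\<lambda>a. (f a, h a)) ?A}"
    by (rule finite_subset[of _ "cols ?A (part_mono lam) \<times> cols ?A ?\<beta>"]) (auto intro: finite_cols)
  moreover have "{(f, h). f \<in> cols ?A (part_mono lam) \<and> h \<in> cols ?A ?\<beta> \<and> inj_on (\<lambda>a. (f a, h a)) ?A} \<noteq> {}"
    using separated_pair_exists[OF lam, of ?A] by auto
  ultimately have "?S lam \<noteq> 0" unfolding sum_sign_fixcols_fixcols[OF finite_atLeastAtMost] by (simp only: of_nat_eq_0_iff card_eq_0_iff) simp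
  then have "\<exists>\<kappa>\<in>partitions_of n. kostka_number \<kappa> lam * t \<kappa> \<noteq> 0"
    unfolding S_t[OF lam] by (meson sum.neutral)
  then obtain \<kappa> where \<kappa>: "\<kappa> \<in> partitions_of n" "kostka_number \<kappa> lam \<noteq> 0" "t \<kappa> \<noteq> 0" by auto
  have "\<kappa> = lam"
    by (rule dominates_antisym[OF \<kappa>(1) lam kostka_number_dominates[OF \<kappa>(2)] dom[OF \<kappa>(1,3)]])
  then show "t lam \<noteq> 0" using \<kappa>(3) by simp
qed

text \<open>By orthogonality and Young's rule an irreducible constituent of
  \<open>\<theta>\<^sub>\<lambda>\<close> is some \<open>f\<^sub>\<kappa>\<close> with \<kappa>
  dominating \<lambda>. The condition on the sign character gives dominance in the other
  direction.\<close>

lemma sym_irr_char_frob: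
  assumes lam: "lam \<in> partitions_of n"
  shows "sym_irr_char lam = frob_restrict n lam"
proof -
  let ?G = "sym_group n" and ?A = "{1..n}" and ?c = "conjugate_partition lam"
  let ?\<theta> = "\<lambda>w. int (card (fixcols ?A (part_mono lam) w))"
  let ?\<psi> = "\<lambda>w. sign w * int (card (fixcols ?A (part_mono ?c) w))"
  interpret G: group ?G by (rule sym_group_is_group)
  have sum: "sum_list lam = n" using lam by (simp add: partitions_of_def)
  have ind1: "char_inner ?G \<chi> (induced_char ?G (young_subgroup lam) (\<lambda>_. 1)) \<noteq> 0 \<longleftrightarrow>
      (\<Sum>g\<in>carrier ?G. \<chi> g * of_int (?\<theta> g)) \<noteq> 0" for \<chi>
  proof -
    have "char_inner ?G \<chi> (induced_char ?G (young_subgroup lam) (\<lambda>_. 1)) = char_inner ?G \<chi> (\<lambda>g. of_int (?\<theta> g))"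
      by (rule char_inner_cong) (simp add: induced_char_young_subgroup[OF sum])
    then show ?thesis unfolding char_inner_real card_sym_group by (simp del: of_int_of_nat_eq)
  qed
  have ind2: "char_inner ?G \<chi> (induced_char ?G (young_subgroup ?c) (\<lambda>\<sigma>. of_int (sign \<sigma>))) \<noteq> 0 \<longleftrightarrow>
      (\<Sum>g\<in>carrier ?G. \<chi> g * of_int (?\<psi> g)) \<noteq> 0" for \<chi>
  proof -
    have "sign (inv' x \<circ> g \<circ> x) = sign g" if "x \<in> carrier ?G" "g \<in> carrier ?G" for x g
      using that by (simp add: sign_compose sign_inverse permutation_compose permutation_inverse sym_group_carrier' mult.assoc)
    then have "char_inner ?G \<chi> (induced_char ?G (young_subgroup ?c) (\<lambda>\<sigma>. of_int (sign \<sigma>))) = char_inner ?G \<chi> (\<lambda>g. of_int (?\<psi> g))"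
      by (intro char_inner_cong) (simp add: induced_char_young_subgroup[OF sum_list_conjugate[OF lam]])
    then show ?thesis by (simp add: char_inner_real card_sym_group del: of_int_mult)
  qed
  have frob_sum: "(\<Sum>g\<in>carrier ?G. frob_restrict n \<kappa> g * of_int (h g)) = of_int (\<Sum>w | w permutes ?A. frob_char ?A \<kappa> w * h w)"
    for \<kappa> and h :: "(nat \<Rightarrow> nat) \<Rightarrow> int"
    by (simp add: carrier_sym_group)
  have mdeg: "mdeg (part_mono lam) = card ?A" by (simp add: mdeg_part_mono sum)
  show ?thesis unfolding sym_irr_char_def sum Let_def ind1 ind2
  proof (rule the_equality)
    have "(\<Sum>w | w permutes ?A. frob_char ?A lam w * ?\<theta> w) = fact n"
      using sum_frob_char_fixcols[OF _ _ mdeg] lam kostka_number_self[OF lam] by (simp add: kostka_number_def)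
    moreover have "(\<Sum>w | w permutes ?A. frob_char ?A lam w * ?\<psi> w) \<noteq> 0"
      by (rule frob_sign_pairing(2)[OF lam lam])
    ultimately show "frob_restrict n lam \<in> extensional (carrier ?G) \<and> is_irreducible_character ?G (frob_restrict n lam) \<and>
        (\<Sum>g\<in>carrier ?G. frob_restrict n lam g * of_int (?\<theta> g)) \<noteq> 0 \<and>
        (\<Sum>g\<in>carrier ?G. frob_restrict n lam g * of_int (?\<psi> g)) \<noteq> 0"
      using frob_restrict_irreducible[OF lam] unfolding frob_sum by (simp add: irr_chars_def del: of_int_sum)
  next
    fix \<chi> assume "\<chi> \<in> extensional (carrier ?G) \<and> is_irreducible_character ?G \<chi> \<and>
        (\<Sum>g\<in>carrier ?G. \<chi> g * of_int (?\<theta> g)) \<noteq> 0 \<and> (\<Sum>g\<in>carrier ?G. \<chi> g * of_int (?\<psi> g)) \<noteq> 0"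
    then have \<chi>: "\<chi> \<in> irr_chars ?G"
      and nz: "(\<Sum>g\<in>carrier ?G. \<chi> g * of_int (?\<theta> g)) \<noteq> 0" "(\<Sum>g\<in>carrier ?G. \<chi> g * of_int (?\<psi> g)) \<noteq> 0"
      by (simp_all add: irr_chars_def)
    \<comment> \<open>Young's rule, with the irreducible characters evaluated at the inverse to fit
      the orthogonality relation.\<close>
    have expand: "(of_int (?\<theta> g) :: complex) = (\<Sum>\<kappa>\<in>partitions_of n. of_int (kostka_number \<kappa> lam) * frob_restrict n \<kappa> (inv\<^bsub>?G\<^esub> g))"
      if g: "g \<in> carrier ?G" for g
      using card_fixcols_expand[OF _ _ mdeg, of g] g G.inv_closed[OF g]
      by (simp add: kostka_number_def sym_group_carrier frob_char_inv del: of_int_of_nat_eq)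
    have "(\<Sum>g\<in>carrier ?G. \<chi> g * of_int (?\<theta> g)) =
        (\<Sum>g\<in>carrier ?G. \<Sum>\<kappa>\<in>partitions_of n. of_int (kostka_number \<kappa> lam) * (\<chi> g * frob_restrict n \<kappa> (inv\<^bsub>?G\<^esub> g)))"
      by (intro sum.cong refl) (simp only: expand sum_distrib_left mult_ac)
    also have "\<dots> = (\<Sum>\<kappa>\<in>partitions_of n. of_int (kostka_number \<kappa> lam) * (\<Sum>g\<in>carrier ?G. \<chi> g * frob_restrict n \<kappa> (inv\<^bsub>?G\<^esub> g)))"
      unfolding sum_distrib_left by (rule sum.swap)
    finally have "\<exists>\<kappa>\<in>partitions_of n. of_int (kostka_number \<kappa> lam) * (\<Sum>g\<in>carrier ?G. \<chi> g * frob_restrict n \<kappa> (inv\<^bsub>?G\<^esub> g)) \<noteq> 0"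
      using nz(1) by (metis (no_types, lifting) sum.neutral)
    then obtain \<kappa> where \<kappa>: "\<kappa> \<in> partitions_of n" "kostka_number \<kappa> lam \<noteq> 0"
      "(\<Sum>g\<in>carrier ?G. \<chi> g * frob_restrict n \<kappa> (inv\<^bsub>?G\<^esub> g)) \<noteq> 0" by fastforce
    have eq: "\<chi> = frob_restrict n \<kappa>"
      using irr_chars_orthogonal[OF sym_group_is_group finite_sym_group \<chi> frob_restrict_irreducible[OF \<kappa>(1)]] \<kappa>(3)
      by (metis (no_types, lifting))
    have "(\<Sum>w | w permutes ?A. frob_char ?A \<kappa> w * ?\<psi> w) \<noteq> 0"
      using nz(2) unfolding eq frob_sum by (simp del: of_int_sum)
    then have "dominates lam \<kappa>" by (rule frob_sign_pairing(1)[OF lam \<kappa>(1)])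
    then have "\<kappa> = lam" using dominates_antisym[OF \<kappa>(1) lam kostka_number_dominates[OF \<kappa>(2)]] by blast
    then show "\<chi> = frob_restrict n lam" using eq by simp
  qed
qed

section \<open>The ring of symmetric functions\<close>

text \<open>A type copy of the series, so that their ring structure is available as a type class;
  \<open>sym_fun\<close> is a record over bare functions.\<close>

typedef ser = "UNIV :: series set" morphisms scoeff Ser by simp

lemma scoeff_Ser [simp]: "scoeff (Ser f) = f" by (simp add: Ser_inverse)

lemma ser_eqI: "(\<And>\<alpha>. scoeff x \<alpha> = scoeff y \<alpha>) \<Longrightarrow> x = y"
  by (metis ext scoeff_inject)

abbreviation factors :: "monomial \<Rightarrow> (monomial \<times> monomial) set" where
  "factors \<alpha> \<equiv> {(\<beta>, \<gamma>). \<beta> + \<gamma> = \<alpha>}"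

definition scalar :: "rat \<Rightarrow> ser" where
  "scalar c = Ser (\<lambda>\<alpha>. if \<alpha> = 0 then c else 0)"

lemma sum_factors_delta:
  "(\<Sum>(\<beta>, \<gamma>)\<in>factors \<alpha>. (if \<beta> = 0 then c else 0) * g \<gamma>) = c * (g \<alpha> :: rat)"
proof -
  have "(\<Sum>(\<beta>, \<gamma>)\<in>factors \<alpha>. (if \<beta> = 0 then c else 0) * g \<gamma>) = (\<Sum>(\<beta>, \<gamma>)\<in>{(0 :: monomial, \<alpha>)}. (if \<beta> = 0 then c else 0) * g \<gamma>)"
    by (rule sum.mono_neutral_right) (auto simp: finite_add_eq split: if_splits)
  then show ?thesis by simp
qed

lemma sum_factors_assoc:
  "(\<Sum>(x, \<delta>)\<in>factors \<alpha>. \<Sum>(\<beta>, \<gamma>)\<in>factors x. F \<beta> \<gamma> \<delta>) = (\<Sum>(\<beta>, y)\<in>factors \<alpha>. \<Sum>(\<gamma>, \<delta>)\<in>factors y. F \<beta> \<gamma> \<delta> :: rat)"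
proof -
  have "(\<Sum>p\<in>factors \<alpha>. \<Sum>q\<in>factors (fst p). F (fst q) (snd q) (snd p)) =
      (\<Sum>(p, q)\<in>(SIGMA p:factors \<alpha>. factors (fst p)). F (fst q) (snd q) (snd p))"
    by (rule sum.Sigma) (simp_all add: finite_add_eq)
  also have "\<dots> = (\<Sum>(p, q)\<in>(SIGMA p:factors \<alpha>. factors (snd p)). F (fst p) (fst q) (snd q))"
    by (rule sum.reindex_bij_witness[of _ "\<lambda>(p, q). ((fst p + fst q, snd q), (fst p, fst q))"
          "\<lambda>(p, q). ((fst q, snd q + snd p), (snd q, snd p))"]) (auto simp: add.assoc)
  also have "\<dots> = (\<Sum>p\<in>factors \<alpha>. \<Sum>q\<in>factors (snd p). F (fst p) (fst q) (snd q))"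
    by (rule sum.Sigma[symmetric]) (simp_all add: finite_add_eq)
  finally show ?thesis by (simp add: case_prod_unfold)
qed

instantiation ser :: comm_ring_1
begin

definition "0 = Ser (\<lambda>\<alpha>. 0)"
definition "1 = Ser (\<lambda>\<alpha>. if \<alpha> = 0 then 1 else 0)"
definition "x + y = Ser (\<lambda>\<alpha>. scoeff x \<alpha> + scoeff y \<alpha>)"
definition "x - y = Ser (\<lambda>\<alpha>. scoeff x \<alpha> - scoeff y \<alpha>)"
definition "- x = Ser (\<lambda>\<alpha>. - scoeff x \<alpha>)"
definition "x * y = Ser (\<lambda>\<alpha>. \<Sum>(\<beta>, \<gamma>)\<in>factors \<alpha>. scoeff x \<beta> * scoeff y \<gamma>)"

instance
proof
  fix x y z :: ser
  show "x * y * z = x * (y * z)"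
  proof (rule ser_eqI)
    fix \<alpha>
    have "scoeff (x * y * z) \<alpha> = (\<Sum>(u, \<delta>)\<in>factors \<alpha>. \<Sum>(\<beta>, \<gamma>)\<in>factors u. scoeff x \<beta> * scoeff y \<gamma> * scoeff z \<delta>)"
      by (simp add: times_ser_def sum_distrib_right case_prod_unfold)
    also have "\<dots> = scoeff (x * (y * z)) \<alpha>"
      unfolding sum_factors_assoc by (simp add: times_ser_def sum_distrib_left case_prod_unfold mult.assoc)
    finally show "scoeff (x * y * z) \<alpha> = scoeff (x * (y * z)) \<alpha>" .
  qed
  show "x * y = y * x"
  proof (rule ser_eqI)
    fix \<alpha> show "scoeff (x * y) \<alpha> = scoeff (y * x) \<alpha>" unfolding times_ser_def scoeff_Ser
      by (rule sum.reindex_bij_witness[of _ prod.swap prod.swap]) (auto simp: add.commute mult.commute)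
  qed
  show "1 * x = x"
    unfolding times_ser_def one_ser_def scoeff_Ser sum_factors_delta by (simp add: scoeff_inverse)
  show "(x + y) * z = x * z + y * z"
    by (rule ser_eqI) (simp add: times_ser_def plus_ser_def case_prod_unfold distrib_right sum.distrib)
  show "(0::ser) \<noteq> 1"
  proof
    assume "(0::ser) = 1"
    then have "scoeff 0 0 = scoeff 1 0" by simp
    then show False by (simp add: zero_ser_def one_ser_def)
  qed
qed (auto intro!: ser_eqI simp: plus_ser_def zero_ser_def uminus_ser_def minus_ser_def)

end

lemma scoeff_add [simp]: "scoeff (x + y) \<alpha> = scoeff x \<alpha> + scoeff y \<alpha>" by (simp add: plus_ser_def)
lemma scoeff_0 [simp]: "scoeff 0 \<alpha> = 0" by (simp add: zero_ser_def)
lemma scoeff_1: "scoeff 1 \<alpha> = (if \<alpha> = 0 then 1 else 0)" by (simp add: one_ser_def)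
lemma scoeff_mult: "scoeff (x * y) \<alpha> = (\<Sum>(\<beta>, \<gamma>)\<in>factors \<alpha>. scoeff x \<beta> * scoeff y \<gamma>)" by (simp add: times_ser_def)
lemma scoeff_sum: "scoeff (\<Sum>i\<in>I. f i) \<alpha> = (\<Sum>i\<in>I. scoeff (f i) \<alpha>)"
  by (induction I rule: infinite_finite_induct) auto
lemma scoeff_scalar_mult [simp]: "scoeff (scalar c * x) \<alpha> = c * scoeff x \<alpha>"
  unfolding scoeff_mult scalar_def scoeff_Ser by (rule sum_factors_delta)

lemma scalar_0: "scalar 0 = 0" by (rule ser_eqI) (simp add: scalar_def)
lemma scalar_1: "scalar 1 = 1" by (simp add: scalar_def one_ser_def)
lemma scalar_add: "scalar (c + d) = scalar c + scalar d" by (rule ser_eqI) (simp add: scalar_def)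
lemma scalar_mult: "scalar (c * d) = scalar c * scalar d"
  by (rule ser_eqI, subst scoeff_scalar_mult) (simp add: scalar_def)

text \<open>A polynomial in variables numbered by natural numbers is a finitely supported function
  on multisets of indices, and the product of such functions is the product of polynomials. Here
  \<open>e k\<close> is substituted for variable \<open>k\<close>.\<close>

definition polyval :: "(nat \<Rightarrow> ser) \<Rightarrow> (nat multiset \<Rightarrow>\<^sub>0 rat) \<Rightarrow> ser" where
  "polyval e F = (\<Sum>M\<in>keys F. scalar (lookup F M) * (\<Prod>k\<in>#M. e k))"

lemma polyval_superset:
  assumes "finite K" "keys F \<subseteq> K"
  shows "polyval e F = (\<Sum>M\<in>K. scalar (lookup F M) * (\<Prod>k\<in>#M. e k))"
  unfolding polyval_def using assms by (intro sum.mono_neutral_left) (auto simp: in_keys_iff scalar_0)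

lemma polyval_add: "polyval e (F + G) = polyval e F + polyval e G"
proof -
  let ?K = "keys F \<union> keys G"
  have "polyval e (F + G) = (\<Sum>M\<in>?K. scalar (lookup (F + G) M) * (\<Prod>k\<in>#M. e k))"
    by (rule polyval_superset) (auto simp: keys_add)
  then show ?thesis
    by (simp add: lookup_add scalar_add distrib_right sum.distrib polyval_superset[of ?K])
qed

lemma polyval_0: "polyval e 0 = 0" by (simp add: polyval_def)

lemma polyval_sum: "polyval e (\<Sum>i\<in>I. F i) = (\<Sum>i\<in>I. polyval e (F i))"
  by (induction I rule: infinite_finite_induct) (auto simp: polyval_add polyval_0)

lemma polyval_diff: "polyval e (F - G) = polyval e F - polyval e G"
  using polyval_add[of e "F - G" G] by simp

lemma polyval_single: "polyval e (single M c) = scalar c * (\<Prod>k\<in>#M. e k)"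
  by (simp add: polyval_def scalar_0)

lemma poly_mapping_sum_single: "F = (\<Sum>M\<in>keys F. single M (lookup F M))"
  by (rule poly_mapping_eqI) (auto simp: lookup_sum lookup_single when_def in_keys_iff)

lemma polyval_mult: "polyval e (F * G) = polyval e F * polyval e G"
proof -
  have "F * G = (\<Sum>M\<in>keys F. \<Sum>N\<in>keys G.
      single (M + N) (lookup F M * lookup G N))"
    by (subst poly_mapping_sum_single[of F], subst poly_mapping_sum_single[of G]) (simp add: sum_product mult_single)
  then have "polyval e (F * G) = (\<Sum>M\<in>keys F. \<Sum>N\<in>keys G.
      scalar (lookup F M * lookup G N) * (\<Prod>k\<in>#M + N. e k))"
    by (simp add: polyval_sum polyval_single)
  also have "\<dots> = polyval e F * polyval e G"
    by (simp add: polyval_def sum_product scalar_mult mult_ac)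
  finally show ?thesis .
qed

section \<open>Symmetric functions inside the ring of series\<close>

definition symfuns :: "ser set" where
  "symfuns = {x. scoeff x \<in> carrier sym_fun}"

lemma bounded_degree_iff: "bounded_degree f \<longleftrightarrow> (\<exists>d. \<forall>\<alpha>. f \<alpha> \<noteq> 0 \<longrightarrow> mdeg \<alpha> \<le> d)"
  by (simp add: bounded_degree_def mdeg_def)

lemma symmetric_series_iff: "symmetric_series f \<longleftrightarrow> (\<forall>\<pi> \<alpha>. bij \<pi> \<longrightarrow> f (map_key \<pi> \<alpha>) = f \<alpha>)"
proof -
  have *: "lookup \<beta> = lookup \<alpha> \<circ> \<pi> \<longleftrightarrow> \<beta> = map_key \<pi> \<alpha>" if "bij \<pi>" for \<alpha> \<beta> :: monomial and \<pi>
    using that by (simp add: poly_mapping_eq_iff map_key.rep_eq bij_is_inj)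
  show ?thesis unfolding symmetric_series_def by (simp add: * cong: imp_cong)
qed

lemma map_key_inv: "bij \<pi> \<Longrightarrow> map_key \<pi> (map_key (inv' \<pi>) \<alpha>) = (\<alpha> :: monomial)"
  "bij \<pi> \<Longrightarrow> map_key (inv' \<pi>) (map_key \<pi> \<alpha>) = (\<alpha> :: monomial)"
  by (rule poly_mapping_eqI, simp add: map_key.rep_eq bij_is_inj bij_imp_bij_inv bij_is_surj surj_f_inv_f inv_f_f)+

lemma symfuns_iff:
  "x \<in> symfuns \<longleftrightarrow> (\<forall>\<pi> \<alpha>. bij \<pi> \<longrightarrow> scoeff x (map_key \<pi> \<alpha>) = scoeff x \<alpha>) \<and>
    (\<exists>d. \<forall>\<alpha>. scoeff x \<alpha> \<noteq> 0 \<longrightarrow> mdeg \<alpha> \<le> d)"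
  by (simp add: symfuns_def sym_fun_def symmetric_series_iff bounded_degree_iff)

lemma map_key_eq_0_iff: "bij (\<pi> :: nat \<Rightarrow> nat) \<Longrightarrow> map_key \<pi> \<alpha> = 0 \<longleftrightarrow> (\<alpha> :: monomial) = 0"
proof
  assume "bij \<pi>" "map_key \<pi> \<alpha> = 0"
  then show "\<alpha> = 0" using map_key_inv(2)[of \<pi> \<alpha>] by (simp add: bij_imp_bij_inv bij_is_inj)
qed (simp add: bij_is_inj)

lemma symfuns_scalar: "scalar c \<in> symfuns"
  unfolding symfuns_iff scalar_def scoeff_Ser by (auto simp: map_key_eq_0_iff intro!: exI[of _ 0])

lemma symfuns_add:
  assumes "x \<in> symfuns" "y \<in> symfuns" shows "x + y \<in> symfuns"
proof -
  obtain d d' where "\<forall>\<alpha>. scoeff x \<alpha> \<noteq> 0 \<longrightarrow> mdeg \<alpha> \<le> d" "\<forall>\<alpha>. scoeff y \<alpha> \<noteq> 0 \<longrightarrow> mdeg \<alpha> \<le> d'"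
    using assms unfolding symfuns_iff by blast
  then have "\<forall>\<alpha>. scoeff (x + y) \<alpha> \<noteq> 0 \<longrightarrow> mdeg \<alpha> \<le> max d d'" by (metis add.left_neutral le_max_iff_disj scoeff_add)
  then show ?thesis using assms unfolding symfuns_iff by auto
qed

lemma symfuns_mult:
  assumes x: "x \<in> symfuns" and y: "y \<in> symfuns" shows "x * y \<in> symfuns"
  unfolding symfuns_iff
proof (intro conjI allI impI)
  fix \<pi> :: "nat \<Rightarrow> nat" and \<alpha> assume \<pi>: "bij \<pi>"
  have inj: "inj \<pi>" "inj (inv' \<pi>)" using \<pi> by (simp_all add: bij_is_inj bij_imp_bij_inv)
  let ?m = "map_key \<pi> :: monomial \<Rightarrow> monomial" and ?m' = "map_key (inv' \<pi>) :: monomial \<Rightarrow> monomial"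
  show "scoeff (x * y) (?m \<alpha>) = scoeff (x * y) \<alpha>" unfolding scoeff_mult
  proof (rule sum.reindex_bij_witness[of _ "\<lambda>(\<beta>, \<gamma>). (?m \<beta>, ?m \<gamma>)" "\<lambda>(\<beta>, \<gamma>). (?m' \<beta>, ?m' \<gamma>)"])
    fix p assume "p \<in> factors (?m \<alpha>)"
    then show "(\<lambda>(\<beta>, \<gamma>). (?m' \<beta>, ?m' \<gamma>)) p \<in> factors \<alpha>"
      by (auto simp: map_key_plus[OF inj(2), symmetric] map_key_inv[OF \<pi>])
    show "(case (\<lambda>(\<beta>, \<gamma>). (?m' \<beta>, ?m' \<gamma>)) p of (\<beta>, \<gamma>) \<Rightarrow> scoeff x \<beta> * scoeff y \<gamma>) = (case p of (\<beta>, \<gamma>) \<Rightarrow> scoeff x \<beta> * scoeff y \<gamma>)"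
      using x y bij_imp_bij_inv[OF \<pi>] unfolding symfuns_iff by (auto split: prod.splits)
  qed (auto simp: map_key_inv[OF \<pi>] map_key_plus[OF inj(1), symmetric])
next
  obtain d d' where d: "\<forall>\<alpha>. scoeff x \<alpha> \<noteq> 0 \<longrightarrow> mdeg \<alpha> \<le> d" "\<forall>\<alpha>. scoeff y \<alpha> \<noteq> 0 \<longrightarrow> mdeg \<alpha> \<le> d'"
    using x y unfolding symfuns_iff by blast
  have "mdeg \<alpha> \<le> d + d'" if "scoeff (x * y) \<alpha> \<noteq> 0" for \<alpha>
  proof -
    obtain p where "p \<in> factors \<alpha>" "(case p of (\<beta>, \<gamma>) \<Rightarrow> scoeff x \<beta> * scoeff y \<gamma>) \<noteq> 0"
      using \<open>scoeff (x * y) \<alpha> \<noteq> 0\<close> unfolding scoeff_mult by (rule sum.not_neutral_contains_not_neutral)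
    then obtain \<beta> \<gamma> where "\<beta> + \<gamma> = \<alpha>" "scoeff x \<beta> \<noteq> 0" "scoeff y \<gamma> \<noteq> 0" by auto
    then show ?thesis using d mdeg_add[of \<beta> \<gamma>] by (metis add_mono)
  qed
  then show "\<exists>d. \<forall>\<alpha>. scoeff (x * y) \<alpha> \<noteq> 0 \<longrightarrow> mdeg \<alpha> \<le> d" by blast
qed

lemma symfuns_0: "0 \<in> symfuns"
  using symfuns_scalar[of 0] by (simp add: scalar_0)

lemma symfuns_1: "1 \<in> symfuns"
  using symfuns_scalar[of 1] by (simp add: scalar_1)

lemma symfuns_sum: "(\<And>i. i \<in> I \<Longrightarrow> f i \<in> symfuns) \<Longrightarrow> (\<Sum>i\<in>I. f i) \<in> symfuns"
  by (induction I rule: infinite_finite_induct) (auto simp: symfuns_0 symfuns_add)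

lemma symfuns_prod_mset: "(\<And>k. k \<in># M \<Longrightarrow> e k \<in> symfuns) \<Longrightarrow> (\<Prod>k\<in>#M. e k) \<in> symfuns"
  by (induction M) (auto simp: symfuns_1 symfuns_mult)

lemma symfuns_polyval: "(\<And>k. e k \<in> symfuns) \<Longrightarrow> polyval e F \<in> symfuns"
  unfolding polyval_def
  by (intro symfuns_sum symfuns_mult symfuns_scalar symfuns_prod_mset)

abbreviation psum :: "nat \<Rightarrow> ser" where "psum k \<equiv> Ser (power_sum k)"

lemma symfuns_psum: "psum k \<in> symfuns"
  unfolding symfuns_iff scoeff_Ser
proof (intro conjI allI impI)
  fix \<pi> :: "nat \<Rightarrow> nat" and \<alpha> assume \<pi>: "bij \<pi>"
  have s: "map_key \<pi> (single (\<pi> i) k) = single i k" for i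
    using \<pi> by (simp add: bij_is_inj map_key_single)
  have "(\<exists>i. map_key \<pi> \<alpha> = single i k) \<longleftrightarrow> (\<exists>i. \<alpha> = single i k)"
  proof
    assume "\<exists>i. map_key \<pi> \<alpha> = single i k"
    then obtain i where "map_key \<pi> \<alpha> = map_key \<pi> (single (\<pi> i) k)" using s by metis
    then have "\<alpha> = single (\<pi> i) k" by (metis map_key_inv(2) \<pi>)
    then show "\<exists>i. \<alpha> = single i k" by blast
  next
    assume "\<exists>i. \<alpha> = single i k"
    then obtain i where "\<alpha> = single (\<pi> (inv' \<pi> i)) k" using \<pi> by (metis bij_is_surj surj_f_inv_f)
    then show "\<exists>i. map_key \<pi> \<alpha> = single i k" using s by metis
  qed
  then show "power_sum k (map_key \<pi> \<alpha>) = power_sum k \<alpha>" by (simp add: power_sum_def)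
qed (auto simp: power_sum_def intro!: exI[of _ k])

section \<open>Adams operations\<close>

definition scale :: "nat \<Rightarrow> monomial \<Rightarrow> monomial" where
  "scale k \<alpha> = Poly_Mapping.map ((*) k) \<alpha>"

lemma lookup_scale: "lookup (scale k \<alpha>) i = k * lookup \<alpha> i"
  by (simp add: scale_def map.rep_eq when_def)

lemma scale_add: "scale k (\<alpha> + \<beta>) = scale k \<alpha> + scale k \<beta>"
  by (rule poly_mapping_eqI) (simp add: lookup_scale lookup_add distrib_left)

lemma scale_inject: "k > 0 \<Longrightarrow> scale k \<alpha> = scale k \<beta> \<longleftrightarrow> \<alpha> = \<beta>"
  by (auto simp: poly_mapping_eq_iff lookup_scale fun_eq_iff)

lemma scale_0: "scale k 0 = 0" by (simp add: poly_mapping_eq_iff lookup_scale fun_eq_iff)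

lemma scale_single: "scale k (single i l) = single i (k * l)"
  by (rule poly_mapping_eqI) (simp add: lookup_scale lookup_single when_def)

lemma mdeg_scale: "mdeg (scale k \<alpha>) = k * mdeg \<alpha>"
proof -
  have "mdeg (scale k \<alpha>) = (\<Sum>i\<in>keys \<alpha>. lookup (scale k \<alpha>) i)"
    by (rule mdeg_superset) (auto simp: in_keys_iff lookup_scale)
  then show ?thesis by (simp add: lookup_scale mdeg_def sum_distrib_left)
qed

lemma scale_map_key: "bij \<pi> \<Longrightarrow> scale k (map_key \<pi> \<alpha>) = map_key \<pi> (scale k \<alpha>)"
  by (rule poly_mapping_eqI) (simp add: lookup_scale map_key.rep_eq bij_is_inj)

text \<open>The substitution of \<open>x\<^sub>i ^ k\<close> for every \<open>x\<^sub>i\<close>,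
  which is the map \<open>g \<mapsto> p\<^sub>k[g]\<close>.\<close>

definition adams :: "nat \<Rightarrow> ser \<Rightarrow> ser" where
  "adams k x = Ser (\<lambda>\<alpha>. if \<alpha> \<in> range (scale k) then scoeff x (inv' (scale k) \<alpha>) else 0)"

lemma adams_scale: "k > 0 \<Longrightarrow> scoeff (adams k x) (scale k \<alpha>) = scoeff x \<alpha>"
  by (simp add: adams_def inv_f_f inj_def scale_inject)

lemma adams_range: "scoeff (adams k x) \<alpha> \<noteq> 0 \<Longrightarrow> \<alpha> \<in> range (scale k)"
  by (auto simp: adams_def split: if_splits)

lemma adams_outside: "\<alpha> \<notin> range (scale k) \<Longrightarrow> scoeff (adams k x) \<alpha> = 0"
  by (simp add: adams_def)

lemma adams_eqI:
  assumes k: "k > 0" and "\<And>\<alpha>. scoeff y (scale k \<alpha>) = scoeff x \<alpha>" "\<And>\<alpha>. \<alpha> \<notin> range (scale k) \<Longrightarrow> scoeff y \<alpha> = 0"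
  shows "adams k x = y"
proof (rule ser_eqI)
  fix \<alpha> show "scoeff (adams k x) \<alpha> = scoeff y \<alpha>"
    using assms adams_scale[OF k, of x] adams_range[of k x \<alpha>] by (cases "\<alpha> \<in> range (scale k)") auto
qed

lemma adams_add: "k > 0 \<Longrightarrow> adams k (x + y) = adams k x + adams k y"
  by (rule adams_eqI) (auto simp: adams_scale adams_outside)

lemma adams_scalar_mult: "k > 0 \<Longrightarrow> adams k (scalar c * x) = scalar c * adams k x"
  by (rule adams_eqI) (auto simp: adams_scale adams_outside)

lemma adams_1: "k > 0 \<Longrightarrow> adams k 1 = 1"
proof (rule adams_eqI)
  assume k: "k > 0"
  show "scoeff 1 (scale k \<alpha>) = scoeff 1 \<alpha>" for \<alpha>
    using scale_inject[OF k, of \<alpha> 0] by (simp add: scoeff_1 scale_0)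
  show "scoeff 1 \<alpha> = 0" if "\<alpha> \<notin> range (scale k)" for \<alpha>
    using that scale_0[of k] by (auto simp: scoeff_1)
qed

lemma adams_mult: assumes k: "k > 0" shows "adams k (x * y) = adams k x * adams k y"
proof (rule adams_eqI[OF k])
  fix \<alpha>
  let ?s = "(\<lambda>(\<beta>, \<gamma>). (scale k \<beta>, scale k \<gamma>))"
  have "scoeff (x * y) \<alpha> = (\<Sum>(\<beta>, \<gamma>)\<in>factors \<alpha>. scoeff (adams k x) (scale k \<beta>) * scoeff (adams k y) (scale k \<gamma>))"
    by (simp add: scoeff_mult adams_scale[OF k])
  also have "\<dots> = (\<Sum>p\<in>?s ` factors \<alpha>. case p of (\<beta>, \<gamma>) \<Rightarrow> scoeff (adams k x) \<beta> * scoeff (adams k y) \<gamma>)"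
    by (subst sum.reindex) (auto simp: inj_on_def scale_inject[OF k] case_prod_unfold)
  \<comment> \<open>A factorisation of \<open>scale k \<alpha>\<close> into two exponent vectors
    divisible by \<open>k\<close> comes from one of \<alpha>; all other factorisations contribute
    0.\<close>
  also have "\<dots> = scoeff (adams k x * adams k y) (scale k \<alpha>)" unfolding scoeff_mult
  proof (rule sum.mono_neutral_left)
    show "?s ` factors \<alpha> \<subseteq> factors (scale k \<alpha>)" by (auto simp: scale_add)
    show "\<forall>p\<in>factors (scale k \<alpha>) - ?s ` factors \<alpha>.
        (case p of (\<beta>, \<gamma>) \<Rightarrow> scoeff (adams k x) \<beta> * scoeff (adams k y) \<gamma>) = 0"
    proof
      fix p assume p: "p \<in> factors (scale k \<alpha>) - ?s ` factors \<alpha>"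
      obtain \<beta> \<gamma> where bg: "p = (\<beta>, \<gamma>)" by (cases p)
      have "False" if "\<beta> \<in> range (scale k)" "\<gamma> \<in> range (scale k)"
      proof -
        obtain \<beta>' \<gamma>' where s: "\<beta> = scale k \<beta>'" "\<gamma> = scale k \<gamma>'" using \<open>\<beta> \<in> _\<close> \<open>\<gamma> \<in> _\<close> by blast
        then have "scale k (\<beta>' + \<gamma>') = scale k \<alpha>" using p bg by (simp add: scale_add)
        then show False using p bg s scale_inject[OF k] by auto
      qed
      then have "scoeff (adams k x) \<beta> = 0 \<or> scoeff (adams k y) \<gamma> = 0" using adams_range by blast
      then show "(case p of (\<beta>, \<gamma>) \<Rightarrow> scoeff (adams k x) \<beta> * scoeff (adams k y) \<gamma>) = 0" using bg by auto
    qed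
  qed (rule finite_add_eq)
  finally show "scoeff (adams k x * adams k y) (scale k \<alpha>) = scoeff (x * y) \<alpha>" ..
next
  fix \<alpha> assume \<alpha>: "\<alpha> \<notin> range (scale k)"
  show "scoeff (adams k x * adams k y) \<alpha> = 0" unfolding scoeff_mult
  proof (rule sum.neutral, rule ballI)
    fix p assume p: "p \<in> factors \<alpha>"
    obtain \<beta> \<gamma> where bg: "p = (\<beta>, \<gamma>)" by (cases p)
    have "False" if "\<beta> \<in> range (scale k)" "\<gamma> \<in> range (scale k)"
      using that \<alpha> p bg by (auto simp: scale_add[symmetric])
    then have "scoeff (adams k x) \<beta> = 0 \<or> scoeff (adams k y) \<gamma> = 0" using adams_range by blast
    then show "(case p of (\<beta>, \<gamma>) \<Rightarrow> scoeff (adams k x) \<beta> * scoeff (adams k y) \<gamma>) = 0" using bg by auto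
  qed
qed

lemma adams_psum: assumes k: "k > 0" shows "adams k (psum l) = psum (k * l)"
proof (rule adams_eqI[OF k])
  show "scoeff (psum (k * l)) (scale k \<alpha>) = scoeff (psum l) \<alpha>" for \<alpha>
    using scale_inject[OF k, of \<alpha>] by (simp add: power_sum_def scale_single[symmetric])
  show "scoeff (psum (k * l)) \<alpha> = 0" if "\<alpha> \<notin> range (scale k)" for \<alpha>
    using that by (auto simp: power_sum_def scale_single[symmetric])
qed

lemma symfuns_adams:
  assumes k: "k > 0" and x: "x \<in> symfuns" shows "adams k x \<in> symfuns"
  unfolding symfuns_iff
proof (intro conjI allI impI)
  fix \<pi> :: "nat \<Rightarrow> nat" and \<alpha> assume \<pi>: "bij \<pi>"
  show "scoeff (adams k x) (map_key \<pi> \<alpha>) = scoeff (adams k x) \<alpha>"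
  proof (cases "\<alpha> \<in> range (scale k)")
    case True
    then show ?thesis using x \<pi>
      by (auto simp: scale_map_key[symmetric] adams_scale[OF k] symfuns_iff)
  next
    case False
    have "map_key \<pi> \<alpha> \<notin> range (scale k)"
    proof
      assume "map_key \<pi> \<alpha> \<in> range (scale k)"
      then obtain \<beta> where "map_key \<pi> \<alpha> = scale k \<beta>" by blast
      then have "\<alpha> = scale k (map_key (inv' \<pi>) \<beta>)"
        using map_key_inv(2)[OF \<pi>, of \<alpha>] scale_map_key[OF bij_imp_bij_inv[OF \<pi>]] by simp
      then show False using False by blast
    qed
    then show ?thesis using False adams_range by metis
  qed
next
  obtain d where d: "\<forall>\<alpha>. scoeff x \<alpha> \<noteq> 0 \<longrightarrow> mdeg \<alpha> \<le> d" using x unfolding symfuns_iff by blast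
  have "mdeg \<alpha> \<le> k * d" if "scoeff (adams k x) \<alpha> \<noteq> 0" for \<alpha>
  proof -
    have "\<alpha> \<in> range (scale k)" using that adams_range by blast
    then obtain \<beta> where "\<alpha> = scale k \<beta>" by blast
    then show ?thesis using that d by (simp add: adams_scale[OF k] mdeg_scale)
  qed
  then show "\<exists>d. \<forall>\<alpha>. scoeff (adams k x) \<alpha> \<noteq> 0 \<longrightarrow> mdeg \<alpha> \<le> d" by blast
qed

section \<open>Power sums\<close>

text \<open>Index 0 stands for \<open>p\<^sub>1\<close>, so that every multiset of natural numbers
  is a monomial in the power sums.\<close>

abbreviation psums :: "nat \<Rightarrow> ser" where "psums k \<equiv> psum (Suc k)"

text \<open>A choice of one term from each factor in a product of power sums: the pair
  \<open>(i, k)\<close> picks the power \<open>Suc k\<close> of variable \<open>i\<close> from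
  \<open>psums k\<close>.\<close>

definition labels :: "(nat \<times> nat) multiset \<Rightarrow> monomial" where
  "labels N = (\<Sum>(i, k)\<in>#N. single i (Suc k))"

definition exponents :: "monomial \<Rightarrow> nat multiset" where
  "exponents \<alpha> = image_mset (lookup \<alpha>) (mset_set (keys \<alpha>))"

lemma labels_add: "labels (add_mset (i, k) N) = single i (Suc k) + labels N"
  by (simp add: labels_def)

lemma exponents_add_fresh:
  assumes "i \<notin> keys \<alpha>"
  shows "keys (single i (Suc k) + \<alpha>) = insert i (keys \<alpha>)"
    "exponents (single i (Suc k) + \<alpha>) = add_mset (Suc k) (exponents \<alpha>)"
proof -
  show K: "keys (single i (Suc k) + \<alpha>) = insert i (keys \<alpha>)"
    by (auto simp: in_keys_iff lookup_add lookup_single when_def split: if_splits)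
  have "lookup \<alpha> i = 0" using assms by (simp add: in_keys_iff)
  then show "exponents (single i (Suc k) + \<alpha>) = add_mset (Suc k) (exponents \<alpha>)"
    using assms unfolding exponents_def K
    by (auto simp: lookup_add lookup_single when_def intro!: image_mset_cong)
qed

text \<open>A choice involves at most as many variables as there are factors. Equality means that no
  variable was picked twice, and then the exponents reveal the factors.\<close>

lemma exponents_labels:
  "card (keys (labels N)) \<le> size N \<and>
    (card (keys (labels N)) = size N \<longrightarrow> exponents (labels N) = image_mset (\<lambda>p. Suc (snd p)) N)"
proof (induction N)
  case empty
  then show ?case by (simp add: labels_def exponents_def)
next
  case (add p N)
  obtain i k where p: "p = (i, k)" by (cases p)
  show ?case
  proof (cases "i \<in> keys (labels N)")
    case True
    have "keys (single i (Suc k) + labels N) = keys (labels N)"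
      using True by (auto simp: in_keys_iff lookup_add lookup_single when_def split: if_splits)
    then show ?thesis using add p by (simp add: labels_add)
  next
    case False
    then show ?thesis using add p by (simp add: labels_add exponents_add_fresh)
  qed
qed

lemma labels_exist: "\<exists>N. image_mset snd N = M \<and> card (keys (labels N)) = size M"
proof (induction M)
  case empty
  then show ?case by (intro exI[of _ "{#}"]) (simp add: labels_def)
next
  case (add k M)
  then obtain N where N: "image_mset snd N = M" "card (keys (labels N)) = size M" by blast
  obtain i where "i \<notin> keys (labels N)" using ex_new_if_finite[OF infinite_UNIV_nat finite_keys] by blast
  then show ?case using N by (intro exI[of _ "add_mset (i, k) N"]) (simp add: labels_add exponents_add_fresh)
qed

text \<open>Nonnegativity excludes cancellation between different choices.\<close>

lemma psums_nonneg: "scoeff (\<Prod>k\<in>#M. psums k) \<alpha> \<ge> 0"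
proof (induction M arbitrary: \<alpha>)
  case empty
  then show ?case by (simp add: scoeff_1)
next
  case (add k M)
  then show ?case by (auto simp: scoeff_mult power_sum_def intro!: sum_nonneg)
qed

lemma psums_labels_pos: "scoeff (\<Prod>k\<in>#image_mset snd N. psums k) (labels N) > 0"
proof (induction N)
  case empty
  then show ?case by (simp add: scoeff_1 labels_def)
next
  case (add p N)
  obtain i k where p: "p = (i, k)" by (cases p)
  let ?x = "\<Prod>k\<in>#image_mset snd N. psums k" and ?s = "single i (Suc k)"
  have "0 < (case (?s, labels N) of (\<beta>, \<gamma>) \<Rightarrow> scoeff (psums k) \<beta> * scoeff ?x \<gamma>)"
  proof -
    have "scoeff (psums k) ?s = 1" by (auto simp: power_sum_def)
    then show ?thesis using add by simp
  qed
  also have "\<dots> \<le> (\<Sum>(\<beta>, \<gamma>)\<in>factors (?s + labels N). scoeff (psums k) \<beta> * scoeff ?x \<gamma>)"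
    by (rule member_le_sum) (use psums_nonneg in \<open>auto simp: finite_add_eq power_sum_def\<close>)
  finally show ?case by (simp add: p labels_add scoeff_mult)
qed

lemma psums_nonzero:
  "scoeff (\<Prod>k\<in>#M. psums k) \<alpha> \<noteq> 0 \<Longrightarrow> \<exists>N. image_mset snd N = M \<and> labels N = \<alpha>"
proof (induction M arbitrary: \<alpha>)
  case empty
  then show ?case by (intro exI[of _ "{#}"]) (simp add: scoeff_1 labels_def split: if_splits)
next
  case (add k M)
  let ?x = "\<Prod>k\<in>#M. psums k"
  have "(\<Sum>(\<beta>, \<gamma>)\<in>factors \<alpha>. scoeff (psums k) \<beta> * scoeff ?x \<gamma>) \<noteq> 0"
    using add.prems by (simp add: scoeff_mult)
  then obtain q where "q \<in> factors \<alpha>" "(case q of (\<beta>, \<gamma>) \<Rightarrow> scoeff (psums k) \<beta> * scoeff ?x \<gamma>) \<noteq> 0"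
    by (rule sum.not_neutral_contains_not_neutral)
  then obtain \<beta> \<gamma> where bg: "\<beta> + \<gamma> = \<alpha>" "power_sum (Suc k) \<beta> \<noteq> 0" "scoeff ?x \<gamma> \<noteq> 0" by auto
  obtain i where i: "\<beta> = single i (Suc k)" using bg(2) by (auto simp: power_sum_def split: if_splits)
  obtain N where "image_mset snd N = M" "labels N = \<gamma>" using add.IH[OF bg(3)] by blast
  then show ?case using i bg(1) by (intro exI[of _ "add_mset (i, k) N"]) (simp add: labels_add)
qed

text \<open>Among the products of power sums occurring in \<open>F\<close> take one with the largest number of
  factors; the monomial whose exponents are the indices of those factors occurs in no other.\<close>

lemma power_sums_independent:
  assumes "polyval psums F = 0" shows "F = 0"
proof (rule ccontr)
  assume "F \<noteq> 0"
  then have ne: "keys F \<noteq> {}" by simp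
  have "\<exists>M\<in>keys F. \<forall>M'\<in>keys F. size M' \<le> size M"
  proof -
    let ?S = "size ` keys F"
    have "Max ?S \<in> ?S" by (rule Max_in) (use ne in auto)
    then obtain M where "M \<in> keys F" "size M = Max ?S" by auto
    then show ?thesis using Max_ge[of ?S] by (intro bexI[of _ M]) auto
  qed
  then obtain M where M: "M \<in> keys F" "\<And>M'. M' \<in> keys F \<Longrightarrow> size M' \<le> size M" by blast
  obtain N where N: "image_mset snd N = M" "card (keys (labels N)) = size M" using labels_exist by blast
  have sN: "size N = size M" using N(1) by (metis size_image_mset)
  have ss: "image_mset (\<lambda>p. Suc (snd p)) N = image_mset Suc (image_mset snd N)" for N :: "(nat \<times> nat) multiset"
    by (simp add: multiset.map_comp o_def)
  have ex: "exponents (labels N) = image_mset Suc M"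
  proof -
    have "exponents (labels N) = image_mset (\<lambda>p. Suc (snd p)) N" using exponents_labels[of N] N(2) sN by simp
    then show ?thesis unfolding ss N(1) .
  qed
  have zero: "scoeff (\<Prod>k\<in>#M'. psums k) (labels N) = 0" if M': "M' \<in> keys F" "M' \<noteq> M" for M'
  proof (rule ccontr)
    assume "scoeff (\<Prod>k\<in>#M'. psums k) (labels N) \<noteq> 0"
    then obtain N' where N': "image_mset snd N' = M'" "labels N' = labels N" using psums_nonzero by blast
    have "size N' = size M'" using N'(1) by (metis size_image_mset)
    \<comment> \<open>By maximality \<open>size M'\<close> is at most \<open>size M\<close>, the
      number of variables of the common monomial; and this number is at most
      \<open>size N' = size M'\<close>.\<close>
    then have "card (keys (labels N')) = size N'"
      using exponents_labels[of N'] N' N(2) M(2)[OF M'(1)] by simp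
    then have "exponents (labels N') = image_mset Suc M'"
      using exponents_labels[of N'] unfolding ss N'(1) by blast
    then have "image_mset Suc M' = image_mset Suc M" using ex N'(2) by simp
    then have "M' = M" using injD[OF multiset.inj_map[OF inj_Suc]] by blast
    then show False using M'(2) by simp
  qed
  have "0 = scoeff (polyval psums F) (labels N)" using assms by simp
  also have "\<dots> = (\<Sum>M'\<in>keys F. lookup F M' * scoeff (\<Prod>k\<in>#M'. psums k) (labels N))"
    by (simp add: polyval_def scoeff_sum)
  also have "\<dots> = (\<Sum>M'\<in>{M}. lookup F M' * scoeff (\<Prod>k\<in>#M'. psums k) (labels N))"
    by (rule sum.mono_neutral_right) (use M zero in auto)
  also have "\<dots> = lookup F M * scoeff (\<Prod>k\<in>#M. psums k) (labels N)" by simp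
  finally show False using psums_labels_pos[of N] M(1) by (auto simp: N(1) in_keys_iff)
qed

lemma polyval_psums_inject: "polyval psums F = polyval psums G \<Longrightarrow> F = G"
  using power_sums_independent[of "F - G"] by (simp add: polyval_diff)

section \<open>Complete symmetric functions and cycle types\<close>

definition complete_series :: "nat \<Rightarrow> ser" where
  "complete_series m = Ser (\<lambda>\<alpha>. if mdeg \<alpha> = m then 1 else 0)"

lemma complete_series_1: "complete_series 1 = psum 1"
proof (rule ser_eqI)
  fix \<alpha>
  have "(\<exists>i. \<alpha> = single i 1) \<longleftrightarrow> mdeg \<alpha> = 1"
  proof
    assume deg: "mdeg \<alpha> = 1"
    then obtain i where i: "lookup \<alpha> i \<noteq> 0" by (metis mdeg_eq_0_iff poly_mapping_eqI lookup_zero zero_neq_one)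
    have "mdeg \<alpha> = mdeg (cut i \<alpha>) + lookup \<alpha> i" by (simp only: mdeg_cut)
    then have "mdeg (cut i \<alpha>) = 0" "lookup \<alpha> i = 1" using i deg by auto
    then have "\<alpha> = single i 1" using cut_add[of i \<alpha>] by (simp add: mdeg_eq_0_iff)
    then show "\<exists>i. \<alpha> = single i 1" by blast
  qed auto
  then show "scoeff (complete_series 1) \<alpha> = scoeff (psum 1) \<alpha>" by (simp add: complete_series_def power_sum_def)
qed

lemma mdeg_map_key: assumes "bij (\<pi> :: nat \<Rightarrow> nat)" shows "mdeg (map_key \<pi> \<alpha>) = mdeg \<alpha>"
proof -
  have "mdeg (map_key \<pi> \<alpha>) = (\<Sum>i\<in>inv' \<pi> ` keys \<alpha>. lookup \<alpha> (\<pi> i))"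
    using assms by (subst mdeg_superset[of "inv' \<pi> ` keys \<alpha>"])
      (auto simp: in_keys_iff map_key.rep_eq bij_is_inj inv_f_f intro: image_eqI[of _ _ "\<pi> _"])
  also have "\<dots> = mdeg \<alpha>" using assms
    by (subst sum.reindex) (auto simp: mdeg_def bij_imp_bij_inv bij_is_inj bij_is_surj surj_f_inv_f inj_on_subset[OF bij_is_inj])
  finally show ?thesis .
qed

lemma symfuns_complete_series: "complete_series m \<in> symfuns"
  unfolding symfuns_iff complete_series_def by (auto simp: mdeg_map_key intro!: exI[of _ m])

text \<open>The product of the \<open>p\<^sub>k[h\<^sub>m]\<close> over the cycle lengths
  \<open>k\<close> of \<sigma> on \<open>I\<close>, as a generating function. The set
  \<open>I\<close> is kept variable so that cycles can be split off one at a time.\<close>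

definition tuple_series :: "nat set \<Rightarrow> (nat \<Rightarrow> nat) \<Rightarrow> nat \<Rightarrow> ser" where
  "tuple_series I \<sigma> m = Ser (\<lambda>\<alpha>. of_nat (card (invariant_tuples I \<sigma> (\<lambda>_. m) \<alpha>)))"

text \<open>The contribution of one cycle of length \<open>k\<close>: a constant tuple with value
  \<open>b\<close> has total exponent \<open>scale k b\<close>.\<close>

lemma card_constant_tuples:
  assumes k: "k > 0"
  shows "of_nat (card {b. mdeg b = m \<and> scale k b = \<gamma>}) = scoeff (adams k (complete_series m)) \<gamma>"
proof (cases "\<gamma> \<in> range (scale k)")
  case True
  then obtain b where b: "\<gamma> = scale k b" by blast
  have "{b'. mdeg b' = m \<and> scale k b' = \<gamma>} = (if mdeg b = m then {b} else {})"
    using b scale_inject[OF k] by auto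
  then show ?thesis by (simp add: b adams_scale[OF k] complete_series_def)
next
  case False
  then have "{b. mdeg b = m \<and> scale k b = \<gamma>} = {}" by auto
  then have "card {b. mdeg b = m \<and> scale k b = \<gamma>} = 0" by (simp only: card.empty)
  then show ?thesis using False by (simp add: adams_outside)
qed

lemma sum_constant_scale: "finite Ob \<Longrightarrow> (\<Sum>i\<in>Ob. b) = scale (card Ob) b"
  by (rule poly_mapping_eqI) (simp add: lookup_sum lookup_scale del: sum_constant, simp)

text \<open>An invariant tuple is a constant on \<open>Ob\<close> together with an invariant tuple
  on the complement. That \<open>Ob\<close> is a single cycle is expressed by
  \<open>const\<close>.\<close>

lemma tuple_series_split:
  assumes fin: "finite I" and Ob: "Ob \<subseteq> I" "Ob \<noteq> {}" and \<sigma>: "\<And>i. i \<in> Ob \<Longrightarrow> \<sigma> i \<in> Ob" "\<And>i. i \<in> I - Ob \<Longrightarrow> \<sigma> i \<in> I - Ob"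
    and const: "\<And>\<beta> i j. (\<And>i. i \<in> Ob \<Longrightarrow> \<beta> (\<sigma> i) = \<beta> i) \<Longrightarrow> i \<in> Ob \<Longrightarrow> j \<in> Ob \<Longrightarrow> \<beta> i = (\<beta> j :: monomial)"
  shows "tuple_series I \<sigma> m = adams (card Ob) (complete_series m) * tuple_series (I - Ob) \<sigma> m"
proof (rule ser_eqI)
  fix \<alpha>
  have finO: "finite Ob" using fin Ob(1) finite_subset by blast
  have k: "card Ob > 0" using finO Ob(2) by (simp add: card_gt_0_iff)
  obtain ob where ob: "ob \<in> Ob" using Ob(2) by blast
  let ?T = "\<lambda>I \<alpha>. invariant_tuples I \<sigma> (\<lambda>_. m) \<alpha>"
  let ?B = "\<lambda>\<gamma>. {b. mdeg b = m \<and> scale (card Ob) b = \<gamma>}"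
  let ?g = "(\<lambda>(p, (b, \<delta>)). (\<lambda>i\<in>I. if i \<in> Ob then b else \<delta> i))"
  let ?f = "(\<lambda>\<beta>. ((scale (card Ob) (\<beta> ob), \<Sum>i\<in>I - Ob. \<beta> i), (\<beta> ob, restrict \<beta> (I - Ob))))"
  let ?R = "(SIGMA p:factors \<alpha>. ?B (fst p) \<times> ?T (I - Ob) (snd p))"
  have finB: "finite (?B \<gamma>)" for \<gamma>
    by (rule finite_subset[of _ "{inv' (scale (card Ob)) \<gamma>}"]) (auto simp: inv_f_f inj_def scale_inject[OF k])
  have bij: "bij_betw ?f (?T I \<alpha>)
    ?R"
  proof (rule bij_betwI[where g = "\<lambda>(p, (b, \<delta>)). (\<lambda>i\<in>I. if i \<in> Ob then b else \<delta> i)"])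
    show "?f \<in> ?T I \<alpha> \<rightarrow>
      ?R"
    proof
      fix \<beta> assume \<beta>: "\<beta> \<in> ?T I \<alpha>"
      have inv: "\<beta> (\<sigma> i) = \<beta> i" "mdeg (\<beta> i) = m" if "i \<in> I" for i using \<beta> that by (auto simp: invariant_tuples_def)
      have c: "\<beta> i = \<beta> ob" if "i \<in> Ob" for i using const[of \<beta> i ob] inv Ob(1) that ob by blast
      have "(\<Sum>i\<in>I. \<beta> i) = (\<Sum>i\<in>I - Ob. \<beta> i) + (\<Sum>i\<in>Ob. \<beta> i)" by (rule sum.subset_diff[OF Ob(1) fin])
      also have "(\<Sum>i\<in>Ob. \<beta> i) = scale (card Ob) (\<beta> ob)" using c sum_constant_scale[OF finO, of "\<beta> ob"] by simp
      finally have "scale (card Ob) (\<beta> ob) + (\<Sum>i\<in>I - Ob. \<beta> i) = \<alpha>" using \<beta> by (simp add: invariant_tuples_def add.commute)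
      then show "((scale (card Ob) (\<beta> ob), \<Sum>i\<in>I - Ob. \<beta> i), (\<beta> ob, restrict \<beta> (I - Ob))) \<in> ?R"
        using inv ob Ob(1) \<sigma>(2) by (auto simp: invariant_tuples_def)
    qed
    show "?g \<in> ?R \<rightarrow> ?T I \<alpha>"
    proof
      fix q assume q: "q \<in> ?R"
      obtain \<gamma> \<gamma>' b \<delta> where qq: "q = ((\<gamma>, \<gamma>'), (b, \<delta>))" by (metis prod.collapse)
      then have h: "\<gamma> + \<gamma>' = \<alpha>" "mdeg b = m" "scale (card Ob) b = \<gamma>" "\<delta> \<in> ?T (I - Ob) \<gamma>'" using q by auto
      let ?\<beta> = "\<lambda>i\<in>I. if i \<in> Ob then b else \<delta> i"
      have "(\<Sum>i\<in>I. ?\<beta> i) = (\<Sum>i\<in>I - Ob. ?\<beta> i) + (\<Sum>i\<in>Ob. ?\<beta> i)" by (rule sum.subset_diff[OF Ob(1) fin])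
      also have "(\<Sum>i\<in>Ob. ?\<beta> i) = (\<Sum>i\<in>Ob. b)" using Ob(1) by (intro sum.cong) auto
      also have "(\<Sum>i\<in>I - Ob. ?\<beta> i) = (\<Sum>i\<in>I - Ob. \<delta> i)" by (intro sum.cong) auto
      finally have "(\<Sum>i\<in>I. ?\<beta> i) = \<alpha>" using h by (simp only: sum_constant_scale[OF finO]) (simp add: invariant_tuples_def add.commute)
      moreover have "mdeg (?\<beta> i) = m \<and> ?\<beta> (\<sigma> i) = ?\<beta> i" if i: "i \<in> I" for i
      proof (cases "i \<in> Ob")
        case True
        then show ?thesis using \<sigma>(1)[OF True] Ob(1) h(2) by auto
      next
        case False
        then have "\<sigma> i \<in> I - Ob" using \<sigma>(2)[of i] i by blast
        then show ?thesis using h(4) i False by (auto simp: invariant_tuples_def)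
      qed
      ultimately have "?\<beta> \<in> ?T I \<alpha>" by (simp add: invariant_tuples_def)
      then show "?g q \<in> ?T I \<alpha>" by (simp add: qq)
    qed
    show "?g ((scale (card Ob) (\<beta> ob), \<Sum>i\<in>I - Ob. \<beta> i), (\<beta> ob, restrict \<beta> (I - Ob))) = \<beta>"
      if \<beta>: "\<beta> \<in> ?T I \<alpha>" for \<beta>
    proof -
      have inv: "\<beta> (\<sigma> i) = \<beta> i" if "i \<in> I" for i using \<beta> that by (auto simp: invariant_tuples_def)
      have c: "\<beta> i = \<beta> ob" if "i \<in> Ob" for i using const[of \<beta> i ob] inv Ob(1) that ob by blast
      have "\<beta> \<in> extensional I" using \<beta> by (simp add: invariant_tuples_def)
      then show ?thesis using c by (auto simp: fun_eq_iff extensional_def)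
    qed
    show "?f (?g q) = q"
      if q: "q \<in> ?R" for q
    proof -
      obtain \<gamma> \<gamma>' b \<delta> where qq: "q = ((\<gamma>, \<gamma>'), (b, \<delta>))" by (metis prod.collapse)
      then have h: "\<gamma> + \<gamma>' = \<alpha>" "mdeg b = m" "scale (card Ob) b = \<gamma>" "\<delta> \<in> ?T (I - Ob) \<gamma>'" using q by auto
      have "(\<Sum>i\<in>I - Ob. if i \<in> Ob then b else \<delta> i) = \<gamma>'" using h(4) by (simp add: invariant_tuples_def)
      moreover have "restrict (\<lambda>i\<in>I. if i \<in> Ob then b else \<delta> i) (I - Ob) = \<delta>"
        using h(4) by (auto simp: invariant_tuples_def fun_eq_iff extensional_def)
      moreover have "ob \<in> I" using ob Ob(1) by blast
      ultimately show ?thesis using qq h(3) ob by simp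
    qed
  qed
  have "card (?T I \<alpha>) = card ?R" by (rule bij_betw_same_card[OF bij])
  also have "\<dots> = (\<Sum>p\<in>factors \<alpha>. card (?B (fst p)) * card (?T (I - Ob) (snd p)))"
    using finB fin by (simp add: card_SigmaI finite_add_eq finite_invariant_tuples card_cartesian_product)
  finally show "scoeff (tuple_series I \<sigma> m) \<alpha> = scoeff (adams (card Ob) (complete_series m) * tuple_series (I - Ob) \<sigma> m) \<alpha>"
    by (simp add: tuple_series_def scoeff_mult card_constant_tuples[OF k, symmetric] case_prod_unfold)
qed

lemma tuple_series_empty: "tuple_series {} \<sigma> m = 1"
proof (rule ser_eqI)
  fix \<alpha>
  have "invariant_tuples {} \<sigma> (\<lambda>_. m) \<alpha> = (if \<alpha> = 0 then {\<lambda>_. undefined} else {})"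
    by (auto simp: invariant_tuples_def)
  then show "scoeff (tuple_series {} \<sigma> m) \<alpha> = scoeff 1 \<alpha>" by (simp add: tuple_series_def scoeff_1)
qed

text \<open>The multiset \<open>M\<close> lists the cycle lengths, each lowered by one. It has to be
  the same for all \<open>m\<close>: the value \<open>m = 1\<close> gives a product of power sums,
  and general \<open>m\<close> gives the image of this product under the substitution that defines
  the plethysm with \<open>h\<^sub>m\<close>.\<close>

lemma tuple_series_cycle_type:
  assumes "finite I" "\<sigma> permutes S" "\<And>i. i \<in> I \<Longrightarrow> \<sigma> i \<in> I"
  shows "\<exists>M. \<forall>m. tuple_series I \<sigma> m = (\<Prod>k\<in>#M. adams (Suc k) (complete_series m))"
  using assms(1,3)
proof (induction "card I" arbitrary: I rule: less_induct)
  case less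
  show ?case
  proof (cases "I = {}")
    case True
    then show ?thesis by (intro exI[of _ "{#}"]) (simp add: tuple_series_empty)
  next
    case False
    then obtain i where i: "i \<in> I" by blast
    let ?Ob = "{(\<sigma> ^^ t) i | t. True}"
    have inj: "inj \<sigma>" by (rule permutes_inj[OF assms(2)])
    have it: "(\<sigma> ^^ t) j \<in> I" if "j \<in> I" for t j using that less.prems(2) by (induction t) auto
    then have Ob: "?Ob \<subseteq> I" "?Ob \<noteq> {}" using i by blast+
    have "i \<in> ?Ob" by (auto intro: exI[of _ 0])
    have clO: "\<sigma> j \<in> ?Ob" if "j \<in> ?Ob" for j
      using that by (auto intro: exI[of _ "Suc _"])
    have finO: "finite ?Ob" using Ob(1) less.prems(1) finite_subset by blast
    \<comment> \<open>An injective map of a finite set into itself is onto, so the complement of the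
      orbit is invariant as well.\<close>
    have "\<sigma> ` ?Ob = ?Ob" by (rule endo_inj_surj[OF finO]) (use clO inj_on_subset[OF inj] in auto)
    then have cl': "\<sigma> j \<in> I - ?Ob" if "j \<in> I - ?Ob" for j
      using that less.prems(2) injD[OF inj] by (metis (no_types, lifting) DiffD1 DiffD2 DiffI imageE)
    have const: "\<beta> a = \<beta> b" if "\<And>j. j \<in> ?Ob \<Longrightarrow> \<beta> (\<sigma> j) = (\<beta> j :: monomial)" "a \<in> ?Ob" "b \<in> ?Ob" for \<beta> a b
    proof -
      have "\<beta> ((\<sigma> ^^ t) i) = \<beta> i" for t
      proof (induction t)
        case (Suc t)
        have "(\<sigma> ^^ t) i \<in> ?Ob" by blast
        then show ?case using that(1) Suc by simp
      qed simp
      then show ?thesis using that(2,3) by force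
    qed
    have "card (I - ?Ob) < card I" using Ob less.prems(1) by (intro psubset_card_mono) auto
    then obtain M where M: "\<forall>m. tuple_series (I - ?Ob) \<sigma> m = (\<Prod>k\<in>#M. adams (Suc k) (complete_series m))"
      using less.hyps[of "I - ?Ob"] less.prems(1) cl' by blast
    obtain k where k: "card ?Ob = Suc k" using finO Ob(2) by (metis card_eq_0_iff not0_implies_Suc)
    show ?thesis
    proof (intro exI[of _ "add_mset k M"] allI)
      fix m
      have "tuple_series I \<sigma> m = adams (card ?Ob) (complete_series m) * tuple_series (I - ?Ob) \<sigma> m"
        by (rule tuple_series_split[OF less.prems(1) Ob clO cl' const])
      then show "tuple_series I \<sigma> m = (\<Prod>k\<in>#add_mset k M. adams (Suc k) (complete_series m))" using M k by simp
    qed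
  qed
qed

section \<open>Plethysm\<close>

definition homogeneous :: "nat \<Rightarrow> ser \<Rightarrow> bool" where
  "homogeneous N x \<longleftrightarrow> (\<forall>\<alpha>. scoeff x \<alpha> \<noteq> 0 \<longrightarrow> mdeg \<alpha> = N)"

text \<open>Kostka inversion applied to the coefficients at the monomials of partitions; the formula
  is linear in \<open>x\<close>.\<close>

definition schur_coeff :: "nat \<Rightarrow> ser \<Rightarrow> nat list \<Rightarrow> rat" where
  "schur_coeff N x \<nu> = (\<Sum>\<mu>\<in>partitions_of N. of_int (inverse_kostka N \<mu> \<nu>) * scoeff x (part_mono \<mu>))"

lemma symfuns_lookup:
  "x \<in> symfuns \<Longrightarrow> bij \<pi> \<Longrightarrow> lookup \<beta> = lookup \<alpha> \<circ> \<pi> \<Longrightarrow> scoeff x \<beta> = scoeff x \<alpha>"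
  by (simp add: symfuns_def sym_fun_def symmetric_series_def)

lemma schur_coeff_expansion:
  assumes x: "x \<in> symfuns" and \<alpha>: "mdeg \<alpha> = N"
  shows "scoeff x \<alpha> = (\<Sum>\<nu>\<in>partitions_of N. schur_coeff N x \<nu> * schur \<nu> \<alpha>)"
proof -
  let ?P = "partitions_of N"
  obtain mu \<pi> where mu: "mu \<in> ?P" "bij \<pi>" "shape_of mu = lookup \<alpha> \<circ> \<pi>" by (rule sort_monomial[OF \<alpha>])
  have lk: "lookup (part_mono mu) = lookup \<alpha> \<circ> \<pi>"
    using mu by (simp add: lookup_part_mono)
  have "(\<Sum>\<nu>\<in>?P. schur_coeff N x \<nu> * schur \<nu> \<alpha>) =
      (\<Sum>\<nu>\<in>?P. \<Sum>\<kappa>\<in>?P. scoeff x (part_mono \<kappa>) * of_int (inverse_kostka N \<kappa> \<nu> * kostka_number \<nu> mu))"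
  proof (rule sum.cong[OF refl])
    fix \<nu> assume \<nu>: "\<nu> \<in> ?P"
    have "schur \<nu> \<alpha> = of_int (kostka_number \<nu> mu)"
      using schur_kostka[OF \<nu>] kostka_part_mono[OF mu] by (simp add: kostka_number_def)
    then show "schur_coeff N x \<nu> * schur \<nu> \<alpha> =
        (\<Sum>\<kappa>\<in>?P. scoeff x (part_mono \<kappa>) * of_int (inverse_kostka N \<kappa> \<nu> * kostka_number \<nu> mu))"
      by (simp add: schur_coeff_def sum_distrib_left mult_ac)
  qed
  also have "\<dots> = (\<Sum>\<kappa>\<in>?P. scoeff x (part_mono \<kappa>) * of_int (\<Sum>\<nu>\<in>?P. inverse_kostka N \<kappa> \<nu> * kostka_number \<nu> mu))"
    by (subst sum.swap) (simp add: sum_distrib_left)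
  also have "\<dots> = (\<Sum>\<kappa>\<in>?P. scoeff x (part_mono \<kappa>) * (if \<kappa> = mu then 1 else 0))"
    using mu(1) by (intro sum.cong refl) (simp add: inverse_kostka(1))
  also have "\<dots> = scoeff x (part_mono mu)" by (rule sum_mult_delta(1)[OF finite_partitions_of mu(1)])
  also have "\<dots> = scoeff x \<alpha>" by (rule symfuns_lookup[OF x mu(2) lk])
  finally show ?thesis ..
qed

lemma schur_0: "lam \<in> partitions_of N \<Longrightarrow> mdeg \<alpha> \<noteq> N \<Longrightarrow> schur lam \<alpha> = 0"
  using schur_kostka[of lam N \<alpha>] kostka_nonzero[of \<alpha> "shape_of lam"] by (auto simp: ssize_shape_of partitions_of_def)

lemma homogeneous_schur_expansion:
  assumes x: "x \<in> symfuns" and hom: "homogeneous N x"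
  shows "scoeff x = (\<lambda>\<alpha>. \<Sum>\<nu>\<in>partitions_of N. schur_coeff N x \<nu> * schur \<nu> \<alpha>)"
proof
  fix \<alpha> show "scoeff x \<alpha> = (\<Sum>\<nu>\<in>partitions_of N. schur_coeff N x \<nu> * schur \<nu> \<alpha>)"
  proof (cases "mdeg \<alpha> = N")
    case True then show ?thesis by (rule schur_coeff_expansion[OF x])
  next
    case False
    then have "scoeff x \<alpha> = 0" using hom unfolding homogeneous_def by blast
    moreover have "(\<Sum>\<nu>\<in>partitions_of N. schur_coeff N x \<nu> * schur \<nu> \<alpha>) = 0"
      using False by (intro sum.neutral) (simp add: schur_0)
    ultimately show ?thesis by simp
  qed
qed

lemma schur_coeff_unique:
  assumes eq: "scoeff x = (\<lambda>\<alpha>. \<Sum>\<nu>\<in>partitions_of N. a \<nu> * schur \<nu> \<alpha>)" and \<nu>: "\<nu> \<in> partitions_of N"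
  shows "a \<nu> = schur_coeff N x \<nu>"
proof -
  let ?P = "partitions_of N"
  have "schur_coeff N x \<nu> = (\<Sum>\<mu>\<in>?P. \<Sum>\<kappa>\<in>?P. a \<kappa> * of_int (kostka_number \<kappa> \<mu> * inverse_kostka N \<mu> \<nu>))"
    unfolding schur_coeff_def eq sum_distrib_left
    by (intro sum.cong refl) (simp add: schur_kostka kostka_number_def)
  also have "\<dots> = (\<Sum>\<kappa>\<in>?P. a \<kappa> * of_int (\<Sum>\<mu>\<in>?P. kostka_number \<kappa> \<mu> * inverse_kostka N \<mu> \<nu>))"
    by (subst sum.swap) (simp add: sum_distrib_left)
  also have "\<dots> = (\<Sum>\<kappa>\<in>?P. a \<kappa> * (if \<kappa> = \<nu> then 1 else 0))"
    using \<nu> by (intro sum.cong refl) (simp add: inverse_kostka(2))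
  also have "\<dots> = a \<nu>" by (rule sum_mult_delta(1)[OF finite_partitions_of \<nu>])
  finally show ?thesis ..
qed

text \<open>In \<open>sum_fixcols_fibre\<close> take every point as its own fibre: then \<sigma> is
  the only permutation lying over \<sigma>, and the sum has a single term.\<close>

lemma card_fixcols_invariant_tuples:
  fixes n :: nat
  assumes \<sigma>: "\<sigma> permutes {1..n}"
  shows "card (fixcols {1..n} \<alpha> \<sigma>) = card (invariant_tuples {1..n} \<sigma> (\<lambda>_. 1) \<alpha>)"
proof -
  let ?A = "{1..n}"
  have one: "card {a \<in> ?A. a = i} = 1" if "i \<in> ?A" for i
  proof -
    have "{a \<in> ?A. a = i} = {i}" using that by auto
    then show ?thesis by simp
  qed
  have "{w. w permutes ?A \<and> (\<forall>a\<in>?A. w a = \<sigma> a)} = {\<sigma>}"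
    using \<sigma> by (auto simp: fun_eq_iff permutes_not_in) (metis permutes_not_in)
  note W = this
  have T: "invariant_tuples ?A \<sigma> (\<lambda>i. card {a \<in> ?A. a = i}) \<alpha> = invariant_tuples ?A \<sigma> (\<lambda>_. 1) \<alpha>"
    unfolding invariant_tuples_def using one by (intro Collect_cong conj_cong refl ball_cong) auto
  have P: "(\<Prod>i\<in>?A. fact (card {a \<in> ?A. a = i})) = (1 :: nat)"
    using one by (intro prod.neutral) (metis fact_1)
  have "(\<Sum>w | w permutes ?A \<and> (\<forall>a\<in>?A. w a = \<sigma> a). card (fixcols ?A \<alpha> w)) =
      (\<Prod>i\<in>?A. fact (card {a \<in> ?A. a = i})) * card (invariant_tuples ?A \<sigma> (\<lambda>i. card {a \<in> ?A. a = i}) \<alpha>)"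
    by (rule sum_fixcols_fibre) (use \<sigma> in simp_all)
  then show ?thesis unfolding W T P by simp
qed

lemma scoeff_tuple_series_1:
  "\<sigma> permutes {1..n} \<Longrightarrow> scoeff (tuple_series {1..n} \<sigma> 1) \<alpha> = of_nat (card (fixcols {1..n} \<alpha> \<sigma>))"
  by (simp only: tuple_series_def scoeff_Ser card_fixcols_invariant_tuples)

text \<open>Frobenius' formula. For \<open>m = 1\<close> the tuple series is the product of power
  sums of the cycle type, and its coefficients are the values of the permutation characters on
  colourings.\<close>

lemma schur_tuple_series:
  assumes lam: "lam \<in> partitions_of n"
  shows "Ser (schur lam) = scalar (1 / fact n) *
    (\<Sum>\<sigma> | \<sigma> permutes {1..n}. scalar (of_int (frob_char {1..n} lam \<sigma>)) * tuple_series {1..n} \<sigma> 1)"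
proof (rule ser_eqI)
  fix \<alpha>
  let ?A = "{1..n}"
  have "(\<Sum>\<sigma> | \<sigma> permutes ?A. of_int (frob_char ?A lam \<sigma>) * scoeff (tuple_series ?A \<sigma> 1) \<alpha>) =
      of_int (\<Sum>\<sigma> | \<sigma> permutes ?A. frob_char ?A lam \<sigma> * int (card (fixcols ?A \<alpha> \<sigma>)))"
    unfolding of_int_sum by (intro sum.cong refl) (simp only: mem_Collect_eq scoeff_tuple_series_1 of_int_mult of_int_of_nat_eq)
  also have "(\<Sum>\<sigma> | \<sigma> permutes ?A. frob_char ?A lam \<sigma> * int (card (fixcols ?A \<alpha> \<sigma>))) = fact n * int (kostka \<alpha> (shape_of lam))"
  proof (cases "mdeg \<alpha> = n")
    case True
    then show ?thesis using sum_frob_char_fixcols[of ?A lam \<alpha>] lam by simp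
  next
    case False
    then have "kostka \<alpha> (shape_of lam) = 0"
      using kostka_nonzero(2)[of \<alpha> "shape_of lam"] lam by (auto simp: ssize_shape_of partitions_of_def)
    then show ?thesis using False card_fixcols_0[of \<alpha> ?A] by simp
  qed
  finally have "(\<Sum>\<sigma> | \<sigma> permutes ?A. of_int (frob_char ?A lam \<sigma>) * scoeff (tuple_series ?A \<sigma> 1) \<alpha>) =
      fact n * schur lam \<alpha>" by (simp add: schur_kostka[OF lam])
  then show "scoeff (Ser (schur lam)) \<alpha> = scoeff (scalar (1 / fact n) *
      (\<Sum>\<sigma> | \<sigma> permutes ?A. scalar (of_int (frob_char ?A lam \<sigma>)) * tuple_series ?A \<sigma> 1)) \<alpha>"
    by (simp only: scoeff_scalar_mult scoeff_sum scoeff_Ser) simp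
qed

text \<open>One polynomial \<open>F\<close> serves all \<open>m\<close>: evaluated at the power sums
  it is \<open>s\<^sub>\<lambda>\<close>, and evaluated at the \<open>p\<^sub>k[h\<^sub>m]\<close>
  it is the average over the symmetric group.\<close>

lemma schur_polyval:
  assumes lam: "lam \<in> partitions_of n"
  obtains F where "Ser (schur lam) = polyval psums F"
    "\<And>m. polyval (\<lambda>k. adams (Suc k) (complete_series m)) F = scalar (1 / fact n) *
      (\<Sum>\<sigma> | \<sigma> permutes {1..n}. scalar (of_int (frob_char {1..n} lam \<sigma>)) * tuple_series {1..n} \<sigma> m)"
proof -
  have "\<forall>\<sigma>\<in>{\<sigma>. \<sigma> permutes {1..n}}. \<exists>M. \<forall>m. tuple_series {1..n} \<sigma> m = (\<Prod>k\<in>#M. adams (Suc k) (complete_series m))"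
  proof
    fix \<sigma> assume "\<sigma> \<in> {\<sigma>. \<sigma> permutes {1..n}}"
    then have \<sigma>: "\<sigma> permutes {1..n}" by simp
    show "\<exists>M. \<forall>m. tuple_series {1..n} \<sigma> m = (\<Prod>k\<in>#M. adams (Suc k) (complete_series m))"
      using permutes_in_image[OF \<sigma>] by (intro tuple_series_cycle_type[OF finite_atLeastAtMost \<sigma>]) blast
  qed
  from bchoice[OF this] obtain M where
    M': "\<forall>\<sigma>\<in>{\<sigma>. \<sigma> permutes {1..n}}. \<forall>m. tuple_series {1..n} \<sigma> m = (\<Prod>k\<in>#M \<sigma>. adams (Suc k) (complete_series m))" ..
  have M: "tuple_series {1..n} \<sigma> m = (\<Prod>k\<in>#M \<sigma>. adams (Suc k) (complete_series m))" if "\<sigma> permutes {1..n}" for \<sigma> m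
    using M' that by blast
  let ?F = "single {#} (1 / fact n) *
    (\<Sum>\<sigma> | \<sigma> permutes {1..n}. single (M \<sigma>) (of_int (frob_char {1..n} lam \<sigma>)))"
  have F: "polyval (\<lambda>k. adams (Suc k) (complete_series m)) ?F = scalar (1 / fact n) *
      (\<Sum>\<sigma> | \<sigma> permutes {1..n}. scalar (of_int (frob_char {1..n} lam \<sigma>)) * tuple_series {1..n} \<sigma> m)" for m
  proof -
    have "(\<Sum>\<sigma> | \<sigma> permutes {1..n}. scalar (of_int (frob_char {1..n} lam \<sigma>)) * (\<Prod>k\<in>#M \<sigma>. adams (Suc k) (complete_series m))) =
        (\<Sum>\<sigma> | \<sigma> permutes {1..n}. scalar (of_int (frob_char {1..n} lam \<sigma>)) * tuple_series {1..n} \<sigma> m)"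
      by (rule sum.cong[OF refl]) (simp only: M mem_Collect_eq)
    then show ?thesis by (simp only: polyval_mult polyval_sum polyval_single) simp
  qed
  \<comment> \<open>Since \<open>h\<^sub>1 = p\<^sub>1\<close>, the case \<open>m = 1\<close> is the
    evaluation at the power sums.\<close>
  have "(\<lambda>k. adams (Suc k) (complete_series 1)) = psums" using adams_psum[of "Suc _" 1] unfolding complete_series_1 by auto
  then have "Ser (schur lam) = polyval psums ?F" using F[of 1] schur_tuple_series[OF lam] by simp
  then show ?thesis using that F by blast
qed

text \<open>Schur functions span every degree by Kostka inversion, and they are polynomials in the
  power sums by \<open>schur_polyval\<close>.\<close>

lemma power_sums_span:
  assumes x: "x \<in> symfuns" obtains F where "x = polyval psums F"
proof -
  obtain d where d: "\<And>\<alpha>. scoeff x \<alpha> \<noteq> 0 \<Longrightarrow> mdeg \<alpha> \<le> d" using x unfolding symfuns_iff by blast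
  have "\<forall>\<nu>\<in>(\<Union>N\<le>d. partitions_of N). \<exists>F. Ser (schur \<nu>) = polyval psums F" using schur_polyval by blast
  then obtain F where F: "\<And>N \<nu>. N \<le> d \<Longrightarrow> \<nu> \<in> partitions_of N \<Longrightarrow> Ser (schur \<nu>) = polyval psums (F \<nu>)"
    by (metis UN_I atMost_iff)
  have sF: "schur \<nu> \<alpha> = scoeff (polyval psums (F \<nu>)) \<alpha>" if "N \<le> d" "\<nu> \<in> partitions_of N" for N \<nu> \<alpha>
    using F[OF that] by (metis scoeff_Ser)
  have "x = polyval psums (\<Sum>N\<le>d. \<Sum>\<nu>\<in>partitions_of N. single {#} (schur_coeff N x \<nu>) * F \<nu>)"
  proof (rule ser_eqI)
    fix \<alpha>
    have inner: "(\<Sum>\<nu>\<in>partitions_of N. schur_coeff N x \<nu> * schur \<nu> \<alpha>) = (if N = mdeg \<alpha> then scoeff x \<alpha> else 0)" for N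
    proof (cases "N = mdeg \<alpha>")
      case True then show ?thesis using schur_coeff_expansion[OF x, of \<alpha> N] by simp
    next
      case False
      then have "(\<Sum>\<nu>\<in>partitions_of N. schur_coeff N x \<nu> * schur \<nu> \<alpha>) = 0"
        by (intro sum.neutral) (auto simp: schur_0)
      then show ?thesis using False by simp
    qed
    have "scoeff (polyval psums (\<Sum>N\<le>d. \<Sum>\<nu>\<in>partitions_of N. single {#} (schur_coeff N x \<nu>) * F \<nu>)) \<alpha> =
        (\<Sum>N\<le>d. \<Sum>\<nu>\<in>partitions_of N. schur_coeff N x \<nu> * schur \<nu> \<alpha>)"
      by (simp only: polyval_sum scoeff_sum, intro sum.cong refl) (simp add: polyval_mult polyval_single sF)
    also have "\<dots> = (\<Sum>N\<le>d. if N = mdeg \<alpha> then scoeff x \<alpha> else 0)" by (simp only: inner)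
    also have "\<dots> = scoeff x \<alpha>" using d[of \<alpha>] by (cases "mdeg \<alpha> \<le> d") auto
    finally show "scoeff x \<alpha> = scoeff (polyval psums (\<Sum>N\<le>d. \<Sum>\<nu>\<in>partitions_of N. single {#} (schur_coeff N x \<nu>) * F \<nu>)) \<alpha>" ..
  qed
  then show ?thesis by (rule that)
qed

section \<open>Existence and uniqueness of the plethysm operation\<close>

lemma sym_fun_simps:
  "scoeff x \<otimes>\<^bsub>sym_fun\<^esub> scoeff y = scoeff (x * y)" "scoeff x \<oplus>\<^bsub>sym_fun\<^esub> scoeff y = scoeff (x + y)"
  "\<one>\<^bsub>sym_fun\<^esub> = scoeff 1" "(\<lambda>\<alpha>. c * scoeff x \<alpha>) = scoeff (scalar c * x)"
proof -
  show "(\<lambda>\<alpha>. c * scoeff x \<alpha>) = scoeff (scalar c * x)" by (rule ext) simp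
qed (simp_all add: sym_fun_def scoeff_mult fun_eq_iff scoeff_1)

lemma sym_fun_alg_hom_iff:
  "h \<in> sym_fun_alg_hom \<longleftrightarrow>
    (\<forall>x\<in>symfuns. Ser (h (scoeff x)) \<in> symfuns) \<and>
    (\<forall>x\<in>symfuns. \<forall>y\<in>symfuns.
      Ser (h (scoeff (x * y))) = Ser (h (scoeff x)) * Ser (h (scoeff y)) \<and>
      Ser (h (scoeff (x + y))) = Ser (h (scoeff x)) + Ser (h (scoeff y))) \<and>
    Ser (h (scoeff 1)) = 1 \<and>
    (\<forall>c. \<forall>x\<in>symfuns. Ser (h (scoeff (scalar c * x))) = scalar c * Ser (h (scoeff x)))"
proof -
  have car: "(\<forall>f\<in>carrier sym_fun. P f) \<longleftrightarrow> (\<forall>x\<in>symfuns. P (scoeff x))" for P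
    unfolding symfuns_def by (metis mem_Collect_eq scoeff_Ser)
  have eq: "h (scoeff x) = scoeff y \<longleftrightarrow> Ser (h (scoeff x)) = y" for x y by (metis scoeff_Ser scoeff_inverse)
  have "h \<in> sym_fun_alg_hom \<longleftrightarrow>
    (\<forall>f\<in>carrier sym_fun. h f \<in> carrier sym_fun) \<and>
    (\<forall>f\<in>carrier sym_fun. \<forall>g\<in>carrier sym_fun. h (f \<otimes>\<^bsub>sym_fun\<^esub> g) = h f \<otimes>\<^bsub>sym_fun\<^esub> h g \<and> h (f \<oplus>\<^bsub>sym_fun\<^esub> g) = h f \<oplus>\<^bsub>sym_fun\<^esub> h g) \<and>
    h \<one>\<^bsub>sym_fun\<^esub> = \<one>\<^bsub>sym_fun\<^esub> \<and> (\<forall>c. \<forall>f\<in>carrier sym_fun. h (\<lambda>\<alpha>. c * f \<alpha>) = (\<lambda>\<alpha>. c * h f \<alpha>))"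
    by (auto simp add: sym_fun_alg_hom_def Ring.ring_hom_def Pi_def)
  also have "\<dots> \<longleftrightarrow> (\<forall>x\<in>symfuns. Ser (h (scoeff x)) \<in> symfuns) \<and>
    (\<forall>x\<in>symfuns. \<forall>y\<in>symfuns.
      h (scoeff x \<otimes>\<^bsub>sym_fun\<^esub> scoeff y) = scoeff (Ser (h (scoeff x))) \<otimes>\<^bsub>sym_fun\<^esub> scoeff (Ser (h (scoeff y))) \<and>
      h (scoeff x \<oplus>\<^bsub>sym_fun\<^esub> scoeff y) = scoeff (Ser (h (scoeff x))) \<oplus>\<^bsub>sym_fun\<^esub> scoeff (Ser (h (scoeff y)))) \<and>
    h \<one>\<^bsub>sym_fun\<^esub> = \<one>\<^bsub>sym_fun\<^esub> \<and>
    (\<forall>c. \<forall>x\<in>symfuns. h (\<lambda>\<alpha>. c * scoeff x \<alpha>) = (\<lambda>\<alpha>. c * scoeff (Ser (h (scoeff x))) \<alpha>))"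
    unfolding car by (simp add: symfuns_def)
  finally show ?thesis unfolding sym_fun_simps eq .
qed

lemma sym_fun_alg_hom_polyval:
  assumes h: "h \<in> sym_fun_alg_hom" and e: "\<And>k. e k \<in> symfuns"
  shows "Ser (h (scoeff (polyval e F))) = polyval (\<lambda>k. Ser (h (scoeff (e k)))) F"
proof -
  let ?H = "\<lambda>x. Ser (h (scoeff x))"
  note H = h[unfolded sym_fun_alg_hom_iff]
  have Hm: "?H (\<Prod>k\<in>#M. e k) = (\<Prod>k\<in>#M. ?H (e k))" for M
  proof (induction M)
    case empty show ?case using H by simp
  next
    case (add k M)
    have "?H (e k * (\<Prod>k\<in>#M. e k)) = ?H (e k) * ?H (\<Prod>k\<in>#M. e k)"
      using H e symfuns_prod_mset[of M e] by blast
    then show ?case using add by simp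
  qed
  have H0: "?H 0 = 0"
  proof -
    have "?H (scalar 0 * 1) = scalar 0 * ?H 1" using H symfuns_1 by blast
    then show ?thesis by (simp add: scalar_0)
  qed
  have mem: "scalar c * (\<Prod>k\<in>#M. e k) \<in> symfuns" for c M
    by (intro symfuns_mult symfuns_scalar symfuns_prod_mset e)
  have Hs: "?H (\<Sum>M\<in>K. scalar (c M) * (\<Prod>k\<in>#M. e k)) = (\<Sum>M\<in>K. ?H (scalar (c M) * (\<Prod>k\<in>#M. e k)))" if "finite K" for K c
    using that
  proof (induction K rule: finite_induct)
    case empty show ?case using H0 by (simp only: sum.empty)
  next
    case (insert M K)
    have "?H (scalar (c M) * (\<Prod>k\<in>#M. e k) + (\<Sum>M\<in>K. scalar (c M) * (\<Prod>k\<in>#M. e k))) =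
        ?H (scalar (c M) * (\<Prod>k\<in>#M. e k)) + ?H (\<Sum>M\<in>K. scalar (c M) * (\<Prod>k\<in>#M. e k))"
      using H mem symfuns_sum[of K "\<lambda>M. scalar (c M) * (\<Prod>k\<in>#M. e k)"] by blast
    then show ?case by (simp only: sum.insert[OF insert(1,2)] insert.IH)
  qed
  have "?H (scalar c * (\<Prod>k\<in>#M. e k)) = scalar c * (\<Prod>k\<in>#M. ?H (e k))" for c M
    using H symfuns_prod_mset[of M e] e unfolding Hm[symmetric] by blast
  then show ?thesis unfolding polyval_def Hs[OF finite_keys] by simp
qed

lemma polyval_scalar_mult: "polyval e (single {#} c * F) = scalar c * polyval e F"
  by (simp add: polyval_mult polyval_single)

text \<open>Writes \<open>x\<close> as a polynomial in the power sums and replaces each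
  \<open>p\<^sub>k\<close> by \<open>p\<^sub>k[y]\<close>. Independence makes the polynomial unique,
  and spanning provides one for every symmetric function.\<close>

definition plethystic :: "ser \<Rightarrow> ser \<Rightarrow> ser" where
  "plethystic x y = polyval (\<lambda>k. adams (Suc k) y) (inv' (polyval psums) x)"

lemma plethystic_polyval: "plethystic (polyval psums F) y = polyval (\<lambda>k. adams (Suc k) y) F"
proof -
  have "inj (polyval psums)" using polyval_psums_inject by (auto intro: injI)
  then show ?thesis by (simp add: plethystic_def inv_f_f)
qed

lemma plethystic_hom:
  assumes x: "x \<in> symfuns" "x' \<in> symfuns" and y: "y \<in> symfuns"
  shows "plethystic x y \<in> symfuns"
    "plethystic (x * x') y = plethystic x y * plethystic x' y"
    "plethystic (x + x') y = plethystic x y + plethystic x' y"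
    "plethystic 1 y = 1" "plethystic (scalar c * x) y = scalar c * plethystic x y"
proof -
  obtain F where F: "x = polyval psums F" by (rule power_sums_span[OF x(1)])
  obtain F' where F': "x' = polyval psums F'" by (rule power_sums_span[OF x(2)])
  have one: "polyval e 1 = 1" for e
    using polyval_single[of e "{#}" 1] by (simp add: scalar_1)
  show "plethystic x y \<in> symfuns" unfolding F plethystic_polyval
    by (rule symfuns_polyval) (simp add: symfuns_adams y)
  show "plethystic (x * x') y = plethystic x y * plethystic x' y"
    unfolding F F' polyval_mult[symmetric] plethystic_polyval ..
  show "plethystic (x + x') y = plethystic x y + plethystic x' y"
    unfolding F F' polyval_add[symmetric] plethystic_polyval ..
  show "plethystic 1 y = 1" using plethystic_polyval[of 1 y] by (simp only: one)
  show "plethystic (scalar c * x) y = scalar c * plethystic x y"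
    unfolding F polyval_scalar_mult[symmetric] plethystic_polyval ..
qed

lemma plethystic_scalar: "y \<in> symfuns \<Longrightarrow> plethystic (scalar c) y = scalar c"
  using plethystic_hom(4)[OF symfuns_1 symfuns_1]
    plethystic_hom(5)[OF symfuns_1 symfuns_1, of y c] by simp

lemma adams_scalar: "k > 0 \<Longrightarrow> adams k (scalar c) = scalar c"
  using adams_scalar_mult[of k c 1] by (simp add: adams_1)

lemma plethystic_psum: assumes "k \<ge> 1" shows "plethystic (psum k) y = adams k y"
proof -
  have k: "k = Suc (k - 1)" using assms by simp
  have "psum k = polyval psums (single {#k - 1#} 1)"
    using k by (simp add: polyval_single scalar_1)
  then show ?thesis using k by (simp only: plethystic_polyval) (simp add: polyval_single scalar_1)
qed

text \<open>The value \<open>undefined\<close> outside the ring agrees with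
  \<open>is_plethysm\<close>, since \<open>plethysm\<close> is specified as a unique total
  function.\<close>

definition plethysm_op :: "series \<Rightarrow> series \<Rightarrow> series" where
  "plethysm_op f g = (if f \<in> carrier sym_fun \<and> g \<in> carrier sym_fun then scoeff (plethystic (Ser f) (Ser g)) else undefined)"

lemma symfuns_Ser: "f \<in> carrier sym_fun \<longleftrightarrow> Ser f \<in> symfuns"
  by (simp add: symfuns_def)

lemma plethysm_op_Ser: "x \<in> symfuns \<Longrightarrow> y \<in> symfuns \<Longrightarrow> plethysm_op (scoeff x) (scoeff y) = scoeff (plethystic x y)"
  by (simp add: plethysm_op_def symfuns_Ser scoeff_inverse)

lemma is_plethysm_op: "is_plethysm plethysm_op"
  unfolding is_plethysm_def
proof (intro conjI ballI allI impI)
  fix f g assume f: "f \<in> carrier sym_fun" and g: "g \<in> carrier sym_fun"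
  show "plethysm_op f g \<in> carrier sym_fun"
    using f g plethystic_hom(1)[of "Ser f" "Ser f" "Ser g"] by (simp add: plethysm_op_def symfuns_Ser scoeff_inverse)
next
  fix k l :: nat assume "k \<ge> 1" "l \<ge> 1"
  then show "plethysm_op (power_sum k) (power_sum l) = power_sum (k * l)"
    using plethysm_op_Ser[OF symfuns_psum symfuns_psum, of k l]
    by (simp add: plethystic_psum adams_psum)
next
  fix k :: nat assume k: "k \<ge> 1"
  have e: "Ser (plethysm_op (power_sum k) (scoeff x)) = adams k x" if "x \<in> symfuns" for x
    using plethysm_op_Ser[OF symfuns_psum that, of k] k by (simp add: plethystic_psum scoeff_inverse)
  show "plethysm_op (power_sum k) \<in> sym_fun_alg_hom"
    unfolding sym_fun_alg_hom_iff using k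
    by (simp add: e symfuns_adams symfuns_mult symfuns_add symfuns_1
        symfuns_scalar adams_mult adams_add adams_1 adams_scalar)
next
  fix g assume "g \<in> carrier sym_fun"
  then have y: "Ser g \<in> symfuns" by (simp add: symfuns_Ser)
  have e: "Ser (plethysm_op (scoeff x) g) = plethystic x (Ser g)" if "x \<in> symfuns" for x
    using plethysm_op_Ser[OF that y] by (simp add: scoeff_inverse)
  show "(\<lambda>f. plethysm_op f g) \<in> sym_fun_alg_hom"
    unfolding sym_fun_alg_hom_iff
    by (simp add: e y plethystic_hom symfuns_mult symfuns_add symfuns_1
        symfuns_scalar plethystic_scalar plethystic_hom(4)[OF symfuns_1 symfuns_1 y])
next
  fix f g assume "f \<notin> carrier sym_fun \<or> g \<notin> carrier sym_fun"
  then show "plethysm_op f g = undefined" by (auto simp: plethysm_op_def)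
qed

text \<open>First \<open>g \<mapsto> p\<^sub>k[g]\<close> is determined, being a homomorphism with
  known values on the generating power sums; then so is \<open>f \<mapsto> f[g]\<close>, whose
  values on the power sums have just been found.\<close>

lemma is_plethysm_unique:
  assumes P: "is_plethysm P" shows "P = plethysm_op"
proof (rule ext, rule ext)
  fix f g
  show "P f g = plethysm_op f g"
  proof (cases "f \<in> carrier sym_fun \<and> g \<in> carrier sym_fun")
    case True
    obtain F where F: "Ser f = polyval psums F" using power_sums_span True symfuns_Ser by blast
    obtain G where G: "Ser g = polyval psums G" using power_sums_span True symfuns_Ser by blast
    have hom: "P (power_sum (Suc k)) \<in> sym_fun_alg_hom" "plethysm_op (power_sum (Suc k)) \<in> sym_fun_alg_hom" for k
      using P is_plethysm_op unfolding is_plethysm_def by simp_all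
    have pp: "P (power_sum (Suc k)) (power_sum (Suc l)) = plethysm_op (power_sum (Suc k)) (power_sum (Suc l))" for k l
      using P is_plethysm_op unfolding is_plethysm_def by simp
    have pg: "Ser (P (power_sum (Suc k)) g) = adams (Suc k) (Ser g)" for k
    proof -
      have "Ser (P (power_sum (Suc k)) (scoeff (Ser g))) = Ser (plethysm_op (power_sum (Suc k)) (scoeff (Ser g)))"
        unfolding G sym_fun_alg_hom_polyval[OF hom(1) symfuns_psum] sym_fun_alg_hom_polyval[OF hom(2) symfuns_psum]
        by (simp add: pp)
      also have "\<dots> = adams (Suc k) (Ser g)"
        using plethysm_op_Ser[OF symfuns_psum, of "Ser g" "Suc k"] True
        by (simp add: symfuns_Ser plethystic_psum scoeff_inverse)
      finally show ?thesis by simp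
    qed
    have "(\<lambda>f. P f g) \<in> sym_fun_alg_hom" using P True unfolding is_plethysm_def by blast
    from sym_fun_alg_hom_polyval[OF this symfuns_psum, of Suc F]
    have "Ser (P f g) = polyval (\<lambda>k. adams (Suc k) (Ser g)) F" using F pg by (metis (no_types, lifting) ext scoeff_Ser)
    also have "\<dots> = plethystic (Ser f) (Ser g)" by (simp only: F plethystic_polyval)
    finally have "P f g = scoeff (plethystic (Ser f) (Ser g))" by (metis scoeff_Ser)
    then show ?thesis using True by (simp add: plethysm_op_def)
  next
    case False
    then have "P f g = undefined" using P unfolding is_plethysm_def by blast
    then show ?thesis using False by (auto simp: plethysm_op_def)
  qed
qed

lemma plethysm_eq: "plethysm = plethysm_op"
  unfolding plethysm_def using is_plethysm_op is_plethysm_unique by (rule the_equality)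

section \<open>Square roots and matrices\<close>

lemma shape_of_row: "shape_of [r] = (\<lambda>i. if i = 0 then r else 0)"
  by (auto simp: shape_of_def)

lemma is_shape_row: "is_shape (shape_of [r])"
  by (rule is_shape_shape_of) simp

lemma lower_row: "lower s (shape_of [r]) = (if s \<le> r then {shape_of [r - s]} else {})"
proof -
  have "\<kappa> = shape_of [r - s] \<and> s \<le> r" if "\<kappa> \<in> lower s (shape_of [r])" for \<kappa>
  proof -
    have \<kappa>: "hstrip \<kappa> (shape_of [r])" "ssize \<kappa> + s = r"
      using that by (auto simp: lower_def ssize_shape_of)
    have z: "\<kappa> i = 0" if "i \<noteq> 0" for i using \<kappa>(1) that by (auto simp: hstrip_def shape_of_row dest: spec[of _ i])
    then have "ssize \<kappa> = (\<Sum>i<1. \<kappa> i)" by (intro ssize_eq) auto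
    then have "\<kappa> 0 = r - s" "s \<le> r" using \<kappa>(2) by auto
    then show ?thesis using z by (auto simp: shape_of_row fun_eq_iff)
  qed
  moreover have "shape_of [r - s] \<in> lower s (shape_of [r])" if "s \<le> r"
  proof -
    have "hstrip (shape_of [r - s]) (shape_of [r])" by (simp add: hstrip_def shape_of_row)
    then show ?thesis using that is_shape_row by (simp add: lower_def ssize_shape_of)
  qed
  ultimately show ?thesis by auto
qed

lemma strips_row: "strips k s (shape_of [r]) = (if (\<Sum>i<k. s i) = r then 1 else 0)"
proof (induction k arbitrary: r)
  case 0
  then show ?case by (auto simp: strips_0 empty_shape_def shape_of_row)
next
  case (Suc k)
  then show ?case by (auto simp: strips_Suc add_strip_def lower_row)
qed

text \<open>A one-row shape has exactly one chain for every content of the right degree, hence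
  \<open>s\<^sub>m = h\<^sub>m\<close>.\<close>

lemma schur_row:
  assumes "m \<ge> 1" shows "schur [m] = scoeff (complete_series m)"
proof
  fix \<alpha>
  have "kostka \<alpha> (shape_of [m]) = (if mdeg \<alpha> = m then 1 else 0)"
    unfolding kostka_def strips_row mdeg_superset[OF finite_lessThan keys_less_degree[of \<alpha>]] ..
  moreover have "[m] \<in> partitions_of m" using assms by (simp add: partitions_of_def)
  ultimately show "schur [m] \<alpha> = scoeff (complete_series m) \<alpha>"
    by (simp add: schur_kostka complete_series_def)
qed

text \<open>Matrix positions start at 0 while \<sigma> acts on \<open>{1..n}\<close>: row
  \<open>\<sigma> (Suc k) - 1\<close> of the product is column \<open>k\<close> of \<open>A\<close>,
  and every row has this form.\<close>

lemma perm_matrix_transpose_index: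
  assumes \<sigma>: "\<sigma> permutes {1..n}" and A: "A \<in> carrier_mat n n" and kj: "k < n" "j < n"
  shows "(perm_matrix n \<sigma> * transpose_mat A) $$ (\<sigma> (Suc k) - 1, j) = A $$ (j, k)"
proof -
  have \<sigma>k: "\<sigma> (Suc k) \<in> {1..n}" using permutes_in_image[OF \<sigma>, of "Suc k"] kj by auto
  have inj: "\<sigma> (Suc t) = \<sigma> (Suc k) \<longleftrightarrow> t = k" for t using permutes_inj[OF \<sigma>] by (auto dest: injD)
  have "(perm_matrix n \<sigma> * transpose_mat A) $$ (\<sigma> (Suc k) - 1, j) =
      (\<Sum>t<n. (if \<sigma> (Suc t) = \<sigma> (Suc k) then 1 else 0) * A $$ (j, t))"
  proof -
    have "\<sigma> (Suc k) - 1 < n" "Suc (\<sigma> (Suc k) - 1) = \<sigma> (Suc k)" using \<sigma>k by auto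
    then show ?thesis using kj A by (simp add: perm_matrix_def scalar_prod_def atLeast0LessThan)
  qed
  also have "\<dots> = (\<Sum>t<n. A $$ (j, t) * (if t = k then 1 else 0))" by (simp add: inj mult.commute)
  also have "\<dots> = A $$ (j, k)" by (rule sum_mult_delta(1)) (use kj in auto)
  finally show ?thesis .
qed

lemma twisted_symmetric_iff:
  assumes \<sigma>: "\<sigma> permutes {1..n}" and A: "A \<in> carrier_mat n n"
  shows "perm_matrix n \<sigma> * transpose_mat A = A \<longleftrightarrow> (\<forall>k<n. \<forall>j<n. A $$ (\<sigma> (Suc k) - 1, j) = A $$ (j, k))"
proof
  assume "perm_matrix n \<sigma> * transpose_mat A = A"
  then show "\<forall>k<n. \<forall>j<n. A $$ (\<sigma> (Suc k) - 1, j) = A $$ (j, k)" using perm_matrix_transpose_index[OF \<sigma> A] by simp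
next
  assume eq: "\<forall>k<n. \<forall>j<n. A $$ (\<sigma> (Suc k) - 1, j) = A $$ (j, k)"
  show "perm_matrix n \<sigma> * transpose_mat A = A"
  proof (rule eq_matI)
    fix i j assume "i < dim_row A" "j < dim_col A"
    then have ij: "i < n" "j < n" using A by auto
    have "inv' \<sigma> (Suc i) \<in> {1..n}" using permutes_in_image[OF permutes_inv[OF \<sigma>], of "Suc i"] ij by auto
    then obtain k where k: "inv' \<sigma> (Suc i) = Suc k" "k < n" by (cases "inv' \<sigma> (Suc i)") auto
    then have "\<sigma> (Suc k) = Suc i" using permutes_inverses(1)[OF \<sigma>, of "Suc i"] by simp
    then have "i = \<sigma> (Suc k) - 1" by simp
    then show "(perm_matrix n \<sigma> * transpose_mat A) $$ (i, j) = A $$ (i, j)"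
      using perm_matrix_transpose_index[OF \<sigma> A k(2) ij(2)] eq k(2) ij(2) by simp
  qed (use A in \<open>auto simp: perm_matrix_def\<close>)
qed

text \<open>A tuple records the columns of the matrix.  The row sums need no separate condition, as row
  \<open>\<sigma>(k)\<close> of the matrix is column \<open>k\<close> read as a row.\<close>

lemma twisted_symmetric_count_tuples:
  assumes \<sigma>: "\<sigma> permutes {1..n}"
  shows "twisted_symmetric_count n m \<sigma> = card (twisted_tuples {1..n} \<sigma> (\<lambda>_. m))"
proof -
  let ?I = "{1..n}"
  define col where "col A = (\<lambda>j\<in>?I. Abs_poly_mapping (\<lambda>i. if i \<in> ?I then A $$ (i - 1, j - 1) else 0) :: monomial)" for A :: "nat mat"
  have lk: "lookup (col A j) i = (if i \<in> ?I then A $$ (i - 1, j - 1) else 0)" if "j \<in> ?I" for A i j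
  proof -
    have "finite {i. (if i \<in> ?I then A $$ (i - 1, j - 1) else 0) \<noteq> 0}" by (rule finite_subset[of _ ?I]) auto
    then show ?thesis using that by (simp add: col_def)
  qed
  have mdeg_col: "mdeg \<beta> = (\<Sum>i<n. lookup \<beta> (Suc i))" if "keys \<beta> \<subseteq> ?I" for \<beta> :: monomial
  proof -
    have "mdeg \<beta> = (\<Sum>i\<in>?I. lookup \<beta> i)" by (rule mdeg_superset[OF _ that]) simp
    also have "\<dots> = (\<Sum>i<n. lookup \<beta> (Suc i))"
      by (rule sum.reindex_bij_witness[of _ Suc "\<lambda>i. i - 1"]) auto
    finally show ?thesis .
  qed
  let ?M = "{A \<in> magic_matrices n m. perm_matrix n \<sigma> * transpose_mat A = A}"
  have \<sigma>I: "\<sigma> i \<in> ?I" if "i \<in> ?I" for i using permutes_in_image[OF \<sigma>] that by blast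
  have "bij_betw col ?M (twisted_tuples ?I \<sigma> (\<lambda>_. m))"
  proof (rule bij_betwI[where g = "\<lambda>\<beta>. mat n n (\<lambda>(i, j). lookup (\<beta> (Suc j)) (Suc i))"])
    show "col \<in> ?M \<rightarrow> twisted_tuples ?I \<sigma> (\<lambda>_. m)"
    proof
      fix A assume "A \<in> ?M"
      then have A: "A \<in> carrier_mat n n" "\<And>j. j < n \<Longrightarrow> (\<Sum>i<n. A $$ (i, j)) = m"
        "\<forall>k<n. \<forall>j<n. A $$ (\<sigma> (Suc k) - 1, j) = A $$ (j, k)"
        using twisted_symmetric_iff[OF \<sigma>] by (auto simp: magic_matrices_def)
      have keys: "keys (col A j) \<subseteq> ?I" if "j \<in> ?I" for j
        using lk[OF that] by (auto simp: in_keys_iff split: if_splits)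
      have "mdeg (col A j) = m" if j: "j \<in> ?I" for j
      proof -
        have "j - 1 < n" using j by auto
        then show ?thesis unfolding mdeg_col[OF keys[OF j]] using A(2)[of "j - 1"] j by (simp add: lk)
      qed
      moreover have "lookup (col A i) (\<sigma> j) = lookup (col A j) i" if i: "i \<in> ?I" and j: "j \<in> ?I" for i j
      proof -
        have "j - 1 < n" "i - 1 < n" "Suc (j - 1) = j" using i j by auto
        then show ?thesis
          using lk[OF i, of A "\<sigma> j"] lk[OF j, of A i] \<sigma>I[OF j] i A(3)[rule_format, of "j - 1" "i - 1"] j by simp
      qed
      ultimately show "col A \<in> twisted_tuples ?I \<sigma> (\<lambda>_. m)"
        using keys by (auto simp: twisted_tuples_def col_def simp del: atLeastAtMost_iff)
    qed
    show "(\<lambda>\<beta>. mat n n (\<lambda>(i, j). lookup (\<beta> (Suc j)) (Suc i))) \<in> twisted_tuples ?I \<sigma> (\<lambda>_. m) \<rightarrow> ?M"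
    proof
      fix \<beta> assume \<beta>: "\<beta> \<in> twisted_tuples ?I \<sigma> (\<lambda>_. m)"
      let ?A = "mat n n (\<lambda>(i, j). lookup (\<beta> (Suc j)) (Suc i))"
      have \<beta>': "mdeg (\<beta> i) = m" "keys (\<beta> i) \<subseteq> ?I" if "i \<in> ?I" for i
        using \<beta> that by (auto simp: twisted_tuples_def)
      have tw: "lookup (\<beta> i) (\<sigma> j) = lookup (\<beta> j) i" if "i \<in> ?I" "j \<in> ?I" for i j
        using \<beta> that by (auto simp: twisted_tuples_def)
      have cs: "(\<Sum>i<n. ?A $$ (i, j)) = m" if "j < n" for j
        using mdeg_col[OF \<beta>'(2), of "Suc j"] \<beta>'(1)[of "Suc j"] that by simp
      have eq: "\<forall>k<n. \<forall>j<n. ?A $$ (\<sigma> (Suc k) - 1, j) = ?A $$ (j, k)"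
      proof (intro allI impI)
        fix k j assume kj: "k < n" "j < n"
        have "\<sigma> (Suc k) \<in> ?I" using \<sigma>I[of "Suc k"] kj by auto
        then show "?A $$ (\<sigma> (Suc k) - 1, j) = ?A $$ (j, k)" using tw[of "Suc j" "Suc k"] kj by auto
      qed
      have rs: "(\<Sum>j<n. ?A $$ (i, j)) = m" if i: "i < n" for i
      proof -
        have "inv' \<sigma> (Suc i) \<in> ?I" using permutes_in_image[OF permutes_inv[OF \<sigma>], of "Suc i"] i by auto
        then obtain k where k: "inv' \<sigma> (Suc i) = Suc k" "k < n" by (cases "inv' \<sigma> (Suc i)") auto
        then have "\<sigma> (Suc k) = Suc i" using permutes_inverses(1)[OF \<sigma>, of "Suc i"] by simp
        then have "?A $$ (i, j) = ?A $$ (j, k)" if "j < n" for j using eq[rule_format, OF k(2) that] by simp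
        then have "(\<Sum>j<n. ?A $$ (i, j)) = (\<Sum>j<n. ?A $$ (j, k))" by (intro sum.cong refl) blast
        then show ?thesis using cs[OF k(2)] by simp
      qed
      show "?A \<in> ?M" using cs rs eq twisted_symmetric_iff[OF \<sigma>, of ?A] by (simp add: magic_matrices_def)
    qed
    show "mat n n (\<lambda>(i, j). lookup (col A (Suc j)) (Suc i)) = A" if "A \<in> ?M" for A
      using that by (intro eq_matI) (auto simp: magic_matrices_def lk)
    show "col (mat n n (\<lambda>(i, j). lookup (\<beta> (Suc j)) (Suc i))) = \<beta>" if \<beta>: "\<beta> \<in> twisted_tuples ?I \<sigma> (\<lambda>_. m)" for \<beta>
    proof (rule extensionalityI[of _ ?I])
      fix j assume j: "j \<in> ?I"
      have keys: "keys (\<beta> j) \<subseteq> ?I" using \<beta> j by (auto simp: twisted_tuples_def)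
      show "col (mat n n (\<lambda>(i, j). lookup (\<beta> (Suc j)) (Suc i))) j = \<beta> j"
      proof (rule poly_mapping_eqI)
        fix i show "lookup (col (mat n n (\<lambda>(i, j). lookup (\<beta> (Suc j)) (Suc i))) j) i = lookup (\<beta> j) i"
          unfolding lk[OF j] using keys j by (auto simp: in_keys_iff subset_iff)
      qed
    qed (use \<beta> in \<open>auto simp: twisted_tuples_def col_def\<close>)
  qed
  then show ?thesis unfolding twisted_symmetric_count_def by (rule bij_betw_same_card)
qed

text \<open>Blocks are numbered from 1 to match the points on which \<open>sym_group n\<close>
  acts.\<close>

definition block :: "nat \<Rightarrow> nat \<Rightarrow> nat" where
  "block m a = Suc ((a - 1) div m)"

lemma block_in: "a \<in> {1..n * m} \<Longrightarrow> block m a \<in> {1..n}"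
  by (cases a) (auto simp: block_def less_mult_imp_div_less Suc_le_eq)

lemma card_block:
  assumes "m \<ge> 1" "i \<in> {1..n}"
  shows "card {a \<in> {1..n * m}. block m a = i} = m"
proof -
  obtain k where k: "i = Suc k" "k < n" using assms(2) by (cases i) auto
  have "{a \<in> {1..n * m}. block m a = i} = {Suc (k * m)..k * m + m}"
  proof (intro equalityI subsetI)
    fix a assume "a \<in> {a \<in> {1..n * m}. block m a = i}"
    then obtain c where c: "a = Suc c" "c div m = k" using k(1) by (cases a) (auto simp: block_def)
    have "k * m \<le> c" "c < k * m + m"
      using div_mult_mod_eq[of c m] mod_less_divisor[of m c] assms(1) unfolding c(2)[symmetric] by linarith+
    then show "a \<in> {Suc (k * m)..k * m + m}" using c(1) by simp
  next
    fix a assume a: "a \<in> {Suc (k * m)..k * m + m}"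
    then obtain c where c: "a = Suc c" "k * m \<le> c" "c < k * m + m" by (cases a) auto
    have "k * m + m \<le> n * m" using k(2) mult_le_mono1[of "Suc k" n m] by simp
    moreover have "c div m = k" by (rule div_nat_eqI) (use c in \<open>auto simp: algebra_simps\<close>)
    ultimately show "a \<in> {a \<in> {1..n * m}. block m a = i}" using c k(1) by (auto simp: block_def)
  qed
  then show ?thesis by simp
qed

text \<open>The coset over \<sigma> of \<open>(S\<^sub>m)\<^sup>n\<close> in the wreath
  product.\<close>

definition block_perms :: "nat \<Rightarrow> nat \<Rightarrow> (nat \<Rightarrow> nat) \<Rightarrow> (nat \<Rightarrow> nat) set" where
  "block_perms n m \<sigma> = {w. w permutes {1..n * m} \<and> (\<forall>a\<in>{1..n * m}. block m (w a) = \<sigma> (block m a))}"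

lemma finite_block_perms: "finite (block_perms n m \<sigma>)"
  unfolding block_perms_def by (rule finite_permutes_subset) simp

lemma prod_fact_blocks:
  assumes "m \<ge> 1" shows "(\<Prod>i\<in>{1..n}. fact (card {a \<in> {1..n * m}. block m a = i})) = (fact m :: nat) ^ n"
proof -
  have "(\<Prod>i\<in>{1..n}. fact (card {a \<in> {1..n * m}. block m a = i})) = (\<Prod>i\<in>{1..n}. fact m :: nat)"
    by (rule prod.cong[OF refl]) (simp only: card_block[OF assms])
  then show ?thesis by simp
qed

lemma card_block_perms:
  assumes m: "m \<ge> 1" and \<sigma>: "\<sigma> permutes {1..n}"
  shows "card (block_perms n m \<sigma>) = fact m ^ n"
proof -
  let ?A = "{1..n * m}"
  have fib: "card {a \<in> ?A. block m a = c} = card {a \<in> ?A. \<sigma> (block m a) = c}" for c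
  proof -
    have eq: "{a \<in> ?A. \<sigma> (block m a) = c} = {a \<in> ?A. block m a = inv' \<sigma> c}"
      using permutes_inverses[OF \<sigma>] by auto
    show ?thesis
    proof (cases "c \<in> {1..n}")
      case True
      then have "inv' \<sigma> c \<in> {1..n}" using permutes_in_image[OF permutes_inv[OF \<sigma>]] by blast
      then show ?thesis unfolding eq using card_block[OF m True] card_block[OF m] by simp
    next
      case False
      then have "inv' \<sigma> c \<notin> {1..n}" using permutes_in_image[OF permutes_inv[OF \<sigma>]] by blast
      moreover have "{a \<in> ?A. block m a = d} = {}" if "d \<notin> {1..n}" for d using that block_in by blast
      ultimately have "{a \<in> ?A. block m a = inv' \<sigma> c} = {}" "{a \<in> ?A. block m a = c} = {}" using False by blast+
      then show ?thesis by (simp only: eq)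
    qed
  qed
  have im: "(\<lambda>a. \<sigma> (block m a)) ` ?A \<subseteq> {1..n}" using block_in permutes_in_image[OF \<sigma>] by blast
  have "card (block_perms n m \<sigma>) = (\<Prod>c\<in>{1..n}. fact (card {a \<in> ?A. \<sigma> (block m a) = c}))"
    unfolding block_perms_def
    using card_permutes_matching[OF finite_atLeastAtMost finite_atLeastAtMost im, of "block m"] fib by simp
  then show ?thesis by (simp only: fib[symmetric] prod_fact_blocks[OF m])
qed

text \<open>The fibres have \<open>m\<close> elements for the labels in \<open>{1..n}\<close>, the
  only ones at which the tuple conditions look.\<close>

lemma fibre_count_cong:
  assumes m: "m \<ge> 1" and \<sigma>: "\<sigma> permutes {1..n}"
  shows "twisted_tuples {1..n} \<sigma> (\<lambda>i. card {a \<in> {1..n * m}. block m a = i}) = twisted_tuples {1..n} \<sigma> (\<lambda>_. m)"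
    "invariant_tuples {1..n} \<sigma> (\<lambda>i. card {a \<in> {1..n * m}. block m a = i}) \<alpha> = invariant_tuples {1..n} \<sigma> (\<lambda>_. m) \<alpha>"
  unfolding twisted_tuples_def invariant_tuples_def
  by (intro Collect_cong conj_cong refl ball_cong, simp only: card_block[OF m])+

lemma sum_fixcols_block_perms:
  assumes m: "m \<ge> 1" and \<sigma>: "\<sigma> permutes {1..n}"
  shows "(\<Sum>w\<in>block_perms n m \<sigma>. card (fixcols {1..n * m} \<alpha> w)) =
    fact m ^ n * card (invariant_tuples {1..n} \<sigma> (\<lambda>_. m) \<alpha>)"
proof -
  let ?A = "{1..n * m}"
  have "(\<Sum>w\<in>block_perms n m \<sigma>. card (fixcols ?A \<alpha> w)) = (\<Prod>i\<in>{1..n}. fact (card {a \<in> ?A. block m a = i})) *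
      card (invariant_tuples {1..n} \<sigma> (\<lambda>i. card {a \<in> ?A. block m a = i}) \<alpha>)"
    unfolding block_perms_def by (rule sum_fixcols_fibre[OF finite_atLeastAtMost finite_atLeastAtMost block_in \<sigma>])
  then show ?thesis by (simp only: prod_fact_blocks[OF m] fibre_count_cong[OF m \<sigma>])
qed

text \<open>Each permutation is a square root of exactly one other, so the sum counts the
  \<open>x\<close> whose square permutes the blocks by \<sigma>; these are the ones in
  \<open>card_square_in_fibre\<close>.\<close>

lemma sum_sqrts_block_perms:
  assumes m: "m \<ge> 1" and \<sigma>: "\<sigma> permutes {1..n}"
  shows "(\<Sum>w\<in>block_perms n m \<sigma>. card (sqrts {1..n * m} w)) = fact m ^ n * twisted_symmetric_count n m \<sigma>"
proof -
  let ?A = "{1..n * m}"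
  let ?X = "{x. x permutes ?A \<and> (\<forall>a\<in>?A. block m (x (x a)) = \<sigma> (block m a))}"
  have "?X = (\<Union>w\<in>block_perms n m \<sigma>. sqrts ?A w)"
  proof (intro equalityI subsetI)
    fix x assume x: "x \<in> ?X"
    then have "x \<circ> x \<in> block_perms n m \<sigma>" by (auto simp: block_perms_def intro: permutes_compose)
    moreover have "x \<in> sqrts ?A (x \<circ> x)" using x by (simp add: sqrts_def)
    ultimately show "x \<in> (\<Union>w\<in>block_perms n m \<sigma>. sqrts ?A w)" by blast
  next
    fix x assume "x \<in> (\<Union>w\<in>block_perms n m \<sigma>. sqrts ?A w)"
    then obtain w where w: "w \<in> block_perms n m \<sigma>" "x \<in> sqrts ?A w" by blast
    then show "x \<in> ?X"
      unfolding sqrts_def block_perms_def by auto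
  qed
  moreover have "card (\<Union>w\<in>block_perms n m \<sigma>. sqrts ?A w) = (\<Sum>w\<in>block_perms n m \<sigma>. card (sqrts ?A w))"
  proof (rule card_UN_disjoint[OF finite_block_perms])
    show "\<forall>w\<in>block_perms n m \<sigma>. finite (sqrts ?A w)" by (auto simp: sqrts_def intro: finite_permutes_subset)
    show "\<forall>w\<in>block_perms n m \<sigma>. \<forall>w'\<in>block_perms n m \<sigma>. w \<noteq> w' \<longrightarrow> sqrts ?A w \<inter> sqrts ?A w' = {}"
    proof (intro ballI impI)
      fix w w' assume w: "w \<in> block_perms n m \<sigma>" "w' \<in> block_perms n m \<sigma>" "w \<noteq> w'"
      have "w = w'" if "x \<in> sqrts ?A w" "x \<in> sqrts ?A w'" for x
      proof
        fix a show "w a = w' a"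
        proof (cases "a \<in> ?A")
          case True then show ?thesis using that unfolding sqrts_def by (metis (mono_tags, lifting) mem_Collect_eq)
        next
          case False then show ?thesis using w(1,2) unfolding block_perms_def mem_Collect_eq by (metis permutes_not_in)
        qed
      qed
      then show "sqrts ?A w \<inter> sqrts ?A w' = {}" using w(3) by blast
    qed
  qed
  moreover have "card ?X =
      (\<Prod>i\<in>{1..n}. fact (card {a \<in> ?A. block m a = i})) *
      card (twisted_tuples {1..n} \<sigma> (\<lambda>i. card {a \<in> ?A. block m a = i}))"
    by (rule card_square_in_fibre[OF finite_atLeastAtMost finite_atLeastAtMost block_in \<sigma>])
  ultimately show ?thesis
    by (simp only: prod_fact_blocks[OF m] fibre_count_cong[OF m \<sigma>] twisted_symmetric_count_tuples[OF \<sigma>])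
qed

lemma sqrts_character: "is_character (sym_group N) (\<lambda>w. of_nat (card (sqrts {1..N} w)))"
proof -
  have "is_character (sym_group N) (frob_restrict N \<nu>)" if "\<nu> \<in> partitions_of N" for \<nu>
    using frob_restrict_irreducible[OF that]
    by (auto simp: irr_chars_def is_irreducible_character_def irreducible_representation_def is_character_def)
  then have "is_character (sym_group N) (\<lambda>w. \<Sum>\<nu>\<in>partitions_of N. frob_restrict N \<nu> w)"
    by (intro is_character_sum sym_group_is_group finite_partitions_of)
  moreover have "(\<Sum>\<nu>\<in>partitions_of N. frob_restrict N \<nu> w) = of_nat (card (sqrts {1..N} w))" if w: "w \<in> carrier (sym_group N)" for w
  proof -
    have "(\<Sum>\<nu>\<in>partitions_of N. frob_char {1..N} \<nu> w) = int (card (sqrts {1..N} w))"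
      using sum_frob_char_eq_card_sqrts[of "{1..N}" w] w by (simp add: sym_group_carrier)
    moreover have "(\<Sum>\<nu>\<in>partitions_of N. frob_restrict N \<nu> w) = of_int (\<Sum>\<nu>\<in>partitions_of N. frob_char {1..N} \<nu> w)"
      using w by simp
    ultimately show ?thesis by (simp only: of_int_of_nat_eq)
  qed
  ultimately show ?thesis by (simp add: is_character_def affords_def)
qed

lemma block_perms_mult:
  assumes g: "g permutes {1..n}" and h: "h permutes {1..n}" and w: "w \<in> block_perms n m g"
  shows "bij_betw (\<lambda>v. w \<circ> v) (block_perms n m h) (block_perms n m (g \<circ> h))"
proof (rule bij_betwI[where g = "\<lambda>u. inv' w \<circ> u"])
  let ?A = "{1..n * m}"
  have wp: "w permutes ?A" and wb: "\<And>a. a \<in> ?A \<Longrightarrow> block m (w a) = g (block m a)"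
    using w by (auto simp: block_perms_def)
  show "(\<lambda>v. w \<circ> v) \<in> block_perms n m h \<rightarrow> block_perms n m (g \<circ> h)"
  proof
    fix v assume "v \<in> block_perms n m h"
    then have v: "v permutes ?A" "\<And>a. a \<in> ?A \<Longrightarrow> block m (v a) = h (block m a)" by (auto simp: block_perms_def)
    have "block m (w (v a)) = g (h (block m a))" if "a \<in> ?A" for a
      using wb[of "v a"] v(2)[OF that] permutes_in_image[OF v(1)] that by simp
    then show "w \<circ> v \<in> block_perms n m (g \<circ> h)" using permutes_compose[OF v(1) wp] by (simp add: block_perms_def)
  qed
  show "(\<lambda>u. inv' w \<circ> u) \<in> block_perms n m (g \<circ> h) \<rightarrow> block_perms n m h"
  proof
    fix u assume "u \<in> block_perms n m (g \<circ> h)"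
    then have u: "u permutes ?A" "\<And>a. a \<in> ?A \<Longrightarrow> block m (u a) = g (h (block m a))" by (auto simp: block_perms_def)
    have iw: "inv' w permutes ?A" by (rule permutes_inv[OF wp])
    have "block m (inv' w (u a)) = h (block m a)" if a: "a \<in> ?A" for a
    proof -
      have "inv' w (u a) \<in> ?A" using permutes_in_image[OF iw] permutes_in_image[OF u(1)] a by blast
      then have "g (block m (inv' w (u a))) = g (h (block m a))"
        using wb[of "inv' w (u a)"] u(2)[OF a] permutes_inverses(1)[OF wp] by simp
      then show ?thesis using permutes_inj[OF g] by (blast dest: injD)
    qed
    then show "inv' w \<circ> u \<in> block_perms n m h" using permutes_compose[OF u(1) iw] by (simp add: block_perms_def)
  qed
  show "inv' w \<circ> (w \<circ> v) = v" for v using permutes_inverses[OF wp] by (simp add: fun_eq_iff)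
  show "w \<circ> (inv' w \<circ> u) = u" for u using permutes_inverses[OF wp] by (simp add: fun_eq_iff)
qed

lemma twisted_symmetric_count_character:
  assumes m: "m \<ge> 1"
  shows "is_character (sym_group n) (\<lambda>\<sigma>. of_nat (twisted_symmetric_count n m \<sigma>))"
proof -
  let ?\<psi> = "\<lambda>w. of_nat (card (sqrts {1..n * m} w)) :: complex"
  have "is_character (sym_group n) (\<lambda>\<sigma>. (\<Sum>w\<in>block_perms n m \<sigma>. ?\<psi> w) / of_nat (fact m ^ n))"
  proof (rule is_character_average[OF sym_group_is_group sym_group_is_group sqrts_character])
    show "block_perms n m g \<subseteq> carrier (sym_group (n * m))" for g by (auto simp: block_perms_def sym_group_carrier)
    show "finite (block_perms n m g)" for g by (rule finite_block_perms)
    show "card (block_perms n m g) = fact m ^ n" if "g \<in> carrier (sym_group n)" for g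
      using that card_block_perms[OF m] by (simp add: sym_group_carrier)
    show "(0 :: nat) < fact m ^ n" by simp
    show "bij_betw (\<lambda>v. w \<otimes>\<^bsub>sym_group (n * m)\<^esub> v) (block_perms n m h) (block_perms n m (g \<otimes>\<^bsub>sym_group n\<^esub> h))"
      if "g \<in> carrier (sym_group n)" "h \<in> carrier (sym_group n)" "w \<in> block_perms n m g" for g h w
      using that block_perms_mult[of g n h w m] by (simp add: sym_group_carrier sym_group_mult)
  qed
  moreover have "(\<Sum>w\<in>block_perms n m \<sigma>. ?\<psi> w) / of_nat (fact m ^ n) = of_nat (twisted_symmetric_count n m \<sigma>)"
    if "\<sigma> \<in> carrier (sym_group n)" for \<sigma>
  proof -
    have "(\<Sum>w\<in>block_perms n m \<sigma>. ?\<psi> w) = of_nat (fact m ^ n * twisted_symmetric_count n m \<sigma>)"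
      using sum_sqrts_block_perms[OF m] that unfolding sym_group_carrier by (metis of_nat_sum)
    then show ?thesis by simp
  qed
  ultimately show ?thesis by (simp add: is_character_def affords_def)
qed

text \<open>Up to the factor \<open>(m!)^n\<close> the coefficients of the tuple series are values
  of permutation characters summed over \<open>block_perms\<close>. Kostka inversion turns them into
  sums of \<open>f\<^sub>\<nu> w\<close>, and summing over \<nu> counts the square roots of each
  \<open>w\<close>.\<close>

lemma sum_schur_coeff_tuple_series:
  assumes m: "m \<ge> 1" and \<sigma>: "\<sigma> permutes {1..n}"
  shows "(\<Sum>\<nu>\<in>partitions_of (n * m). schur_coeff (n * m) (tuple_series {1..n} \<sigma> m) \<nu>) = of_nat (twisted_symmetric_count n m \<sigma>)"
proof -
  let ?N = "n * m" and ?A = "{1..n * m}" and ?W = "block_perms n m \<sigma>" and ?k = "(fact m :: rat) ^ n"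
  have coeff: "?k * scoeff (tuple_series {1..n} \<sigma> m) \<alpha> = (\<Sum>w\<in>?W. of_nat (card (fixcols ?A \<alpha> w)))" for \<alpha>
  proof -
    have "(of_nat (\<Sum>w\<in>?W. card (fixcols ?A \<alpha> w)) :: rat) = of_nat (fact m ^ n * card (invariant_tuples {1..n} \<sigma> (\<lambda>_. m) \<alpha>))"
      by (simp only: sum_fixcols_block_perms[OF m \<sigma>])
    then show ?thesis by (simp add: tuple_series_def)
  qed
  have "?k * schur_coeff ?N (tuple_series {1..n} \<sigma> m) \<nu> = (\<Sum>w\<in>?W. of_int (frob_char ?A \<nu> w))" for \<nu>
  proof -
    have "?k * schur_coeff ?N (tuple_series {1..n} \<sigma> m) \<nu> =
        (\<Sum>\<mu>\<in>partitions_of ?N. of_int (inverse_kostka ?N \<mu> \<nu>) * (?k * scoeff (tuple_series {1..n} \<sigma> m) (part_mono \<mu>)))"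
      by (simp add: schur_coeff_def sum_distrib_left mult_ac)
    also have "\<dots> = (\<Sum>\<mu>\<in>partitions_of ?N. \<Sum>w\<in>?W. of_int (inverse_kostka ?N \<mu> \<nu> * int (card (fixcols ?A (part_mono \<mu>) w))))"
      unfolding coeff by (simp add: sum_distrib_left)
    also have "\<dots> = (\<Sum>w\<in>?W. of_int (frob_char ?A \<nu> w))"
      by (subst sum.swap) (simp add: frob_char_def)
    finally show ?thesis .
  qed
  then have "?k * (\<Sum>\<nu>\<in>partitions_of ?N. schur_coeff ?N (tuple_series {1..n} \<sigma> m) \<nu>) =
      (\<Sum>\<nu>\<in>partitions_of ?N. \<Sum>w\<in>?W. of_int (frob_char ?A \<nu> w))"
    by (simp add: sum_distrib_left)
  also have "\<dots> = (\<Sum>w\<in>?W. of_int (\<Sum>\<nu>\<in>partitions_of ?N. frob_char ?A \<nu> w))"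
    by (subst sum.swap) simp
  also have "\<dots> = (\<Sum>w\<in>?W. of_nat (card (sqrts ?A w)))"
  proof (rule sum.cong[OF refl])
    fix w assume "w \<in> ?W"
    then have "w permutes ?A" by (simp add: block_perms_def)
    then have "(\<Sum>\<nu>\<in>partitions_of ?N. frob_char ?A \<nu> w) = int (card (sqrts ?A w))"
      using sum_frob_char_eq_card_sqrts[of ?A w] by simp
    then show "(of_int (\<Sum>\<nu>\<in>partitions_of ?N. frob_char ?A \<nu> w) :: rat) = of_nat (card (sqrts ?A w))"
      by (simp only: of_int_of_nat_eq)
  qed
  also have "\<dots> = ?k * of_nat (twisted_symmetric_count n m \<sigma>)"
  proof -
    have "(of_nat (\<Sum>w\<in>?W. card (sqrts ?A w)) :: rat) = of_nat (fact m ^ n * twisted_symmetric_count n m \<sigma>)"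
      by (simp only: sum_sqrts_block_perms[OF m \<sigma>])
    then show ?thesis by simp
  qed
  finally show ?thesis by simp
qed

lemma homogeneous_tuple_series: "homogeneous (n * m) (tuple_series {1..n} \<sigma> m)"
  unfolding homogeneous_def
proof (intro allI impI)
  fix \<alpha> assume "scoeff (tuple_series {1..n} \<sigma> m) \<alpha> \<noteq> 0"
  then have "invariant_tuples {1..n} \<sigma> (\<lambda>_. m) \<alpha> \<noteq> {}" by (auto simp: tuple_series_def)
  then obtain \<beta> where "\<forall>i\<in>{1..n}. mdeg (\<beta> i) = m" "(\<Sum>i\<in>{1..n}. \<beta> i) = \<alpha>"
    unfolding invariant_tuples_def by blast
  then show "mdeg \<alpha> = n * m" using mdeg_sum[of \<beta> "{1..n}"] by simp
qed

lemma homogeneous_sum: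
  assumes "\<And>i. i \<in> I \<Longrightarrow> homogeneous N (x i)" shows "homogeneous N (scalar c * (\<Sum>i\<in>I. scalar (d i) * x i))"
  unfolding homogeneous_def
proof (intro allI impI)
  fix \<alpha> assume "scoeff (scalar c * (\<Sum>i\<in>I. scalar (d i) * x i)) \<alpha> \<noteq> 0"
  then have "(\<Sum>i\<in>I. scoeff (scalar (d i) * x i) \<alpha>) \<noteq> 0" by (simp add: scoeff_sum)
  then obtain i where "i \<in> I" "scoeff (scalar (d i) * x i) \<alpha> \<noteq> 0" by (rule sum.not_neutral_contains_not_neutral)
  then show "mdeg \<alpha> = N" using assms by (auto simp: homogeneous_def)
qed

lemma schur_coeff_linear:
  "schur_coeff N (scalar c * (\<Sum>i\<in>I. scalar (d i) * x i)) \<nu> = c * (\<Sum>i\<in>I. d i * schur_coeff N (x i) \<nu>)"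
  unfolding schur_coeff_def scoeff_scalar_mult scoeff_sum sum_distrib_left
  by (subst sum.swap) (simp add: mult_ac)

text \<open>The polynomial \<open>F\<close> of \<open>schur_polyval\<close> is used twice: its value
  at the power sums identifies the plethysm with \<open>X\<close>, and its value at the
  \<open>p\<^sub>k[h\<^sub>m]\<close> expresses \<open>X\<close> by tuple series. Uniqueness of
  Schur expansions resolves the definite description in \<open>plethysm_coeff\<close>.\<close>

lemma sum_plethysm_coeff:
  assumes m: "m \<ge> 1" and lam: "lam \<in> partitions_of n"
  shows "(\<Sum>\<nu>\<in>partitions_of (n * m). plethysm_coeff lam m \<nu>) =
    (\<Sum>\<sigma> | \<sigma> permutes {1..n}. of_int (frob_char {1..n} lam \<sigma>) * of_nat (twisted_symmetric_count n m \<sigma>)) / fact n"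
proof -
  let ?N = "n * m" and ?S = "{\<sigma>. \<sigma> permutes {1..n}}"
  obtain F where F: "Ser (schur lam) = polyval psums F"
    "polyval (\<lambda>k. adams (Suc k) (complete_series m)) F = scalar (1 / fact n) *
      (\<Sum>\<sigma>\<in>?S. scalar (of_int (frob_char {1..n} lam \<sigma>)) * tuple_series {1..n} \<sigma> m)"
    using schur_polyval[OF lam] by blast
  define X where "X = polyval (\<lambda>k. adams (Suc k) (complete_series m)) F"
  have Xs: "X \<in> symfuns" unfolding X_def
    by (intro symfuns_polyval symfuns_adams symfuns_complete_series) simp
  have Xh: "homogeneous ?N X" unfolding X_def F(2) by (intro homogeneous_sum homogeneous_tuple_series)
  have sl: "Ser (schur lam) \<in> symfuns" unfolding F(1)
    by (intro symfuns_polyval symfuns_psum)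
  have "plethysm (schur lam) (schur [m]) = scoeff (plethystic (Ser (schur lam)) (complete_series m))"
    using plethysm_op_Ser[OF sl symfuns_complete_series[of m]] by (simp add: plethysm_eq schur_row[OF m])
  then have P: "plethysm (schur lam) (schur [m]) = scoeff X" by (simp only: F(1) plethystic_polyval X_def)
  have sum: "sum_list lam = n" using lam by (simp add: partitions_of_def)
  have "plethysm_coeff lam m = restrict (schur_coeff ?N X) (partitions_of ?N)"
    unfolding plethysm_coeff_def sum P
  proof (rule the_equality)
    show "restrict (schur_coeff ?N X) (partitions_of ?N) \<in> extensional (partitions_of ?N) \<and>
        scoeff X = (\<lambda>\<alpha>. \<Sum>\<nu>\<in>partitions_of ?N. restrict (schur_coeff ?N X) (partitions_of ?N) \<nu> * schur \<nu> \<alpha>)"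
      using homogeneous_schur_expansion[OF Xs Xh] by (simp cong: sum.cong)
  next
    fix a assume "a \<in> extensional (partitions_of ?N) \<and> scoeff X = (\<lambda>\<alpha>. \<Sum>\<nu>\<in>partitions_of ?N. a \<nu> * schur \<nu> \<alpha>)"
    then have a: "a \<in> extensional (partitions_of ?N)" "scoeff X = (\<lambda>\<alpha>. \<Sum>\<nu>\<in>partitions_of ?N. a \<nu> * schur \<nu> \<alpha>)" by blast+
    show "a = restrict (schur_coeff ?N X) (partitions_of ?N)"
      by (rule extensionalityI[OF a(1)]) (simp_all add: schur_coeff_unique[OF a(2)])
  qed
  then have "(\<Sum>\<nu>\<in>partitions_of ?N. plethysm_coeff lam m \<nu>) = (\<Sum>\<nu>\<in>partitions_of ?N. schur_coeff ?N X \<nu>)" by simp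
  also have "\<dots> = 1 / fact n * (\<Sum>\<sigma>\<in>?S. of_int (frob_char {1..n} lam \<sigma>) * (\<Sum>\<nu>\<in>partitions_of ?N. schur_coeff ?N (tuple_series {1..n} \<sigma> m) \<nu>))"
    unfolding X_def F(2) schur_coeff_linear sum_distrib_left[symmetric]
    by (rule arg_cong[of _ _ "(*) (1 / fact n)"], subst sum.swap) (simp only: sum_distrib_left)
  also have "(\<Sum>\<sigma>\<in>?S. of_int (frob_char {1..n} lam \<sigma>) * (\<Sum>\<nu>\<in>partitions_of ?N. schur_coeff ?N (tuple_series {1..n} \<sigma> m) \<nu>)) =
      (\<Sum>\<sigma>\<in>?S. of_int (frob_char {1..n} lam \<sigma>) * of_nat (twisted_symmetric_count n m \<sigma>))"
    by (rule sum.cong[OF refl]) (simp only: mem_Collect_eq sum_schur_coeff_tuple_series[OF m])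
  finally show ?thesis by simp
qed

theorem theorem1p2:
  fixes n m :: nat
  assumes "n \<ge> 1" and "m \<ge> 1"
  shows "is_character (sym_group n) (\<lambda>\<sigma>. of_nat (twisted_symmetric_count n m \<sigma>)) \<and>
    (\<forall>lam\<in>partitions_of n.
       char_inner (sym_group n) (sym_irr_char lam) (\<lambda>\<sigma>. of_nat (twisted_symmetric_count n m \<sigma>)) =
       of_rat (\<Sum>\<nu>\<in>partitions_of (n * m). plethysm_coeff lam m \<nu>))"
proof (intro conjI ballI)
  show "is_character (sym_group n) (\<lambda>\<sigma>. of_nat (twisted_symmetric_count n m \<sigma>))"
    by (rule twisted_symmetric_count_character[OF assms(2)])
  fix lam assume lam: "lam \<in> partitions_of n"
  \<comment> \<open>The counts are natural numbers, so the conjugation in \<open>char_inner\<close>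
    acts trivially; what remains is the passage from rational to complex sums.\<close>
  have "char_inner (sym_group n) (sym_irr_char lam) (\<lambda>\<sigma>. of_nat (twisted_symmetric_count n m \<sigma>)) =
      (\<Sum>\<sigma> | \<sigma> permutes {1..n}. of_int (frob_char {1..n} lam \<sigma>) * of_nat (twisted_symmetric_count n m \<sigma>)) / fact n"
    by (simp add: char_inner_def sym_irr_char_frob[OF lam] card_sym_group, simp add: carrier_sym_group)
  also have "\<dots> = of_rat ((\<Sum>\<sigma> | \<sigma> permutes {1..n}. of_int (frob_char {1..n} lam \<sigma>) * of_nat (twisted_symmetric_count n m \<sigma>)) / fact n)"
  proof -
    have "complex_of_rat (fact n) = fact n" by (metis of_nat_fact of_rat_of_nat_eq)
    then show ?thesis by (simp add: of_rat_divide of_rat_sum of_rat_mult)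
  qed
  finally show "char_inner (sym_group n) (sym_irr_char lam) (\<lambda>\<sigma>. of_nat (twisted_symmetric_count n m \<sigma>)) =
      of_rat (\<Sum>\<nu>\<in>partitions_of (n * m). plethysm_coeff lam m \<nu>)"
    by (simp only: sum_plethysm_coeff[OF assms(2) lam])
qed

end
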